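(* Let $k\geq 1$ be an integer and let $G,J_0,H,c,\mathscr G,\mathscr W,W^*,S^*,\mathscr T_\psi$ be as defined in the context. Let $\mathscr H=H\ltimes\mathscr T_\psi$, $\widetilde{\mathscr W}=(\mathscr W\setminus W^* )\cup S^*$ and $\mathscr K=c^{\mathscr G}\cup(J_0+\widetilde{\mathscr W})$. Then the triple $(\mathscr G,\mathscr H,\mathscr K)$ is a Bol loop folder such that the corresponding Bol loop is simple of exponent $2$.
   Context: **Loop folders.** A loop folder is a triple $(G,H,K)$ where $G$ is a group, $H\leq G$, and $K\subseteq G$ with $1\in K$ is a system of representatives of the right cosets of every conjugate $H^g$ in $G$. It determines (corresponds to) the loop $(K,\circ)$ with $H(x\circ y)=Hxy$. It is a Bol loop folder if $(K,\circ)$ is a right Bol loop, i.e. satisfies $((xy)z)y=x(y(zy))$. Exponent $2$ means $x^2=1$ for all $x$ in a nontrivial loop. A loop is simple if it has no proper (nontrivial) normal subloops, where normal subloops are the kernels of loop homomorphisms. **The group $G$.** $G$ is a group having an elementary Abelian normal subgroup $J$ of order $32$ such that $G/J\cong PGL(2,5)\cong S_5$ and $J$ is, as a $G/J$-module, the $\mathbb F_2$-permutation module of $PGL(2,5)$ on the $6$ points of the projective line over $\mathbb F_5$ modulo its center (the all-one vector); moreover $[G,G]/[G,J]\cong SL(2,5)$ and $G$ splits over $[G,G]J$ (i.e. $[G,G]J$ has a complement in $G$). $J_0=[G,J]$ is the minimal normal subgroup of $G$, $P$ is a Sylow $5$-subgroup of $G$, $H=N_G(P)$, and $c$ is an involution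 in $G\setminus[G,G]J$. The image of $H$ in $G/J$ is $F_{20}\cong C_5\rtimes C_4$. **The module $U$.** $N$ is the $4$-dimensional absolutely irreducible $\mathbb F_2S_5$-module which is the nontrivial composition factor of the permutation module of $S_5$ on $5$ points. $U=U_1\oplus U_2$ is the direct sum of two copies of $N$ as a vector space, made into an $S_5$-module as follows: an even $g\in S_5$ acts by $u_1\oplus u_2\mapsto u_1g\oplus u_2g$, an odd $g$ acts by $u_1\oplus u_2\mapsto u_2g\oplus u_1g$. $W=\{u\oplus u\mid u\in N\}$ is the unique nonzero proper $S_5$-submodule of $U$. With $F_{20}\leq S_5$ the image $HJ/J$ of $H$ under $G\to G/J\cong S_5$, $U$ has precisely three nonzero proper $F_{20}$-submodules $W,T_1,T_2$. Under $A_5$ the orbits on each of $W,U_1,U_2$ have lengths $1,5,10$; let $S_0,S_1,S_2$ be the orbits of length $5$ in $W,U_1,U_2$, respectively, and $S=\{0\}\cup S_0\cup S_1\cup S_2\subseteq U$. **The group $\mathscr G$.** Put $\mathscr U=U^k$, $\mathscr W=W^k$, and $\mathscr G=G\ltimes\mathscr U$, where $J$ acts trivially on the $S_5$-module $\mathscr U$ and $G/J\cong S_5$ acts on $\mathscr U=U^k$ componentwise, an even $g\in S_5$ acting on each component $U=U_1\oplus U_2$ by $u_1\oplus u_2\mapsto u_1g\oplus u_2g$ and an odd $g\in S_5$ acting on each component by $u_1\oplus u_2\mapsto u_2g\oplus u_1g$. $\mathscr J=O_2(\mathscr G)=\langle J,\mathscr U\rangle$ is elementary Abelian and is written additively. $c^{\mathscr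 G}$ is the conjugacy class of $c$ in $\mathscr G$. Write $\mathscr U=U^*\oplus U^{k-1}$ where $U^*$ is one of the $k$ copies of $U$, and let $W^*,T_1^*,S^*\subseteq U^*$ correspond to $W,T_1,S\subseteq U$. Let $\psi:J_0\to T_1^*$ be an isomorphism of $F_{20}$-modules (such an isomorphism exists), and define \[\mathscr T_\psi=\{v+\psi(v)+u\mid v\in J_0,\ u\in T_1^{k-1}\}\leq\mathscr J,\] where $T_1^{k-1}\leq U^{k-1}$. The subgroup $\mathscr T_\psi$ is normalized by $H$.
   Formalization: The right Bol identity is taken as ((xy)z)y = x((yz)y); the printed ((xy)z)y = x(y(zy)) is the right Moufang identity, and a Moufang loop of exponent 2 is an elementary Abelian 2-group, impossible for this loop of order 96·16^k. *)

theory Defs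
  imports
    "HOL-Analysis.Determinants"
    "HOL-Algebra.Generated_Groups"
    "HOL-Algebra.Group_Action"
    "HOL-Algebra.Sym_Groups"
    "HOL-Computational_Algebra.Primes"
    "HOL-Library.Function_Algebras"
    "HOL-Library.Z2"
begin

section \<open>Loops and loop folders\<close>

definition is_loop :: "('a, 'b) monoid_scheme \<Rightarrow> bool" where
  "is_loop L \<longleftrightarrow>
     (\<forall>x\<in>carrier L. \<forall>y\<in>carrier L. x \<otimes>\<^bsub>L\<^esub> y \<in> carrier L) \<and>
     \<one>\<^bsub>L\<^esub> \<in> carrier L \<and>
     (\<forall>x\<in>carrier L. \<one>\<^bsub>L\<^esub> \<otimes>\<^bsub>L\<^esub> x = x \<and> x \<otimes>\<^bsub>L\<^esub> \<one>\<^bsub>L\<^esub> = x) \<and>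
     (\<forall>a\<in>carrier L. \<forall>b\<in>carrier L. \<exists>!x. x \<in> carrier L \<and> a \<otimes>\<^bsub>L\<^esub> x = b) \<and>
     (\<forall>a\<in>carrier L. \<forall>b\<in>carrier L. \<exists>!y. y \<in> carrier L \<and> y \<otimes>\<^bsub>L\<^esub> a = b)"

text \<open>The right Bol identity \<open>((xy)z)y = x((yz)y)\<close>. The superficially similar
  \<open>((xy)z)y = x(y(zy))\<close> is the right Moufang identity, a strictly stronger law: a Moufang loop of
  exponent 2 is an elementary Abelian group.\<close>

definition right_bol_loop :: "('a, 'b) monoid_scheme \<Rightarrow> bool" where
  "right_bol_loop L \<longleftrightarrow> is_loop L \<and>
     (\<forall>x\<in>carrier L. \<forall>y\<in>carrier L. \<forall>z\<in>carrier L.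
        ((x \<otimes>\<^bsub>L\<^esub> y) \<otimes>\<^bsub>L\<^esub> z) \<otimes>\<^bsub>L\<^esub> y = x \<otimes>\<^bsub>L\<^esub> ((y \<otimes>\<^bsub>L\<^esub> z) \<otimes>\<^bsub>L\<^esub> y))"

definition loop_exponent_two :: "('a, 'b) monoid_scheme \<Rightarrow> bool" where
  "loop_exponent_two L \<longleftrightarrow>
     carrier L \<noteq> {\<one>\<^bsub>L\<^esub>} \<and> (\<forall>x\<in>carrier L. x \<otimes>\<^bsub>L\<^esub> x = \<one>\<^bsub>L\<^esub>)"

text \<open>The target loop ranges over loops on the type \<open>'a set\<close>. This is no restriction: the image
  of a homomorphism out of \<open>L\<close> is isomorphic to a loop on the set of its fibres.\<close>

definition normal_subloop :: "'a set \<Rightarrow> ('a, 'b) monoid_scheme \<Rightarrow> bool" where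
  "normal_subloop N L \<longleftrightarrow>
     (\<exists>(M :: 'a set monoid) f. is_loop M \<and> f \<in> hom L M \<and> N = kernel L M f)"

definition simple_loop :: "('a, 'b) monoid_scheme \<Rightarrow> bool" where
  "simple_loop L \<longleftrightarrow> is_loop L \<and>
     (\<forall>N. normal_subloop N L \<longrightarrow> N = {\<one>\<^bsub>L\<^esub>} \<or> N = carrier L)"

definition loop_folder :: "('a, 'b) monoid_scheme \<Rightarrow> 'a set \<Rightarrow> 'a set \<Rightarrow> bool" where
  "loop_folder G H K \<longleftrightarrow>
     group G \<and> subgroup H G \<and> K \<subseteq> carrier G \<and> \<one>\<^bsub>G\<^esub> \<in> K \<and>
     (\<forall>g\<in>carrier G. \<forall>C\<in>rcosets\<^bsub>G\<^esub> (inv\<^bsub>G\<^esub> g <#\<^bsub>G\<^esub> H #>\<^bsub>G\<^esub> g). \<exists>!x. x \<in> K \<inter> C)"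

definition folder_loop :: "('a, 'b) monoid_scheme \<Rightarrow> 'a set \<Rightarrow> 'a set \<Rightarrow> 'a monoid" where
  "folder_loop G H K =
     \<lparr>carrier = K,
      mult = (\<lambda>x y. THE z. z \<in> K \<and> H #>\<^bsub>G\<^esub> z = H #>\<^bsub>G\<^esub> (x \<otimes>\<^bsub>G\<^esub> y)),
      one = \<one>\<^bsub>G\<^esub>\<rparr>"

definition bol_loop_folder :: "('a, 'b) monoid_scheme \<Rightarrow> 'a set \<Rightarrow> 'a set \<Rightarrow> bool" where
  "bol_loop_folder G H K \<longleftrightarrow> loop_folder G H K \<and> right_bol_loop (folder_loop G H K)"


section \<open>Groups\<close>

definition commutator_subgroup :: "('a, 'b) monoid_scheme \<Rightarrow> 'a set \<Rightarrow> 'a set \<Rightarrow> 'a set" where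
  "commutator_subgroup G A B =
     generate G {a \<otimes>\<^bsub>G\<^esub> b \<otimes>\<^bsub>G\<^esub> inv\<^bsub>G\<^esub> a \<otimes>\<^bsub>G\<^esub> inv\<^bsub>G\<^esub> b | a b. a \<in> A \<and> b \<in> B}"

definition conjugacy_class :: "('a, 'b) monoid_scheme \<Rightarrow> 'a \<Rightarrow> 'a set" where
  "conjugacy_class G c = {inv\<^bsub>G\<^esub> g \<otimes>\<^bsub>G\<^esub> c \<otimes>\<^bsub>G\<^esub> g | g. g \<in> carrier G}"

definition elementary_abelian_2 :: "('a, 'b) monoid_scheme \<Rightarrow> 'a set \<Rightarrow> bool" where
  "elementary_abelian_2 G A \<longleftrightarrow>
     (\<forall>x\<in>A. \<forall>y\<in>A. x \<otimes>\<^bsub>G\<^esub> y = y \<otimes>\<^bsub>G\<^esub> x) \<and> (\<forall>x\<in>A. x \<otimes>\<^bsub>G\<^esub> x = \<one>\<^bsub>G\<^esub>)"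

definition splits_over :: "('a, 'b) monoid_scheme \<Rightarrow> 'a set \<Rightarrow> bool" where
  "splits_over G N \<longleftrightarrow>
     (\<exists>C. subgroup C G \<and> C \<inter> N = {\<one>\<^bsub>G\<^esub>} \<and> C <#>\<^bsub>G\<^esub> N = carrier G)"

definition sylow_subgroup :: "('a, 'b) monoid_scheme \<Rightarrow> nat \<Rightarrow> 'a set \<Rightarrow> bool" where
  "sylow_subgroup G p P \<longleftrightarrow> subgroup P G \<and> card P = p ^ multiplicity p (order G)"

text \<open>The numeral type \<open>5\<close> is the ring of integers modulo 5, i.e. the field \<open>F\<^sub>5\<close>.\<close>

definition GL25 :: "(5 ^ 2 ^ 2) monoid" where
  "GL25 = \<lparr>carrier = {A. invertible A}, mult = (**), one = mat 1\<rparr>"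

definition SL25 :: "(5 ^ 2 ^ 2) monoid" where
  "SL25 = \<lparr>carrier = {A. det A = 1}, mult = (**), one = mat 1\<rparr>"

definition PGL25 :: "(5 ^ 2 ^ 2) set monoid" where
  "PGL25 = GL25 Mod {mat a | a. a \<noteq> 0}"

definition proj_line :: "(5 ^ 2) set set" where
  "proj_line = {range (\<lambda>a. a *s v) | v. v \<noteq> 0}"

text \<open>The permutation module of \<open>PGL(2,5)\<close> over \<open>F\<^sub>2\<close>: functions on the projective line
  (extended by 0 to all sets of vectors), with the right action \<open>(f A)(L) = f(A L)\<close>.\<close>

definition perm_module :: "((5 ^ 2) set \<Rightarrow> bit) monoid" where
  "perm_module = \<lparr>carrier = {f. \<forall>L. L \<notin> proj_line \<longrightarrow> f L = 0}, mult = (+), one = 0\<rparr>"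

definition all_one :: "(5 ^ 2) set \<Rightarrow> bit" where
  "all_one = (\<lambda>L. if L \<in> proj_line then 1 else 0)"

definition perm_act :: "((5 ^ 2) set \<Rightarrow> bit) \<Rightarrow> 5 ^ 2 ^ 2 \<Rightarrow> (5 ^ 2) set \<Rightarrow> bit" where
  "perm_act f A = (\<lambda>L. f ((\<lambda>v. A *v v) ` L))"

abbreviation perm_module_mod_center :: "((5 ^ 2) set \<Rightarrow> bit) set monoid" where
  "perm_module_mod_center \<equiv> perm_module Mod {0, all_one}"

text \<open>\<open>G/J\<close> acts on \<open>J\<close> from the right by conjugation. An element of \<open>PGL25\<close> is a coset of the
  scalar matrices, and the action of \<open>A \<in> \<rho> (J #> g)\<close> does not depend on the representative \<open>A\<close>.\<close>

definition is_perm_module_mod_center :: "('g, 'b) monoid_scheme \<Rightarrow> 'g set \<Rightarrow> bool" where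
  "is_perm_module_mod_center G J \<longleftrightarrow>
     (\<exists>\<rho> \<in> iso (G Mod J) PGL25. \<exists>\<phi> \<in> iso perm_module_mod_center (G\<lparr>carrier := J\<rparr>).
        \<forall>g\<in>carrier G. \<forall>A\<in>\<rho> (J #>\<^bsub>G\<^esub> g). \<forall>Q\<in>carrier perm_module_mod_center.
          \<phi> ((\<lambda>f. perm_act f A) ` Q) = inv\<^bsub>G\<^esub> g \<otimes>\<^bsub>G\<^esub> \<phi> Q \<otimes>\<^bsub>G\<^esub> g)"

definition base_group :: "('g, 'b) monoid_scheme \<Rightarrow> 'g set \<Rightarrow> bool" where
  "base_group G J \<longleftrightarrow>
     group G \<and> J \<lhd> G \<and> elementary_abelian_2 G J \<and> card J = 32 \<and>
     is_perm_module_mod_center G J \<and>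
     (G\<lparr>carrier := derived G (carrier G)\<rparr> Mod commutator_subgroup G (carrier G) J) \<cong> SL25 \<and>
     splits_over G (derived G (carrier G) <#>\<^bsub>G\<^esub> J)"


section \<open>The \<open>S\<^sub>5\<close>-module \<open>U\<close>\<close>

text \<open>The permutation module of \<open>S\<^sub>5\<close> on \<open>{1..5}\<close> over \<open>F\<^sub>2\<close> is the direct sum of the all-one
  vectors and the vectors of coordinate sum 0; the latter summand \<open>N\<close> is its nontrivial composition
  factor. Permutations act on the right by \<open>(u p)(i) = u(p i)\<close>, matching the multiplication
  \<open>p \<circ> q\<close> of \<open>sym_group\<close>.\<close>

definition N_mod :: "(nat \<Rightarrow> bit) set" where
  "N_mod = {v. (\<forall>i. i \<notin> {1..5} \<longrightarrow> v i = 0) \<and> (\<Sum>i\<in>{1..5}. v i) = 0}"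

type_synonym U_elt = "(nat \<Rightarrow> bit) \<times> (nat \<Rightarrow> bit)"

definition U_mod :: "U_elt set" where
  "U_mod = N_mod \<times> N_mod"

definition U1_mod :: "U_elt set" where
  "U1_mod = N_mod \<times> {0}"

definition U2_mod :: "U_elt set" where
  "U2_mod = {0} \<times> N_mod"

definition W_mod :: "U_elt set" where
  "W_mod = {(u, u) | u. u \<in> N_mod}"

definition U_act :: "U_elt \<Rightarrow> (nat \<Rightarrow> nat) \<Rightarrow> U_elt" where
  "U_act u p = (if evenperm p then (fst u \<circ> p, snd u \<circ> p) else (snd u \<circ> p, fst u \<circ> p))"

definition A5_orbit :: "U_elt \<Rightarrow> U_elt set" where
  "A5_orbit u = {U_act u p | p. p \<in> carrier (alt_group 5)}"

text \<open>Each of \<open>W\<close>, \<open>U\<^sub>1\<close>, \<open>U\<^sub>2\<close> has exactly one \<open>A\<^sub>5\<close>-orbit of length 5.\<close>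

definition S_set :: "U_elt set" where
  "S_set = {0} \<union> {u \<in> W_mod \<union> U1_mod \<union> U2_mod. card (A5_orbit u) = 5}"

definition U_submodule :: "(nat \<Rightarrow> nat) set \<Rightarrow> U_elt set \<Rightarrow> bool" where
  "U_submodule F T \<longleftrightarrow> T \<subseteq> U_mod \<and> 0 \<in> T \<and>
     (\<forall>u\<in>T. \<forall>v\<in>T. u + v \<in> T) \<and> (\<forall>u\<in>T. \<forall>p\<in>F. U_act u p \<in> T)"

text \<open>\<open>M\<^sup>k\<close>, as functions on the indices \<open>0, \<dots>, k - 1\<close> extended by 0.\<close>

definition mod_power :: "nat \<Rightarrow> U_elt set \<Rightarrow> (nat \<Rightarrow> U_elt) set" where
  "mod_power k M = {u. (\<forall>i<k. u i \<in> M) \<and> (\<forall>i\<ge>k. u i = 0)}"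

definition power_act :: "(nat \<Rightarrow> U_elt) \<Rightarrow> (nat \<Rightarrow> nat) \<Rightarrow> nat \<Rightarrow> U_elt" where
  "power_act u p = (\<lambda>i. U_act (u i) p)"

text \<open>For \<open>s < k\<close> the \<open>s\<close>-th copy of \<open>U\<close> in \<open>U\<^sup>k\<close> plays the role of \<open>U\<^sup>*\<close>; the complement
  \<open>U\<^sup>k\<^sup>-\<^sup>1\<close> consists of the \<open>u\<close> with \<open>u s = 0\<close>.\<close>

definition copy_at :: "nat \<Rightarrow> U_elt \<Rightarrow> nat \<Rightarrow> U_elt" where
  "copy_at s x = (\<lambda>i. if i = s then x else 0)"


section \<open>The loop folder\<close>

text \<open>The pair \<open>(g, u)\<close> stands for the product \<open>g u\<close>, where \<open>u\<^sup>g = g\<^sup>-\<^sup>1 u g\<close> is the right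
  action of \<open>g\<close> on \<open>u\<close>.\<close>

definition semidirect ::
  "('g, 'b) monoid_scheme \<Rightarrow> 'v::ab_group_add set \<Rightarrow> ('v \<Rightarrow> 'g \<Rightarrow> 'v) \<Rightarrow> ('g \<times> 'v) monoid" where
  "semidirect G M act =
     \<lparr>carrier = carrier G \<times> M,
      mult = (\<lambda>(g, u) (h, v). (g \<otimes>\<^bsub>G\<^esub> h, act u h + v)),
      one = (\<one>\<^bsub>G\<^esub>, 0)\<rparr>"

text \<open>Here \<open>\<theta>\<close> is an isomorphism from \<open>G Mod J\<close> to \<open>sym_group 5\<close>.\<close>

definition script_G ::
  "('g, 'b) monoid_scheme \<Rightarrow> 'g set \<Rightarrow> ('g set \<Rightarrow> nat \<Rightarrow> nat) \<Rightarrow> nat \<Rightarrow> ('g \<times> (nat \<Rightarrow> U_elt)) monoid"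
  where
  "script_G G J \<theta> k =
     semidirect G (mod_power k U_mod) (\<lambda>u g. power_act u (\<theta> (J #>\<^bsub>G\<^esub> g)))"

definition F20_image ::
  "('g, 'b) monoid_scheme \<Rightarrow> 'g set \<Rightarrow> ('g set \<Rightarrow> nat \<Rightarrow> nat) \<Rightarrow> 'g set \<Rightarrow> (nat \<Rightarrow> nat) set" where
  "F20_image G J \<theta> H = {\<theta> (J #>\<^bsub>G\<^esub> h) | h. h \<in> H}"

text \<open>\<open>\<psi>\<close> is an isomorphism of \<open>F\<^sub>2\<^sub>0\<close>-modules from \<open>J\<^sub>0\<close> onto \<open>T\<^sub>1\<^sup>* \<le> U\<^sup>*\<close>; the group \<open>H\<close> acts on
  both sides through \<open>F\<^sub>2\<^sub>0\<close>.\<close>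

definition F20_module_iso ::
  "('g, 'b) monoid_scheme \<Rightarrow> 'g set \<Rightarrow> ('g set \<Rightarrow> nat \<Rightarrow> nat) \<Rightarrow> 'g set \<Rightarrow> 'g set \<Rightarrow>
     (nat \<Rightarrow> U_elt) set \<Rightarrow> ('g \<Rightarrow> nat \<Rightarrow> U_elt) \<Rightarrow> bool" where
  "F20_module_iso G J \<theta> H J0 T \<psi> \<longleftrightarrow>
     bij_betw \<psi> J0 T \<and>
     (\<forall>v\<in>J0. \<forall>w\<in>J0. \<psi> (v \<otimes>\<^bsub>G\<^esub> w) = \<psi> v + \<psi> w) \<and>
     (\<forall>v\<in>J0. \<forall>h\<in>H. \<psi> (inv\<^bsub>G\<^esub> h \<otimes>\<^bsub>G\<^esub> v \<otimes>\<^bsub>G\<^esub> h) = power_act (\<psi> v) (\<theta> (J #>\<^bsub>G\<^esub> h)))"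

definition script_T ::
  "'g set \<Rightarrow> U_elt set \<Rightarrow> ('g \<Rightarrow> nat \<Rightarrow> U_elt) \<Rightarrow> nat \<Rightarrow> nat \<Rightarrow> ('g \<times> (nat \<Rightarrow> U_elt)) set" where
  "script_T J0 T1 \<psi> k s =
     {(v, \<psi> v + u) | v u. v \<in> J0 \<and> u \<in> mod_power k T1 \<and> u s = 0}"

definition script_H ::
  "('g, 'b) monoid_scheme \<Rightarrow> 'g set \<Rightarrow> ('g set \<Rightarrow> nat \<Rightarrow> nat) \<Rightarrow> 'g set \<Rightarrow> 'g set \<Rightarrow> U_elt set \<Rightarrow>
     ('g \<Rightarrow> nat \<Rightarrow> U_elt) \<Rightarrow> nat \<Rightarrow> nat \<Rightarrow> ('g \<times> (nat \<Rightarrow> U_elt)) set" where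
  "script_H G J \<theta> H J0 T1 \<psi> k s =
     (\<lambda>h. (h, 0)) ` H <#>\<^bsub>script_G G J \<theta> k\<^esub> script_T J0 T1 \<psi> k s"

definition W_tilde :: "nat \<Rightarrow> nat \<Rightarrow> (nat \<Rightarrow> U_elt) set" where
  "W_tilde k s = (mod_power k W_mod - copy_at s ` W_mod) \<union> copy_at s ` S_set"

definition script_K ::
  "('g, 'b) monoid_scheme \<Rightarrow> 'g set \<Rightarrow> ('g set \<Rightarrow> nat \<Rightarrow> nat) \<Rightarrow> 'g set \<Rightarrow> 'g \<Rightarrow> nat \<Rightarrow> nat \<Rightarrow>
     ('g \<times> (nat \<Rightarrow> U_elt)) set" where
  "script_K G J \<theta> J0 c k s =
     conjugacy_class (script_G G J \<theta> k) (c, 0) \<union> J0 \<times> W_tilde k s"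

end

theory Submission
  imports
    Defs
    "HOL-Algebra.Multiplicative_Group"
    "HOL-Library.FuncSet"
begin

text \<open>A conjugation-invariant set \<open>K\<close> of elements with square 1 that meets every coset of \<open>H\<close> exactly
  once gives a Bol loop of exponent 2. Since \<open>|K| = 96 \<cdot> 16\<^sup>k = |G : H|\<close> for the groups at hand, it
  suffices that two elements of \<open>K\<close> in one coset of \<open>H\<close> agree. The three nonzero proper
  \<open>F\<^sub>2\<^sub>0\<close>-submodules of \<open>U\<close> are the graphs of the multiplications by the cube roots of unity on \<open>N\<close>,
  viewed as the field with 16 elements; hence \<open>W\<close> meets \<open>T\<^sub>1\<close> trivially, and \<open>S\<close> is a transversal of
  \<open>T\<^sub>1\<close> in \<open>U\<close>. Two conjugates of \<open>c\<close> over distinct transpositions are never in one coset, since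
  modulo \<open>J\<^sub>0\<close> their product would be an involution of \<open>SL(2,5)\<close> outside its center.

  A normal subloop has the form \<open>K \<inter> D\<close> with \<open>D\<close> normal in the group generated by \<open>K\<close>. If it meets the
  class of \<open>c\<close>, it contains that class, hence more than half of \<open>K\<close>, and is everything. Otherwise \<open>D\<close>
  lies over \<open>J\<close>, since \<open>F\<^sub>2\<^sub>0\<close> has trivial core in \<open>S\<^sub>5\<close>. For \<open>x\<close> of order 3 the operator
  \<open>1 + x + x\<^sup>2\<close> kills \<open>J\<^sub>0\<close>, so it maps \<open>K \<inter> D\<close> into \<open>D \<inter> U\<^sup>k\<close>. Every nonzero \<open>S\<^sub>5\<close>-submodule of \<open>U\<close>
  contains \<open>W\<close>, and \<open>D\<close> does not contain \<open>W\<^sup>*\<close>: the elements of \<open>W\<^sup>*\<close> outside \<open>S\<^sup>*\<close> have their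
  representatives modulo \<open>H\<close> outside \<open>W\<^sup>*\<close>, which leads to nontrivial elements of \<open>J\<^sub>0\<close> in \<open>D\<close>.\<close>

subsection \<open>The projective line over the field with 5 elements\<close>


text \<open>The Bol identity costs nothing: for y and z in \<open>K\<close> the product y z y is the
  conjugate of z by the involution y, so it lies in \<open>K\<close> again. The work lies in
  separating \<open>K\<close> by cosets and in excluding normal subloops. Two permutation actions of
  G are used, \<open>t\<close> on five points and \<sigma> on six. They are linked only through
  their common kernel \<open>J\<close>: how transpositions and three-cycles move the six points is
  deduced from the fact that an element outside \<open>J\<close> fixes at most two of them. Origin
  of the constants: F20 has order 20, and \<open>H\<close> meets \<open>J\<close> in a group of
  order 2, generated by the image of the point fixed by \<open>P\<close> and not contained in
  \<open>J0\<close>, so |H| = 40. The class of c in G has 8 elements over each of 10 transpositions;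
  with |J0| = 16 this gives 80 + 16 = 96 = 3840 / 40. The map \<psi> ties \<open>J0\<close> to one
  copy of U: a vector w of the diagonal of that copy outside S is represented modulo
  \<open>H\<close> by x in S together with the v in \<open>J0\<close> for which \<psi> v = w + x,
  and v is nontrivial. This is what carries a normal subloop from U into \<open>J0\<close>.\<close>

lemma UNIV_mod5: "(UNIV :: 5 set) = {0, 1, 2, 3, 4}"
proof -
  have "card {0::5, 1, 2, 3, 4} = CARD(5)" by simp
  then show ?thesis by (metis card_eq_UNIV_imp_eq_UNIV finite_class.finite_UNIV)
qed

lemma forall_mod5: "(\<forall>x::5. P x) \<longleftrightarrow> P 0 \<and> P 1 \<and> P 2 \<and> P 3 \<and> P 4"
  using UNIV_mod5 by (metis UNIV_I insert_iff empty_iff)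

lemma mod5_cases: obtains "x = (0::5)" | "x = 1" | "x = 2" | "x = 3" | "x = 4"
  using forall_mod5[of "\<lambda>x. x = 0 \<or> x = 1 \<or> x = 2 \<or> x = 3 \<or> x = 4"] by auto

lemma mod5_mult_eq_0: "(x::5) * y = 0 \<longleftrightarrow> x = 0 \<or> y = 0"
  by (cases x rule: mod5_cases; cases y rule: mod5_cases) simp_all

lemma mod5_unit: "(x::5) \<noteq> 0 \<Longrightarrow> \<exists>y. x * y = 1"
  by (cases x rule: mod5_cases) (auto intro: exI[of _ 1] exI[of _ 3] exI[of _ 2] exI[of _ 4])

lemma mod5_mult_left_cancel: "(x::5) \<noteq> 0 \<Longrightarrow> x * y = x * z \<longleftrightarrow> y = z"
  using mod5_mult_eq_0[of x "y - z"] by (simp add: algebra_simps)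

definition pline :: "5 ^ 2 \<Rightarrow> (5 ^ 2) set" where "pline v = range (\<lambda>a. a *s v)"

lemma pline_scale: "a \<noteq> 0 \<Longrightarrow> pline (a *s v) = pline v"
proof -
  assume "a \<noteq> 0"
  then obtain b where b: "a * b = 1" using mod5_unit by blast
  have "c *s v = (c * b) *s (a *s v)" for c
    using b by (simp add: vector_smult_assoc mult.assoc mult.commute[of b a])
  then have "c *s v \<in> pline (a *s v)" for c unfolding pline_def by (metis rangeI)
  moreover have "c *s (a *s v) \<in> pline v" for c unfolding pline_def by (simp add: vector_smult_assoc)
  ultimately show ?thesis by (auto simp: pline_def)
qed

lemma pline_self: "v \<in> pline v"
  unfolding pline_def by (metis rangeI vector_smult_lid)

lemma vec2_eq: "(v::5^2) = w \<longleftrightarrow> v $ 1 = w $ 1 \<and> v $ 2 = w $ 2"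
  by (simp add: vec_eq_iff forall_2)

text \<open>Scaling a spanning vector so that its first nonzero coordinate is 1 leaves a single line
  without slope and one line for each slope x.\<close>

lemma proj_line_alt: "proj_line = insert (pline (vector [0, 1])) (range (\<lambda>x. pline (vector [1, x])))"
proof -
  have sub: "pline v \<in> insert (pline (vector [0, 1])) (range (\<lambda>x. pline (vector [1, x])))" if "v \<noteq> 0" for v
  proof (cases "v $ 1 = 0")
    case True
    then have "v $ 2 \<noteq> 0" using that by (simp add: vec2_eq)
    moreover have "v = v $ 2 *s vector [0, 1]" using True by (simp add: vec2_eq)
    ultimately show ?thesis using pline_scale by (metis insertI1)
  next
    case False
    then obtain b where b: "v $ 1 * b = 1" using mod5_unit by blast
    have "v = v $ 1 *s vector [1, b * v $ 2]" using b by (simp add: vec2_eq mult.assoc[symmetric])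
    then have "pline v = pline (vector [1, b * v $ 2])"
      using pline_scale[OF False, of "vector [1, b * v $ 2]"] by argo
    then show ?thesis by simp
  qed
  have nz: "vector [0, 1] \<noteq> (0 :: 5^2)" "\<And>x. vector [1, x] \<noteq> (0 :: 5^2)"
    by (simp_all add: vec2_eq)
  have pl: "proj_line = pline ` {v. v \<noteq> 0}" unfolding proj_line_def pline_def by auto
  show ?thesis
  proof
    show "proj_line \<subseteq> insert (pline (vector [0, 1])) (range (\<lambda>x. pline (vector [1, x])))"
      unfolding pl by (rule image_subsetI, rule sub) simp
    show "insert (pline (vector [0, 1])) (range (\<lambda>x. pline (vector [1, x]))) \<subseteq> proj_line"
      unfolding pl using nz by blast
  qed
qed

lemma pline_inj:
  "pline (vector [1, x]) = pline (vector [1, y]) \<longleftrightarrow> x = y"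
  "pline (vector [0, 1]) \<noteq> pline (vector [1, x])"
proof -
  have "x = y" if "pline (vector [1, x]) = pline (vector [1, y])"
  proof -
    have "vector [1, x] \<in> pline (vector [1, y])" using pline_self that by metis
    then show ?thesis unfolding pline_def by (auto simp: vec2_eq)
  qed
  then show "pline (vector [1, x]) = pline (vector [1, y]) \<longleftrightarrow> x = y" by auto
  show "pline (vector [0, 1]) \<noteq> pline (vector [1, x])"
  proof
    assume "pline (vector [0, 1]) = pline (vector [1, x])"
    then have "vector [0, 1] \<in> pline (vector [1, x])" using pline_self by metis
    then show False unfolding pline_def by (auto simp: vec2_eq)
  qed
qed

lemma card_proj_line: "card proj_line = 6"
proof -
  have "card (range (\<lambda>x::5. pline (vector [1, x]))) = 5"
    using pline_inj(1) by (subst card_image) (auto simp: inj_on_def)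
  then show ?thesis unfolding proj_line_alt using pline_inj(2) by (subst card_insert_disjoint) auto
qed

lemma mat_vec2: "((A::5^2^2) *v v) $ 1 = A$1$1 * v$1 + A$1$2 * v$2"
  "(A *v v) $ 2 = A$2$1 * v$1 + A$2$2 * v$2"
  by (simp_all add: matrix_vector_mult_def sum_2)

lemma image_pline: "(*v) A ` pline v = pline (A *v v)"
  proof -
  have "A *v (a *s v) = a *s (A *v v)" for a
    by (simp add: vec2_eq mat_vec2 algebra_simps)
  then show ?thesis unfolding pline_def by (simp add: image_image)
qed

text \<open>A fixed line of slope x makes x a root of q x^2 + (p - t) x - r, and a fixed line (0, 1)
  makes q = 0. Three fixed lines thus give a polynomial of degree at most 2 with three roots, or one
  of degree at most 1 with two roots. It vanishes, so q = r = 0 and p = t.\<close>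

lemma scalar_if_three_fixed_lines:
  fixes A :: "5 ^ 2 ^ 2"
  assumes L: "L1 \<in> proj_line" "L2 \<in> proj_line" "L3 \<in> proj_line" "L1 \<noteq> L2" "L1 \<noteq> L3" "L2 \<noteq> L3"
    and fixed: "(*v) A ` L1 = L1" "(*v) A ` L2 = L2" "(*v) A ` L3 = L3"
  shows "\<exists>a. A = mat a"
proof -
  let ?p = "A$1$1" and ?q = "A$1$2" and ?r = "A$2$1" and ?t = "A$2$2"
  have inf: "?q = 0" if "(*v) A ` pline (vector [0, 1]) = pline (vector [0, 1])"
  proof -
    have "A *v vector [0, 1] \<in> pline (vector [0, 1])" using that pline_self by blast
    then show ?thesis unfolding pline_def by (auto simp: vec2_eq mat_vec2)
  qed
  have fin: "?r + ?t * x = (?p + ?q * x) * x" if "(*v) A ` pline (vector [1, x]) = pline (vector [1, x])" for x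
  proof -
    have "A *v vector [1, x] \<in> pline (vector [1, x])" using that pline_self by blast
    then show ?thesis unfolding pline_def by (auto simp: vec2_eq mat_vec2)
  qed
  have two: "?q = 0 \<Longrightarrow> ?r + ?t * x = (?p + ?q * x) * x \<Longrightarrow> ?r + ?t * y = (?p + ?q * y) * y \<Longrightarrow> x \<noteq> y
     \<Longrightarrow> ?t = ?p \<and> ?r = 0" for x y
  proof -
    assume a: "?q = 0" "?r + ?t * x = (?p + ?q * x) * x" "?r + ?t * y = (?p + ?q * y) * y" "x \<noteq> y"
    have "(?t - ?p) * (x - y) = (?r + ?t * x - ?p * x) - (?r + ?t * y - ?p * y)" by (simp add: algebra_simps)
    also have "\<dots> = 0" using a by simp
    finally have "?t = ?p" using a(4) by (simp add: mod5_mult_eq_0)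
    then show ?thesis using a by simp
  qed
  have three: "?q = 0" if a: "?r + ?t * x = (?p + ?q * x) * x" "?r + ?t * y = (?p + ?q * y) * y"
     "?r + ?t * z = (?p + ?q * z) * z" "x \<noteq> y" "x \<noteq> z" "y \<noteq> z" for x y z
  proof -
    have "(x - y) * (?q * (x + y) + ?p - ?t) = ((?p + ?q * x) * x - (?r + ?t * x)) - ((?p + ?q * y) * y - (?r + ?t * y))"
      by (simp add: algebra_simps)
    also have "\<dots> = 0" using a by simp
    finally have 1: "?q * (x + y) + ?p - ?t = 0" using a by (auto simp: mod5_mult_eq_0)
    have "(x - z) * (?q * (x + z) + ?p - ?t) = ((?p + ?q * x) * x - (?r + ?t * x)) - ((?p + ?q * z) * z - (?r + ?t * z))"
      by (simp add: algebra_simps)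
    also have "\<dots> = 0" using a by simp
    finally have 2: "?q * (x + z) + ?p - ?t = 0" using a by (auto simp: mod5_mult_eq_0)
    have "?q * (y - z) = (?q * (x + y) + ?p - ?t) - (?q * (x + z) + ?p - ?t)" by (simp add: algebra_simps)
    then show ?thesis using 1 2 a(6) by (simp add: mod5_mult_eq_0)
  qed
  \<comment> \<open>The cases run over which of the three lines is spanned by (0, 1): exactly one in
    cases 4, 6 and 7, none in case 8. In the others two of the lines coincide.\<close>
  have "?q = 0 \<and> ?t = ?p \<and> ?r = 0"
    using L(1,2,3) unfolding proj_line_alt
  proof (elim insertE rangeE, goal_cases)
    case 4 then show ?case using inf two fin fixed L by metis
  next
    case (6 x) then show ?case using inf two fin fixed L by metis
  next
    case (7 x) then show ?case using inf two fin fixed L by metis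
  next
    case (8 x y z)
    then have "?q = 0" using three fin fixed L by metis
    then show ?case using two fin fixed L 8 by metis
  qed (use L in auto)
  then have "A = mat ?p" by (auto simp: vec_eq_iff forall_2 mat_def)
  then show ?thesis ..
qed

lemma mat2_eq: "(A::5^2^2) = B \<longleftrightarrow> A$1$1 = B$1$1 \<and> A$1$2 = B$1$2 \<and> A$2$1 = B$2$1 \<and> A$2$2 = B$2$2"
  by (auto simp: vec_eq_iff forall_2)

lemma mat2_mult:
  "((A::5^2^2) ** B)$1$1 = A$1$1 * B$1$1 + A$1$2 * B$2$1"
  "(A ** B)$1$2 = A$1$1 * B$1$2 + A$1$2 * B$2$2"
  "(A ** B)$2$1 = A$2$1 * B$1$1 + A$2$2 * B$2$1"
  "(A ** B)$2$2 = A$2$1 * B$1$2 + A$2$2 * B$2$2"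
  by (simp_all add: matrix_matrix_mult_def sum_2)

lemma mat2: "(mat a :: 5^2^2)$1$1 = a" "(mat a :: 5^2^2)$1$2 = 0" "(mat a :: 5^2^2)$2$1 = 0" "(mat a :: 5^2^2)$2$2 = a"
  by (simp_all add: mat_def)

lemma mat_commute: "mat a ** B = (B :: 5^2^2) ** mat a"
  by (simp add: mat2_eq mat2_mult mat2 mult.commute)

text \<open>Cayley--Hamilton: \<open>A\<^sup>2 = 1 = det A\<close> gives \<open>tr A \<cdot> A = 2\<close>.\<close>

lemma SL25_involution_central:
  fixes A :: "5 ^ 2 ^ 2"
  assumes "det A = 1" "A ** A = mat 1"
  shows "\<exists>a. A = mat a"
proof -
  let ?p = "A$1$1" and ?q = "A$1$2" and ?r = "A$2$1" and ?t = "A$2$2"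
  have d: "?p * ?t - ?q * ?r = 1" using assms(1) by (simp add: det_2)
  have sq: "?p * ?p + ?q * ?r = 1" "?p * ?q + ?q * ?t = 0" "?r * ?p + ?t * ?r = 0" "?r * ?q + ?t * ?t = 1"
    using assms(2) by (simp_all add: mat2_eq mat2_mult mat2)
  have "(?p + ?t) * ?p = (?p * ?p + ?q * ?r) + (?p * ?t - ?q * ?r)" by (simp add: algebra_simps)
  then have s: "(?p + ?t) * ?p = 2" using sq d by simp
  then have s0: "?p + ?t \<noteq> 0" by auto
  have "(?p + ?t) * ?t = (?r * ?q + ?t * ?t) + (?p * ?t - ?q * ?r)" by (simp add: algebra_simps)
  then have "(?p + ?t) * ?t = 2" using sq d by simp
  then have "?p = ?t" using s s0 by (metis mod5_mult_left_cancel)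
  moreover have "(?p + ?t) * ?q = 0" "(?p + ?t) * ?r = 0" using sq by (simp_all add: algebra_simps)
  then have "?q = 0" "?r = 0" using s0 by (auto simp: mod5_mult_eq_0)
  ultimately have "A = mat ?p" by (simp add: mat2_eq mat2)
  then show ?thesis ..
qed

section \<open>The group GL(2,5) and its central subgroup of scalars\<close>

lemma group_GL25: "group GL25"
proof (rule groupI)
  fix x y assume "x \<in> carrier GL25" "y \<in> carrier GL25"
  then show "x \<otimes>\<^bsub>GL25\<^esub> y \<in> carrier GL25" by (simp add: GL25_def invertible_mult)
next
  show "\<one>\<^bsub>GL25\<^esub> \<in> carrier GL25" by (auto simp: GL25_def invertible_def intro: exI[of _ "mat 1"])
next
  fix x y z assume "x \<in> carrier GL25" "y \<in> carrier GL25" "z \<in> carrier GL25"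
  then show "x \<otimes>\<^bsub>GL25\<^esub> y \<otimes>\<^bsub>GL25\<^esub> z = x \<otimes>\<^bsub>GL25\<^esub> (y \<otimes>\<^bsub>GL25\<^esub> z)"
    by (simp add: GL25_def matrix_mul_assoc)
next
  fix x assume x: "x \<in> carrier GL25"
  then show "\<one>\<^bsub>GL25\<^esub> \<otimes>\<^bsub>GL25\<^esub> x = x" by (simp add: GL25_def)
  from x obtain y where "x ** y = mat 1" "y ** x = mat 1" by (auto simp: GL25_def invertible_def)
  then show "\<exists>y\<in>carrier GL25. y \<otimes>\<^bsub>GL25\<^esub> x = \<one>\<^bsub>GL25\<^esub>"
    by (intro bexI[of _ y]) (auto simp: GL25_def invertible_def)
qed

lemma subgroup_scalars: "subgroup {mat a | a. a \<noteq> 0} GL25"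
(is "subgroup ?Z GL25")
proof -
  interpret group GL25 by (rule group_GL25)
  have mm: "mat a ** mat b = (mat (a * b) :: 5^2^2)" for a b by (simp add: mat2_eq mat2_mult mat2)
  have inv: "\<exists>b. b \<noteq> 0 \<and> mat a ** mat b = (mat 1 :: 5^2^2) \<and> mat b ** mat a = (mat 1 :: 5^2^2)" if az: "a \<noteq> 0" for a :: 5
  proof -
    obtain b where b: "a * b = 1" using mod5_unit[OF az] by blast
    then have "b \<noteq> 0" by auto
    then show ?thesis using b by (intro exI[of _ b]) (simp add: mm mult.commute)
  qed
  show ?thesis
  proof (rule subgroupI)
    show sub: "?Z \<subseteq> carrier GL25"
    proof
      fix x :: "5^2^2" assume "x \<in> ?Z"
      then obtain a where "x = mat a" "a \<noteq> 0" by blast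
      then have "invertible x" unfolding invertible_def using inv by blast
      then show "x \<in> carrier GL25" by (simp add: GL25_def)
    qed
    show "?Z \<noteq> {}"
    proof -
      have "(mat 1 :: 5^2^2) \<in> ?Z" by (rule CollectI, rule exI[of _ 1]) simp
      then show ?thesis by fast
    qed
    fix x :: "5^2^2" assume "x \<in> ?Z"
    then obtain a where a: "x = mat a" "a \<noteq> 0" by auto
    then obtain b where b: "b \<noteq> 0" "mat a ** mat b = (mat 1 :: 5^2^2)" "mat b ** mat a = (mat 1 :: 5^2^2)"
      using inv by blast
    have "inv\<^bsub>GL25\<^esub> x = mat b"
    proof (rule inv_equality)
      show "mat b \<otimes>\<^bsub>GL25\<^esub> x = \<one>\<^bsub>GL25\<^esub>" using a b by (simp add: GL25_def)
      show "x \<in> carrier GL25" "mat b \<in> carrier GL25" using sub a b by blast+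
    qed
    then show "inv\<^bsub>GL25\<^esub> x \<in> ?Z" using b by auto
  next
    fix x y :: "5^2^2" assume "x \<in> ?Z" "y \<in> ?Z"
    then show "x \<otimes>\<^bsub>GL25\<^esub> y \<in> ?Z" by (auto simp: GL25_def mm mod5_mult_eq_0)
  qed
qed

lemma normal_scalars: "{mat a | a. a \<noteq> 0} \<lhd> GL25"
proof -
  interpret group GL25 by (rule group_GL25)
  show ?thesis
  proof (rule normalI[OF subgroup_scalars], intro ballI)
    fix x assume "x \<in> carrier GL25"
    then show "{mat a | a. a \<noteq> 0} #>\<^bsub>GL25\<^esub> x = x <#\<^bsub>GL25\<^esub> {mat a | a. a \<noteq> 0}"
      by (auto simp: r_coset_def l_coset_def GL25_def mat_commute)
  qed
qed

section \<open>The permutation module on the six points modulo the constants\<close>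

definition lsupp :: "'x set \<Rightarrow> ('x \<Rightarrow> bit) \<Rightarrow> bool" where
  "lsupp X f \<longleftrightarrow> (\<forall>L. L \<notin> X \<longrightarrow> f L = 0)"

lemma bit_add_self [simp]: "(x::bit) + x = 0"
  by (cases x) simp_all

lemma bit_fun_add_self [simp]: "(f::'x \<Rightarrow> bit) + f = 0"
  by (simp add: fun_eq_iff)

lemma group_perm_module: "group perm_module"
  unfolding perm_module_def
  by (rule groupI) (auto simp: add.assoc intro: exI[of _ "uminus _"] bexI[of _ "uminus _"])

lemma all_one_normal: "{0, all_one} \<lhd> perm_module"
proof -
  interpret group perm_module by (rule group_perm_module)
  have inv: "inv\<^bsub>perm_module\<^esub> f = f" if "f \<in> carrier perm_module" for f
    using that by (intro inv_equality) (auto simp: perm_module_def)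
  have sub: "subgroup {0, all_one} perm_module"
  proof (rule subgroupI)
    show z: "{0, all_one} \<subseteq> carrier perm_module" by (auto simp: perm_module_def all_one_def)
    show "inv\<^bsub>perm_module\<^esub> f \<in> {0, all_one}" if "f \<in> {0, all_one}" for f
      using that z inv by auto
    show "f \<otimes>\<^bsub>perm_module\<^esub> g \<in> {0, all_one}" if "f \<in> {0, all_one}" "g \<in> {0, all_one}" for f g
      using that by (auto simp: perm_module_def)
  qed simp
  then show ?thesis
    by (rule normalI) (auto simp: perm_module_def r_coset_def l_coset_def add.commute)
qed

text \<open>All that is used about \<open>J\<close> as a \<open>PGL(2,5)\<close>-module: \<open>E\<close> is the projection of the permutation
  module onto \<open>J\<close> and \<open>\<sigma>\<close> the action on the projective line.\<close>

lemma base_group_action: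
  fixes G :: "('g, 'b) monoid_scheme"
  assumes "base_group G J"
  obtains \<sigma> :: "'g \<Rightarrow> (5 ^ 2) set \<Rightarrow> (5 ^ 2) set" and E :: "((5 ^ 2) set \<Rightarrow> bit) \<Rightarrow> 'g"
  where "\<And>g. g \<in> carrier G \<Longrightarrow> \<sigma> g permutes proj_line"
    and "\<And>g h. g \<in> carrier G \<Longrightarrow> h \<in> carrier G \<Longrightarrow> \<sigma> (g \<otimes>\<^bsub>G\<^esub> h) = \<sigma> g \<circ> \<sigma> h"
    and "\<And>j. j \<in> J \<Longrightarrow> \<sigma> j = id"
    and "\<And>g. g \<in> carrier G \<Longrightarrow> g \<notin> J \<Longrightarrow> card {L \<in> proj_line. \<sigma> g L = L} \<le> 2"
    and "\<And>f. lsupp proj_line f \<Longrightarrow> E f \<in> J"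
    and "\<And>f f'. lsupp proj_line f \<Longrightarrow> lsupp proj_line f' \<Longrightarrow> E (f + f') = E f \<otimes>\<^bsub>G\<^esub> E f'"
    and "\<And>j. j \<in> J \<Longrightarrow> \<exists>f. lsupp proj_line f \<and> E f = j"
    and "\<And>f. lsupp proj_line f \<Longrightarrow> E f = \<one>\<^bsub>G\<^esub> \<longleftrightarrow> f = 0 \<or> f = all_one"
    and "\<And>f g. lsupp proj_line f \<Longrightarrow> g \<in> carrier G \<Longrightarrow> E (f \<circ> \<sigma> g) = inv\<^bsub>G\<^esub> g \<otimes>\<^bsub>G\<^esub> E f \<otimes>\<^bsub>G\<^esub> g"
proof -
  let ?Z = "{mat a | a. a \<noteq> (0::5)} :: (5^2^2) set"
  interpret G: group G using assms by (simp add: base_group_def)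
  interpret J: normal J G using assms by (simp add: base_group_def)
  interpret GL: group GL25 by (rule group_GL25)
  interpret Z: normal ?Z GL25 by (rule normal_scalars)
  interpret PM: group perm_module by (rule group_perm_module)
  interpret C: normal "{0, all_one}" perm_module by (rule all_one_normal)
  obtain \<rho> \<phi> where \<rho>: "\<rho> \<in> iso (G Mod J) PGL25"
    and \<phi>: "\<phi> \<in> iso perm_module_mod_center (G\<lparr>carrier := J\<rparr>)"
    and act: "\<And>g A Q. g \<in> carrier G \<Longrightarrow> A \<in> \<rho> (J #>\<^bsub>G\<^esub> g) \<Longrightarrow> Q \<in> carrier perm_module_mod_center \<Longrightarrow>
          \<phi> ((\<lambda>f. perm_act f A) ` Q) = inv\<^bsub>G\<^esub> g \<otimes>\<^bsub>G\<^esub> \<phi> Q \<otimes>\<^bsub>G\<^esub> g"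
    using assms unfolding base_group_def is_perm_module_mod_center_def by blast
  have gPGL: "group PGL25" unfolding PGL25_def by (rule Z.factorgroup_is_group)
  interpret \<rho>: group_hom "G Mod J" PGL25 \<rho>
    using \<rho> gPGL J.factorgroup_is_group by (simp add: group_hom_def group_hom_axioms_def iso_def)
  have \<rho>inj: "inj_on \<rho> (carrier (G Mod J))" using \<rho> by (simp add: iso_def bij_betw_def)
  have cos: "J #>\<^bsub>G\<^esub> g \<in> carrier (G Mod J)" if "g \<in> carrier G" for g
    using that by (auto simp: carrier_FactGroup)
  have \<rho>cos: "\<exists>A\<in>carrier GL25. \<rho> (J #>\<^bsub>G\<^esub> g) = ?Z #>\<^bsub>GL25\<^esub> A" if "g \<in> carrier G" for g
    using \<rho>.hom_closed[OF cos[OF that]] by (auto simp: PGL25_def carrier_FactGroup)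
  \<comment> \<open>One matrix is chosen for every g. Another choice differs from it by a scalar,
    which fixes every line.\<close>
  define a where "a g = (SOME A. A \<in> \<rho> (J #>\<^bsub>G\<^esub> g))" for g
  have a: "a g \<in> \<rho> (J #>\<^bsub>G\<^esub> g)" "a g \<in> carrier GL25" "\<rho> (J #>\<^bsub>G\<^esub> g) = ?Z #>\<^bsub>GL25\<^esub> a g" if g: "g \<in> carrier G" for g
  proof -
    obtain A where A: "A \<in> carrier GL25" "\<rho> (J #>\<^bsub>G\<^esub> g) = ?Z #>\<^bsub>GL25\<^esub> A" using \<rho>cos g by blast
    then have "A \<in> \<rho> (J #>\<^bsub>G\<^esub> g)" using GL.rcos_self subgroup_scalars by auto
    then show 1: "a g \<in> \<rho> (J #>\<^bsub>G\<^esub> g)" unfolding a_def by (rule someI)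
    then show "a g \<in> carrier GL25" using A GL.r_coset_subset_G[OF Z.subset A(1)] by auto
    show "\<rho> (J #>\<^bsub>G\<^esub> g) = ?Z #>\<^bsub>GL25\<^esub> a g"
      using 1 A GL.repr_independence subgroup_scalars by auto
  qed
  have ev: "perm_act f A = f \<circ> (`) ((*v) A)" for f A by (simp add: perm_act_def fun_eq_iff)
  have im: "(*v) A ` L \<in> proj_line \<longleftrightarrow> L \<in> proj_line" if A: "A \<in> carrier GL25" for A L
  proof -
    obtain B where B: "A ** B = mat 1" "B ** A = mat 1" using A by (auto simp: GL25_def invertible_def)
    have pr: "(*v) A ` L \<in> proj_line" if LB: "L \<in> proj_line" "B ** A = mat 1" for A B L
    proof -
      obtain v where v: "L = pline v" "v \<noteq> 0" using LB(1) unfolding proj_line_def pline_def by blast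
      have "A *v v \<noteq> 0"
        using v(2) LB(2) by (metis matrix_vector_mul_assoc matrix_vector_mul_lid matrix_vector_mult_0_right)
      then show ?thesis unfolding v image_pline by (auto simp: proj_line_def pline_def)
    qed
    have "(*v) B ` (*v) A ` L = L" using B by (simp add: image_image matrix_vector_mul_assoc)
    then show ?thesis using pr[of L B A] pr[of "(*v) A ` L" A B] B by metis
  qed
  have scal: "(*v) (M ** A) ` L = (*v) A ` L" if M: "M \<in> ?Z" and L: "L \<in> proj_line" and A: "A \<in> carrier GL25" for M A L
  proof -
    obtain b where b: "M = mat b" "b \<noteq> 0" using M by auto
    obtain v where v: "(*v) A ` L = pline v" using L im[OF A, of L] by (auto simp: proj_line_def pline_def)
    have "(*v) (M ** A) ` L = (*v) M ` pline v" unfolding v[symmetric] by (simp add: image_image matrix_vector_mul_assoc)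
    also have "\<dots> = pline (M *v v)" by (rule image_pline)
    also have "M *v v = b *s v" unfolding b by (simp add: vec2_eq mat_vec2 mat2)
    finally show ?thesis using b v by (simp add: pline_scale)
  qed
  \<comment> \<open>Off the projective line the map is the identity, as \<open>permutes\<close>
    demands; it then composes without exceptions.\<close>
  define \<sigma> where "\<sigma> g L = (if L \<in> proj_line then (*v) (a g) ` L else L)" for g L
  have \<sigma>: "\<sigma> g L = (*v) A ` L" if g: "g \<in> carrier G" and A: "A \<in> \<rho> (J #>\<^bsub>G\<^esub> g)" and L: "L \<in> proj_line" for g A L
  proof -
    obtain M where "M \<in> ?Z" "A = M ** a g" using A a(3)[OF g] by (auto simp: r_coset_def GL25_def)
    then show ?thesis using scal[OF _ L a(2)[OF g]] L by (simp add: \<sigma>_def)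
  qed
  have \<sigma>l: "\<sigma> g L \<in> proj_line \<longleftrightarrow> L \<in> proj_line" if "g \<in> carrier G" for g L
    using im[OF a(2)[OF that]] by (auto simp: \<sigma>_def)
  have mult: "\<sigma> (g \<otimes>\<^bsub>G\<^esub> h) = \<sigma> g \<circ> \<sigma> h" if g: "g \<in> carrier G" and h: "h \<in> carrier G" for g h
  proof
    fix L
    have "a g ** a h \<in> \<rho> (J #>\<^bsub>G\<^esub> g) <#>\<^bsub>GL25\<^esub> \<rho> (J #>\<^bsub>G\<^esub> h)"
      using a(1)[OF g] a(1)[OF h] by (auto simp: set_mult_def GL25_def)
    also have "\<dots> = \<rho> (J #>\<^bsub>G\<^esub> (g \<otimes>\<^bsub>G\<^esub> h))"
      using \<rho>.hom_mult[OF cos[OF g] cos[OF h]] J.rcos_sum[OF g h] by (simp add: PGL25_def)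
    finally have *: "a g ** a h \<in> \<rho> (J #>\<^bsub>G\<^esub> (g \<otimes>\<^bsub>G\<^esub> h))" .
    show "\<sigma> (g \<otimes>\<^bsub>G\<^esub> h) L = (\<sigma> g \<circ> \<sigma> h) L"
    proof (cases "L \<in> proj_line")
      case True
      then show ?thesis using \<sigma>[OF _ * True] g h \<sigma>l[OF h, of L]
        by (simp add: \<sigma>_def image_image matrix_vector_mul_assoc)
    qed (simp add: \<sigma>_def)
  qed
  have one: "\<sigma> j = id" if j: "j \<in> J" for j
  proof
    fix L
    have "\<rho> (J #>\<^bsub>G\<^esub> j) = \<rho> J" using j by (simp add: J.rcos_const G.is_group)
    also have "\<dots> = ?Z" using \<rho>.hom_one by (simp add: PGL25_def)
    finally have "mat 1 \<in> \<rho> (J #>\<^bsub>G\<^esub> j)" using one_neq_zero[where 'a=5] by blast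
    then show "\<sigma> j L = id L"
      using \<sigma>[of j "mat 1" L] j J.subset by (cases "L \<in> proj_line") (auto simp: \<sigma>_def[of _ L])
  qed
  have perm: "\<sigma> g permutes proj_line" if g: "g \<in> carrier G" for g
  proof -
    have "\<sigma> g \<circ> \<sigma> (inv\<^bsub>G\<^esub> g) = id" "\<sigma> (inv\<^bsub>G\<^esub> g) \<circ> \<sigma> g = id"
      using mult[of g "inv\<^bsub>G\<^esub> g"] mult[of "inv\<^bsub>G\<^esub> g" g] g one[OF J.one_closed] by simp_all
    then have "bij (\<sigma> g)" using o_bij by blast
    then show ?thesis unfolding permutes_def bij_iff by (auto simp: \<sigma>_def)
  qed
  have fix2: "card {L \<in> proj_line. \<sigma> g L = L} \<le> 2" if g: "g \<in> carrier G" "g \<notin> J" for g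
  proof (rule ccontr)
    assume "\<not> ?thesis"
    then have "3 \<le> card {L \<in> proj_line. \<sigma> g L = L}" by simp
    then obtain T where T: "T \<subseteq> {L \<in> proj_line. \<sigma> g L = L}" "card T = 3"
      by (meson obtain_subset_with_card_n)
    then obtain L1 L2 L3 where L: "T = {L1, L2, L3}" "L1 \<noteq> L2" "L1 \<noteq> L3" "L2 \<noteq> L3"
      unfolding card_3_iff by blast
    then have m: "L1 \<in> proj_line" "L2 \<in> proj_line" "L3 \<in> proj_line" "\<sigma> g L1 = L1" "\<sigma> g L2 = L2" "\<sigma> g L3 = L3"
      using T(1) by blast+
    then have "(*v) (a g) ` L1 = L1" "(*v) (a g) ` L2 = L2" "(*v) (a g) ` L3 = L3" by (simp_all add: \<sigma>_def)
    then obtain b where b: "a g = mat b"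
      using scalar_if_three_fixed_lines[OF m(1-3) L(2-4), of "a g"] by metis
    have "b \<noteq> 0"
    proof
      assume "b = 0"
      moreover obtain B where "a g ** B = mat 1" using a(2)[OF g(1)] by (auto simp: GL25_def invertible_def)
      ultimately show False using b by (simp add: mat2_eq mat2_mult mat2)
    qed
    then have "a g \<in> ?Z" unfolding b by (intro CollectI exI[of _ b]) simp
    then have "\<rho> (J #>\<^bsub>G\<^esub> g) = ?Z" unfolding a(3)[OF g(1)] by (rule Z.rcos_const[OF GL.is_group])
    also have "\<dots> = \<rho> J" using \<rho>.hom_one by (simp add: PGL25_def)
    finally have "J #>\<^bsub>G\<^esub> g = J"
      using \<rho>inj cos[OF g(1)] cos[OF G.one_closed] J.subset by (auto dest: inj_onD)
    then show False using g G.rcos_self[OF g(1) J.subgroup_axioms] by simp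
  qed
  interpret \<phi>: group_hom perm_module_mod_center "G\<lparr>carrier := J\<rparr>" \<phi>
    using \<phi> C.factorgroup_is_group G.subgroup_imp_group[OF J.subgroup_axioms]
    by (simp add: group_hom_def group_hom_axioms_def iso_def)
  define E where "E f = \<phi> ({0, all_one} #>\<^bsub>perm_module\<^esub> f)" for f
  have ls: "lsupp proj_line f \<longleftrightarrow> f \<in> carrier perm_module" for f by (simp add: lsupp_def perm_module_def)
  have ccos: "{0, all_one} #>\<^bsub>perm_module\<^esub> f \<in> carrier perm_module_mod_center" if "lsupp proj_line f" for f
    using that by (auto simp: carrier_FactGroup ls)
  have cosf: "{0, all_one} #>\<^bsub>perm_module\<^esub> f = {f, all_one + f}" for f
    by (auto simp: r_coset_def perm_module_def)
  have E1: "E f \<in> J" if "lsupp proj_line f" for f using \<phi>.hom_closed[OF ccos[OF that]] by (simp add: E_def)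
  have E2: "E (f + f') = E f \<otimes>\<^bsub>G\<^esub> E f'" if "lsupp proj_line f" "lsupp proj_line f'" for f f'
  proof -
    have "f + f' = f \<otimes>\<^bsub>perm_module\<^esub> f'" by (simp add: perm_module_def)
    then show ?thesis unfolding E_def
      using \<phi>.hom_mult[OF ccos[OF that(1)] ccos[OF that(2)]] C.rcos_sum[of f f'] that by (simp add: ls)
  qed
  have E3: "\<exists>f. lsupp proj_line f \<and> E f = j" if "j \<in> J" for j
  proof -
    have "j \<in> \<phi> ` carrier perm_module_mod_center" using \<phi> that by (simp add: iso_def bij_betw_def)
    then show ?thesis by (auto simp: E_def carrier_FactGroup ls)
  qed
  have E4: "E f = \<one>\<^bsub>G\<^esub> \<longleftrightarrow> f = 0 \<or> f = all_one" if f: "lsupp proj_line f" for f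
  proof -
    have o: "\<phi> {0, all_one} = \<one>\<^bsub>G\<^esub>" using \<phi>.hom_one by simp
    have "{0, all_one} \<in> carrier perm_module_mod_center" using \<phi>.G.one_closed by simp
    moreover have "inj_on \<phi> (carrier perm_module_mod_center)" using \<phi> by (simp add: iso_def bij_betw_def)
    ultimately have "E f = \<one>\<^bsub>G\<^esub> \<longleftrightarrow> {f, all_one + f} = {0, all_one}"
      unfolding E_def using ccos[OF f] o cosf by (metis inj_onD)
    also have "\<dots> \<longleftrightarrow> f = 0 \<or> f = all_one" by (auto simp: doubleton_eq_iff)
    finally show ?thesis .
  qed
  have E5: "E (f \<circ> \<sigma> g) = inv\<^bsub>G\<^esub> g \<otimes>\<^bsub>G\<^esub> E f \<otimes>\<^bsub>G\<^esub> g" if f: "lsupp proj_line f" and g: "g \<in> carrier G" for f g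
  proof -
    have pa: "perm_act f' (a g) = f' \<circ> \<sigma> g" if "lsupp proj_line f'" for f'
    proof
      fix L show "perm_act f' (a g) L = (f' \<circ> \<sigma> g) L"
        using that im[OF a(2)[OF g], of L] by (cases "L \<in> proj_line") (auto simp: ev \<sigma>_def lsupp_def)
    qed
    \<comment> \<open>The constants are invariant, so the action on a coset of the constants can be
      computed on the representatives f and all_one + f.\<close>
    have o: "all_one \<circ> \<sigma> g = all_one" using \<sigma>l[OF g] by (auto simp: all_one_def fun_eq_iff)
    have "lsupp proj_line (all_one + f)" using f by (auto simp: lsupp_def all_one_def)
    then have "perm_act (all_one + f) (a g) = all_one + (f \<circ> \<sigma> g)"
      using pa[of "all_one + f"] o by (auto simp: fun_eq_iff)
    then have "(\<lambda>f. perm_act f (a g)) ` ({0, all_one} #>\<^bsub>perm_module\<^esub> f) = {0, all_one} #>\<^bsub>perm_module\<^esub> (f \<circ> \<sigma> g)"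
      using pa[OF f] by (simp add: cosf)
    then show ?thesis unfolding E_def using act[OF g a(1)[OF g] ccos[OF f]] by simp
  qed
  show thesis by (rule that[of \<sigma> E]) (fact perm mult one fix2 E1 E2 E3 E4 E5)+
qed

subsection \<open>Folders of involutions\<close>

text \<open>\<open>K_separated\<close> speaks of x \<otimes> y instead of x \<otimes> inv y because
  elements of \<open>K\<close> are their own inverses. Invariance under conjugation reduces the
  condition on all conjugates of \<open>H\<close> to the one on \<open>H\<close> itself.\<close>

locale involution_folder = group G for G (structure) +
  fixes H K :: "'a set"
  assumes finite_carrier: "finite (carrier G)"
    and H_subgroup: "subgroup H G"
    and K_subset: "K \<subseteq> carrier G"
    and one_in_K: "\<one> \<in> K"
    and K_conj: "\<And>x g. x \<in> K \<Longrightarrow> g \<in> carrier G \<Longrightarrow> inv g \<otimes> x \<otimes> g \<in> K"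
    and K_square: "\<And>x. x \<in> K \<Longrightarrow> x \<otimes> x = \<one>"
    and K_separated: "\<And>x y. x \<in> K \<Longrightarrow> y \<in> K \<Longrightarrow> x \<otimes> y \<in> H \<Longrightarrow> x = y"
    and K_large: "order G \<le> card H * card K"
begin

lemma K_closed [simp]: "x \<in> K \<Longrightarrow> x \<in> carrier G"
  using K_subset by auto

lemma K_inv: "x \<in> K \<Longrightarrow> inv x = x"
  by (simp add: K_square inv_equality)

lemma H_closed [simp]: "h \<in> H \<Longrightarrow> h \<in> carrier G"
  using subgroup.subset[OF H_subgroup] by auto

lemma rcoset_eq_iff:
  assumes "x \<in> carrier G" "y \<in> carrier G"
  shows "H #> x = H #> y \<longleftrightarrow> x \<otimes> inv y \<in> H"
proof
  assume "H #> x = H #> y"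
  then have "x \<in> H #> y" using rcos_self[OF assms(1) H_subgroup] by simp
  then obtain h where "h \<in> H" "x = h \<otimes> y" by (auto simp: r_coset_def)
  then show "x \<otimes> inv y \<in> H" using assms by (simp add: m_assoc)
next
  assume h: "x \<otimes> inv y \<in> H"
  have "x = (x \<otimes> inv y) \<otimes> y" using assms by (simp add: m_assoc)
  then have "x \<in> H #> y" using h by (auto simp: r_coset_def)
  then show "H #> x = H #> y" using repr_independence[OF _ assms(2) H_subgroup] by simp
qed

text \<open>By \<open>K_separated\<close> distinct elements of \<open>K\<close> lie in distinct
  right cosets of \<open>H\<close>. By Lagrange and \<open>K_large\<close> there are no more cosets
  than elements of \<open>K\<close>, so each coset is met.\<close>

lemma ex1_rep:
  assumes "g \<in> carrier G"
  shows "\<exists>!z. z \<in> K \<and> H #> z = H #> g"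
proof -
  have inj: "inj_on ((#>) H) K"
  proof (rule inj_onI)
    fix x y assume "x \<in> K" "y \<in> K" "H #> x = H #> y"
    then show "x = y" using rcoset_eq_iff[of x y] K_inv[of y] K_separated by simp
  qed
  have sub: "(#>) H ` K \<subseteq> rcosets H" unfolding RCOSETS_def using K_closed by blast
  have H0: "0 < card H"
    using H_subgroup finite_carrier subgroup.one_closed subgroup.subset by (metis card_gt_0_iff empty_iff finite_subset)
  have "card (rcosets H) * card H = order G" by (rule lagrange[OF H_subgroup])
  then have "card H * card (rcosets H) \<le> card H * card K" using K_large by (simp add: mult.commute)
  then have "card (rcosets H) \<le> card K" using H0 mult_le_cancel1 by blast
  moreover have "card ((#>) H ` K) = card K" by (rule card_image[OF inj])
  moreover have "finite (rcosets H)" using finite_carrier H_subgroup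
    by (simp add: RCOSETS_def)
  ultimately have eq: "(#>) H ` K = rcosets H" using sub by (intro card_subset_eq) (auto dest: card_mono[of _ "(#>) H ` K"])
  have "H #> g \<in> rcosets H" using assms by (auto simp: RCOSETS_def)
  then have "H #> g \<in> (#>) H ` K" using eq by simp
  then obtain z where "z \<in> K" "H #> z = H #> g" by auto
  then show ?thesis using inj by (auto dest: inj_onD)
qed

definition rep :: "'a \<Rightarrow> 'a" where
  "rep g = (THE z. z \<in> K \<and> H #> z = H #> g)"

lemma rep:
  assumes "g \<in> carrier G"
  shows "rep g \<in> K" "H #> rep g = H #> g"
  using theI'[OF ex1_rep[OF assms]] unfolding rep_def by auto

lemma rep_eqI: "g \<in> carrier G \<Longrightarrow> z \<in> K \<Longrightarrow> z \<otimes> inv g \<in> H \<Longrightarrow> rep g = z"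
  using ex1_rep[of g] rep[of g] rcoset_eq_iff[of z g] by auto

lemma rep_K [simp]: "x \<in> K \<Longrightarrow> rep x = x"
  by (rule rep_eqI) (simp_all add: subgroup.one_closed[OF H_subgroup])

lemma rep_H: "h \<in> H \<Longrightarrow> rep h = \<one>"
  by (rule rep_eqI) (simp_all add: one_in_K subgroup.m_inv_closed[OF H_subgroup])

lemma rep_cong: "x \<in> carrier G \<Longrightarrow> y \<in> carrier G \<Longrightarrow> H #> x = H #> y \<Longrightarrow> rep x = rep y"
  by (simp add: rep_def)

text \<open>Right multiplication acts on the right cosets of \<open>H\<close>. Hence a
  left-bracketed loop product is the representative of the corresponding product in the
  group.\<close>

lemma rep_rep_mult:
  assumes "g \<in> carrier G" "h \<in> carrier G"
  shows "rep (rep g \<otimes> h) = rep (g \<otimes> h)"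
proof (rule rep_cong)
  show "H #> (rep g \<otimes> h) = H #> (g \<otimes> h)"
    using assms rep[OF assms(1)] subgroup.subset[OF H_subgroup] by (simp add: coset_mult_assoc[symmetric])
qed (use assms rep in auto)

lemma rep_mem:
  assumes "g \<in> carrier G"
  shows "rep g \<otimes> inv g \<in> H"
  using assms rep[OF assms] rcoset_eq_iff[of "rep g" g] by simp

lemma loop_folder: "loop_folder G H K"
  unfolding loop_folder_def
proof (intro conjI ballI)
  show "group G" by (rule is_group)
  show "subgroup H G" by (rule H_subgroup)
  show "K \<subseteq> carrier G" by (rule K_subset)
  show "\<one> \<in> K" by (rule one_in_K)
next
  fix g C assume g: "g \<in> carrier G" and C: "C \<in> rcosets (inv g <# H #> g)"
  then obtain a where a: "a \<in> carrier G" "C = (inv g <# H #> g) #> a" by (auto simp: RCOSETS_def)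
  \<comment> \<open>Conjugation by g carries the right coset of the conjugate subgroup through a to
    the right coset of \<open>H\<close> through g a g^-1. Since it also preserves \<open>K\<close>,
    transversality need only be known for \<open>H\<close>.\<close>
  have mem: "x \<in> C \<longleftrightarrow> g \<otimes> x \<otimes> inv g \<otimes> inv (g \<otimes> a \<otimes> inv g) \<in> H" if x: "x \<in> carrier G" for x
  proof -
    have "x \<in> C \<longleftrightarrow> (\<exists>h\<in>H. x = inv g \<otimes> h \<otimes> g \<otimes> a)" unfolding a(2) r_coset_def l_coset_def by auto
    also have "\<dots> \<longleftrightarrow> (\<exists>h\<in>H. g \<otimes> x \<otimes> inv g \<otimes> inv (g \<otimes> a \<otimes> inv g) = h)"
    proof (rule bex_cong[OF refl])
      fix h assume h: "h \<in> H"
      have 1: "g \<otimes> x \<otimes> inv g \<otimes> inv (g \<otimes> a \<otimes> inv g) = g \<otimes> x \<otimes> inv a \<otimes> inv g"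
        using g a x by (simp add: inv_mult_group m_assoc) (simp add: m_assoc[symmetric])
      show "x = inv g \<otimes> h \<otimes> g \<otimes> a \<longleftrightarrow> g \<otimes> x \<otimes> inv g \<otimes> inv (g \<otimes> a \<otimes> inv g) = h"
        unfolding 1
      proof
        assume "x = inv g \<otimes> h \<otimes> g \<otimes> a"
        then show "g \<otimes> x \<otimes> inv a \<otimes> inv g = h" using g a h
          by (simp add: m_assoc) (simp add: m_assoc[symmetric])
      next
        assume "g \<otimes> x \<otimes> inv a \<otimes> inv g = h"
        then have "inv g \<otimes> h \<otimes> g \<otimes> a = inv g \<otimes> (g \<otimes> x \<otimes> inv a \<otimes> inv g) \<otimes> g \<otimes> a" by simp
        also have "\<dots> = x" using g a x by (simp add: m_assoc) (simp add: m_assoc[symmetric])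
        finally show "x = inv g \<otimes> h \<otimes> g \<otimes> a" by simp
      qed
    qed
    finally show ?thesis by auto
  qed
  have conj: "g \<otimes> x \<otimes> inv g \<in> K" if "x \<in> K" for x
    using K_conj[OF that, of "inv g"] g by simp
  have ga: "g \<otimes> a \<otimes> inv g \<in> carrier G" using g a by simp
  show "\<exists>!x. x \<in> K \<inter> C"
  proof (rule ex_ex1I)
    let ?z = "rep (g \<otimes> a \<otimes> inv g)"
    have z: "?z \<in> K" using rep(1)[OF ga] .
    have "g \<otimes> (inv g \<otimes> ?z \<otimes> g) \<otimes> inv g = ?z"
      using g z by (simp add: m_assoc) (simp add: m_assoc[symmetric])
    then have "inv g \<otimes> ?z \<otimes> g \<in> C" using mem[of "inv g \<otimes> ?z \<otimes> g"] rep_mem[OF ga] g z by simp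
    then show "\<exists>x. x \<in> K \<inter> C" using K_conj[OF z g] by auto
  next
    fix x y assume x: "x \<in> K \<inter> C" and y: "y \<in> K \<inter> C"
    then have "rep (g \<otimes> a \<otimes> inv g) = g \<otimes> x \<otimes> inv g" "rep (g \<otimes> a \<otimes> inv g) = g \<otimes> y \<otimes> inv g"
      using mem[of x] mem[of y] conj ga by (auto intro!: rep_eqI)
    then have "g \<otimes> x \<otimes> inv g = g \<otimes> y \<otimes> inv g" by argo
    then show "x = y" using x y g by simp
  qed
qed

abbreviation L where "L \<equiv> folder_loop G H K"

lemma carrier_L [simp]: "carrier L = K" and one_L [simp]: "\<one>\<^bsub>L\<^esub> = \<one>"
  and mult_L [simp]: "x \<otimes>\<^bsub>L\<^esub> y = rep (x \<otimes> y)"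
  by (simp_all add: folder_loop_def rep_def)

lemma rep_right_cancel:
  assumes "x \<in> K" "y \<in> K" "a \<in> K" "rep (x \<otimes> a) = rep (y \<otimes> a)"
  shows "x = y"
proof -
  have "rep (rep (x \<otimes> a) \<otimes> inv a) = x" "rep (rep (y \<otimes> a) \<otimes> inv a) = y"
    using assms(1-3) by (simp_all add: rep_rep_mult m_assoc)
  then show ?thesis using assms(4) by metis
qed

text \<open>Right division is explicit: divide in the group and take the representative. Left
  division is where the conjugates of \<open>H\<close> enter: a \<circ> x = b says that x lies in
  the right coset through a^-1 b of the conjugate of \<open>H\<close> by a.\<close>

lemma is_loop_L: "is_loop L"
  unfolding is_loop_def
proof (intro conjI ballI)
  fix a b assume "a \<in> carrier L" "b \<in> carrier L"
  then have a: "a \<in> K" and b: "b \<in> K" by simp_all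
  then show "a \<otimes>\<^bsub>L\<^esub> b \<in> carrier L" using rep by simp
  have eq: "a \<otimes>\<^bsub>L\<^esub> x = b \<longleftrightarrow> x \<in> (inv a <# H #> a) #> (inv a \<otimes> b)" if x: "x \<in> K" for x
  proof -
    have "a \<otimes>\<^bsub>L\<^esub> x = b \<longleftrightarrow> a \<otimes> x \<otimes> inv b \<in> H"
    proof
      assume "a \<otimes>\<^bsub>L\<^esub> x = b"
      then have "b \<otimes> inv (a \<otimes> x) \<in> H" using rep_mem[of "a \<otimes> x"] a x by simp
      then have "inv (b \<otimes> inv (a \<otimes> x)) \<in> H" using subgroup.m_inv_closed[OF H_subgroup] by simp
      then show "a \<otimes> x \<otimes> inv b \<in> H" using a b x by (simp add: inv_mult_group)
    next
      assume "a \<otimes> x \<otimes> inv b \<in> H"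
      then have "inv (a \<otimes> x \<otimes> inv b) \<in> H" using subgroup.m_inv_closed[OF H_subgroup] by simp
      then have "b \<otimes> inv (a \<otimes> x) \<in> H" using a b x by (simp add: inv_mult_group)
      then show "a \<otimes>\<^bsub>L\<^esub> x = b" using a b x by (simp add: rep_eqI)
    qed
    also have "\<dots> \<longleftrightarrow> (\<exists>h\<in>H. a \<otimes> x \<otimes> inv b = h)" by auto
    also have "\<dots> \<longleftrightarrow> (\<exists>h\<in>H. x = inv a \<otimes> h \<otimes> a \<otimes> (inv a \<otimes> b))"
    proof (rule bex_cong[OF refl])
      fix h assume h: "h \<in> H"
      have "inv a \<otimes> h \<otimes> a \<otimes> (inv a \<otimes> b) = inv a \<otimes> (h \<otimes> b)"
        using a b h by (simp add: m_assoc) (simp add: m_assoc[symmetric])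
      moreover have "a \<otimes> x \<otimes> inv b = h \<longleftrightarrow> a \<otimes> x = h \<otimes> b"
        using a b h x by (metis K_closed H_closed inv_closed inv_solve_right' m_closed inv_inv)
      moreover have "a \<otimes> x = h \<otimes> b \<longleftrightarrow> x = inv a \<otimes> (h \<otimes> b)"
        using a b h x by (metis K_closed H_closed inv_solve_left m_closed)
      ultimately show "a \<otimes> x \<otimes> inv b = h \<longleftrightarrow> x = inv a \<otimes> h \<otimes> a \<otimes> (inv a \<otimes> b)" by simp
    qed
    also have "\<dots> \<longleftrightarrow> x \<in> (inv a <# H #> a) #> (inv a \<otimes> b)"
      unfolding r_coset_def l_coset_def by auto
    finally show ?thesis .
  qed
  have "(inv a <# H #> a) #> (inv a \<otimes> b) \<in> rcosets (inv a <# H #> a)"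
    using a b by (auto simp: RCOSETS_def)
  then have "\<exists>!x. x \<in> K \<inter> ((inv a <# H #> a) #> (inv a \<otimes> b))"
    using loop_folder a unfolding loop_folder_def by blast
  then show "\<exists>!x. x \<in> carrier L \<and> a \<otimes>\<^bsub>L\<^esub> x = b" using eq by (metis IntE IntI carrier_L)
  show "\<exists>!y. y \<in> carrier L \<and> y \<otimes>\<^bsub>L\<^esub> a = b"
  proof (rule ex_ex1I)
    show "\<exists>y. y \<in> carrier L \<and> y \<otimes>\<^bsub>L\<^esub> a = b"
      using a b rep by (intro exI[of _ "rep (b \<otimes> inv a)"]) (simp add: rep_rep_mult m_assoc)
  qed (use a rep_right_cancel in auto)
qed (auto simp: one_in_K)

text \<open>Since y z y lies in \<open>K\<close>, it is its own representative, and both sides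
  become the representative of x y z y.\<close>

lemma right_bol_L: "right_bol_loop L"
  unfolding right_bol_loop_def
proof (intro conjI ballI is_loop_L)
  fix x y z assume "x \<in> carrier L" "y \<in> carrier L" "z \<in> carrier L"
  then have k: "x \<in> K" "y \<in> K" "z \<in> K" by simp_all
  then have "y \<otimes> z \<otimes> y \<in> K" using K_conj[of z y] K_inv[of y] by simp
  then show "((x \<otimes>\<^bsub>L\<^esub> y) \<otimes>\<^bsub>L\<^esub> z) \<otimes>\<^bsub>L\<^esub> y = x \<otimes>\<^bsub>L\<^esub> ((y \<otimes>\<^bsub>L\<^esub> z) \<otimes>\<^bsub>L\<^esub> y)"
    using k by (simp add: rep_rep_mult m_assoc)
qed

lemma bol_loop_folder: "bol_loop_folder G H K"
  by (simp add: bol_loop_folder_def loop_folder right_bol_L)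

lemma exponent_two_L: "K \<noteq> {\<one>} \<Longrightarrow> loop_exponent_two L"
  by (simp add: loop_exponent_two_def K_square one_in_K)

text \<open>\<open>D\<close> is the kernel of the action of \<open>G\<close> on the image of \<open>L\<close>.\<close>

lemma normal_subloop_core:
  assumes gen: "generate G K = carrier G" and "normal_subloop N L"
  obtains D where "D \<lhd> G" "N = K \<inter> D"
    and "\<And>h d. h \<in> H \<Longrightarrow> d \<in> D \<Longrightarrow> h \<otimes> d \<in> K \<Longrightarrow> h \<otimes> d \<in> N"
    and "\<And>d. d \<in> D \<Longrightarrow> \<exists>h\<in>H. \<exists>n\<in>N. d = h \<otimes> n"
    and "\<And>n y. n \<in> N \<Longrightarrow> y \<in> K \<Longrightarrow> \<exists>d\<in>D. d \<otimes> y \<in> K \<and> d \<otimes> inv n \<in> H"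
    and "\<And>y. y \<in> K \<Longrightarrow> y \<notin> N \<Longrightarrow> card N \<le> card (K - N)"
proof -
  obtain M :: "'a set monoid" and f where M: "is_loop M" and f: "f \<in> hom L M" and N: "N = kernel L M f"
    using assms(2) unfolding normal_subloop_def by blast
  have f_closed: "f x \<in> carrier M" if "x \<in> K" for x using f that by (auto simp: hom_def)
  have f_mult: "f (rep (x \<otimes> y)) = f x \<otimes>\<^bsub>M\<^esub> f y" if "x \<in> K" "y \<in> K" for x y
    using f that by (auto simp: hom_def)
  \<comment> \<open>The image of the unit and the unit of \<open>M\<close> solve the same equation
    for left division.\<close>
  have f_one: "f \<one> = \<one>\<^bsub>M\<^esub>"
  proof -
    have "f \<one> \<otimes>\<^bsub>M\<^esub> f \<one> = f \<one>" using f_mult[OF one_in_K one_in_K] by (simp add: one_in_K)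
    moreover have "f \<one> \<otimes>\<^bsub>M\<^esub> \<one>\<^bsub>M\<^esub> = f \<one>" "\<one>\<^bsub>M\<^esub> \<in> carrier M"
      using M f_closed[OF one_in_K] unfolding is_loop_def by auto
    ultimately show ?thesis using M f_closed[OF one_in_K] unfolding is_loop_def by blast
  qed
  have N_iff: "x \<in> N \<longleftrightarrow> x \<in> K \<and> f x = \<one>\<^bsub>M\<^esub>" for x by (simp add: N kernel_def)
  define F where "F g = f (rep g)" for g
  have F_mult: "F (g \<otimes> y) = F g \<otimes>\<^bsub>M\<^esub> f y" if "g \<in> carrier G" "y \<in> K" for g y
    using f_mult[of "rep g" y] that rep by (simp add: F_def rep_rep_mult)
  have F_K: "F x = f x" if "x \<in> K" for x using that by (simp add: F_def)
  have F_closed: "F g \<in> carrier M" if "g \<in> carrier G" for g using that rep f_closed by (simp add: F_def)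
  \<comment> \<open>Right multiplication by an element of \<open>K\<close> respects the fibres of
    \<open>F\<close> because f is a homomorphism. As \<open>K\<close> generates the group, this
    passes to every element by induction on words.\<close>
  have cong: "F (g1 \<otimes> y) = F (g2 \<otimes> y)"
    if "y \<in> carrier G" "g1 \<in> carrier G" "g2 \<in> carrier G" "F g1 = F g2" for y g1 g2
  proof -
    have "y \<in> generate G K" using gen that by simp
    then show ?thesis using that(2-4)
    proof (induction arbitrary: g1 g2 rule: generate.induct)
      case (eng h1 h2)
      then have c: "h1 \<in> carrier G" "h2 \<in> carrier G" using gen by auto
      have "F (g1 \<otimes> h1) = F (g2 \<otimes> h1)" by (rule eng.IH(1)[OF eng.prems])
      then have "F (g1 \<otimes> h1 \<otimes> h2) = F (g2 \<otimes> h1 \<otimes> h2)"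
        by (rule eng.IH(2)[OF m_closed[OF eng.prems(1) c(1)] m_closed[OF eng.prems(2) c(1)]])
      then show ?case by (simp only: m_assoc[OF eng.prems(1) c] m_assoc[OF eng.prems(2) c])
    qed (simp_all add: F_mult K_inv)
  qed
  define D where "D = {d \<in> carrier G. \<forall>g\<in>carrier G. F (g \<otimes> d) = F g}"
  have Dc: "d \<in> carrier G" "\<And>g. g \<in> carrier G \<Longrightarrow> F (g \<otimes> d) = F g" if "d \<in> D" for d
    using that by (auto simp: D_def)
  have sub: "subgroup D G"
  proof (rule subgroupI)
    show "D \<subseteq> carrier G" by (auto simp: D_def)
    show "D \<noteq> {}" by (auto simp: D_def intro: exI[of _ \<one>])
    fix a assume a: "a \<in> D"
    have "F (g \<otimes> inv a) = F g" if g: "g \<in> carrier G" for g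
      using Dc(2)[OF a, of "g \<otimes> inv a"] Dc(1)[OF a] g by (simp add: m_assoc)
    then show "inv a \<in> D" using Dc(1)[OF a] by (auto simp: D_def)
    fix b assume b: "b \<in> D"
    have "F (g \<otimes> (a \<otimes> b)) = F g" if g: "g \<in> carrier G" for g
      using Dc(2)[OF a, of g] Dc(2)[OF b, of "g \<otimes> a"] Dc(1)[OF a] Dc(1)[OF b] g by (simp add: m_assoc)
    then show "a \<otimes> b \<in> D" using Dc(1)[OF a] Dc(1)[OF b] by (auto simp: D_def)
  qed
  have nor: "D \<lhd> G"
    unfolding normal_inv_iff
  proof (intro conjI ballI sub)
    fix x d assume x: "x \<in> carrier G" and d: "d \<in> D"
    have "F (g \<otimes> (x \<otimes> d \<otimes> inv x)) = F g" if g: "g \<in> carrier G" for g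
    proof -
      have "F (g \<otimes> x \<otimes> d) = F (g \<otimes> x)" using Dc(2)[OF d] g x by simp
      then have "F (g \<otimes> x \<otimes> d \<otimes> inv x) = F (g \<otimes> x \<otimes> inv x)" using Dc(1)[OF d] g x by (intro cong) auto
      then show ?thesis using g x Dc(1)[OF d] by (simp add: m_assoc)
    qed
    then show "x \<otimes> d \<otimes> inv x \<in> D" using x Dc(1)[OF d] by (auto simp: D_def)
  qed
  have ND: "N = K \<inter> D"
  proof
    show "N \<subseteq> K \<inter> D"
    proof
      fix x assume x: "x \<in> N"
      then have k: "x \<in> K" "f x = \<one>\<^bsub>M\<^esub>" by (auto simp: N_iff)
      have "F (g \<otimes> x) = F g" if "g \<in> carrier G" for g
        using F_mult[OF that k(1)] F_closed[OF that] M k(2) unfolding is_loop_def by auto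
      then show "x \<in> K \<inter> D" using k by (auto simp: D_def)
    qed
    show "K \<inter> D \<subseteq> N"
    proof
      fix x assume x: "x \<in> K \<inter> D"
      then have "F (\<one> \<otimes> x) = F \<one>" using Dc(2) by blast
      then show "x \<in> N" using x F_K one_in_K f_one by (simp add: N_iff)
    qed
  qed
  show thesis
  proof (rule that[OF nor ND])
    fix h d assume h: "h \<in> H" and d: "d \<in> D" and k: "h \<otimes> d \<in> K"
    have "F (h \<otimes> d) = F h" using Dc(2)[OF d] h by simp
    also have "F h = \<one>\<^bsub>M\<^esub>" using h by (simp add: F_def rep_H f_one)
    finally show "h \<otimes> d \<in> N" using F_K[OF k] k by (simp add: N_iff)
  next
    fix d assume d: "d \<in> D"
    have dc: "d \<in> carrier G" using Dc(1)[OF d] .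
    have "F (\<one> \<otimes> d) = F \<one>" using Dc(2)[OF d] by blast
    then have "f (rep d) = \<one>\<^bsub>M\<^esub>" using dc f_one one_in_K by (simp add: F_def)
    then have "rep d \<in> N" using rep[OF dc] by (simp add: N_iff)
    moreover have "inv (rep d \<otimes> inv d) \<in> H" using rep_mem[OF dc] subgroup.m_inv_closed[OF H_subgroup] by simp
    moreover have "d = inv (rep d \<otimes> inv d) \<otimes> rep d" using dc rep[OF dc] by (simp add: inv_mult_group m_assoc)
    ultimately show "\<exists>h\<in>H. \<exists>n\<in>N. d = h \<otimes> n" by blast
  next
    fix n y assume n: "n \<in> N" and y: "y \<in> K"
    have nk: "n \<in> K" using n by (simp add: N_iff)
    have ny: "n \<otimes> y \<in> carrier G" using nk y by simp
    \<comment> \<open>The loop product of n and y has the same image as y, so the quotient z y^-1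
      preserves all fibres of \<open>F\<close>.\<close>
    let ?z = "rep (n \<otimes> y)"
    have z: "?z \<in> K" using rep[OF ny] by simp
    have fz: "f ?z = f y" using f_mult[OF nk y] n M f_closed[OF y] unfolding N_iff is_loop_def by auto
    have "?z \<otimes> inv y \<in> D"
      unfolding D_def
    proof (intro CollectI conjI ballI)
      show "?z \<otimes> inv y \<in> carrier G" using z y by simp
      fix g assume g: "g \<in> carrier G"
      have "F (g \<otimes> ?z) = F (g \<otimes> y)" using F_mult[OF g z] F_mult[OF g y] fz by simp
      then have "F (g \<otimes> ?z \<otimes> inv y) = F (g \<otimes> y \<otimes> inv y)" using g z y by (intro cong) auto
      then show "F (g \<otimes> (?z \<otimes> inv y)) = F g" using g z y by (simp add: m_assoc)
    qed
    moreover have "?z \<otimes> inv y \<otimes> y \<in> K" using z y by (simp add: m_assoc)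
    moreover have "?z \<otimes> inv y \<otimes> inv n \<in> H" using rep_mem[OF ny] z y nk by (simp add: inv_mult_group m_assoc)
    ultimately show "\<exists>d\<in>D. d \<otimes> y \<in> K \<and> d \<otimes> inv n \<in> H" by blast
  next
    fix y assume y: "y \<in> K" "y \<notin> N"
    have fin: "finite K" using finite_carrier K_subset finite_subset by blast
    \<comment> \<open>Right translation by y embeds \<open>N\<close> into the fibre through y, which
      is disjoint from \<open>N\<close>.\<close>
    have "(\<lambda>n. rep (n \<otimes> y)) ` N \<subseteq> K - N"
    proof (rule image_subsetI)
      fix n assume n: "n \<in> N"
      then have nk: "n \<in> K" by (simp add: N_iff)
      have "f (rep (n \<otimes> y)) = f y" using f_mult[OF nk y(1)] n M f_closed[OF y(1)] unfolding N_iff is_loop_def by auto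
      then show "rep (n \<otimes> y) \<in> K - N" using y nk rep by (simp add: N_iff)
    qed
    moreover have "inj_on (\<lambda>n. rep (n \<otimes> y)) N"
      by (rule inj_onI) (use rep_right_cancel y N_iff in blast)
    ultimately show "card N \<le> card (K - N)" using fin by (metis card_inj_on_le finite_Diff)
  qed
qed

end

section \<open>Bits, and the module N of vectors of even weight\<close>

abbreviation tr where "tr \<equiv> Transposition.transpose"

text \<open>Sums and products of bits stay in ring notation, so that the laws of commutative groups
  and rings keep applying to them.\<close>

declare add_bit_eq_xor [simp del] mult_bit_eq_and [simp del]

lemma all_bit: "(\<forall>x::bit. P x) \<longleftrightarrow> P 0 \<and> P 1"
  by (metis bit.exhaust)

lemma ex_bit: "(\<exists>x::bit. P x) \<longleftrightarrow> P 0 \<or> P 1"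
  by (metis bit.exhaust)

lemma bit_add_eq_0: "(x::bit) + y = 0 \<longleftrightarrow> x = y"
  by (cases x; cases y) simp_all

lemma mod5_simps: "(5::5) = 0" "(6::5) = 1" "(7::5) = 2" "(8::5) = 3" "(9::5) = 4" "(10::5) = 0" "(12::5) = 2" "(11::5) = 1" "(16::5) = 1"
  by simp_all

lemma fun_bit_add: "(f + g) x = f x + (g x :: bit)" "(0 :: 'x \<Rightarrow> bit) x = 0"
  by simp_all

lemma bit_fun_add_eq_0: "(f::'x \<Rightarrow> bit) + g = 0 \<longleftrightarrow> f = g"
  by (simp only: fun_eq_iff fun_bit_add bit_add_eq_0)

lemma add_comp: "(f + g) \<circ> p = (f \<circ> p) + (g \<circ> p)" for f g :: "'x \<Rightarrow> bit"
  by (simp add: fun_eq_iff)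

lemma zero_comp [simp]: "(0 :: 'x \<Rightarrow> bit) \<circ> p = 0"
  by (simp add: fun_eq_iff)

text \<open>The nonzero vectors of N have weight 2 (ten vectors \<open>pairv a b\<close>) or weight
  4 (five vectors \<open>covec a\<close>). These are the orbits of lengths 10 and 5.\<close>

definition pairv :: "nat \<Rightarrow> nat \<Rightarrow> nat \<Rightarrow> bit" where
  "pairv a b = (\<lambda>i. if i = a \<or> i = b then 1 else 0)"

definition covec :: "nat \<Rightarrow> nat \<Rightarrow> bit" where
  "covec a = (\<lambda>i. if i \<in> {1..5} \<and> i \<noteq> a then 1 else 0)"

lemma atLeastAtMost_1_5: "{1..5::nat} = {1, 2, 3, 4, 5}"
  by auto

lemma N_mod_iff: "n \<in> N_mod \<longleftrightarrow> (\<forall>i. i \<notin> {1..5} \<longrightarrow> n i = 0) \<and> n 1 + n 2 + n 3 + n 4 + n 5 = 0"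
  unfolding N_mod_def atLeastAtMost_1_5
  by (cases "n 1"; cases "n 2"; cases "n 3"; cases "n 4"; cases "n 5") simp_all

lemma N_mod_0 [simp]: "0 \<in> N_mod" by (simp add: N_mod_def)

lemma N_mod_add [simp]: "n \<in> N_mod \<Longrightarrow> m \<in> N_mod \<Longrightarrow> n + m \<in> N_mod"
  by (auto simp: N_mod_def sum.distrib)

lemma N_mod_comp: "n \<in> N_mod \<Longrightarrow> p permutes {1..5} \<Longrightarrow> n \<circ> p \<in> N_mod"
  unfolding N_mod_def using sum.permute[of p "{1..5}" n] by (auto simp: permutes_in_image permutes_not_in)

lemma pairv_in_N: "a \<in> {1..5} \<Longrightarrow> b \<in> {1..5} \<Longrightarrow> a \<noteq> b \<Longrightarrow> pairv a b \<in> N_mod"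
proof -
  assume "a \<in> {1..5}" "b \<in> {1..5}" "a \<noteq> b"
  moreover have "i \<in> {1..5} \<Longrightarrow> i = 1 \<or> i = 2 \<or> i = 3 \<or> i = 4 \<or> i = 5" for i :: nat by auto
  ultimately have "a = 1 \<or> a = 2 \<or> a = 3 \<or> a = 4 \<or> a = 5" "b = 1 \<or> b = 2 \<or> b = 3 \<or> b = 4 \<or> b = 5" "a \<noteq> b"
    by auto
  then have "pairv a b 1 + pairv a b 2 + pairv a b 3 + pairv a b 4 + pairv a b 5 = 0"
    by (elim disjE) (simp_all add: pairv_def)
  then show ?thesis using \<open>a \<in> {1..5}\<close> \<open>b \<in> {1..5}\<close> unfolding N_mod_iff by (auto simp: pairv_def)
qed

lemma covec_in_N: "a \<in> {1..5} \<Longrightarrow> covec a \<in> N_mod"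
proof -
  assume "a \<in> {1..5}"
  then have "a = 1 \<or> a = 2 \<or> a = 3 \<or> a = 4 \<or> a = 5" by auto
  then show ?thesis unfolding N_mod_iff by (elim disjE) (simp_all add: covec_def)
qed

text \<open>The vanishing sum makes the support a set of even size, and within five points a
  nonempty one has size 2 or 4.\<close>

lemma N_mod_forms:
  assumes "n \<in> N_mod" "n \<noteq> 0"
  shows "(\<exists>a\<in>{1..5}. \<exists>b\<in>{1..5}. a \<noteq> b \<and> n = pairv a b) \<or> (\<exists>a\<in>{1..5}. n = covec a)"
proof -
  define S where "S = {i\<in>{1..5}. n i = 1}"
  have n: "n = (\<lambda>i. if i \<in> S then 1 else 0)" using assms(1) by (auto simp: fun_eq_iff S_def N_mod_def)
  have fin: "finite S" "S \<subseteq> {1..5}" by (auto simp: S_def)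
  have "(\<Sum>i\<in>{1..5}. n i) = of_nat (card S)"
    unfolding n using fin by (simp add: sum.If_cases Int_absorb1)
  then have c: "of_nat (card S) = (0 :: bit)" using assms(1) by (simp add: N_mod_def)
  have "even (card S)"
  proof (rule ccontr)
    assume "odd (card S)"
    then obtain k where "card S = 2 * k + 1" by (rule oddE)
    then show False using c by simp
  qed
  moreover have "card S \<le> 5" using card_mono[OF _ fin(2)] by simp
  moreover have "S \<noteq> {}" using assms(2) n by (auto simp: fun_eq_iff)
  then have "card S \<noteq> 0" using fin by simp
  ultimately have "card S = 2 \<or> card S = 4" by presburger
  then show ?thesis
  proof
    assume "card S = 2"
    then obtain a b where "S = {a, b}" "a \<noteq> b" by (auto simp: card_2_iff)
    then have "n = pairv a b" "a \<in> {1..5}" "b \<in> {1..5}" using n fin by (auto simp: pairv_def fun_eq_iff)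
    then show ?thesis using \<open>a \<noteq> b\<close> by blast
  next
    assume "card S = 4"
    then have "card ({1..5} - S) = 1" using fin by (simp add: card_Diff_subset)
    then obtain a where a: "{1..5} - S = {a}" by (auto simp: card_1_singleton_iff)
    then have "i \<in> S \<longleftrightarrow> i \<in> {1..5} \<and> i \<noteq> a" for i using fin by blast
    then have "n = covec a" unfolding covec_def using n by (simp add: fun_eq_iff)
    then show ?thesis using a by blast
  qed
qed

text \<open>The coordinate at 1 is the sum of the other four, so n is the sum of the vectors
  \<open>pairv 1 a\<close> over the a > 1 in its support.\<close>

lemma N_mod_span:
  assumes "0 \<in> A" "\<And>u v. u \<in> A \<Longrightarrow> v \<in> A \<Longrightarrow> u + v \<in> A"
    and "\<And>a b. a \<in> {1..5} \<Longrightarrow> b \<in> {1..5} \<Longrightarrow> a \<noteq> b \<Longrightarrow> pairv a b \<in> A"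
  shows "N_mod \<subseteq> A"
proof
  fix n assume n: "n \<in> N_mod"
  define g where "g a = (if n a = 1 then pairv 1 a else 0)" for a
  have "g a \<in> A" if "a \<in> {2, 3, 4, 5}" for a using that assms by (auto simp: g_def)
  then have "g 2 + g 3 + g 4 + g 5 \<in> A" using assms(2) by simp
  moreover have "g 2 + g 3 + g 4 + g 5 = n"
  proof
    fix i
    have gi: "g a i = (if i = 1 \<or> i = a then n a else 0)" for a by (simp add: g_def pairv_def)
    have "n 1 = n 2 + n 3 + n 4 + n 5" using n unfolding N_mod_iff
      by (metis add.assoc bit_add_eq_0)
    moreover have "i \<notin> {1..5} \<Longrightarrow> n i = 0" using n by (simp add: N_mod_def)
    moreover have "i \<in> {1..5} \<Longrightarrow> i = 1 \<or> i = 2 \<or> i = 3 \<or> i = 4 \<or> i = 5" by auto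
    ultimately show "(g 2 + g 3 + g 4 + g 5) i = n i"
      unfolding fun_bit_add gi by (cases "i \<in> {1..5}") auto
  qed
  ultimately show "n \<in> A" by simp
qed

lemma finite_N_mod: "finite N_mod" and card_N_mod: "card N_mod = 16"
proof -
  \<comment> \<open>The coordinates at 2, 3, 4, 5 are arbitrary and determine the one at 1.\<close>
  let ?B = "{S. S \<subseteq> {2..5::nat}}"
  let ?f = "\<lambda>n. {i\<in>{2..5}. n i = 1}"
  have bb: "bij_betw ?f N_mod ?B"
  proof (rule bij_betwI')
    fix n m assume n: "n \<in> N_mod" and m: "m \<in> N_mod"
    show "?f n = ?f m \<longleftrightarrow> n = m"
    proof
      assume eq: "?f n = ?f m"
      have e: "n i = m i" if "i \<in> {2..5}" for i
      proof -
        have "i \<in> ?f n \<longleftrightarrow> i \<in> ?f m" using eq by simp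
        then show ?thesis using that by (cases "n i"; cases "m i") auto
      qed
      have "n 1 = n 2 + n 3 + n 4 + n 5" "m 1 = m 2 + m 3 + m 4 + m 5"
        using n m unfolding N_mod_iff by (metis add.assoc bit_add_eq_0)+
      then have "n 1 = m 1" using e by simp
      then have "n i = m i" for i
        using e[of i] n m unfolding N_mod_def by (cases "i \<in> {1..5}"; cases "i = 1") auto
      then show "n = m" by auto
    qed simp
  next
    fix S :: "nat set" assume S: "S \<in> ?B"
    define h where "h i = (if i \<in> S then 1 else 0 :: bit)" for i
    define n where "n i = (if i = 1 then h 2 + h 3 + h 4 + h 5 else h i)" for i
    have "h i = 0" if "i \<notin> {2..5}" for i using S that by (auto simp: h_def)
    then have "\<forall>i. i \<notin> {1..5} \<longrightarrow> n i = 0" by (simp add: n_def)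
    moreover have "n 1 + n 2 + n 3 + n 4 + n 5 = 0"
      by (cases "h 2"; cases "h 3"; cases "h 4"; cases "h 5") (simp_all add: n_def)
    ultimately have "n \<in> N_mod" unfolding N_mod_iff by simp
    moreover have "?f n = S" using S by (auto simp: n_def h_def)
    ultimately show "\<exists>n\<in>N_mod. S = ?f n" by blast
  qed auto
  have "card ?B = 16" using card_Pow[of "{2..5::nat}"] by (simp add: Pow_def)
  then show "card N_mod = 16" using bij_betw_same_card[OF bb] by simp
  show "finite N_mod" using bij_betw_finite[OF bb] by simp
qed

subsection \<open>Permutations of five points\<close>

definition cyc3 :: "nat \<Rightarrow> nat \<Rightarrow> nat \<Rightarrow> nat \<Rightarrow> nat" where
  "cyc3 a b c = tr a b \<circ> tr b c"

lemma cyc3_apply: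
  assumes "a \<noteq> b" "b \<noteq> c" "a \<noteq> c"
  shows "cyc3 a b c a = b" "cyc3 a b c b = c" "cyc3 a b c c = a" "d \<notin> {a, b, c} \<Longrightarrow> cyc3 a b c d = d"
  using assms by (auto simp: cyc3_def Transposition.transpose_def)

lemma cyc3_permutes: "a \<in> A \<Longrightarrow> b \<in> A \<Longrightarrow> c \<in> A \<Longrightarrow> cyc3 a b c permutes A"
  unfolding cyc3_def by (intro permutes_compose permutes_swap_id)

lemma permutation_1_5: "p permutes {1..5::nat} \<Longrightarrow> permutation p"
  by (auto simp: permutation_permutes)

lemma evenperm_compose_1_5:
  "p permutes {1..5::nat} \<Longrightarrow> q permutes {1..5} \<Longrightarrow> evenperm (p \<circ> q) \<longleftrightarrow> evenperm p = evenperm q"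
  by (simp add: evenperm_comp permutation_1_5)

lemma evenperm_cyc3: "a \<noteq> b \<Longrightarrow> b \<noteq> c \<Longrightarrow> evenperm (cyc3 a b c)"
  unfolding cyc3_def by (simp add: evenperm_comp permutation_swap_id evenperm_swap)

lemma cyc3_cube:
  assumes "a \<noteq> b" "b \<noteq> c" "a \<noteq> c"
  shows "cyc3 a b c \<circ> cyc3 a b c \<circ> cyc3 a b c = id"
  using assms by (auto simp: fun_eq_iff cyc3_def Transposition.transpose_def)

text \<open>At a fixed point of the cycle the three summands agree, and 3 = 1 in characteristic
  2.\<close>

lemma fun_add3_cyc3:
  fixes n :: "nat \<Rightarrow> bit"
  assumes "a \<noteq> b" "b \<noteq> c" "a \<noteq> c" "d \<notin> {a, b, c}"
  shows "(n + (n \<circ> cyc3 a b c) + (n \<circ> cyc3 a b c \<circ> cyc3 a b c)) d = n d"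
  using cyc3_apply(4)[OF assms] by simp

text \<open>Every point is fixed by some three-cycle, and there 1 + x + x^2 acts as the identity.
  This is how the final argument gets from the norms of a vector back to the vector.\<close>

lemma N_mod_eq_0_if_killed:
  assumes n: "n \<in> N_mod"
    and k: "\<And>a b c. a \<in> {1..5} \<Longrightarrow> b \<in> {1..5} \<Longrightarrow> c \<in> {1..5} \<Longrightarrow> a \<noteq> b \<Longrightarrow> b \<noteq> c \<Longrightarrow> a \<noteq> c \<Longrightarrow>
      n + (n \<circ> cyc3 a b c) + (n \<circ> cyc3 a b c \<circ> cyc3 a b c) = 0"
  shows "n = 0"
proof -
  have *: "n d = 0" if "a \<in> {1..5}" "b \<in> {1..5}" "c \<in> {1..5}" "a \<noteq> b" "b \<noteq> c" "a \<noteq> c" "d \<notin> {a, b, c}" for a b c d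
  proof -
    have e: "n + (n \<circ> cyc3 a b c) + (n \<circ> cyc3 a b c \<circ> cyc3 a b c) = 0" using k that by blast
    have "(n + (n \<circ> cyc3 a b c) + (n \<circ> cyc3 a b c \<circ> cyc3 a b c)) d = n d"
      using that by (intro fun_add3_cyc3) auto
    then show ?thesis unfolding e by simp
  qed
  have "n 1 = 0" using *[of 3 4 5 1] by simp
  moreover have "n 2 = 0" using *[of 3 4 5 2] by simp
  moreover have "n 3 = 0" using *[of 1 2 4 3] by simp
  moreover have "n 4 = 0" using *[of 1 2 3 4] by simp
  moreover have "n 5 = 0" using *[of 1 2 3 5] by simp
  moreover have "i \<in> {1..5} \<Longrightarrow> i = 1 \<or> i = 2 \<or> i = 3 \<or> i = 4 \<or> i = 5" for i :: nat by auto
  ultimately have "n i = 0" for i using n unfolding N_mod_def by (cases "i \<in> {1..5}") auto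
  then show ?thesis by auto
qed

lemma ex_other_point:
  obtains c where "c \<in> {1..5::nat}" "c \<notin> {a1, a2, a3, a4}"
proof -
  have "card {a1, a2, a3, a4} \<le> 4" by (auto simp: card_insert_if)
  then have "\<not> {1..5} \<subseteq> {a1, a2, a3, a4}" using card_mono[of "{a1, a2, a3, a4}" "{1..5::nat}"] by auto
  then show thesis using that by blast
qed

text \<open>A permutation with the prescribed two values is made even, if necessary, by first
  swapping two points other than c and d.\<close>

lemma even_two_transitive:
  assumes "a \<in> {1..5}" "b \<in> {1..5}" "a \<noteq> b" "c \<in> {1..5}" "d \<in> {1..5}" "c \<noteq> d"
  shows "\<exists>p. p permutes {1..5::nat} \<and> evenperm p \<and> p c = a \<and> p d = b"
proof -
  define q where "q = tr (tr c a d) b \<circ> tr c a"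
  have m: "tr c a d \<in> {1..5}" using assms by (auto simp: Transposition.transpose_def)
  then have q: "q permutes {1..5}" unfolding q_def using assms by (intro permutes_compose permutes_swap_id)
  have qc: "q c = a" "q d = b" using assms by (auto simp: q_def Transposition.transpose_def)
  obtain e where e: "e \<in> {1..5}" "e \<notin> {c, d}" using ex_other_point[of c d d d] by blast
  obtain f where f: "f \<in> {1..5}" "f \<notin> {c, d, e}" using ex_other_point[of c d e e] by blast
  let ?r = "q \<circ> tr e f"
  have r: "?r permutes {1..5}" "?r c = a" "?r d = b"
    using q e f qc by (auto intro!: permutes_compose permutes_swap_id simp: Transposition.transpose_def)
  have "evenperm q \<or> evenperm ?r"
    using evenperm_compose_1_5[OF q permutes_swap_id[OF e(1) f(1)]] e f by (auto simp: evenperm_swap)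
  then show ?thesis using q qc r by blast
qed

text \<open>On five points an involution is a product of at most two disjoint transpositions, and
  with two factors it would be even.\<close>

lemma odd_involution_1_5:
  assumes p: "p permutes {1..5::nat}" and sq: "p \<circ> p = id" and odd: "\<not> evenperm p"
  shows "\<exists>a\<in>{1..5}. \<exists>b\<in>{1..5}. a \<noteq> b \<and> p = tr a b"
proof -
  have pp: "p (p x) = x" for x using sq by (metis comp_apply id_apply)
  have "p \<noteq> id" using odd by (auto simp: evenperm_id)
  then obtain a where a: "p a \<noteq> a" by (auto simp: fun_eq_iff)
  have a5: "a \<in> {1..5}" using a p by (auto simp: permutes_def)
  have b5: "p a \<in> {1..5}" using a5 permutes_in_image[OF p] by simp
  show ?thesis
  proof (cases "p = tr a (p a)")
    case True
    then show ?thesis using a a5 b5 by metis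
  next
    case False
    then obtain c where c: "p c \<noteq> tr a (p a) c" by auto
    then have cn: "c \<noteq> a" "c \<noteq> p a" "p c \<noteq> c" using pp by (auto simp: Transposition.transpose_def split: if_splits)
    have c5: "c \<in> {1..5}" using cn p by (auto simp: permutes_def)
    have d5: "p c \<in> {1..5}" using c5 permutes_in_image[OF p] by simp
    have dn: "p c \<noteq> a" "p c \<noteq> p a" using cn pp by metis+
    have card4: "card {a, p a, c, p c} = 4" using a cn dn by auto
    have "p = tr a (p a) \<circ> tr c (p c)"
    proof
      fix x
      show "p x = (tr a (p a) \<circ> tr c (p c)) x"
      proof (cases "x \<in> {a, p a, c, p c}")
        case True
        then show ?thesis using a cn dn pp by (auto simp: Transposition.transpose_def)
      next
        case x: False
        \<comment> \<open>A third moved pair would require six points.\<close>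
        have "p x = x"
        proof (rule ccontr)
          assume px: "p x \<noteq> x"
          then have x5: "x \<in> {1..5}" "p x \<in> {1..5}" using p permutes_in_image[OF p] by (auto simp: permutes_def)
          have "p x \<notin> {a, p a, c, p c, x}" using x px pp by (metis insertE singletonD insert_iff)
          then have "card {p x, x, a, p a, c, p c} = 6" using x card4 by (simp add: card_insert_if)
          moreover have "card {p x, x, a, p a, c, p c} \<le> card {1..5::nat}"
            using x5 a5 b5 c5 d5 by (intro card_mono) auto
          ultimately show False by simp
        qed
        then show ?thesis using x by (auto simp: Transposition.transpose_def)
      qed
    qed
    then have "evenperm p"
      using a cn by (metis evenperm_comp evenperm_swap permutation_swap_id)
    then show ?thesis using odd by simp
  qed
qed

subsection \<open>The module U\<close>

lemma U_act_id [simp]: "U_act u id = u"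
  by (simp add: U_act_def)

lemma U_act_comp:
  "p permutes {1..5} \<Longrightarrow> q permutes {1..5} \<Longrightarrow> U_act (U_act u p) q = U_act u (p \<circ> q)"
  by (auto simp: U_act_def evenperm_compose_1_5 comp_assoc)

lemma U_act_add: "U_act (u + v) p = U_act u p + U_act v p"
  by (simp add: U_act_def add_comp prod_eq_iff)

lemma U_act_0 [simp]: "U_act 0 p = 0"
  by (simp add: U_act_def prod_eq_iff)

lemma U_add_self [simp]: "(u :: U_elt) + u = 0"
  by (simp add: prod_eq_iff)

lemma U_mod_act: "u \<in> U_mod \<Longrightarrow> p permutes {1..5} \<Longrightarrow> U_act u p \<in> U_mod"
  by (auto simp: U_mod_def U_act_def N_mod_comp)

lemma W_mod_act: "u \<in> W_mod \<Longrightarrow> p permutes {1..5} \<Longrightarrow> U_act u p \<in> W_mod"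
  by (auto simp: W_mod_def U_act_def N_mod_comp)

lemma U_mod_0: "0 \<in> U_mod" and W_mod_0: "0 \<in> W_mod"
  by (auto simp: U_mod_def W_mod_def zero_prod_def)

lemma U_mod_add: "u \<in> U_mod \<Longrightarrow> v \<in> U_mod \<Longrightarrow> u + v \<in> U_mod"
  by (auto simp: U_mod_def)

lemma W_mod_add: "u \<in> W_mod \<Longrightarrow> v \<in> W_mod \<Longrightarrow> u + v \<in> W_mod"
  by (auto simp: W_mod_def)

lemma W_sub_U: "W_mod \<subseteq> U_mod"
  by (auto simp: W_mod_def U_mod_def)

lemma finite_U_mod: "finite U_mod" and card_U_mod: "card U_mod = 256"
  by (simp_all add: U_mod_def finite_N_mod card_N_mod card_cartesian_product)

lemma card_W_mod: "card W_mod = 16"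
proof -
  have "W_mod = (\<lambda>u. (u, u)) ` N_mod" by (auto simp: W_mod_def)
  moreover have "card ((\<lambda>u. (u, u)) ` N_mod) = 16"
    by (subst card_image) (auto simp: inj_on_def card_N_mod)
  ultimately show ?thesis by metis
qed

lemma covec_comp:
  assumes "p permutes {1..5}" shows "covec (p b) \<circ> p = covec b"
proof
  fix x
  have "p x \<in> {1..5} \<longleftrightarrow> x \<in> {1..5}" by (rule permutes_in_image[OF assms])
  moreover have "p x = p b \<longleftrightarrow> x = b" using permutes_inj[OF assms] by (auto dest: injD)
  ultimately show "(covec (p b) \<circ> p) x = covec b x" by (simp only: covec_def comp_apply)
qed

lemma pairv_comp: "p permutes {1..5} \<Longrightarrow> pairv (p a) (p b) \<circ> p = pairv a b"
  by (auto simp: pairv_def fun_eq_iff permutes_inj inj_eq)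

lemma covec_inj: "a \<in> {1..5} \<Longrightarrow> b \<in> {1..5} \<Longrightarrow> covec a = covec b \<Longrightarrow> a = b"
  unfolding covec_def by (metis (mono_tags, lifting) zero_neq_one)

section \<open>Orbits of A5 and the set S\<close>

definition N_orbit :: "(nat \<Rightarrow> bit) \<Rightarrow> (nat \<Rightarrow> bit) set" where
  "N_orbit n = {n \<circ> p | p. p permutes {1..5} \<and> evenperm p}"

lemma A5_orbit_eq:
  "A5_orbit (n, n) = (\<lambda>n. (n, n)) ` N_orbit n" "A5_orbit (n, 0) = (\<lambda>n. (n, 0)) ` N_orbit n"
  "A5_orbit (0, n) = (\<lambda>n. (0, n)) ` N_orbit n"
  unfolding A5_orbit_def N_orbit_def alt_group_carrier by (auto simp: U_act_def)

lemma card_A5_orbit: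
  "card (A5_orbit (n, n)) = card (N_orbit n)" "card (A5_orbit (n, 0)) = card (N_orbit n)"
  "card (A5_orbit (0, n)) = card (N_orbit n)"
  unfolding A5_orbit_eq by (auto intro!: card_image simp: inj_on_def)

lemma card_N_orbit_covec:
  assumes "a \<in> {1..5}" shows "card (N_orbit (covec a)) = 5"
proof -
  have "N_orbit (covec a) = covec ` {1..5}"
  proof (intro equalityI subsetI)
    fix v assume "v \<in> N_orbit (covec a)"
    then obtain p where p: "p permutes {1..5}" "v = covec a \<circ> p" by (auto simp: N_orbit_def)
    obtain b where b: "p b = a" using p(1) by (metis permutes_def)
    then have "b \<in> {1..5}" using permutes_in_image[OF p(1), of b] assms by simp
    then show "v \<in> covec ` {1..5}" using covec_comp[OF p(1), of b] b p(2) by auto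
  next
    fix v assume "v \<in> covec ` {1..5}"
    then obtain b where b: "b \<in> {1..5}" "v = covec b" by auto
    obtain a' where a': "a' \<in> {1..5}" "a' \<notin> {a}" using ex_other_point[of a a a a] by blast
    obtain b' where b': "b' \<in> {1..5}" "b' \<notin> {b}" using ex_other_point[of b b b b] by blast
    obtain p where "p permutes {1..5}" "evenperm p" "p b = a"
      using even_two_transitive[of a a' b b'] assms a' b b' by auto
    then have "v = covec a \<circ> p" "p permutes {1..5}" "evenperm p" using covec_comp[of p b] b by simp_all
    then show "v \<in> N_orbit (covec a)" unfolding N_orbit_def by blast
  qed
  moreover have "inj_on covec {1..5}" using covec_inj by (auto simp: inj_on_def)
  ultimately show ?thesis by (simp add: card_image)
qed

text \<open>The orbit consists of all ten pairs by double transitivity. Exhibiting six of them is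
  enough to exclude the length 5.\<close>

lemma card_N_orbit_pairv:
  assumes "a \<in> {1..5}" "b \<in> {1..5}" "a \<noteq> b" shows "card (N_orbit (pairv a b)) \<noteq> 5"
proof -
  have mem: "pairv c d \<in> N_orbit (pairv a b)" if cd: "c \<in> {1..5}" "d \<in> {1..5}" "c \<noteq> d" for c d
  proof -
    obtain p where "p permutes {1..5}" "evenperm p" "p c = a" "p d = b"
      using even_two_transitive[OF assms cd] by auto
    then have "pairv c d = pairv a b \<circ> p" "p permutes {1..5}" "evenperm p" using pairv_comp[of p c d] by simp_all
    then show ?thesis unfolding N_orbit_def by blast
  qed
  have supp: "{i. pairv c d i = 1} = {c, d}" for c d by (auto simp: pairv_def)
  let ?S = "{{1,2}, {1,3}, {1,4}, {1,5}, {2,3}, {2,4::nat}}"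
  have "?S \<subseteq> (\<lambda>n. {i. n i = 1}) ` N_orbit (pairv a b)"
    using mem[of 1 2] mem[of 1 3] mem[of 1 4] mem[of 1 5] mem[of 2 3] mem[of 2 4]
    by (auto simp: supp[symmetric])
  moreover have fin: "finite (N_orbit (pairv a b))"
  proof (rule finite_subset[OF _ finite_N_mod])
    show "N_orbit (pairv a b) \<subseteq> N_mod" using N_mod_comp pairv_in_N[OF assms] by (auto simp: N_orbit_def)
  qed
  ultimately have "card ?S \<le> card (N_orbit (pairv a b))" by (metis surj_card_le)
  moreover have "card ?S = 6" by (simp add: card_insert_if doubleton_eq_iff)
  ultimately show ?thesis by simp
qed

text \<open>Orbits of length 5 are exactly those of the vectors of weight 4. The explicit form shows
  |S| = 1 + 5 * 3 = 16, the index of \<open>T1\<close> in U.\<close>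

lemma S_set_eq: "S_set = {0} \<union> (\<Union>a\<in>{1..5}. {(covec a, covec a), (covec a, 0), (0, covec a)})"
proof -
  have key: "card (N_orbit n) = 5 \<longleftrightarrow> (\<exists>a\<in>{1..5}. n = covec a)" if "n \<in> N_mod" for n
  proof (cases "n = 0")
    case True
    have "N_orbit 0 \<subseteq> {0}" by (auto simp: N_orbit_def)
    then have "card (N_orbit 0) \<le> 1" using card_mono[of "{0}" "N_orbit 0"] by simp
    moreover have "\<nexists>a. a \<in> {1..5} \<and> 0 = covec a"
    proof
      assume "\<exists>a. a \<in> {1..5} \<and> 0 = covec a"
      then obtain a where "covec a 1 = 0" "covec a 2 = 0" by (metis zero_fun_apply)
      then show False by (auto simp: covec_def split: if_splits)
    qed
    ultimately show ?thesis using True by auto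
  next
    case False
    have "pairv a b \<noteq> covec c" if "a \<in> {1..5}" "b \<in> {1..5}" "a \<noteq> b" "c \<in> {1..5}" for a b c
      using card_N_orbit_pairv[of a b] card_N_orbit_covec[of c] that by auto
    then show ?thesis using N_mod_forms[OF that False] card_N_orbit_covec card_N_orbit_pairv by metis
  qed
  have "u \<in> S_set \<longleftrightarrow> u = 0 \<or> (\<exists>n\<in>N_mod. card (N_orbit n) = 5 \<and> (u = (n, n) \<or> u = (n, 0) \<or> u = (0, n)))" for u
    unfolding S_set_def W_mod_def U1_mod_def U2_mod_def by (auto simp: card_A5_orbit)
  then show ?thesis using key covec_in_N by (auto simp: set_eq_iff)
qed

subsection \<open>Submodules for a Frobenius group of order 20\<close>

lemma mod5_neqs: "(0::5) \<noteq> 1" "(0::5) \<noteq> 2" "(0::5) \<noteq> 3" "(0::5) \<noteq> 4" "(1::5) \<noteq> 0" "(1::5) \<noteq> 2" "(1::5) \<noteq> 3" "(1::5) \<noteq> 4" "(2::5) \<noteq> 0" "(2::5) \<noteq> 1" "(2::5) \<noteq> 3" "(2::5) \<noteq> 4" "(3::5) \<noteq> 0" "(3::5) \<noteq> 1" "(3::5) \<noteq> 2" "(3::5) \<noteq> 4" "(4::5) \<noteq> 0" "(4::5) \<noteq> 1" "(4::5) \<noteq> 2" "(4::5) \<noteq> 3"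
  by simp_all

lemma mod5_negs: "- 1 = (4::5)" "- 2 = (3::5)" "- 3 = (2::5)" "- 4 = (1::5)"
  unfolding neg_eq_iff_add_eq_0 by simp_all

lemma mod5_adds: "0 + 1 = (1::5)" "0 + 4 = (4::5)" "1 + 1 = (2::5)" "1 + 4 = (0::5)" "2 + 1 = (3::5)" "2 + 4 = (1::5)" "3 + 1 = (4::5)" "3 + 4 = (2::5)" "4 + 1 = (0::5)" "4 + 4 = (3::5)"
  by simp_all

text \<open>A labelling \<open>lab\<close> identifies the five points with the residues modulo 5, in
  such a way that F20 acts by maps j -> a j + b.\<close>

lemma lab_surj:
  assumes "bij_betw lab (UNIV :: 5 set) {1..5::nat}" "a \<in> {1..5}"
  obtains i where "a = lab i"
  using assms unfolding bij_betw_def by blast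

lemma lab_in: "bij_betw lab (UNIV :: 5 set) {1..5::nat} \<Longrightarrow> lab i \<in> {1..5}"
  unfolding bij_betw_def by blast

lemma lab_inj: "bij_betw lab (UNIV :: 5 set) {1..5::nat} \<Longrightarrow> lab i = lab j \<longleftrightarrow> i = j"
  unfolding bij_betw_def inj_on_def by blast

lemma N_lab_eqI:
  assumes "bij_betw lab (UNIV :: 5 set) {1..5}" "n \<in> N_mod" "m \<in> N_mod" "\<And>j. n (lab j) = m (lab j)"
  shows "n = m"
proof
  fix i show "n i = m i"
  proof (cases "i \<in> {1..5}")
    case True
    then show ?thesis using lab_surj[OF assms(1)] assms(4) by metis
  next
    case False
    then show ?thesis using assms(2,3) unfolding N_mod_def by simp
  qed
qed

lemma N_lab_sum:
  assumes "bij_betw lab (UNIV :: 5 set) {1..5}" "n \<in> N_mod"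
  shows "n (lab 4) = n (lab 0) + n (lab 1) + n (lab 2) + n (lab 3)"
proof -
  have "(\<Sum>j\<in>UNIV. n (lab j)) = (\<Sum>i\<in>{1..5}. n i)"
    using sum.reindex_bij_betw[OF assms(1)] by simp
  then have "(\<Sum>j\<in>UNIV. n (lab j)) = 0" using assms(2) by (simp add: N_mod_def)
  then have "n (lab 0) + n (lab 1) + n (lab 2) + n (lab 3) + n (lab 4) = 0"
    unfolding UNIV_mod5 by (simp add: add.assoc)
  then show ?thesis by (metis bit_add_eq_0)
qed

lemma bij_lab_affine:
  assumes "bij_betw lab (UNIV :: 5 set) {1..5::nat}" "e \<noteq> 0"
  shows "bij_betw (\<lambda>j. lab (e * j + r)) UNIV {1..5}"
proof -
  obtain d where d: "e * d = 1" using mod5_unit[OF assms(2)] by blast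
  have "bij (\<lambda>j. e * j + r)"
  proof (rule bij_betw_byWitness[where f' = "\<lambda>j. d * (j - r)"])
    show "\<forall>a\<in>UNIV. d * (e * a + r - r) = a" using d by (simp add: mult.assoc[symmetric] mult.commute[of d e])
    show "\<forall>a\<in>UNIV. e * (d * (a - r)) + r = a" using d by (simp add: mult.assoc[symmetric])
  qed auto
  from bij_betw_trans[OF this assms(1)] show ?thesis by (simp add: comp_def)
qed

text \<open>\<open>T\<close> is the graph of multiplication by the cube root of unity \<open>x + x\<^sup>-\<^sup>1\<close> in \<open>F\<^sub>2[x]/(1 + x + \<dots> + x\<^sup>4)\<close>,
  identified with the module \<open>N\<close> through the labelling of the five points.\<close>

definition omega_graph :: "(5 \<Rightarrow> nat) \<Rightarrow> U_elt set \<Rightarrow> bool" where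
  "omega_graph lab T \<longleftrightarrow> bij_betw lab UNIV {1..5} \<and>
     (\<forall>n m. (n, m) \<in> T \<longleftrightarrow> n \<in> N_mod \<and> m \<in> N_mod \<and> (\<forall>j. m (lab j) = n (lab (j + 1)) + n (lab (j + 4))))"

text \<open>The element of the group ring of C5 over F_2 with coefficients g, applied to n, where
  the generator of C5 acts as y.\<close>

definition poly_act :: "(nat \<Rightarrow> nat) \<Rightarrow> (5 \<Rightarrow> bit) \<Rightarrow> (nat \<Rightarrow> bit) \<Rightarrow> nat \<Rightarrow> bit" where
  "poly_act y g n = (\<lambda>x. g 0 * n x + g 1 * n (y x) + g 2 * n (y (y x)) + g 3 * n (y (y (y x))) + g 4 * n (y (y (y (y x)))))"

text \<open>Since 1 + x + ... + x^4 is irreducible over F_2, N is a field with 16 elements under the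
  group ring, with unit (0, 1, 1, 1, 1). The lemma gives inverses; x0, ..., x3 and their sum are the
  five coordinates of a vector of N.\<close>

lemma unit_multiplier:
  "\<forall>x0 x1 x2 x3::bit. x0 = 0 \<and> x1 = 0 \<and> x2 = 0 \<and> x3 = 0 \<or>
    (\<exists>g0 g1 g2 g3 g4.
      g0 * x0 + g1 * x1 + g2 * x2 + g3 * x3 + g4 * (x0 + x1 + x2 + x3) = 0 \<and>
      g0 * x1 + g1 * x2 + g2 * x3 + g3 * (x0 + x1 + x2 + x3) + g4 * x0 = 1 \<and>
      g0 * x2 + g1 * x3 + g2 * (x0 + x1 + x2 + x3) + g3 * x0 + g4 * x1 = 1 \<and>
      g0 * x3 + g1 * (x0 + x1 + x2 + x3) + g2 * x0 + g3 * x1 + g4 * x2 = 1 \<and>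
      g0 * (x0 + x1 + x2 + x3) + g1 * x0 + g2 * x1 + g3 * x2 + g4 * x3 = 1)"
  by (simp add: all_bit ex_bit)

text \<open>The equation \<open>m(x\<^sup>2) m(x) = 1\<close> in the field with 16 elements, that is \<open>m\<^sup>3 = 1\<close>.\<close>

lemma cube_roots:
  "\<forall>x0 x1 x2 x3::bit.
      x0 * x0 + x3 * x1 + x1 * x2 + (x0 + x1 + x2 + x3) * x3 + x2 * (x0 + x1 + x2 + x3) = 0 \<longrightarrow>
      x0 * x1 + x3 * x2 + x1 * x3 + (x0 + x1 + x2 + x3) * (x0 + x1 + x2 + x3) + x2 * x0 = 1 \<longrightarrow>
      x0 * x2 + x3 * x3 + x1 * (x0 + x1 + x2 + x3) + (x0 + x1 + x2 + x3) * x0 + x2 * x1 = 1 \<longrightarrow>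
      x0 * x3 + x3 * (x0 + x1 + x2 + x3) + x1 * x0 + (x0 + x1 + x2 + x3) * x1 + x2 * x2 = 1 \<longrightarrow>
      x0 * (x0 + x1 + x2 + x3) + x3 * x0 + x1 * x1 + (x0 + x1 + x2 + x3) * x2 + x2 * x3 = 1 \<longrightarrow>
      x0 = 0 \<and> (x1 = 1 \<and> x2 = 1 \<and> x3 = 1 \<or> x1 = 1 \<and> x2 = 0 \<and> x3 = 0 \<or> x1 = 0 \<and> x2 = 1 \<and> x3 = 1)"
  by (simp add: all_bit)

text \<open>\<open>T\<close> meets 0 x N trivially, so it is the graph of a map commuting with C5,
  that is, of multiplication by some m in the field N. The element f swaps the two components and
  acts on N as a field automorphism; invariance under f says that m times its image is 1, which
  means m^3 = 1. The root m = 1 gives \<open>W_mod\<close>, and the two primitive roots are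
  exchanged by doubling the labels, whence the factor e.\<close>

lemma submodule_is_omega_graph:
  assumes lab: "bij_betw lab (UNIV :: 5 set) {1..5}"
    and y: "y permutes {1..5}" "\<And>j. y (lab j) = lab (j + 1)"
    and f: "f permutes {1..5}" "\<And>j. f (lab j) = lab (2 * j)"
    and T: "T \<subseteq> U_mod" "0 \<in> T" "\<And>u v. u \<in> T \<Longrightarrow> v \<in> T \<Longrightarrow> u + v \<in> T"
    and Ty: "\<And>n m. (n, m) \<in> T \<Longrightarrow> (n \<circ> y, m \<circ> y) \<in> T"
    and Tf: "\<And>n m. (n, m) \<in> T \<Longrightarrow> (m \<circ> f, n \<circ> f) \<in> T"
    and nontriv: "T \<noteq> {0}" "T \<noteq> U_mod" "T \<noteq> W_mod"
  shows "\<exists>e. e \<noteq> 0 \<and> omega_graph (\<lambda>j. lab (e * j)) T"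
proof -
  have TN: "n \<in> N_mod" "m \<in> N_mod" if "(n, m) \<in> T" for n m using that T(1) by (auto simp: U_mod_def)
  have act_lab: "poly_act y g n (lab j) = g 0 * n (lab j) + g 1 * n (lab (j + 1)) + g 2 * n (lab (j + 2))
      + g 3 * n (lab (j + 3)) + g 4 * n (lab (j + 4))" for g n j
    by (simp add: poly_act_def y(2) add.assoc)
  have act_T: "(poly_act y g n, poly_act y g m) \<in> T" if nm: "(n, m) \<in> T" for g n m
  proof -
    have sc: "((\<lambda>x. b * n x), (\<lambda>x. b * m x)) \<in> T" if "(n, m) \<in> T" for b n m
      using that T(2) by (cases b) (simp_all add: zero_prod_def zero_fun_def)
    define Y where "Y i = ((\<lambda>x. n ((y ^^ i) x)), (\<lambda>x. m ((y ^^ i) x)))" for i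
    have Y: "Y i \<in> T" for i
    proof (induction i)
      case (Suc i)
      then show ?case using Ty[of "\<lambda>x. n ((y ^^ i) x)" "\<lambda>x. m ((y ^^ i) x)"]
        by (simp add: Y_def comp_def funpow_swap1)
    qed (simp add: Y_def nm)
    define Z where "Z b i = ((\<lambda>x. b * n ((y ^^ i) x)), (\<lambda>x. b * m ((y ^^ i) x)))" for b i
    have Z: "Z b i \<in> T" for b i unfolding Z_def by (rule sc) (use Y[of i] in \<open>simp add: Y_def\<close>)
    have "Z (g 0) 0 + Z (g 1) 1 + Z (g 2) 2 + Z (g 3) 3 + Z (g 4) 4 \<in> T" by (intro T(3) Z)
    then show ?thesis by (simp add: Z_def poly_act_def plus_fun_def numeral_eq_Suc)
  qed
  have actN: "poly_act y g n \<in> N_mod" if "n \<in> N_mod" for g n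
  proof -
    have sc: "(\<lambda>x. b * n x) \<in> N_mod" if "n \<in> N_mod" for b n
      by (cases b) (use that N_mod_0 in \<open>simp_all add: zero_fun_def\<close>)
    have c: "n \<circ> y \<in> N_mod" "n \<circ> y \<circ> y \<in> N_mod" "n \<circ> y \<circ> y \<circ> y \<in> N_mod" "n \<circ> y \<circ> y \<circ> y \<circ> y \<in> N_mod"
      using that by (simp_all add: N_mod_comp[OF _ y(1)])
    have "(\<lambda>x. g 0 * n x) + (\<lambda>x. g 1 * (n \<circ> y) x) + (\<lambda>x. g 2 * (n \<circ> y \<circ> y) x) + (\<lambda>x. g 3 * (n \<circ> y \<circ> y \<circ> y) x)
       + (\<lambda>x. g 4 * (n \<circ> y \<circ> y \<circ> y \<circ> y) x) \<in> N_mod"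
      using c that by (intro N_mod_add sc)
    then show ?thesis by (simp add: poly_act_def plus_fun_def)
  qed
  \<comment> \<open>\<open>q\<close> is the unit of the field N: as a polynomial x + x^2 + x^3 + x^4
    = 1.\<close>
  define q where "q = covec (lab 0)"
  have qN: "q \<in> N_mod" unfolding q_def using lab_in[OF lab] covec_in_N by blast
  have q_lab: "q (lab j) = (if j = 0 then 0 else 1)" for j
    using lab_in[OF lab] by (simp add: q_def covec_def lab_inj[OF lab])
  have qf: "q \<circ> f = q"
  proof (rule N_lab_eqI[OF lab _ qN])
    show "q \<circ> f \<in> N_mod" by (rule N_mod_comp[OF qN f(1)])
    show "(q \<circ> f) (lab j) = q (lab j)" for j by (simp add: f(2) q_lab mod5_mult_eq_0)
  qed
  \<comment> \<open>With the labels negated, the action of \<open>gen n\<close> becomes convolution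
    with n, so it sends the unit \<open>q\<close> to n.\<close>
  define gen where "gen n j = n (lab (- j))" for n :: "nat \<Rightarrow> bit" and j :: 5
  have act_q: "poly_act y (gen n) q = n" if n: "n \<in> N_mod" for n
  proof (rule N_lab_eqI[OF lab actN[OF qN] n])
    have "\<forall>j. poly_act y (gen n) q (lab j) = n (lab j)"
      unfolding forall_mod5 act_lab q_lab gen_def using N_lab_sum[OF lab n]
      by (cases "n (lab 0)"; cases "n (lab 1)"; cases "n (lab 2)"; cases "n (lab 3)") (simp_all add: mod5_simps mod5_negs)
    then show "poly_act y (gen n) q (lab j) = n (lab j)" for j by blast
  qed
  have to_q: "\<exists>g. poly_act y g n = q" if n: "n \<in> N_mod" "n \<noteq> 0" for n
  proof -
    have nz: "\<not> (n (lab 0) = 0 \<and> n (lab 1) = 0 \<and> n (lab 2) = 0 \<and> n (lab 3) = 0)"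
    proof
      assume z: "n (lab 0) = 0 \<and> n (lab 1) = 0 \<and> n (lab 2) = 0 \<and> n (lab 3) = 0"
      then have "\<forall>j. n (lab j) = 0" unfolding forall_mod5 using N_lab_sum[OF lab n(1)] by simp
      then have "n = 0" using N_lab_eqI[OF lab n(1) N_mod_0] by simp
      then show False using n(2) by simp
    qed
    obtain g0 g1 g2 g3 g4 where g:
      "g0 * n (lab 0) + g1 * n (lab 1) + g2 * n (lab 2) + g3 * n (lab 3) + g4 * n (lab 4) = 0"
      "g0 * n (lab 1) + g1 * n (lab 2) + g2 * n (lab 3) + g3 * n (lab 4) + g4 * n (lab 0) = 1"
      "g0 * n (lab 2) + g1 * n (lab 3) + g2 * n (lab 4) + g3 * n (lab 0) + g4 * n (lab 1) = 1"
      "g0 * n (lab 3) + g1 * n (lab 4) + g2 * n (lab 0) + g3 * n (lab 1) + g4 * n (lab 2) = 1"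
      "g0 * n (lab 4) + g1 * n (lab 0) + g2 * n (lab 1) + g3 * n (lab 2) + g4 * n (lab 3) = 1"
      using unit_multiplier[rule_format, of "n (lab 0)" "n (lab 1)" "n (lab 2)" "n (lab 3)"] nz
      unfolding N_lab_sum[OF lab n(1), symmetric] by blast
    define g :: "5 \<Rightarrow> bit" where "g = (\<lambda>i. if i = 0 then g0 else if i = 1 then g1 else if i = 2 then g2 else if i = 3 then g3 else g4)"
    have gs: "g 0 = g0" "g 1 = g1" "g 2 = g2" "g 3 = g3" "g 4 = g4" by (simp_all add: g_def)
    have "\<forall>j. poly_act y g n (lab j) = q (lab j)"
      unfolding forall_mod5 act_lab q_lab gs using g by (simp add: mod5_simps mod5_negs)
    then have "poly_act y g n = q" by (intro N_lab_eqI[OF lab actN[OF n(1)] qN]) blast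
    then show ?thesis by blast
  qed
  have act0: "poly_act y g 0 = 0" for g by (simp add: poly_act_def fun_eq_iff)
  have from_q: "(n, poly_act y (gen n) m) \<in> T" if "(q, m) \<in> T" "n \<in> N_mod" for n m
    using act_T[OF that(1), of "gen n"] act_q[OF that(2)] by simp
  \<comment> \<open>A nonzero vector (0, m) can be scaled to (0, q) and swapped to (q, 0), and these
    two generate all of U.\<close>
  have no0: "m = 0" if m: "(0, m) \<in> T" for m
  proof (rule ccontr)
    assume "m \<noteq> 0"
    then obtain g where "poly_act y g m = q" using to_q TN[OF m] by blast
    then have 1: "(0, q) \<in> T" using act_T[OF m, of g] by (simp add: act0)
    then have 2: "(q, 0) \<in> T" using Tf[OF 1] by (simp add: qf)
    have "(n, m) \<in> T" if "n \<in> N_mod" "m \<in> N_mod" for n m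
    proof -
      have a: "(n, 0) \<in> T" using from_q[OF 2 that(1)] by (simp add: act0)
      have b: "(0, m) \<in> T" using act_T[OF 1, of "gen m"] act_q[OF that(2)] by (simp add: act0)
      show ?thesis using T(3)[OF a b] by simp
    qed
    then have "T = U_mod" using T(1) by (auto simp: U_mod_def)
    then show False using nontriv by simp
  qed
  obtain n0 m0 where nm0: "(n0, m0) \<in> T" "(n0, m0) \<noteq> 0"
  proof -
    obtain u where "u \<in> T" "u \<noteq> 0" using nontriv(1) T(2) by blast
    then show thesis using that[of "fst u" "snd u"] by simp
  qed
  have "n0 \<noteq> 0" using nm0 no0 by (auto simp: zero_prod_def)
  then obtain g where g: "poly_act y g n0 = q" using to_q TN nm0 by blast
  obtain m where m: "(q, m) \<in> T" using act_T[OF nm0(1), of g] g by auto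
  have mN: "m \<in> N_mod" using TN m by blast
  \<comment> \<open>Swapping (q, m) by f and comparing with the multiple of (q, m) having the same
    first component leaves a vector with first component 0.\<close>
  have mf: "(m \<circ> f, q) \<in> T" using Tf[OF m] by (simp add: qf)
  have "(m \<circ> f, poly_act y (gen (m \<circ> f)) m) \<in> T" by (rule from_q[OF m N_mod_comp[OF mN f(1)]])
  from T(3)[OF mf this] have "(0, q + poly_act y (gen (m \<circ> f)) m) \<in> T" by simp
  then have eq: "q = poly_act y (gen (m \<circ> f)) m" using no0 bit_fun_add_eq_0 by blast
  have eq': "\<forall>j. poly_act y (gen (m \<circ> f)) m (lab j) = (if j = 0 then 0 else 1)" using eq q_lab by metis
  have cases: "m (lab 0) = 0 \<and> (m (lab 1) = 1 \<and> m (lab 2) = 1 \<and> m (lab 3) = 1 \<or> m (lab 1) = 1 \<and> m (lab 2) = 0 \<and> m (lab 3) = 0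
      \<or> m (lab 1) = 0 \<and> m (lab 2) = 1 \<and> m (lab 3) = 1)"
  proof (rule cube_roots[rule_format])
  qed (use eq' in \<open>unfold forall_mod5 act_lab gen_def comp_def f(2) N_lab_sum[OF lab mN, symmetric]\<close>, simp_all add: mod5_simps mod5_negs)
  have m4: "m (lab 4) = m (lab 0) + m (lab 1) + m (lab 2) + m (lab 3)" by (rule N_lab_sum[OF lab mN])
  have graph: "(n, m') \<in> T \<longleftrightarrow> n \<in> N_mod \<and> m' \<in> N_mod \<and> (\<forall>j. m' (lab j) = poly_act y (gen n) m (lab j))" for n m'
  proof
    assume nm: "(n, m') \<in> T"
    then have "(n, poly_act y (gen n) m) \<in> T" using from_q[OF m] TN by blast
    from T(3)[OF nm this] have "(0, m' + poly_act y (gen n) m) \<in> T" by simp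
    then have "m' = poly_act y (gen n) m" using no0 bit_fun_add_eq_0 by blast
    then show "n \<in> N_mod \<and> m' \<in> N_mod \<and> (\<forall>j. m' (lab j) = poly_act y (gen n) m (lab j))" using TN[OF nm] by simp
  next
    assume a: "n \<in> N_mod \<and> m' \<in> N_mod \<and> (\<forall>j. m' (lab j) = poly_act y (gen n) m (lab j))"
    then have "m' = poly_act y (gen n) m" by (intro N_lab_eqI[OF lab _ actN[OF mN]]) auto
    then show "(n, m') \<in> T" using from_q[OF m] a by simp
  qed
  from cases show ?thesis
  proof (elim conjE disjE)
    assume a: "m (lab 0) = 0" "m (lab 1) = 1" "m (lab 2) = 1" "m (lab 3) = 1"
    then have "\<forall>j. m (lab j) = q (lab j)" unfolding forall_mod5 q_lab using m4 by simp
    then have "m = q" using N_lab_eqI[OF lab mN qN] by blast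
    then have "(n, m') \<in> T \<longleftrightarrow> n \<in> N_mod \<and> m' = n" for n m'
      using from_q[of q n] act_q[of n] graph[of n m'] m N_lab_eqI[OF lab, of m' n] by auto
    then have "T = W_mod" by (auto simp: W_mod_def)
    then show ?thesis using nontriv by simp
  next
    assume a: "m (lab 0) = 0" "m (lab 1) = 1" "m (lab 2) = 0" "m (lab 3) = 0"
    have "\<forall>j. poly_act y (gen n) m (lab j) = n (lab (j + 1)) + n (lab (j + 4))" for n
      unfolding forall_mod5 act_lab gen_def using a m4 by (simp add: mod5_simps mod5_negs add.commute)
    then have "omega_graph (\<lambda>j. lab (1 * j)) T" unfolding omega_graph_def graph using lab by simp
    then show ?thesis by (intro exI[of _ 1]) simp
  next
    assume a: "m (lab 0) = 0" "m (lab 1) = 0" "m (lab 2) = 1" "m (lab 3) = 1"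
    have p: "\<forall>j. poly_act y (gen n) m (lab j) = n (lab (j + 2)) + n (lab (j + 3))" for n
      unfolding forall_mod5 act_lab gen_def using a m4 by (simp add: mod5_simps mod5_negs add.commute)
    \<comment> \<open>Doubling the labels turns the neighbours at distance 1 and 4 into those at
      distance 2 and 8 = 3.\<close>
    have e: "(\<forall>j. m' (lab j) = n (lab (j + 2)) + n (lab (j + 3))) \<longleftrightarrow>
       (\<forall>j. m' (lab (2 * j)) = n (lab (2 * (j + 1))) + n (lab (2 * (j + 4))))" for n m' :: "nat \<Rightarrow> bit"
      unfolding forall_mod5 by (auto simp: mod5_simps)
    have g2: "(n, m') \<in> T \<longleftrightarrow> n \<in> N_mod \<and> m' \<in> N_mod \<and>
        (\<forall>j. m' (lab (2 * j)) = n (lab (2 * (j + 1))) + n (lab (2 * (j + 4))))" for n m'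
      unfolding graph e[symmetric] using p by simp
    have "bij_betw (\<lambda>j. lab (2 * j)) UNIV {1..5}" using bij_lab_affine[OF lab, of 2 0] by simp
    then have "omega_graph (\<lambda>j. lab (2 * j)) T" unfolding omega_graph_def using g2 by blast
    then show ?thesis by (intro exI[of _ 2]) simp
  qed
qed

text \<open>The defining relation is invariant under translation of the labels. This allows any
  chosen point to be given the label 0.\<close>

lemma omega_graph_shift:
  assumes "omega_graph lab T" shows "omega_graph (\<lambda>j. lab (j + r)) T"
proof -
  have lab: "bij_betw lab UNIV {1..5}" using assms by (simp add: omega_graph_def)
  have "(\<forall>j. m (lab j) = n (lab (j + 1)) + n (lab (j + 4))) \<longleftrightarrow>
      (\<forall>j. m (lab (j + r)) = n (lab (j + 1 + r)) + n (lab (j + 4 + r)))" for n m :: "nat \<Rightarrow> bit"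
  proof
    assume "\<forall>j. m (lab (j + r)) = n (lab (j + 1 + r)) + n (lab (j + 4 + r))"
    then have "m (lab (j - r + r)) = n (lab (j - r + 1 + r)) + n (lab (j - r + 4 + r))" for j by blast
    then show "\<forall>j. m (lab j) = n (lab (j + 1)) + n (lab (j + 4))" by (simp add: algebra_simps)
  qed (simp add: algebra_simps)
  then show ?thesis using assms bij_lab_affine[OF lab, of 1 r] by (simp add: omega_graph_def)
qed

section \<open>Intersections of an omega graph with W, with fixed vectors of transpositions and with
  sums from S\<close>

lemma omega_graph_lab: "omega_graph lab T \<Longrightarrow> bij_betw lab UNIV {1..5}"
  by (simp add: omega_graph_def)

lemma omega_graphD:
  assumes "omega_graph lab T" "(n, m) \<in> T"
  shows "n \<in> N_mod" "m \<in> N_mod" "\<And>j. m (lab j) = n (lab (j + 1)) + n (lab (j + 4))"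
  using assms by (auto simp: omega_graph_def)

lemma tr_lab:
  assumes "bij_betw lab (UNIV :: 5 set) {1..5::nat}"
  shows "tr (lab i) (lab j) (lab t) = lab (if t = i then j else if t = j then i else t)"
  by (simp add: Transposition.transpose_def lab_inj[OF assms])

lemma omega_graph_card:
  assumes "omega_graph lab T" shows "card T = 16"
proof -
  have lab: "bij_betw lab UNIV {1..5}" by (rule omega_graph_lab[OF assms])
  define w where "w n i = (if i \<in> {1..5} then n (lab (the_inv_into UNIV lab i + 1)) + n (lab (the_inv_into UNIV lab i + 4)) else 0)"
    for n :: "nat \<Rightarrow> bit" and i
  have inv: "the_inv_into UNIV lab (lab j) = j" for j
    using lab the_inv_into_f_f[of lab UNIV j] by (simp add: bij_betw_def)
  have wl: "w n (lab j) = n (lab (j + 1)) + n (lab (j + 4))" for n j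
    using lab_in[OF lab, of j] inv[of j] unfolding w_def by simp
  have wN: "w n \<in> N_mod" if "n \<in> N_mod" for n
  proof -
    have "(\<Sum>i\<in>{1..5}. w n i) = (\<Sum>j\<in>UNIV. w n (lab j))"
      using sum.reindex_bij_betw[OF lab] by metis
    also have "\<dots> = 0"
      unfolding wl UNIV_mod5 by (cases "n (lab 0)"; cases "n (lab 1)"; cases "n (lab 2)"; cases "n (lab 3)"; cases "n (lab 4)") (simp_all add: mod5_simps)
    finally show ?thesis by (simp add: N_mod_def w_def)
  qed
  have "T = (\<lambda>n. (n, w n)) ` N_mod"
  proof (intro equalityI subsetI)
    fix u assume u: "u \<in> T"
    obtain n m where nm: "u = (n, m)" by fastforce
    have "m = w n" using omega_graphD[OF assms u[unfolded nm]] wN wl by (intro N_lab_eqI[OF lab]) auto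
    then show "u \<in> (\<lambda>n. (n, w n)) ` N_mod" using nm omega_graphD[OF assms u[unfolded nm]] by auto
  next
    fix u assume "u \<in> (\<lambda>n. (n, w n)) ` N_mod"
    then show "u \<in> T" using assms wN wl by (auto simp: omega_graph_def)
  qed
  then show ?thesis using card_image[of "\<lambda>n. (n, w n)" N_mod] by (simp add: inj_on_def card_N_mod)
qed

text \<open>The equation \<omega> x = x for a vector of N, written in coordinates. It forces x = 0
  because \<omega> + 1 is nonzero in the field.\<close>

lemma diag_bits: "\<forall>x0 x1 x2 x3 x4::bit. x4 = x0 + x1 + x2 + x3 \<longrightarrow> x0 = x1 + x4 \<longrightarrow> x1 = x2 + x0 \<longrightarrow> x2 = x3 + x1 \<longrightarrow> x3 = x4 + x2 \<longrightarrow>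
    x0 = 0 \<and> x1 = 0 \<and> x2 = 0 \<and> x3 = 0 \<and> x4 = 0"
  by (simp add: all_bit)

text \<open>The equations saying that \<omega> x is x composed with the transposition of 0 and j,
  for j = 1, 2, 3, 4 in turn. Four of the five coordinates, together with the vanishing sum, already
  force x = 0.\<close>

lemma transposition_bits:
  "\<forall>x0 x1 x2 x3 x4::bit. x4 = x0 + x1 + x2 + x3 \<longrightarrow> x1 = x1 + x4 \<longrightarrow> x0 = x2 + x0 \<longrightarrow> x3 = x4 + x2 \<longrightarrow> x4 = x0 + x3 \<longrightarrow>
    x0 = 0 \<and> x1 = 0 \<and> x2 = 0 \<and> x3 = 0 \<and> x4 = 0"
  "\<forall>x0 x1 x2 x3 x4::bit. x4 = x0 + x1 + x2 + x3 \<longrightarrow> x2 = x1 + x4 \<longrightarrow> x1 = x2 + x0 \<longrightarrow> x0 = x3 + x1 \<longrightarrow> x3 = x4 + x2 \<longrightarrow>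
    x0 = 0 \<and> x1 = 0 \<and> x2 = 0 \<and> x3 = 0 \<and> x4 = 0"
  "\<forall>x0 x1 x2 x3 x4::bit. x4 = x0 + x1 + x2 + x3 \<longrightarrow> x3 = x1 + x4 \<longrightarrow> x1 = x2 + x0 \<longrightarrow> x2 = x3 + x1 \<longrightarrow> x0 = x4 + x2 \<longrightarrow>
    x0 = 0 \<and> x1 = 0 \<and> x2 = 0 \<and> x3 = 0 \<and> x4 = 0"
  "\<forall>x0 x1 x2 x3 x4::bit. x4 = x0 + x1 + x2 + x3 \<longrightarrow> x4 = x1 + x4 \<longrightarrow> x1 = x2 + x0 \<longrightarrow> x3 = x4 + x2 \<longrightarrow> x0 = x0 + x3 \<longrightarrow>
    x0 = 0 \<and> x1 = 0 \<and> x2 = 0 \<and> x3 = 0 \<and> x4 = 0"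
  by (simp_all add: all_bit)

lemma double_transposition_bits:
  "\<forall>x0 x1 x2 x3 x4::bit. x4 = x0 + x1 + x2 + x3 \<longrightarrow> x0 = x1 + x4 \<longrightarrow> x2 + x0 + (x0 + x3) = x1 + x4 \<longrightarrow> x1 = x4 \<and> x2 = x3"
  by (simp add: all_bit)

text \<open>The bits encode the vectors (\<alpha> v, \<beta> v) and (\<gamma> v', \<delta> v') of S,
  where v and v' are the weight 4 vectors missing the labels 0 and k. The second alternative covers
  two zero vectors written with different labels.\<close>

lemma separated_bits:
  "\<forall>\<alpha> \<beta> \<gamma> \<delta>::bit. \<forall>k::5.
     (\<forall>t::5. \<beta> * (if t = 0 then 0 else 1) + \<delta> * (if t = k then 0 else 1) =
      \<alpha> * (if t + 1 = 0 then 0 else 1) + \<gamma> * (if t + 1 = k then 0 else 1) + (\<alpha> * (if t + 4 = 0 then 0 else 1) + \<gamma> * (if t + 4 = k then 0 else 1)))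
     \<longrightarrow> k = 0 \<and> \<alpha> = \<gamma> \<and> \<beta> = \<delta> \<or> \<alpha> = 0 \<and> \<beta> = 0 \<and> \<gamma> = 0 \<and> \<delta> = 0"
  by (simp add: all_bit forall_mod5 mod5_simps)

lemma omega_graph_diag:
  assumes "omega_graph lab T" "(n, n) \<in> T" shows "n = 0"
proof -
  have lab: "bij_betw lab UNIV {1..5}" by (rule omega_graph_lab[OF assms(1)])
  note D = omega_graphD[OF assms]
  have "n (lab 0) = 0 \<and> n (lab 1) = 0 \<and> n (lab 2) = 0 \<and> n (lab 3) = 0 \<and> n (lab 4) = 0"
    by (rule diag_bits[rule_format, OF N_lab_sum[OF lab D(1)] D(3)[of 0, unfolded mod5_adds]
          D(3)[of 1, unfolded mod5_adds] D(3)[of 2, unfolded mod5_adds] D(3)[of 3, unfolded mod5_adds]])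
  then have "\<forall>j. n (lab j) = 0" unfolding forall_mod5 by simp
  then show ?thesis using N_lab_eqI[OF lab D(1) N_mod_0] by simp
qed

text \<open>The vectors (n, n \<circ> tr a b) are those of U fixed by the transposition. After a
  shift a has the label 0, and the four possible labels of b are checked separately.\<close>

lemma omega_graph_transposition:
  assumes T: "omega_graph lab T" and nm: "(n, n \<circ> tr a b) \<in> T" and ab: "a \<in> {1..5}" "b \<in> {1..5}" "a \<noteq> b"
  shows "n = 0"
proof -
  obtain r where r: "a = lab r" using lab_surj[OF omega_graph_lab[OF T] ab(1)] by blast
  define l where "l j = lab (j + r)" for j
  have G: "omega_graph l T" unfolding l_def by (rule omega_graph_shift[OF T])
  have lab: "bij_betw l UNIV {1..5}" by (rule omega_graph_lab[OF G])
  note D = omega_graphD[OF G nm]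
  obtain j where b: "b = l j" using lab_surj[OF lab ab(2)] by blast
  have a: "a = l 0" using r by (simp add: l_def)
  have "j \<noteq> 0" using a b ab by auto
  have e: "n (l (if t = 0 then j else if t = j then 0 else t)) = n (l (t + 1)) + n (l (t + 4))" for t
    using D(3) unfolding a b comp_def tr_lab[OF lab] by blast
  have e1: "n (l (if 1 = j then 0 else 1)) = n (l 2) + n (l 0)" and e2: "n (l (if 2 = j then 0 else 2)) = n (l 3) + n (l 1)"
    and e3: "n (l (if 3 = j then 0 else 3)) = n (l 4) + n (l 2)" and e4: "n (l (if 4 = j then 0 else 4)) = n (l 0) + n (l 3)"
    and e0: "n (l j) = n (l 1) + n (l 4)"
    using e[of 1] e[of 2] e[of 3] e[of 4] e[of 0] by (simp_all only: mod5_adds mod5_neqs if_False if_True refl)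
  note S = N_lab_sum[OF lab D(1)]
  have "n (l 0) = 0 \<and> n (l 1) = 0 \<and> n (l 2) = 0 \<and> n (l 3) = 0 \<and> n (l 4) = 0"
  proof (cases j rule: mod5_cases)
    case 2
    show ?thesis
      by (rule transposition_bits(1)[rule_format, OF S e0[simplified 2 mod5_neqs if_True if_False simp_thms]
          e1[simplified 2 mod5_neqs if_True if_False simp_thms]
          e3[simplified 2 mod5_neqs if_True if_False simp_thms]
          e4[simplified 2 mod5_neqs if_True if_False simp_thms]])
  next
    case 3
    show ?thesis
      by (rule transposition_bits(2)[rule_format, OF S e0[simplified 3 mod5_neqs if_True if_False simp_thms]
          e1[simplified 3 mod5_neqs if_True if_False simp_thms]
          e2[simplified 3 mod5_neqs if_True if_False simp_thms]
          e3[simplified 3 mod5_neqs if_True if_False simp_thms]])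
  next
    case 4
    show ?thesis
      by (rule transposition_bits(3)[rule_format, OF S e0[simplified 4 mod5_neqs if_True if_False simp_thms]
          e1[simplified 4 mod5_neqs if_True if_False simp_thms]
          e2[simplified 4 mod5_neqs if_True if_False simp_thms]
          e3[simplified 4 mod5_neqs if_True if_False simp_thms]])
  next
    case 5
    show ?thesis
      by (rule transposition_bits(4)[rule_format, OF S e0[simplified 5 mod5_neqs if_True if_False simp_thms]
          e1[simplified 5 mod5_neqs if_True if_False simp_thms]
          e3[simplified 5 mod5_neqs if_True if_False simp_thms]
          e4[simplified 5 mod5_neqs if_True if_False simp_thms]])
  qed (use \<open>j \<noteq> 0\<close> in simp)
  then have "\<forall>j. n (l j) = 0" unfolding forall_mod5 by simp
  then show ?thesis using N_lab_eqI[OF lab D(1) N_mod_0] by simp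
qed

text \<open>S is a union of five four-groups, one for each point, meeting in 0. The bits \<alpha>,
  \<beta> are coordinates in such a group.\<close>

lemma S_set_param:
  assumes lab: "bij_betw lab (UNIV :: 5 set) {1..5}" and "x \<in> S_set"
  obtains i \<alpha> \<beta> where "x = ((\<lambda>t. \<alpha> * covec (lab i) t), (\<lambda>t. \<beta> * covec (lab i) t))"
proof -
  from assms(2) consider "x = 0" | a where "a \<in> {1..5}" "x = (covec a, covec a) \<or> x = (covec a, 0) \<or> x = (0, covec a)"
    unfolding S_set_eq by auto
  then show thesis
  proof cases
    case 1
    then show thesis using that[of 0 _ 0] by (auto simp: zero_prod_def zero_fun_def)
  next
    case 2
    obtain i where i: "a = lab i" using lab_surj[OF lab 2(1)] by blast
    from 2(2) show thesis
      using that[of 1 i 1] that[of 1 i 0] that[of 0 i 1] unfolding i by (auto simp: zero_fun_def)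
  qed
qed

text \<open>The omega graph meets each of the five four-groups in S, and each sum of two different
  ones, only in 0. Shifting the labels moves the first group to the label 0, so that only k remains
  to be varied.\<close>

lemma S_set_separated:
  assumes T: "omega_graph lab T" and x: "x \<in> S_set" and z: "z \<in> S_set" and xz: "x + z \<in> T"
  shows "x = z"
proof -
  obtain r \<alpha> \<beta> where xr: "x = ((\<lambda>t. \<alpha> * covec (lab r) t), (\<lambda>t. \<beta> * covec (lab r) t))"
    using S_set_param[OF omega_graph_lab[OF T] x] by blast
  define l where "l j = lab (j + r)" for j
  have G: "omega_graph l T" unfolding l_def by (rule omega_graph_shift[OF T])
  have lab: "bij_betw l UNIV {1..5}" by (rule omega_graph_lab[OF G])
  have x0: "x = ((\<lambda>t. \<alpha> * covec (l 0) t), (\<lambda>t. \<beta> * covec (l 0) t))" using xr by (simp add: l_def)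
  obtain k \<gamma> \<delta> where zk: "z = ((\<lambda>t. \<gamma> * covec (l k) t), (\<lambda>t. \<delta> * covec (l k) t))"
    using S_set_param[OF lab z] by blast
  have cl: "covec (l i) (l t) = (if t = i then 0 else 1)" for i t
    using lab_in[OF lab] by (simp add: covec_def lab_inj[OF lab])
  have "((\<lambda>t. \<alpha> * covec (l 0) t + \<gamma> * covec (l k) t), (\<lambda>t. \<beta> * covec (l 0) t + \<delta> * covec (l k) t)) \<in> T"
    using xz unfolding x0 zk by (simp add: plus_fun_def)
  from omega_graphD(3)[OF G this] have e: "\<beta> * (if t = 0 then 0 else 1) + \<delta> * (if t = k then 0 else 1) =
      \<alpha> * (if t + 1 = 0 then 0 else 1) + \<gamma> * (if t + 1 = k then 0 else 1) + (\<alpha> * (if t + 4 = 0 then 0 else 1) + \<gamma> * (if t + 4 = k then 0 else 1))" for t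
    unfolding cl by blast
  have "k = 0 \<and> \<alpha> = \<gamma> \<and> \<beta> = \<delta> \<or> \<alpha> = 0 \<and> \<beta> = 0 \<and> \<gamma> = 0 \<and> \<delta> = 0"
    using e separated_bits by blast
  then show ?thesis unfolding x0 zk by auto
qed

section \<open>Affine maps of the five points\<close>

definition affine_on :: "(5 \<Rightarrow> nat) \<Rightarrow> (nat \<Rightarrow> nat) \<Rightarrow> bool" where
  "affine_on lab h \<longleftrightarrow> (\<exists>a b. a \<noteq> 0 \<and> (\<forall>j. h (lab j) = lab (a * j + b)))"

text \<open>If a j + b = j has two solutions modulo 5, then a = 1 and b = 0. Sharp double
  transitivity in this form replaces any list of the elements of F20.\<close>

lemma affine_on_two_fixed:
  assumes lab: "bij_betw lab (UNIV :: 5 set) {1..5}" and h: "affine_on lab h" "h permutes {1..5}"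
    and pq: "p \<in> {1..5}" "q \<in> {1..5}" "p \<noteq> q" "h p = p" "h q = q"
  shows "h = id"
proof -
  obtain a b where ab: "a \<noteq> 0" "\<And>j. h (lab j) = lab (a * j + b)" using h by (auto simp: affine_on_def)
  obtain i j where ij: "p = lab i" "q = lab j" using lab_surj[OF lab] pq by metis
  have e: "a * i + b = i" "a * j + b = j" "i \<noteq> j" using pq ij ab lab_inj[OF lab] by auto
  have "(a - 1) * (i - j) = (a * i + b - i) - (a * j + b - j)" by (simp add: algebra_simps)
  then have "a = 1" using e by (simp add: mod5_mult_eq_0)
  then have "b = 0" using e by simp
  show ?thesis
  proof
    fix x show "h x = id x"
    proof (cases "x \<in> {1..5}")
      case True
      then obtain t where "x = lab t" using lab_surj[OF lab] by blast
      then show ?thesis using ab \<open>a = 1\<close> \<open>b = 0\<close> by simp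
    qed (use h(2) permutes_not_in in fastforce)
  qed
qed

lemma affine_not_transposition:
  assumes lab: "bij_betw lab (UNIV :: 5 set) {1..5}" and ab: "a \<in> {1..5}" "b \<in> {1..5}" "a \<noteq> b"
  shows "\<not> affine_on lab (tr a b)"
proof
  assume h: "affine_on lab (tr a b)"
  obtain c where c: "c \<in> {1..5}" "c \<notin> {a, b, b, b}" using ex_other_point by metis
  obtain d where d: "d \<in> {1..5}" "d \<notin> {a, b, c, c}" using ex_other_point by metis
  have "tr a b = id" by (rule affine_on_two_fixed[OF lab h permutes_swap_id[OF ab(1,2)] c(1) d(1)]) (use c d in auto)
  then have "tr a b a = a" by simp
  then show False using ab by simp
qed

text \<open>Two transpositions with a common point move at most three points, so their product fixes
  two and would be the identity.\<close>

lemma affine_product_disjoint: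
  assumes lab: "bij_betw lab (UNIV :: 5 set) {1..5}" and h: "affine_on lab (tr a b \<circ> tr c d)"
    and ab: "a \<in> {1..5}" "b \<in> {1..5}" "a \<noteq> b" and cd: "c \<in> {1..5}" "d \<in> {1..5}" "c \<noteq> d"
    and ne: "tr a b \<noteq> tr c d"
  shows "{a, b} \<inter> {c, d} = {}"
proof (rule ccontr)
  assume "{a, b} \<inter> {c, d} \<noteq> {}"
  then obtain z where z: "{a, b, c, d} = {a, b, z}" by blast
  obtain e where e: "e \<in> {1..5}" "e \<notin> {a, b, z, z}" using ex_other_point by metis
  obtain f where f: "f \<in> {1..5}" "f \<notin> {a, b, z, e}" using ex_other_point by metis
  have ef: "e \<notin> {a, b, c, d}" "f \<notin> {a, b, c, d}" "e \<noteq> f" using e f unfolding z by auto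
  have "tr a b \<circ> tr c d permutes {1..5}" using ab cd by (intro permutes_compose permutes_swap_id)
  then have "tr a b \<circ> tr c d = id"
    by (rule affine_on_two_fixed[OF lab h _ e(1) f(1) ef(3)]) (use ef in auto)
  then have "tr a b \<circ> (tr a b \<circ> tr c d) = tr a b" by simp
  then show False using ne by (metis comp_assoc id_comp transpose_comp_involutory)
qed

text \<open>The vector in \<open>T\<close> is the U-part of a product of two conjugates of c over
  disjoint transpositions, and h is the image of that product. Its components t and t' have equal
  sums over every orbit of h, since they arise from n + m by permutations preserving these orbits.
  Together with t' = \<omega> t this makes t, and then t', invariant under h.\<close>

lemma omega_graph_double_transposition:
  assumes T: "omega_graph lab T" and h: "affine_on lab (tr a b \<circ> tr c d)"
    and ab: "a \<in> {1..5}" "b \<in> {1..5}" "a \<noteq> b" and cd: "c \<in> {1..5}" "d \<in> {1..5}" "c \<noteq> d"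
    and ne: "tr a b \<noteq> tr c d"
    and nm: "n \<in> N_mod" "m \<in> N_mod" "((n \<circ> (tr a b \<circ> tr c d)) + m, (n + m) \<circ> tr c d) \<in> T"
  shows "((n \<circ> (tr a b \<circ> tr c d)) + m) \<circ> (tr a b \<circ> tr c d) = (n \<circ> (tr a b \<circ> tr c d)) + m"
    and "((n + m) \<circ> tr c d) \<circ> (tr a b \<circ> tr c d) = (n + m) \<circ> tr c d"
proof -
  let ?h = "tr a b \<circ> tr c d"
  note lab0 = omega_graph_lab[OF T]
  have disj: "{a, b} \<inter> {c, d} = {}" by (rule affine_product_disjoint[OF lab0 h ab cd ne])
  obtain e where e: "e \<in> {1..5}" "e \<notin> {a, b, c, d}" using ex_other_point by metis
  obtain r where r: "e = lab r" using lab_surj[OF lab0 e(1)] by blast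
  define l where "l j = lab (j + r)" for j
  have G: "omega_graph l T" unfolding l_def by (rule omega_graph_shift[OF T])
  have lab: "bij_betw l UNIV {1..5}" by (rule omega_graph_lab[OF G])
  obtain \<alpha> \<beta> where h0: "\<And>j. ?h (lab j) = lab (\<alpha> * j + \<beta>)" using h unfolding affine_on_def by blast
  have "lab (\<alpha> * r + \<beta>) = lab r" using h0[of r] e unfolding r by simp
  then have rb: "\<alpha> * r + \<beta> = r" using lab_inj[OF lab0] by simp
  have hl: "?h (l j) = l (\<alpha> * j)" for j
  proof -
    have "\<alpha> * (j + r) + \<beta> = \<alpha> * j + (\<alpha> * r + \<beta>)" by (simp add: algebra_simps)
    then show ?thesis unfolding l_def h0 rb by simp
  qed
  obtain i i' k k' where lb: "a = l i" "b = l i'" "c = l k" "d = l k'"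
    using lab_surj[OF lab] ab cd by metis
  have e0: "e = l 0" using r by (simp add: l_def)
  have nz: "i \<noteq> 0" "k \<noteq> 0" using e lb e0 by auto
  have "?h a = b" "?h b = a" "?h c = d" using disj ab cd by (auto simp: Transposition.transpose_def)
  then have "l (\<alpha> * i) = l i'" "l (\<alpha> * i') = l i" "l (\<alpha> * k) = l k'" using hl lb by metis+
  then have al: "\<alpha> * i = i'" "\<alpha> * i' = i" "\<alpha> * k = k'" using lab_inj[OF lab] by simp_all
  have ik: "i \<noteq> i'" "k \<noteq> i" "k \<noteq> i'" using ab disj lb by auto
  \<comment> \<open>From \<alpha> i = i' and \<alpha> i' = i follows \<alpha>^2 = 1, and \<alpha> =
    1 is excluded by i \<noteq> i'. So h is negation of the labels, with orbits {0}, {1, 4}, {2,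
    3}.\<close>
  have a4: "\<alpha> = 4"
    using al(1,2) ik(1) nz(1)
    by (cases \<alpha> rule: mod5_cases; cases i rule: mod5_cases; simp add: mod5_simps; force)
  have "{tr a b, tr c d} = {tr (l 1) (l 4), tr (l 2) (l 3)} \<and> tr a b \<noteq> tr c d"
    using al(1,3) nz ik ne unfolding a4 lb
    by (cases i rule: mod5_cases; cases k rule: mod5_cases) (auto simp: mod5_simps transpose_commute)
  then have two: "tr a b = tr (l 1) (l 4) \<and> tr c d = tr (l 2) (l 3) \<or> tr a b = tr (l 2) (l 3) \<and> tr c d = tr (l 1) (l 4)"
    by (auto simp: doubleton_eq_iff)
  define t where "t = (n \<circ> ?h) + m"
  define t' where "t' = (n + m) \<circ> tr c d"
  have hN: "?h permutes {1..5}" using ab cd by (intro permutes_compose permutes_swap_id)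
  have tN: "t \<in> N_mod" "t' \<in> N_mod"
    unfolding t_def t'_def using N_mod_comp[OF nm(1) hN] nm N_mod_comp[OF _ permutes_swap_id[OF cd(1,2)]] by auto
  have D: "t' (l j) = t (l (j + 1)) + t (l (j + 4))" for j
    using omega_graphD(3)[OF G nm(3)] unfolding t_def t'_def by blast
  have hv: "?h (l j) = l (4 * j)" for j using hl a4 by simp
  have pair: "t' (l 0) = t (l 0)" "t' (l 1) + t' (l 4) = t (l 1) + t (l 4)" "t' (l 2) + t' (l 3) = t (l 2) + t (l 3)"
    using two unfolding t_def t'_def fun_bit_add comp_apply[of n] comp_apply[of "n + m"] hv
    by (auto simp: tr_lab[OF lab] mod5_simps ac_simps)
  have S: "t (l 4) = t (l 0) + t (l 1) + t (l 2) + t (l 3)" by (rule N_lab_sum[OF lab tN(1)])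
  have 1: "t (l 0) = t (l 1) + t (l 4)" "t' (l 1) = t (l 2) + t (l 0)" "t' (l 4) = t (l 0) + t (l 3)"
    using D[of 0] D[of 1] D[of 4] pair(1) by (simp_all add: mod5_simps)
  have sym: "t (l 1) = t (l 4) \<and> t (l 2) = t (l 3)"
    using pair(2) unfolding 1(2,3) by (intro double_transposition_bits[rule_format, OF S 1(1)])
  then have sym': "t' (l 1) = t' (l 4)" "t' (l 2) = t' (l 3)" using pair bit_add_eq_0 by metis+
  show "t \<circ> ?h = t"
  proof (rule N_lab_eqI[OF lab N_mod_comp[OF tN(1) hN] tN(1)])
    have "\<forall>j. (t \<circ> ?h) (l j) = t (l j)"
      unfolding comp_apply[of t] hv forall_mod5 using sym by (simp add: mod5_simps)
    then show "(t \<circ> ?h) (l j) = t (l j)" for j by blast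
  qed
  show "t' \<circ> ?h = t'"
  proof (rule N_lab_eqI[OF lab N_mod_comp[OF tN(2) hN] tN(2)])
    have "\<forall>j. (t' \<circ> ?h) (l j) = t' (l j)"
      unfolding comp_apply[of t'] hv forall_mod5 using sym' by (simp add: mod5_simps)
    then show "(t' \<circ> ?h) (l j) = t' (l j)" for j by blast
  qed
qed

subsection \<open>The group G\<close>

lemma tr_commute: "{a, b} \<inter> {c, d} = {} \<Longrightarrow> tr a b \<circ> tr c d = tr c d \<circ> tr a b"
  by (rule ext) (auto simp: Transposition.transpose_def)

lemma conjugacy_classI: "g \<in> carrier G \<Longrightarrow> inv\<^bsub>G\<^esub> g \<otimes>\<^bsub>G\<^esub> c \<otimes>\<^bsub>G\<^esub> g \<in> conjugacy_class G c"
  by (auto simp: conjugacy_class_def)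

text \<open>Here G acts on five points by \<open>t\<close> and on six by \<sigma>, both with kernel
  \<open>J\<close>, and \<open>E\<close> presents \<open>J\<close> as functions on six points modulo
  constants. The last assumption carries the information on SL(2,5): modulo \<open>J0\<close> an
  element of [G,G] with square 1 commutes with all of [G,G].\<close>

locale base_action = group G for G :: "('g, 'b) monoid_scheme" (structure) +
  fixes J :: "'g set" and X :: "'x set" and \<sigma> :: "'g \<Rightarrow> 'x \<Rightarrow> 'x" and E :: "('x \<Rightarrow> bit) \<Rightarrow> 'g"
    and t :: "'g \<Rightarrow> nat \<Rightarrow> nat" and J0 :: "'g set"
  assumes J_normal: "J \<lhd> G"
    and J_comm: "\<And>x y. x \<in> J \<Longrightarrow> y \<in> J \<Longrightarrow> x \<otimes> y = y \<otimes> x"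
    and J_sq: "\<And>x. x \<in> J \<Longrightarrow> x \<otimes> x = \<one>"
    and card_X: "card X = 6"
    and \<sigma>_permutes: "\<And>g. g \<in> carrier G \<Longrightarrow> \<sigma> g permutes X"
    and \<sigma>_mult: "\<And>g h. g \<in> carrier G \<Longrightarrow> h \<in> carrier G \<Longrightarrow> \<sigma> (g \<otimes> h) = \<sigma> g \<circ> \<sigma> h"
    and \<sigma>_J: "\<And>j. j \<in> J \<Longrightarrow> \<sigma> j = id"
    and \<sigma>_fix: "\<And>g. g \<in> carrier G \<Longrightarrow> g \<notin> J \<Longrightarrow> card {L \<in> X. \<sigma> g L = L} \<le> 2"
    and E_J: "\<And>f. lsupp X f \<Longrightarrow> E f \<in> J"
    and E_add: "\<And>f f'. lsupp X f \<Longrightarrow> lsupp X f' \<Longrightarrow> E (f + f') = E f \<otimes> E f'"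
    and E_surj: "\<And>j. j \<in> J \<Longrightarrow> \<exists>f. lsupp X f \<and> E f = j"
    and E_eq_one: "\<And>f. lsupp X f \<Longrightarrow> E f = \<one> \<longleftrightarrow> f = 0 \<or> f = (\<lambda>L. if L \<in> X then 1 else 0)"
    and E_act: "\<And>f g. lsupp X f \<Longrightarrow> g \<in> carrier G \<Longrightarrow> E (f \<circ> \<sigma> g) = inv g \<otimes> E f \<otimes> g"
    and t_permutes: "\<And>g. g \<in> carrier G \<Longrightarrow> t g permutes {1..5}"
    and t_mult: "\<And>g h. g \<in> carrier G \<Longrightarrow> h \<in> carrier G \<Longrightarrow> t (g \<otimes> h) = t g \<circ> t h"
    and t_surj: "\<And>p. p permutes {1..5} \<Longrightarrow> \<exists>g\<in>carrier G. t g = p"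
    and t_eq_id: "\<And>g. g \<in> carrier G \<Longrightarrow> t g = id \<longleftrightarrow> g \<in> J"
    and J0_def: "J0 = commutator_subgroup G (carrier G) J"
    and derived_involution: "\<And>a x. a \<in> derived G (carrier G) \<Longrightarrow> a \<otimes> a \<in> J0 \<Longrightarrow> x \<in> derived G (carrier G) \<Longrightarrow>
          a \<otimes> x \<otimes> inv a \<otimes> inv x \<in> J0"
begin

lemma J_subgroup: "subgroup J G" using J_normal normal_imp_subgroup by blast

lemma J_closed [simp]: "j \<in> J \<Longrightarrow> j \<in> carrier G"
  using subgroup.subset[OF J_subgroup] by blast

lemma J_mult: "x \<in> J \<Longrightarrow> y \<in> J \<Longrightarrow> x \<otimes> y \<in> J"
  using subgroup.m_closed[OF J_subgroup] by blast

lemma J_one: "\<one> \<in> J"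
  using subgroup.one_closed[OF J_subgroup] by blast

lemma J_inv: "j \<in> J \<Longrightarrow> inv j = j"
  using inv_equality[OF J_sq] by simp

lemma J_conj: "j \<in> J \<Longrightarrow> g \<in> carrier G \<Longrightarrow> inv g \<otimes> j \<otimes> g \<in> J"
  using J_normal by (rule normal.inv_op_closed1)

lemma finite_X: "finite X" using card_X card.infinite by fastforce

lemma t_one: "t \<one> = id" using t_eq_id J_one by simp

lemma t_inv: "g \<in> carrier G \<Longrightarrow> t (inv g) \<circ> t g = id" "g \<in> carrier G \<Longrightarrow> t g \<circ> t (inv g) = id"
  using t_mult[of "inv g" g] t_mult[of g "inv g"] t_one by simp_all

lemma t_eq_iff:
  assumes "g \<in> carrier G" "h \<in> carrier G"
  shows "t g = t h \<longleftrightarrow> inv g \<otimes> h \<in> J"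
proof -
  have "inv g \<otimes> h \<in> J \<longleftrightarrow> t (inv g) \<circ> t h = id"
    using t_eq_id[of "inv g \<otimes> h"] t_mult[of "inv g" h] assms by simp
  also have "\<dots> \<longleftrightarrow> t g = t h"
  proof
    assume "t (inv g) \<circ> t h = id"
    then have "t g \<circ> (t (inv g) \<circ> t h) = t g" by simp
    then show "t g = t h" using t_inv(2)[OF assms(1)] by (simp add: comp_assoc[symmetric])
  next
    assume "t g = t h"
    then show "t (inv g) \<circ> t h = id" using t_inv(1)[OF assms(1)] by simp
  qed
  finally show ?thesis by simp
qed

lemma \<sigma>_eqI:
  assumes "g \<in> carrier G" "h \<in> carrier G" "t g = t h"
  shows "\<sigma> g = \<sigma> h"
proof -
  have j: "inv g \<otimes> h \<in> J" using assms t_eq_iff by simp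
  have "\<sigma> (g \<otimes> (inv g \<otimes> h)) = \<sigma> g \<circ> \<sigma> (inv g \<otimes> h)" using assms by (intro \<sigma>_mult) auto
  moreover have "g \<otimes> (inv g \<otimes> h) = h" using assms by (simp add: m_assoc[symmetric])
  ultimately show ?thesis using \<sigma>_J[OF j] by simp
qed

lemma \<sigma>_in: "g \<in> carrier G \<Longrightarrow> \<sigma> g L \<in> X \<longleftrightarrow> L \<in> X"
  using permutes_in_image[OF \<sigma>_permutes] by simp

lemma \<sigma>_inj: "g \<in> carrier G \<Longrightarrow> \<sigma> g L = \<sigma> g M \<longleftrightarrow> L = M"
  using permutes_inj[OF \<sigma>_permutes] by (auto dest: injD)

lemma lsupp_comp: "lsupp X f \<Longrightarrow> g \<in> carrier G \<Longrightarrow> lsupp X (f \<circ> \<sigma> g)"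
  by (simp add: lsupp_def \<sigma>_in)

lemma lsupp_add: "lsupp X f \<Longrightarrow> lsupp X f' \<Longrightarrow> lsupp X (f + f')"
  by (simp add: lsupp_def)

lemma E_eq_iff:
  assumes "lsupp X f" "lsupp X f'"
  shows "E f = E f' \<longleftrightarrow> f = f' \<or> f + f' = (\<lambda>L. if L \<in> X then 1 else 0)"
proof -
  have "E f = E f' \<longleftrightarrow> E f \<otimes> E f' = \<one>"
    using J_sq[OF E_J[OF assms(2)]] E_J[OF assms(1)] E_J[OF assms(2)]
    by (metis J_closed right_cancel)
  also have "\<dots> \<longleftrightarrow> E (f + f') = \<one>" using E_add assms by simp
  also have "\<dots> \<longleftrightarrow> f + f' = 0 \<or> f + f' = (\<lambda>L. if L \<in> X then 1 else 0)" by (rule E_eq_one[OF lsupp_add[OF assms]])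
  finally show ?thesis by (simp only: bit_fun_add_eq_0)
qed

text \<open>A permutation of order 3 of the six points with at most two fixed points has none.\<close>

lemma three_cycle_fixed_free:
  assumes g: "g \<in> carrier G" and t3: "t g \<circ> t g \<circ> t g = id" and nid: "t g \<noteq> id" and L: "L \<in> X"
  shows "\<sigma> g L \<noteq> L" "\<sigma> g (\<sigma> g (\<sigma> g L)) = L"
proof -
  have gJ: "g \<notin> J" using t_eq_id g nid by simp
  have cube: "\<sigma> g (\<sigma> g (\<sigma> g L)) = L" for L
  proof -
    have "t (g \<otimes> g \<otimes> g) = t \<one>" using t3 g by (simp add: t_mult t_one)
    then have "\<sigma> (g \<otimes> g \<otimes> g) = \<sigma> \<one>" using \<sigma>_eqI g by simp
    then have "\<sigma> g \<circ> \<sigma> g \<circ> \<sigma> g = id" using \<sigma>_mult \<sigma>_J[OF J_one] g by simp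
    then show ?thesis by (metis comp_apply id_apply)
  qed
  show "\<sigma> g (\<sigma> g (\<sigma> g L)) = L" by (rule cube)
  have orb: "card {M, \<sigma> g M, \<sigma> g (\<sigma> g M)} = 3" if "\<sigma> g M \<noteq> M" for M
  proof -
    have "\<sigma> g (\<sigma> g M) \<noteq> M" using that cube by metis
    then show ?thesis using that \<sigma>_inj[OF g] by auto
  qed
  let ?F = "{L \<in> X. \<sigma> g L = L}"
  have F2: "card ?F \<le> 2" by (rule \<sigma>_fix[OF g gJ])
  show "\<sigma> g L \<noteq> L"
  proof
    assume fixed: "\<sigma> g L = L"
    \<comment> \<open>As at most two points are fixed, there is an orbit of length 3, and the three
      points outside it are not all fixed either. A second orbit of length 3 leaves no room for
      L.\<close>
    have "\<not> X \<subseteq> ?F" using card_mono[of ?F X] finite_X F2 card_X by auto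
    then obtain M where M: "M \<in> X" "\<sigma> g M \<noteq> M" by blast
    let ?O = "{M, \<sigma> g M, \<sigma> g (\<sigma> g M)}"
    have OX: "?O \<subseteq> X" using M g \<sigma>_in by auto
    have "card (X - ?O) = 3" using card_Diff_subset[of ?O X] OX orb[OF M(2)] card_X by simp
    then have "\<not> X - ?O \<subseteq> ?F" using card_mono[of ?F "X - ?O"] finite_X F2 by auto
    then obtain M' where M': "M' \<in> X - ?O" "\<sigma> g M' \<noteq> M'" by blast
    let ?O' = "{M', \<sigma> g M', \<sigma> g (\<sigma> g M')}"
    have disj: "?O \<inter> ?O' = {}" using M' cube \<sigma>_inj[OF g] by (auto; metis)
    have OX': "?O' \<subseteq> X" using M' g \<sigma>_in by auto
    have "card (?O \<union> ?O') = 6" using card_Un_disjoint[of ?O ?O'] disj orb[OF M(2)] orb[OF M'(2)] by simp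
    then have "?O \<union> ?O' = X" using OX OX' finite_X card_X by (intro card_subset_eq) auto
    then have "L \<in> ?O \<union> ?O'" using L by simp
    then show False using fixed M(2) M'(2) \<sigma>_inj[OF g] by auto
  qed
qed

text \<open>The three-cycle on the remaining points commutes with the transposition, so on six
  points it permutes the points fixed by g. It has no fixed point there, so one fixed point of g
  yields three, against the bound of two.\<close>

lemma transposition_fixed_free:
  assumes g: "g \<in> carrier G" and tg: "t g = tr a b" and ab: "a \<in> {1..5}" "b \<in> {1..5}" "a \<noteq> b" and L: "L \<in> X"
  shows "\<sigma> g L \<noteq> L"
proof
  assume fixed: "\<sigma> g L = L"
  have "t g a \<noteq> a" using tg ab by simp
  then have gJ: "g \<notin> J" using t_eq_id[OF g] by auto
  obtain c where c: "c \<in> {1..5}" "c \<notin> {a, b, b, b}" using ex_other_point by metis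
  obtain d where d: "d \<in> {1..5}" "d \<notin> {a, b, c, c}" using ex_other_point by metis
  obtain e where e: "e \<in> {1..5}" "e \<notin> {a, b, c, d}" using ex_other_point by metis
  have ne: "c \<noteq> d" "d \<noteq> e" "c \<noteq> e" using c d e by auto
  obtain x where x: "x \<in> carrier G" "t x = cyc3 c d e" using t_surj[OF cyc3_permutes[of c "{1..5}" d e]] c d e by blast
  have nid: "t x \<noteq> id" using x cyc3_apply(1)[OF ne] ne by (metis id_apply)
  have x3: "t x \<circ> t x \<circ> t x = id" unfolding x(2) by (rule cyc3_cube[OF ne])
  have "tr a b \<circ> cyc3 c d e = cyc3 c d e \<circ> tr a b"
  proof -
    have "tr a b \<circ> tr c d = tr c d \<circ> tr a b" "tr a b \<circ> tr d e = tr d e \<circ> tr a b"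
      using c d e by (intro tr_commute; auto)+
    then show ?thesis unfolding cyc3_def by (metis comp_assoc)
  qed
  then have "t (g \<otimes> x) = t (x \<otimes> g)" using g x tg by (simp add: t_mult)
  then have "\<sigma> (g \<otimes> x) = \<sigma> (x \<otimes> g)" using \<sigma>_eqI g x by simp
  then have comm: "\<sigma> g (\<sigma> x M) = \<sigma> x (\<sigma> g M)" for M using \<sigma>_mult g x by (metis comp_apply)
  let ?O = "{L, \<sigma> x L, \<sigma> x (\<sigma> x L)}"
  have "?O \<subseteq> {L \<in> X. \<sigma> g L = L}" using L fixed comm \<sigma>_in[OF x(1)] by auto
  moreover have "card ?O = 3"
  proof -
    have "\<sigma> x L \<noteq> L" "\<sigma> x (\<sigma> x L) \<noteq> L" "\<sigma> x (\<sigma> x L) \<noteq> \<sigma> x L"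
      using three_cycle_fixed_free[OF x(1) x3 nid L] \<sigma>_inj[OF x(1)] by metis+
    then show ?thesis by auto
  qed
  ultimately have "3 \<le> card {L \<in> X. \<sigma> g L = L}" using card_mono[of "{L \<in> X. \<sigma> g L = L}" ?O] finite_X by auto
  then show False using \<sigma>_fix[OF g gJ] by simp
qed

lemma commutator_in_J0: "g \<in> carrier G \<Longrightarrow> j \<in> J \<Longrightarrow> g \<otimes> j \<otimes> inv g \<otimes> inv j \<in> J0"
  unfolding J0_def commutator_subgroup_def by (rule generate.incl) blast

text \<open>A generator of \<open>J0\<close> is the image of a function plus a permuted copy of it,
  and such a sum has total 0. Inverses cause no trouble because elements of \<open>J\<close> are
  involutions.\<close>

lemma J0_even: "v \<in> J0 \<Longrightarrow> \<exists>f. lsupp X f \<and> E f = v \<and> (\<Sum>L\<in>X. f L) = 0"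
  unfolding J0_def commutator_subgroup_def
proof (induction rule: generate.induct)
  case one
  have l: "lsupp X 0" by (simp add: lsupp_def)
  have "E 0 = \<one>" using E_eq_one[OF l] by blast
  moreover have "(\<Sum>L\<in>X. (0 :: 'x \<Rightarrow> bit) L) = 0" by simp
  ultimately show ?case using l by blast
next
  have gen: "\<exists>f. lsupp X f \<and> E f = g \<otimes> j \<otimes> inv g \<otimes> inv j \<and> (\<Sum>L\<in>X. f L) = 0" if g: "g \<in> carrier G" and j: "j \<in> J" for g j
  proof -
    obtain f where f: "lsupp X f" "E f = j" using E_surj j by blast
    have "E ((f \<circ> \<sigma> (inv g)) + f) = g \<otimes> j \<otimes> inv g \<otimes> inv j"
      using E_add[OF lsupp_comp[OF f(1), of "inv g"] f(1)] E_act[OF f(1), of "inv g"] f g j by (simp add: J_inv)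
    moreover have "(\<Sum>L\<in>X. ((f \<circ> \<sigma> (inv g)) + f) L) = 0"
      using sum.permute[OF \<sigma>_permutes[of "inv g"], of f] g by (simp add: sum.distrib)
    ultimately show ?thesis using lsupp_add[OF lsupp_comp[OF f(1), of "inv g"] f(1)] g by blast
  qed
  {
    case (incl h)
    then show ?case using gen by blast
  next
    case (inv h)
    then obtain g j where gj: "g \<in> carrier G" "j \<in> J" "h = g \<otimes> j \<otimes> inv g \<otimes> inv j" by blast
    have "h \<in> J" using gen[OF gj(1,2)] gj(3) E_J by metis
    then show ?case using gen[OF gj(1,2)] gj(3) J_inv by metis
  }
next
  case (eng h1 h2)
  then obtain f1 f2 where "lsupp X f1" "E f1 = h1" "(\<Sum>L\<in>X. f1 L) = 0" "lsupp X f2" "E f2 = h2" "(\<Sum>L\<in>X. f2 L) = 0"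
    by blast
  moreover from this have "lsupp X (f1 + f2)" "E (f1 + f2) = h1 \<otimes> h2" using lsupp_add E_add by auto
  moreover have "(\<Sum>L\<in>X. (f1 + f2) L) = (\<Sum>L\<in>X. f1 L) + (\<Sum>L\<in>X. f2 L)" by (simp add: sum.distrib)
  ultimately show ?case by (metis add.right_neutral)
qed

lemma J0_subset_J: "J0 \<subseteq> J"
  using J0_even E_J by blast

lemma J0_subgroup: "subgroup J0 G"
  unfolding J0_def commutator_subgroup_def
  by (rule generate_is_subgroup) (use J_closed in auto)

lemma J0_conj:
  assumes v: "v \<in> J0" and g: "g \<in> carrier G"
  shows "inv g \<otimes> v \<otimes> g \<in> J0"
proof -
  have vJ: "v \<in> J" using v J0_subset_J by blast
  have "inv g \<otimes> v \<otimes> inv (inv g) \<otimes> inv v \<in> J0" using commutator_in_J0[of "inv g" v] vJ g by simp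
  then have "inv g \<otimes> v \<otimes> inv (inv g) \<otimes> inv v \<otimes> v \<in> J0" using v subgroup.m_closed[OF J0_subgroup] by blast
  moreover have "inv g \<otimes> v \<otimes> inv (inv g) \<otimes> inv v \<otimes> v = inv g \<otimes> v \<otimes> g"
    using vJ g by (simp add: m_assoc)
  ultimately show ?thesis by simp
qed

text \<open>Parity of the weight is well defined modulo the constants because six is even.\<close>

lemma odd_not_in_J0:
  assumes f: "lsupp X f" "(\<Sum>L\<in>X. f L) = 1"
  shows "E f \<notin> J0"
proof
  assume "E f \<in> J0"
  then obtain f' where f': "lsupp X f'" "E f' = E f" "(\<Sum>L\<in>X. f' L) = 0" using J0_even by blast
  have "(\<Sum>L\<in>X. (f' + f) L) = 0"
  proof -
    have "f' = f \<or> f' + f = (\<lambda>L. if L \<in> X then 1 else 0)" using E_eq_iff f f' by blast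
    then show ?thesis
    proof
      assume "f' + f = (\<lambda>L. if L \<in> X then 1 else 0)"
      then have "(\<Sum>L\<in>X. (f' + f) L) = of_nat (card X)" by simp
      then show ?thesis by (simp add: card_X)
    qed simp
  qed
  then show False using f f' by (simp add: sum.distrib)
qed

definition pt :: "'x \<Rightarrow> 'x \<Rightarrow> bit" where "pt p = (\<lambda>L. if L = p then 1 else 0)"

lemma lsupp_pt: "p \<in> X \<Longrightarrow> lsupp X (pt p)" by (auto simp: lsupp_def pt_def)

lemma pt_comp: "g \<in> carrier G \<Longrightarrow> pt (\<sigma> g p) \<circ> \<sigma> g = pt p"
  by (auto simp: pt_def fun_eq_iff \<sigma>_inj)

lemma ex_other_X: obtains L where "L \<in> X" "L \<notin> {p1, p2, p3, p4}"
proof -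
  have "card {p1, p2, p3, p4} \<le> 4" by (auto simp: card_insert_if)
  then have "\<not> X \<subseteq> {p1, p2, p3, p4}" using card_mono[of "{p1, p2, p3, p4}" X] card_X by auto
  then show thesis using that by blast
qed

lemma E_pt_eq_iff:
  assumes "p \<in> X" "q \<in> X" shows "E (pt p) = E (pt q) \<longleftrightarrow> p = q"
proof -
  obtain L where "L \<in> X" "L \<notin> {p, q}" using ex_other_X[of p q q q] by blast
  then have "(pt p + pt q) L = 0" "L \<in> X" by (simp_all add: pt_def)
  then have "pt p + pt q \<noteq> (\<lambda>L. if L \<in> X then 1 else 0)" by (metis zero_neq_one)
  moreover have "pt p = pt q \<longleftrightarrow> p = q" by (auto simp: pt_def fun_eq_iff)
  ultimately show ?thesis using E_eq_iff[OF lsupp_pt[OF assms(1)] lsupp_pt[OF assms(2)]] by simp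
qed

lemma E_pt_conj:
  assumes p: "p \<in> X" and g: "g \<in> carrier G"
  shows "inv g \<otimes> E (pt (\<sigma> g p)) \<otimes> g = E (pt p)"
  using E_act[OF lsupp_pt[of "\<sigma> g p"] g] pt_comp[OF g] \<sigma>_in[OF g] p by simp

text \<open>On six points g has two orbits of length 3. The function f + f g + f g^2 is constant on
  each orbit, with the orbit sum of f as its value. The two values agree because f has total 0, so
  the function is constant on X and \<open>E\<close> sends it to the identity.\<close>

lemma three_cycle_kills_J0:
  assumes g: "g \<in> carrier G" and t3: "t g \<circ> t g \<circ> t g = id" and nid: "t g \<noteq> id" and v: "v \<in> J0"
  shows "v \<otimes> (inv g \<otimes> v \<otimes> g) \<otimes> (inv (g \<otimes> g) \<otimes> v \<otimes> (g \<otimes> g)) = \<one>"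
proof -
  obtain f where f: "lsupp X f" "E f = v" "(\<Sum>L\<in>X. f L) = 0" using J0_even[OF v] by blast
  let ?F = "f + (f \<circ> \<sigma> g) + (f \<circ> \<sigma> (g \<otimes> g))"
  have lF: "lsupp X ?F" using f g by (intro lsupp_add lsupp_comp) auto
  have eF: "E ?F = v \<otimes> (inv g \<otimes> v \<otimes> g) \<otimes> (inv (g \<otimes> g) \<otimes> v \<otimes> (g \<otimes> g))"
    using E_add[OF lsupp_add[OF f(1) lsupp_comp[OF f(1) g]] lsupp_comp[OF f(1), of "g \<otimes> g"]]
      E_add[OF f(1) lsupp_comp[OF f(1) g]] E_act[OF f(1) g] E_act[OF f(1), of "g \<otimes> g"] f(2) g by simp
  have F: "?F L = f L + f (\<sigma> g L) + f (\<sigma> g (\<sigma> g L))" for L using g by (simp add: \<sigma>_mult)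
  note fr = three_cycle_fixed_free[OF g t3 nid]
  have orb: "card {M, \<sigma> g M, \<sigma> g (\<sigma> g M)} = 3" if "M \<in> X" for M
  proof -
    have "\<sigma> g M \<noteq> M" "\<sigma> g (\<sigma> g M) \<noteq> M" "\<sigma> g (\<sigma> g M) \<noteq> \<sigma> g M"
      using fr[OF that] \<sigma>_inj[OF g] by metis+
    then show ?thesis by auto
  qed
  have osum: "(\<Sum>L\<in>{M, \<sigma> g M, \<sigma> g (\<sigma> g M)}. f L) = ?F M" if "M \<in> X" for M
  proof -
    have "M \<noteq> \<sigma> g M" "M \<noteq> \<sigma> g (\<sigma> g M)" "\<sigma> g M \<noteq> \<sigma> g (\<sigma> g M)"
      using fr[OF that] \<sigma>_inj[OF g] by (metis)+
    then show ?thesis unfolding F by (simp add: add.assoc)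
  qed
  have inv1: "?F (\<sigma> g M) = ?F M" if "M \<in> X" for M
    using fr(2)[OF that] unfolding F by (simp add: ac_simps)
  have same: "?F L = ?F M" if L: "L \<in> X" and M: "M \<in> X" for L M
  proof (cases "L \<in> {M, \<sigma> g M, \<sigma> g (\<sigma> g M)}")
    case True
    have "?F (\<sigma> g (\<sigma> g M)) = ?F (\<sigma> g M)" by (rule inv1) (simp add: \<sigma>_in[OF g] M)
    then show ?thesis using inv1[OF M] True by (elim insertE emptyE) (simp_all only:)
  next
    case False
    let ?O = "{M, \<sigma> g M, \<sigma> g (\<sigma> g M)}" and ?P = "{L, \<sigma> g L, \<sigma> g (\<sigma> g L)}"
    have disj: "?O \<inter> ?P = {}" using False fr(2)[OF L] fr(2)[OF M] \<sigma>_inj[OF g] by (auto; metis)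
    have "card (?O \<union> ?P) = 6" using card_Un_disjoint[of ?O ?P] disj orb[OF L] orb[OF M] by simp
    moreover have "?O \<union> ?P \<subseteq> X" using L M \<sigma>_in[OF g] by auto
    ultimately have "?O \<union> ?P = X" using finite_X card_X by (intro card_subset_eq) auto
    then have "(\<Sum>L\<in>X. f L) = ?F M + ?F L"
      using sum.union_disjoint[of ?O ?P f] disj osum[OF L] osum[OF M] by simp
    then show ?thesis using f(3) bit_add_eq_0 by metis
  qed
  define K where "K = ?F"
  have sameK: "K L = K M" if "L \<in> X" "M \<in> X" for L M unfolding K_def by (rule same[OF that])
  have outK: "K L = 0" if "L \<notin> X" for L using lF that unfolding lsupp_def K_def by blast
  obtain M where M: "M \<in> X" using ex_other_X by metis
  have pw: "K L = (if L \<in> X then K M else 0)" for L using sameK[OF _ M, of L] outK[of L] by simp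
  have "K = (\<lambda>L. 0) \<or> K = (\<lambda>L. if L \<in> X then 1 else 0)"
  proof (cases "K M = 0")
    case True
    have "K L = 0" for L using pw[of L] True by simp
    then show ?thesis by blast
  next
    case False
    then have one: "K M = 1" by simp
    have "K L = (if L \<in> X then 1 else 0)" for L using pw[of L] one by simp
    then show ?thesis by blast
  qed
  then have "?F = 0 \<or> ?F = (\<lambda>L. if L \<in> X then 1 else 0)" unfolding K_def zero_fun_def .
  then show ?thesis using E_eq_one[OF lF] eF by simp
qed

lemma commutator_in_derived: "g \<in> carrier G \<Longrightarrow> h \<in> carrier G \<Longrightarrow> g \<otimes> h \<otimes> inv g \<otimes> inv h \<in> derived G (carrier G)"
  unfolding derived_def by (rule generate.incl) blast

text \<open>This is where the quotient \<open>SL(2,5)\<close> enters: its only involution is central.\<close>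

lemma square_not_in_J0:
  assumes a: "a \<in> carrier G" "a \<otimes> a = \<one>" and g: "g \<in> carrier G" and b: "b = inv g \<otimes> a \<otimes> g"
    and ta: "t a = tr p q" and tb: "t b = tr r s"
    and pq: "p \<in> {1..5}" "q \<in> {1..5}" "r \<in> {1..5}" "p \<noteq> q" "r \<noteq> s" "{p, q} \<inter> {r, s} = {}"
  shows "a \<otimes> b \<otimes> (a \<otimes> b) \<notin> J0"
proof
  assume sq: "a \<otimes> b \<otimes> (a \<otimes> b) \<in> J0"
  have ia: "inv a = a" using a inv_equality by simp
  have bG: "b \<in> carrier G" using a g b by simp
  have "a \<otimes> b = a \<otimes> inv g \<otimes> inv a \<otimes> inv (inv g)" unfolding b ia using a g by (simp add: m_assoc)
  then have d: "a \<otimes> b \<in> derived G (carrier G)" using commutator_in_derived[of a "inv g"] a g by simp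
  obtain y where y: "y \<in> carrier G" "t y = tr p q" using t_surj[OF permutes_swap_id] pq by blast
  obtain z where z: "z \<in> carrier G" "t z = tr q r" using t_surj[OF permutes_swap_id] pq by blast
  \<comment> \<open>The commutator x lies over a three-cycle on p, q, r. This does not commute with
    (p q)(r s), whereas x and a b would commute modulo \<open>J0\<close>.\<close>
  let ?x = "y \<otimes> z \<otimes> inv y \<otimes> inv z"
  have x: "?x \<in> carrier G" using y z by simp
  have ti: "t (inv y) = tr p q" "t (inv z) = tr q r"
    using t_inv(1)[OF y(1)] t_inv(1)[OF z(1)] unfolding y z
    by (metis comp_assoc comp_id id_comp transpose_comp_involutory)+
  have tx: "t ?x = tr p q \<circ> tr q r \<circ> tr p q \<circ> tr q r" using y z ti by (simp add: t_mult)
  have "a \<otimes> b \<otimes> ?x \<otimes> inv (a \<otimes> b) \<otimes> inv ?x \<in> J0"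
    by (rule derived_involution[OF d sq commutator_in_derived[OF y(1) z(1)]])
  then have "a \<otimes> b \<otimes> ?x \<otimes> inv (a \<otimes> b) \<otimes> inv ?x \<in> J" using J0_subset_J by blast
  moreover have "a \<otimes> b \<otimes> ?x \<otimes> inv (a \<otimes> b) \<otimes> inv ?x = a \<otimes> b \<otimes> ?x \<otimes> inv (?x \<otimes> (a \<otimes> b))"
    using a bG x by (simp add: inv_mult_group m_assoc)
  ultimately have "t (a \<otimes> b \<otimes> ?x \<otimes> inv (?x \<otimes> (a \<otimes> b))) = id" using t_eq_id a bG x by simp
  then have "t (a \<otimes> b \<otimes> ?x) \<circ> t (inv (?x \<otimes> (a \<otimes> b))) = id" using t_mult[of "a \<otimes> b \<otimes> ?x" "inv (?x \<otimes> (a \<otimes> b))"] a bG x by simp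
  then have "t (a \<otimes> b \<otimes> ?x) \<circ> (t (inv (?x \<otimes> (a \<otimes> b))) \<circ> t (?x \<otimes> (a \<otimes> b))) = t (?x \<otimes> (a \<otimes> b))"
    by (metis comp_assoc id_comp)
  then have "t (a \<otimes> b \<otimes> ?x) = t (?x \<otimes> (a \<otimes> b))" using t_inv(1)[of "?x \<otimes> (a \<otimes> b)"] a bG x by simp
  then have "t a \<circ> t b \<circ> t ?x = t ?x \<circ> (t a \<circ> t b)" using a bG x by (simp only: t_mult m_closed)
  then have "(t a \<circ> t b \<circ> t ?x) p = (t ?x \<circ> (t a \<circ> t b)) p" by simp
  then show False unfolding tx ta tb using pq by (auto simp: Transposition.transpose_def split: if_splits)
qed

text \<open>All involutions of \<open>G\<close> over a given transposition are conjugate, since \<open>c\<close> and \<open>(c c\<^sup>g)\<^sup>2 c\<close> are,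
  for a transposition \<open>c\<^sup>g\<close> disjoint from \<open>c\<close>.\<close>

lemma card_class_in_coset:
  assumes c: "c \<in> carrier G" "c \<otimes> c = \<one>" and tc: "t c = tr p q" and pq: "p \<in> {1..5}" "q \<in> {1..5}" "p \<noteq> q"
  shows "8 \<le> card {m \<in> J. c \<otimes> m \<in> conjugacy_class G c}"
proof -
  let ?S = "{m \<in> J. c \<otimes> m \<in> conjugacy_class G c}"
  have ic: "inv c = c" using c inv_equality by simp
  have finJ: "finite J"
  proof -
    have "J \<subseteq> E ` {f. lsupp X f}" using E_surj by blast
    moreover have "finite {f. lsupp X (f :: 'x \<Rightarrow> bit)}"
    proof (rule finite_imageD)
      let ?h = "\<lambda>f :: 'x \<Rightarrow> bit. {L. f L = 1}"
      show "finite (?h ` {f. lsupp X f})"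
        by (rule finite_subset[of _ "Pow X"]) (auto simp: lsupp_def finite_X)
      show "inj_on ?h {f. lsupp X f}"
      proof (rule inj_onI, rule ext)
        fix f f' :: "'x \<Rightarrow> bit" and L
        assume "?h f = ?h f'"
        then have "L \<in> ?h f \<longleftrightarrow> L \<in> ?h f'" by simp
        then show "f L = f' L" by (cases "f L"; cases "f' L") simp_all
      qed
    qed
    ultimately show ?thesis by (meson finite_imageI finite_subset)
  qed
  \<comment> \<open>Conjugating c m by j multiplies m by the commutator of j and c, so this set of
    elements m is closed under such factors.\<close>
  have key: "(m \<otimes> (j \<otimes> (inv c \<otimes> j \<otimes> c))) \<in> ?S" if m: "m \<in> ?S" and j: "j \<in> J" for m j
  proof -
    obtain g where g: "g \<in> carrier G" "c \<otimes> m = inv g \<otimes> c \<otimes> g" using m by (auto simp: conjugacy_class_def)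
    have mJ: "m \<in> J" using m by simp
    have cj: "inv c \<otimes> j \<otimes> c \<in> J" using J_conj j c by simp
    have "c \<otimes> (m \<otimes> (j \<otimes> (inv c \<otimes> j \<otimes> c))) = c \<otimes> ((inv c \<otimes> j \<otimes> c) \<otimes> m \<otimes> j)"
      using J_comm mJ j cj J_mult by (metis m_assoc J_closed)
    also have "\<dots> = inv j \<otimes> (c \<otimes> m) \<otimes> j" using c j mJ ic by (simp add: m_assoc J_inv) (simp add: m_assoc[symmetric] c)
    also have "\<dots> = inv (g \<otimes> j) \<otimes> c \<otimes> (g \<otimes> j)" unfolding g(2) using g(1) j c by (simp add: inv_mult_group m_assoc)
    finally have eq: "c \<otimes> (m \<otimes> (j \<otimes> (inv c \<otimes> j \<otimes> c))) = inv (g \<otimes> j) \<otimes> c \<otimes> (g \<otimes> j)" .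
    have "c \<otimes> (m \<otimes> (j \<otimes> (inv c \<otimes> j \<otimes> c))) \<in> conjugacy_class G c"
      unfolding eq by (rule conjugacy_classI) (use g j in simp)
    then show ?thesis using mJ j cj J_mult by simp
  qed
  have one: "\<one> \<in> ?S" using c J_one by (auto simp: conjugacy_class_def intro!: exI[of _ \<one>])
  obtain r where r: "r \<in> {1..5}" "r \<notin> {p, q, q, q}" using ex_other_point by metis
  obtain s where s: "s \<in> {1..5}" "s \<notin> {p, q, r, r}" using ex_other_point by metis
  obtain g where g: "g \<in> carrier G" "t g = tr p r \<circ> tr q s"
    using t_surj[OF permutes_compose[OF permutes_swap_id permutes_swap_id]] pq r s by blast
  define b where "b = inv g \<otimes> c \<otimes> g"
  have bG: "b \<in> carrier G" using c g by (simp add: b_def)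
  have bb: "b \<otimes> b = \<one>"
    unfolding b_def using c g by (simp add: m_assoc) (simp add: m_assoc[symmetric] c)
  have tb: "t b = tr r s"
  proof -
    have "t (inv g) = tr p r \<circ> tr q s"
    proof -
      have "(tr p r \<circ> tr q s) \<circ> (tr p r \<circ> tr q s) = id"
        using pq r s by (auto simp: fun_eq_iff Transposition.transpose_def)
      then have "t g \<circ> t g = id" using g by simp
      then show ?thesis using t_inv(1)[OF g(1)] g(2) by (metis comp_assoc comp_id id_comp)
    qed
    then have "t b = (tr p r \<circ> tr q s) \<circ> tr p q \<circ> (tr p r \<circ> tr q s)" unfolding b_def using c g tc by (simp add: t_mult)
    also have "\<dots> = tr r s" using pq r s by (auto simp: fun_eq_iff Transposition.transpose_def)
    finally show ?thesis .
  qed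
  \<comment> \<open>This is the square of the product of two conjugates over disjoint
    transpositions, an element of the set outside \<open>J0\<close>. Multiplying by it doubles the
    part found inside \<open>J0\<close>.\<close>
  define m' where "m' = c \<otimes> b \<otimes> (c \<otimes> b)"
  have m'0: "m' \<notin> J0" unfolding m'_def
    by (rule square_not_in_J0[OF c g(1) b_def tc tb]) (use pq r s in auto)
  have m'G: "m' \<in> carrier G" using c bG by (simp add: m'_def)
  have m'J: "m' \<in> J"
  proof -
    have "t m' = (tr p q \<circ> tr r s) \<circ> (tr p q \<circ> tr r s)" unfolding m'_def using c bG tc tb by (simp add: t_mult)
    also have "\<dots> = id" using pq r s by (auto simp: fun_eq_iff Transposition.transpose_def)
    finally show ?thesis using t_eq_id m'G by simp
  qed
  have "c \<otimes> m' = inv b \<otimes> c \<otimes> b"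
    unfolding m'_def using c bG bb inv_equality[OF bb] by (simp add: m_assoc[symmetric])
  then have m'S: "m' \<in> ?S" using m'J bG by (auto simp: conjugacy_class_def)
  have fpf: "\<sigma> c L \<noteq> L" if "L \<in> X" for L by (rule transposition_fixed_free[OF c(1) tc pq that])
  have inv2: "\<sigma> c (\<sigma> c L) = L" for L
    using \<sigma>_mult[OF c(1) c(1)] c(2) \<sigma>_J[OF J_one] by (metis comp_apply id_apply)
  \<comment> \<open>The points L1, L2, L3 represent the three orbits of c on X. The elements
    \<open>M \<alpha> \<beta>\<close> come from the indicator functions of the first two orbits;
    since these vanish at L3, two of them never differ by the all-one function.\<close>
  obtain L1 where L1: "L1 \<in> X" using ex_other_X by metis
  obtain L2 where L2: "L2 \<in> X" "L2 \<notin> {L1, \<sigma> c L1}" using ex_other_X[of L1 "\<sigma> c L1" L1 L1] by blast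
  obtain L3 where L3: "L3 \<in> X" "L3 \<notin> {L1, \<sigma> c L1, L2, \<sigma> c L2}"
    using ex_other_X by metis
  define w where "w \<alpha> \<beta> = (\<lambda>L. \<alpha> * pt L1 L + \<beta> * pt L2 L)" for \<alpha> \<beta>
  define M where "M \<alpha> \<beta> = E (w \<alpha> \<beta>) \<otimes> (inv c \<otimes> E (w \<alpha> \<beta>) \<otimes> c)" for \<alpha> \<beta>
  have lw: "lsupp X (w \<alpha> \<beta>)" for \<alpha> \<beta> using L1 L2 by (auto simp: lsupp_def w_def pt_def)
  have ME: "M \<alpha> \<beta> = E (w \<alpha> \<beta> + (w \<alpha> \<beta> \<circ> \<sigma> c))" for \<alpha> \<beta>
    unfolding M_def using E_add[OF lw lsupp_comp[OF lw c(1)]] E_act[OF lw c(1)] by simp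
  have M_J0: "M \<alpha> \<beta> \<in> J0" for \<alpha> \<beta>
  proof -
    have e: "E (w \<alpha> \<beta>) \<in> J" using E_J[OF lw] .
    have "M \<alpha> \<beta> = c \<otimes> E (w \<alpha> \<beta>) \<otimes> inv c \<otimes> inv (E (w \<alpha> \<beta>))"
      unfolding M_def ic J_inv[OF e] using J_comm[OF e J_conj[OF e c(1)]] by (simp add: ic)
    then show ?thesis using commutator_in_J0[OF c(1) e] by simp
  qed
  have M_inj: "\<alpha> = \<alpha>' \<and> \<beta> = \<beta>'" if eq: "M \<alpha> \<beta> = M \<alpha>' \<beta>'" for \<alpha> \<beta> \<alpha>' \<beta>'
  proof -
    let ?u = "w \<alpha> \<beta> + (w \<alpha> \<beta> \<circ> \<sigma> c)" and ?u' = "w \<alpha>' \<beta>' + (w \<alpha>' \<beta>' \<circ> \<sigma> c)"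
    have l: "lsupp X ?u" "lsupp X ?u'" using lw c by (auto intro!: lsupp_add lsupp_comp)
    have "(w \<alpha> \<beta> + (w \<alpha> \<beta> \<circ> \<sigma> c)) L3 = 0" for \<alpha> \<beta>
      using L3 inv2 by (auto simp: w_def pt_def)
    then have "(?u + ?u') L3 = 0" by simp
    then have "?u + ?u' \<noteq> (\<lambda>L. if L \<in> X then 1 else 0)" using L3 by (metis zero_neq_one)
    then have uu: "?u = ?u'" using eq E_eq_iff[OF l] unfolding ME by blast
    have v1: "(w \<alpha> \<beta> + (w \<alpha> \<beta> \<circ> \<sigma> c)) L1 = \<alpha>" and v2: "(w \<alpha> \<beta> + (w \<alpha> \<beta> \<circ> \<sigma> c)) L2 = \<beta>" for \<alpha> \<beta>
      using L1 L2 fpf[OF L1] fpf[OF L2(1)] inv2 by (auto simp: w_def pt_def)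
    show ?thesis using v1[of \<alpha> \<beta>] v1[of \<alpha>' \<beta>'] v2[of \<alpha> \<beta>] v2[of \<alpha>' \<beta>'] uu by metis
  qed
  define Q where "Q = (\<lambda>(\<alpha>, \<beta>). M \<alpha> \<beta>) ` (UNIV :: (bit \<times> bit) set)"
  have "UNIV = {0, 1 :: bit}" by (auto intro: bit.exhaust)
  then have "card (UNIV :: bit set) = 2" by (metis card_2_iff zero_neq_one)
  then have cb: "card (UNIV :: (bit \<times> bit) set) = 4" by (simp add: card_cartesian_product UNIV_Times_UNIV[symmetric] del: UNIV_Times_UNIV)
  have cQ: "card Q = 4"
    unfolding Q_def using cb M_inj by (subst card_image) (auto simp: inj_on_def)
  have QJ0: "Q \<subseteq> J0" using M_J0 by (auto simp: Q_def)
  have QS: "Q \<subseteq> ?S"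
  proof
    fix m assume "m \<in> Q"
    then obtain \<alpha> \<beta> where m: "m = M \<alpha> \<beta>" by (auto simp: Q_def)
    have "\<one> \<otimes> M \<alpha> \<beta> \<in> ?S" unfolding M_def by (rule key[OF one E_J[OF lw]])
    then show "m \<in> ?S" using m M_J0 J0_subset_J by (metis J_closed l_one subsetD)
  qed
  have Q'S: "(\<otimes>) m' ` Q \<subseteq> ?S"
  proof (rule image_subsetI)
    fix m assume "m \<in> Q"
    then obtain \<alpha> \<beta> where m: "m = M \<alpha> \<beta>" by (auto simp: Q_def)
    show "m' \<otimes> m \<in> ?S" unfolding m M_def by (rule key[OF m'S E_J[OF lw]])
  qed
  have cQ': "card ((\<otimes>) m' ` Q) = 4"
  proof -
    have "inj_on ((\<otimes>) m') Q"
    proof (rule inj_onI)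
      fix x y assume "x \<in> Q" "y \<in> Q" "m' \<otimes> x = m' \<otimes> y"
      moreover from this have "x \<in> carrier G" "y \<in> carrier G" using QJ0 J0_subset_J by auto
      ultimately show "x = y" using m'G by simp
    qed
    then show ?thesis using cQ by (simp add: card_image)
  qed
  have "Q \<inter> (\<otimes>) m' ` Q = {}"
  proof (rule ccontr)
    assume "Q \<inter> (\<otimes>) m' ` Q \<noteq> {}"
    then obtain m1 m2 where m12: "m1 \<in> Q" "m2 \<in> Q" "m1 = m' \<otimes> m2" by blast
    then have "m1 \<in> J0" "m2 \<in> J0" using QJ0 by auto
    then have "m1 \<otimes> inv m2 \<in> J0" using subgroup.m_closed[OF J0_subgroup] subgroup.m_inv_closed[OF J0_subgroup] by blast
    moreover have "m1 \<otimes> inv m2 = m'" using m12 \<open>m2 \<in> J0\<close> J0_subset_J m'G by (simp add: m_assoc subsetD)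
    ultimately show False using m'0 by simp
  qed
  then have "card (Q \<union> (\<otimes>) m' ` Q) = 8"
    using card_Un_disjoint[of Q "(\<otimes>) m' ` Q"] cQ cQ' by (metis card.infinite finite_imageI zero_neq_numeral numeral_Bit0 add_numeral_left one_add_one)
  moreover have "Q \<union> (\<otimes>) m' ` Q \<subseteq> ?S" using QS Q'S by blast
  ultimately show ?thesis using card_mono[of ?S "Q \<union> (\<otimes>) m' ` Q"] finJ by simp
qed

end

subsection \<open>The normalizer of a Sylow 5-subgroup\<close>

text \<open>Since 5 is prime, a shorter period of a together with period 5 would make a
  fixed.\<close>

lemma five_orbit:
  assumes inj: "inj q" and five: "\<And>x. q (q (q (q (q x)))) = x" and a: "q a \<noteq> a"
  shows "distinct [a, q a, q (q a), q (q (q a)), q (q (q (q a)))]"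
proof -
  have 1: "q (q a) \<noteq> a" using five a by metis
  have 2: "q (q (q a)) \<noteq> a" using five a by metis
  have 3: "q (q (q (q a))) \<noteq> a" using five a by metis
  have i: "q x = q z \<longleftrightarrow> x = z" for x z using inj by (auto dest: injD)
  show ?thesis using a 1 2 3 by (auto simp: i)
qed

lemma ex_relabelling:
  assumes lab: "bij_betw lab (UNIV :: 5 set) {1..5::nat}" and lab': "bij_betw lab' (UNIV :: 5 set) {1..5::nat}"
  shows "\<exists>\<pi>. \<pi> permutes {1..5} \<and> (\<forall>j. \<pi> (lab j) = lab' j)"
proof -
  define \<pi> where "\<pi> i = (if i \<in> {1..5} then lab' (the_inv_into UNIV lab i) else i)" for i
  have l: "\<pi> (lab j) = lab' j" for j
    using lab lab_in[OF lab, of j] the_inv_into_f_f[of lab UNIV j] by (simp add: \<pi>_def bij_betw_def)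
  have "bij_betw (lab' \<circ> the_inv_into UNIV lab) {1..5} {1..5}"
    by (rule bij_betw_trans[OF bij_betw_the_inv_into[OF lab] lab'])
  moreover have "bij_betw \<pi> {1..5} {1..5} \<longleftrightarrow> bij_betw (lab' \<circ> the_inv_into UNIV lab) {1..5} {1..5}"
    by (rule bij_betw_cong) (simp add: \<pi>_def)
  ultimately have "bij_betw \<pi> {1..5} {1..5}" by blast
  then have "\<pi> permutes {1..5}" by (rule bij_imp_permutes) (auto simp: \<pi>_def)
  then show ?thesis using l by blast
qed

context base_action
begin

lemma \<sigma>_pow: "g \<in> carrier G \<Longrightarrow> \<sigma> (g [^] (n::nat)) = \<sigma> g ^^ n"
proof (induction n)
  case 0 then show ?case by (simp add: \<sigma>_J[OF J_one])
next
  case (Suc n)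
  then show ?case by (simp add: \<sigma>_mult funpow_Suc_right del: funpow.simps)
qed

lemma pow5: "g \<in> carrier G \<Longrightarrow> g [^] (5::nat) = g \<otimes> g \<otimes> g \<otimes> g \<otimes> g"
  by (simp add: numeral_eq_Suc)

lemma order_five_not_in_J:
  assumes "g \<in> carrier G" "g [^] (5::nat) = \<one>" "g \<noteq> \<one>" shows "g \<notin> J"
proof
  assume "g \<in> J"
  then have "g \<otimes> g = \<one>" by (rule J_sq)
  then have "g [^] (5::nat) = g" using assms(1) by (simp add: pow5 m_assoc)
  then show False using assms by simp
qed

text \<open>An element outside \<open>J\<close> moves some point. The orbit of length 5 leaves one
  point, which has to be fixed.\<close>

lemma order_five_orbit:
  assumes g: "g \<in> carrier G" "g [^] (5::nat) = \<one>" "g \<notin> J"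
  obtains p L where "distinct [p, L, \<sigma> g L, \<sigma> g (\<sigma> g L), \<sigma> g (\<sigma> g (\<sigma> g L)), \<sigma> g (\<sigma> g (\<sigma> g (\<sigma> g L)))]"
    and "X = {p, L, \<sigma> g L, \<sigma> g (\<sigma> g L), \<sigma> g (\<sigma> g (\<sigma> g L)), \<sigma> g (\<sigma> g (\<sigma> g (\<sigma> g L)))}"
    and "\<sigma> g p = p" and "\<And>M. \<sigma> g (\<sigma> g (\<sigma> g (\<sigma> g (\<sigma> g M)))) = M"
proof -
  have five: "\<sigma> g (\<sigma> g (\<sigma> g (\<sigma> g (\<sigma> g M)))) = M" for M
  proof -
    have "\<sigma> (g \<otimes> g \<otimes> g \<otimes> g \<otimes> g) = id" using g(2) \<sigma>_J[OF J_one] by (simp add: pow5[OF g(1)])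
    then have "\<sigma> g \<circ> \<sigma> g \<circ> \<sigma> g \<circ> \<sigma> g \<circ> \<sigma> g = id" using g(1) by (simp add: \<sigma>_mult)
    then show ?thesis by (metis comp_apply id_apply)
  qed
  have "\<not> X \<subseteq> {L \<in> X. \<sigma> g L = L}"
    using card_mono[of "{L \<in> X. \<sigma> g L = L}" X] finite_X \<sigma>_fix[OF g(1,3)] card_X by auto
  then obtain L where L: "L \<in> X" "\<sigma> g L \<noteq> L" by blast
  let ?l = "[L, \<sigma> g L, \<sigma> g (\<sigma> g L), \<sigma> g (\<sigma> g (\<sigma> g L)), \<sigma> g (\<sigma> g (\<sigma> g (\<sigma> g L)))]"
  have d: "distinct ?l" by (rule five_orbit[OF permutes_inj[OF \<sigma>_permutes[OF g(1)]] five L(2)])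
  have sub: "set ?l \<subseteq> X" using L(1) \<sigma>_in[OF g(1)] by simp
  have "card (X - set ?l) = 1" using card_Diff_subset[of "set ?l" X] sub distinct_card[OF d] card_X by simp
  then obtain p where p: "X - set ?l = {p}" by (auto simp: card_1_singleton_iff)
  have "\<sigma> g p \<notin> set ?l"
  proof
    assume "\<sigma> g p \<in> set ?l"
    then have "\<sigma> g p \<in> \<sigma> g ` set ?l" using five[of L] by auto
    then have "p \<in> set ?l" using \<sigma>_inj[OF g(1)] by (auto simp: image_iff)
    then show False using p by blast
  qed
  moreover have "\<sigma> g p \<in> X" using p \<sigma>_in[OF g(1)] by blast
  ultimately have "\<sigma> g p = p" using p by blast
  then show thesis using that[of p L] d p sub five by auto
qed

lemma conj_pow:
  assumes "g \<in> carrier G" "x \<in> carrier G"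
  shows "(g \<otimes> x \<otimes> inv g) [^] (n::nat) = g \<otimes> x [^] n \<otimes> inv g"
proof (induction n)
  case (Suc n)
  have "g \<otimes> x [^] n \<otimes> inv g \<otimes> (g \<otimes> x \<otimes> inv g) = g \<otimes> x [^] n \<otimes> (inv g \<otimes> g) \<otimes> (x \<otimes> inv g)"
    using assms by (simp only: m_assoc m_closed inv_closed nat_pow_closed)
  then show ?case using assms Suc by (simp add: m_assoc)
qed (use assms in simp)

text \<open>A complement of \<open>J\<close> in \<open>J\<langle>w\<rangle>\<close> is conjugate to \<open>\<langle>w\<rangle>\<close>: solve \<open>g w + g = f\<close> along the orbit of \<open>w\<close>.\<close>

lemma conjugate_complement:
  assumes w: "w \<in> carrier G" "w [^] (5::nat) = \<one>" "w \<notin> J" and j: "j \<in> J" and wj: "(w \<otimes> j) [^] (5::nat) = \<one>"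
  shows "\<exists>j0\<in>J. inv j0 \<otimes> w \<otimes> j0 = w \<otimes> j"
proof -
  obtain p L0 where d: "distinct [p, L0, \<sigma> w L0, \<sigma> w (\<sigma> w L0), \<sigma> w (\<sigma> w (\<sigma> w L0)), \<sigma> w (\<sigma> w (\<sigma> w (\<sigma> w L0)))]"
    and X: "X = {p, L0, \<sigma> w L0, \<sigma> w (\<sigma> w L0), \<sigma> w (\<sigma> w (\<sigma> w L0)), \<sigma> w (\<sigma> w (\<sigma> w (\<sigma> w L0)))}"
    and p: "\<sigma> w p = p" and five: "\<And>M. \<sigma> w (\<sigma> w (\<sigma> w (\<sigma> w (\<sigma> w M)))) = M"
    by (rule order_five_orbit[OF w]) blast
  define L1 where "L1 = \<sigma> w L0" define L2 where "L2 = \<sigma> w L1" define L3 where "L3 = \<sigma> w L2" define L4 where "L4 = \<sigma> w L3"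
  have d': "distinct [p, L0, L1, L2, L3, L4]" and X': "X = {p, L0, L1, L2, L3, L4}"
    using d X unfolding L4_def L3_def L2_def L1_def by simp_all
  have s: "\<sigma> w L0 = L1" "\<sigma> w L1 = L2" "\<sigma> w L2 = L3" "\<sigma> w L3 = L4" "\<sigma> w L4 = L0"
    using five[of L0] by (simp_all add: L4_def L3_def L2_def L1_def)
  obtain f where f: "lsupp X f" "E f = j" using E_surj j by blast
  \<comment> \<open>S n = f + f w + ... + f w^(n-1), chosen so that (w j)^n = w^n E(S n).\<close>
  define S where "S n = rec_nat 0 (\<lambda>_ u. (u \<circ> \<sigma> w) + f) n" for n
  have S0: "S 0 = 0" and SS: "S (Suc n) = (S n \<circ> \<sigma> w) + f" for n by (simp_all add: S_def)
  have lS: "lsupp X (S n)" for n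
  proof (induction n)
    case 0 show ?case unfolding S0 by (simp add: lsupp_def)
  next
    case (Suc n) show ?case unfolding SS by (intro lsupp_add lsupp_comp Suc w f)
  qed
  have pw: "(w \<otimes> j) [^] n = w [^] n \<otimes> E (S n)" for n :: nat
  proof (induction n)
    case 0
    have "E (S 0) = \<one>" using E_eq_one[OF lS[of 0]] S0 by blast
    then show ?case by simp
  next
    case (Suc n)
    have e: "E (S n) \<in> carrier G" using E_J[OF lS] by simp
    have "E (S (Suc n)) = (inv w \<otimes> E (S n) \<otimes> w) \<otimes> j"
      unfolding SS using E_add[OF lsupp_comp[OF lS w(1)] f(1), of n] E_act[OF lS w(1), of n] f(2) by simp
    moreover have "w [^] n \<otimes> w \<otimes> ((inv w \<otimes> E (S n) \<otimes> w) \<otimes> j) = w [^] n \<otimes> (w \<otimes> inv w) \<otimes> E (S n) \<otimes> w \<otimes> j"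
      using e w(1) j by (simp only: m_assoc m_closed inv_closed nat_pow_closed J_closed)
    ultimately show ?case using Suc e w(1) j by (simp add: m_assoc)
  qed
  have "E (S 5) = \<one>" using pw[of 5] wj w(2) E_J[OF lS] by simp
  then have S5: "S 5 = 0 \<or> S 5 = (\<lambda>L. if L \<in> X then 1 else 0)" using E_eq_one[OF lS] by simp
  have S5v: "S 5 M = f (\<sigma> w (\<sigma> w (\<sigma> w (\<sigma> w M)))) + f (\<sigma> w (\<sigma> w (\<sigma> w M))) + f (\<sigma> w (\<sigma> w M)) + f (\<sigma> w M) + f M" for M
    by (simp add: numeral_eq_Suc SS S0)
  \<comment> \<open>\<open>S 5\<close> is constant on X. At the fixed point p its five terms all
    equal f p and add up to f p, while at L0 they run through the orbit.\<close>
  have "S 5 p = S 5 L0" using S5 X' by (elim disjE) (simp_all only: X' insert_iff simp_thms if_True zero_fun_apply)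
  then have fp: "f p = f L4 + f L3 + f L2 + f L1 + f L0" unfolding S5v s p by simp
  \<comment> \<open>The representative of j is changed by a constant so that it vanishes at p. Its
    sum over the orbit is then 0, which is the condition for solving g w + g = f' along the
    orbit.\<close>
  define f' where "f' = (\<lambda>M. if M \<in> X then f M + f p else 0)"
  have lf': "lsupp X f'" by (simp add: lsupp_def f'_def)
  have ef': "E f' = j"
  proof (cases "f p = 0")
    case True
    have "f' = f" using True f(1) by (auto simp: f'_def lsupp_def fun_eq_iff)
    then show ?thesis using f by simp
  next
    case False
    then have "f p = 1" by simp
    then have "(f' + f) M = (if M \<in> X then 1 else 0)" for M
      using f(1) by (cases "f M") (auto simp: f'_def lsupp_def)
    then have "f' + f = (\<lambda>L. if L \<in> X then 1 else 0)" by blast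
    then show ?thesis using E_eq_iff[OF lf' f(1)] f(2) by simp
  qed
  have f'M: "f' M = f M + f p" if "M \<in> X" for M using that by (simp add: f'_def)
  have shift: "\<forall>x0 x1 x2 x3 x4 z::bit. z = x4 + x3 + x2 + x1 + x0 \<longrightarrow> x4 + z = (x0 + z) + (x1 + z) + (x2 + z) + (x3 + z)"
    by (simp add: all_bit)
  have inX: "p \<in> X" "L0 \<in> X" "L1 \<in> X" "L2 \<in> X" "L3 \<in> X" "L4 \<in> X" unfolding X' by simp_all
  have f'v: "f' p = 0" using f'M[OF inX(1)] by simp
  have f'4: "f' L4 = f' L0 + f' L1 + f' L2 + f' L3"
    unfolding f'M[OF inX(2)] f'M[OF inX(3)] f'M[OF inX(4)] f'M[OF inX(5)] f'M[OF inX(6)]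
    by (rule shift[rule_format, OF fp])
  \<comment> \<open>Partial sums of f' along the orbit, starting with 0 at L0. They close up at L4
    because the full sum is 0.\<close>
  define g where "g = (\<lambda>M. if M = L1 then f' L0 else if M = L2 then f' L0 + f' L1 else if M = L3 then f' L0 + f' L1 + f' L2
    else if M = L4 then f' L0 + f' L1 + f' L2 + f' L3 else 0)"
  have gv: "g p = 0" "g L0 = 0" "g L1 = f' L0" "g L2 = f' L0 + f' L1" "g L3 = f' L0 + f' L1 + f' L2" "g L4 = f' L4"
    using d' f'4 by (auto simp: g_def)
  have lg: "lsupp X g" unfolding lsupp_def X' g_def by simp
  have "(g \<circ> \<sigma> w) + g = f'"
  proof
    fix M
    show "((g \<circ> \<sigma> w) + g) M = f' M"
    proof (cases "M \<in> X")
      case True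
      then consider "M = p" | "M = L0" | "M = L1" | "M = L2" | "M = L3" | "M = L4" unfolding X' by blast
      then show ?thesis
      proof cases
        case 5
        have "\<forall>x z::bit. x + z + x = z" by (simp add: all_bit)
        then have "f' L4 + (f' L0 + f' L1 + f' L2) = f' L3" unfolding f'4 by blast
        then show ?thesis using 5 by (simp add: s gv)
      next
        case 6
        then show ?thesis by (simp add: s gv)
      qed (simp_all add: s p gv f'v)
    next
      case False
      then show ?thesis using lsupp_comp[OF lg w(1)] lg lf' unfolding lsupp_def by simp
    qed
  qed
  then have "j = (inv w \<otimes> E g \<otimes> w) \<otimes> E g"
    using E_add[OF lsupp_comp[OF lg w(1)] lg] E_act[OF lg w(1)] ef' by simp
  then have "w \<otimes> j = w \<otimes> ((inv w \<otimes> E g \<otimes> w) \<otimes> E g)" by simp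
  also have "\<dots> = (w \<otimes> inv w) \<otimes> E g \<otimes> w \<otimes> E g"
    using w(1) E_J[OF lg] by (simp only: m_assoc m_closed inv_closed J_closed)
  also have "\<dots> = inv (E g) \<otimes> w \<otimes> E g" using w(1) E_J[OF lg] by (simp add: J_inv)
  finally show ?thesis using E_J[OF lg] by metis
qed

lemma ex_labelling:
  assumes P: "subgroup P G" "card P = 5"
  obtains y lab where "y \<in> P" "y \<noteq> \<one>" "bij_betw lab (UNIV :: 5 set) {1..5}" "\<And>j. t y (lab j) = lab (j + 1)"
proof -
  have "\<not> P \<subseteq> {\<one>}" using card_mono[of "{\<one>}" P] P(2) by auto
  then obtain y where y: "y \<in> P" "y \<noteq> \<one>" by blast
  have yG: "y \<in> carrier G" using y P subgroup.subset by blast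
  interpret PG: group "G\<lparr>carrier := P\<rparr>" using P(1) by (rule subgroup_imp_group)
  have y5: "y [^] (5::nat) = \<one>"
    using PG.pow_order_eq_1[of y] y P(2) by (simp add: order_def nat_pow_consistent[symmetric])
  have yJ: "y \<notin> J" by (rule order_five_not_in_J[OF yG y5 y(2)])
  let ?q = "t y"
  have five: "?q (?q (?q (?q (?q x)))) = x" for x
  proof -
    have "t (y \<otimes> y \<otimes> y \<otimes> y \<otimes> y) = id" using y5 t_one by (simp add: pow5[OF yG])
    then have "?q \<circ> ?q \<circ> ?q \<circ> ?q \<circ> ?q = id" using yG by (simp add: t_mult)
    then show ?thesis by (metis comp_apply id_apply)
  qed
  have qp: "?q permutes {1..5}" by (rule t_permutes[OF yG])
  have "?q \<noteq> id" using yJ t_eq_id yG by simp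
  then obtain a where a: "?q a \<noteq> a" by (auto simp: fun_eq_iff)
  then have a5: "a \<in> {1..5}" using qp by (auto simp: permutes_def)
  have d: "distinct [a, ?q a, ?q (?q a), ?q (?q (?q a)), ?q (?q (?q (?q a)))]"
    by (rule five_orbit[OF permutes_inj[OF qp] five a])
  define lab where "lab = (\<lambda>j::5. if j = 0 then a else if j = 1 then ?q a else if j = 2 then ?q (?q a)
      else if j = 3 then ?q (?q (?q a)) else ?q (?q (?q (?q a))))"
  have lv: "lab 0 = a" "lab 1 = ?q a" "lab 2 = ?q (?q a)" "lab 3 = ?q (?q (?q a))" "lab 4 = ?q (?q (?q (?q a)))"
    by (simp_all add: lab_def)
  have step: "\<forall>j. ?q (lab j) = lab (j + 1)" unfolding forall_mod5 mod5_adds lv using five by simp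
  have inj: "inj lab"
  proof (rule injI)
    fix i j assume "lab i = lab j"
    then show "i = j" using d by (cases i rule: mod5_cases; cases j rule: mod5_cases) (auto simp: lv)
  qed
  have "\<forall>j. lab j \<in> {1..5}" unfolding forall_mod5 lv using a5 permutes_in_image[OF qp] by blast
  then have "range lab \<subseteq> {1..5}" by blast
  moreover have "card (range lab) = card {1..5::nat}" using card_image[OF inj] by simp
  ultimately have "range lab = {1..5}" by (intro card_subset_eq) simp_all
  then have "bij_betw lab UNIV {1..5}" using inj by (simp add: bij_betw_def)
  then show thesis using that[OF y] step by blast
qed

end

locale labelled_folder = base_action G J X \<sigma> E t J0
  for G :: "('g, 'b) monoid_scheme" (structure) and J :: "'g set" and X :: "'x set" and \<sigma> E t J0 +
  fixes P H :: "'g set" and y c :: 'g and lab :: "5 \<Rightarrow> nat" and c1 c2 :: nat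
  assumes P_subgroup: "subgroup P G" and card_P: "card P = 5"
    and H_def: "H = normalizer G P"
    and y: "y \<in> P" "y \<noteq> \<one>"
    and lab: "bij_betw lab (UNIV :: 5 set) {1..5}"
    and t_y: "\<And>j. t y (lab j) = lab (j + 1)"
    and c: "c \<in> carrier G" "c \<otimes> c = \<one>" "t c = tr c1 c2" "c1 \<in> {1..5}" "c2 \<in> {1..5}" "c1 \<noteq> c2"
begin

lemma y_closed [simp]: "y \<in> carrier G" using y P_subgroup subgroup.subset by blast

lemma P_closed [simp]: "x \<in> P \<Longrightarrow> x \<in> carrier G" using P_subgroup subgroup.subset by blast

lemma P_pow5: "x \<in> P \<Longrightarrow> x [^] (5::nat) = \<one>"
proof -
  assume x: "x \<in> P"
  interpret PG: group "G\<lparr>carrier := P\<rparr>" using P_subgroup by (rule subgroup_imp_group)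
  show ?thesis using PG.pow_order_eq_1[of x] x card_P by (simp add: order_def nat_pow_consistent[symmetric])
qed

lemma P_J: "x \<in> P \<Longrightarrow> x \<in> J \<Longrightarrow> x = \<one>"
  using order_five_not_in_J P_pow5 P_closed by blast

lemma t_y_pow: "t (y [^] (k::nat)) (lab j) = lab (j + of_nat k)"
proof (induction k arbitrary: j)
  case 0 then show ?case by (simp add: t_one)
next
  case (Suc k)
  then show ?case by (simp add: t_mult t_y add.assoc)
qed

lemma pow_in_P: "x \<in> P \<Longrightarrow> x [^] (k::nat) \<in> P"
  by (induction k) (simp_all add: subgroup.one_closed[OF P_subgroup] subgroup.m_closed[OF P_subgroup])

lemma P_powers: "x \<in> P \<Longrightarrow> \<exists>k::nat. x = y [^] k"
proof -
  assume x: "x \<in> P"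
  have inj: "inj_on (\<lambda>k::nat. y [^] k) {..<5}"
  proof (rule inj_onI)
    fix k l :: nat assume kl: "k \<in> {..<5}" "l \<in> {..<5}" "y [^] k = y [^] l"
    then have "lab (0 + of_nat k) = lab (0 + of_nat l)" using t_y_pow by metis
    then have "(of_nat k :: 5) = of_nat l" using lab_inj[OF lab] by simp
    moreover have "k = 0 \<or> k = 1 \<or> k = 2 \<or> k = 3 \<or> k = 4" "l = 0 \<or> l = 1 \<or> l = 2 \<or> l = 3 \<or> l = 4" using kl by auto
    ultimately show "k = l" by (elim disjE) simp_all
  qed
  have finP: "finite P" using card_P card.infinite by fastforce
  have "(\<lambda>k::nat. y [^] k) ` {..<5} = P"
    by (rule card_subset_eq[OF finP]) (use pow_in_P y inj card_P in \<open>auto simp: card_image\<close>)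
  then show ?thesis using x by blast
qed

lemma H_subgroup: "subgroup H G"
proof -
  interpret A: group_action G "{H. H \<subseteq> carrier G}" "\<lambda>g. \<lambda>H\<in>{H. H \<subseteq> carrier G}. g <# H #> inv g"
    by (rule action_by_conjugation_on_power_set)
  show ?thesis unfolding H_def normalizer_def
    by (rule A.stabilizer_subgroup) (use P_subgroup subgroup.subset in blast)
qed

lemma H_closed [simp]: "h \<in> H \<Longrightarrow> h \<in> carrier G" using H_subgroup subgroup.subset by blast

text \<open>The element y generates \<open>P\<close>, so it suffices to follow y under conjugation;
  equality of \<open>P\<close> and its conjugate then follows by counting.\<close>

lemma H_iff: "h \<in> H \<longleftrightarrow> h \<in> carrier G \<and> h \<otimes> y \<otimes> inv h \<in> P"
proof -
  have PG: "P \<subseteq> carrier G" using P_subgroup subgroup.subset by blast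
  have 1: "h \<in> H \<longleftrightarrow> h \<in> carrier G \<and> h <# P #> inv h = P"
    unfolding H_def normalizer_def stabilizer_def using PG by auto
  have 2: "h <# P #> inv h = (\<lambda>x. h \<otimes> x \<otimes> inv h) ` P" for h unfolding l_coset_def r_coset_def by auto
  have "(\<lambda>x. h \<otimes> x \<otimes> inv h) ` P = P" if h: "h \<in> carrier G" "h \<otimes> y \<otimes> inv h \<in> P"
  proof (rule card_subset_eq)
    show "finite P" using card_P card.infinite by fastforce
    show "(\<lambda>x. h \<otimes> x \<otimes> inv h) ` P \<subseteq> P"
    proof (rule image_subsetI)
      fix x assume "x \<in> P"
      then obtain k :: nat where k: "x = y [^] k" using P_powers by blast
      have "h \<otimes> x \<otimes> inv h = (h \<otimes> y \<otimes> inv h) [^] k" unfolding k using conj_pow[OF h(1) y_closed] by simp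
      then show "h \<otimes> x \<otimes> inv h \<in> P" using pow_in_P[OF h(2)] by simp
    qed
    have "inj_on (\<lambda>x. h \<otimes> x \<otimes> inv h) P" by (rule inj_onI) (use h(1) in simp)
    then show "card ((\<lambda>x. h \<otimes> x \<otimes> inv h) ` P) = card P" by (rule card_image)
  qed
  note 3 = this
  show ?thesis
  proof
    assume h: "h \<in> H"
    have "h <# P #> inv h = P" using 1 h by blast
    then have "h \<otimes> y \<otimes> inv h \<in> P" unfolding 2 using imageI[OF y(1), of "\<lambda>x. h \<otimes> x \<otimes> inv h"] by argo
    then show "h \<in> carrier G \<and> h \<otimes> y \<otimes> inv h \<in> P" using H_closed[OF h] by blast
  next
    assume a: "h \<in> carrier G \<and> h \<otimes> y \<otimes> inv h \<in> P"
    then have "h <# P #> inv h = P" unfolding 2 using 3 by blast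
    then show "h \<in> H" using 1 a by blast
  qed
qed

text \<open>From h y = y^k h, increasing a label by 1 before h means increasing it by k afterwards.
  So k is the slope.\<close>

lemma H_affine:
  assumes h: "h \<in> H" shows "affine_on lab (t h)"
proof -
  obtain k :: nat where k: "h \<otimes> y \<otimes> inv h = y [^] k" using h H_iff P_powers by blast
  have hy: "h \<otimes> y = y [^] k \<otimes> h"
  proof -
    have "h \<otimes> y = h \<otimes> y \<otimes> inv h \<otimes> h" using h by (simp add: m_assoc)
    then show ?thesis using k by simp
  qed
  have "t h (lab 0) \<in> {1..5}"
    using permutes_in_image[OF t_permutes[OF H_closed[OF h]]] lab_in[OF lab] by blast
  then obtain b where b: "t h (lab 0) = lab b" by (rule lab_surj[OF lab])
  have step: "t h (lab (j + 1)) = t (y [^] k) (t h (lab j))" for j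
    using arg_cong[OF hy, of t] h by (simp add: t_mult t_y fun_eq_iff) (metis t_y)
  have step': "t h (lab (j + 1)) = lab (i + of_nat k)" if "t h (lab j) = lab i" for i j
    using step[of j] that t_y_pow by simp
  have s1: "t h (lab 1) = lab (b + of_nat k)" using step'[of 0] b by simp
  have s2: "t h (lab 2) = lab (b + of_nat k + of_nat k)" using step'[of 1, OF s1] by simp
  have s3: "t h (lab 3) = lab (b + of_nat k + of_nat k + of_nat k)" using step'[of 2, OF s2] by simp
  have s4: "t h (lab 4) = lab (b + of_nat k + of_nat k + of_nat k + of_nat k)" using step'[of 3, OF s3] by simp
  have "\<forall>j. t h (lab j) = lab (of_nat k * j + b)"
    unfolding forall_mod5 using b s1 s2 s3 s4 by (simp add: algebra_simps)
  moreover have "(of_nat k :: 5) \<noteq> 0"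
  proof
    assume "(of_nat k :: 5) = 0"
    then have "t h (lab 1) = t h (lab 0)" using s1 b by simp
    then have "lab 1 = lab 0" using permutes_inj[OF t_permutes[of h]] h by (auto dest: injD)
    then show False using lab_inj[OF lab] by simp
  qed
  ultimately show ?thesis unfolding affine_on_def by blast
qed

text \<open>A Frattini argument: lift the affine map to some g. Then g y g^-1 and w = y^a agree
  modulo \<open>J\<close>, and by \<open>conjugate_complement\<close> a factor j0 from
  \<open>J\<close> corrects g so that y is sent exactly to w.\<close>

lemma H_lift:
  assumes a: "a \<noteq> 0" shows "\<exists>h\<in>H. \<forall>j. t h (lab j) = lab (a * j + b)"
proof -
  obtain \<pi> where \<pi>: "\<pi> permutes {1..5}" "\<And>j. \<pi> (lab j) = lab (a * j + b)"
    using ex_relabelling[OF lab bij_lab_affine[OF lab a, of b]] by blast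
  obtain g where g: "g \<in> carrier G" "t g = \<pi>" using t_surj[OF \<pi>(1)] by blast
  have "\<exists>k::nat. of_nat k = a"
    by (cases a rule: mod5_cases) (auto intro: exI[of _ 0] exI[of _ 1] exI[of _ 2] exI[of _ 3] exI[of _ 4])
  then obtain k :: nat where k: "of_nat k = a" by blast
  define w where "w = y [^] k"
  have wP: "w \<in> P" unfolding w_def by (rule pow_in_P[OF y(1)])
  have tw: "t w (lab j) = lab (j + a)" for j unfolding w_def t_y_pow k by simp
  have w1: "w \<noteq> \<one>"
  proof
    assume "w = \<one>"
    then have "lab 0 = lab (0 + a)" using tw[of 0] t_one by simp
    then show False using a lab_inj[OF lab] by simp
  qed
  have wG: "w \<in> carrier G" using wP by simp
  define x where "x = g \<otimes> y \<otimes> inv g"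
  have xG: "x \<in> carrier G" using g by (simp add: x_def)
  have "t x = t w"
  proof -
    have "t x \<circ> t g = t w \<circ> t g"
    proof -
      have "x \<otimes> g = g \<otimes> y" unfolding x_def using g by (simp add: m_assoc)
      then have "t x \<circ> t g = t g \<circ> t y" using t_mult[OF xG g(1)] t_mult[OF g(1) y_closed] by simp
      moreover have "t g \<circ> t y = t w \<circ> t g"
      proof
        fix i show "(t g \<circ> t y) i = (t w \<circ> t g) i"
        proof (cases "i \<in> {1..5}")
          case True
          then obtain j where j: "i = lab j" using lab_surj[OF lab] by blast
          show ?thesis unfolding j g(2) comp_apply t_y \<pi>(2) tw by (simp add: algebra_simps)
        next
          case False
          then have "t g i = i" "t y i = i" "t w i = i"
            using permutes_not_in[OF t_permutes] g(1) wG y_closed by blast+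
          then show ?thesis by simp
        qed
      qed
      ultimately show ?thesis by simp
    qed
    then have "t x \<circ> (t g \<circ> t (inv g)) = t w \<circ> (t g \<circ> t (inv g))" by (simp only: comp_assoc[symmetric])
    then show ?thesis using t_inv(2)[OF g(1)] by simp
  qed
  then have jJ: "inv w \<otimes> x \<in> J" using t_eq_iff[OF wG xG] by simp
  have wj: "w \<otimes> (inv w \<otimes> x) = x" using wG xG by (simp add: m_assoc[symmetric])
  have "x [^] (5::nat) = \<one>" unfolding x_def using conj_pow[OF g(1) y_closed, of 5] P_pow5[OF y(1)] g by simp
  then obtain j0 where j0: "j0 \<in> J" "inv j0 \<otimes> w \<otimes> j0 = x"
    using conjugate_complement[OF wG P_pow5[OF wP] _ jJ] P_J[OF wP] w1 wj by auto
  have "(j0 \<otimes> g) \<otimes> y \<otimes> inv (j0 \<otimes> g) = j0 \<otimes> x \<otimes> inv j0"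
    unfolding x_def using j0(1) g by (simp add: inv_mult_group m_assoc)
  also have "\<dots> = (j0 \<otimes> inv j0) \<otimes> w \<otimes> (j0 \<otimes> inv j0)"
    unfolding j0(2)[symmetric] using j0(1) wG by (simp only: m_assoc m_closed inv_closed J_closed)
  also have "\<dots> = w" using j0(1) wG by simp
  finally have "j0 \<otimes> g \<in> H" using H_iff wP j0 g by simp
  moreover have "t (j0 \<otimes> g) = \<pi>" using t_mult[of j0 g] t_eq_id[of j0] j0(1) g by simp
  ultimately show ?thesis using \<pi>(2) by metis
qed

section \<open>The fixed point of P and the intersection of H with J\<close>

definition p0 :: 'x where "p0 = (SOME p. p \<in> X \<and> \<sigma> y p = p \<and> (\<forall>L\<in>X. \<sigma> y L = L \<longrightarrow> L = p) \<and>
    (\<forall>L\<in>X. \<forall>M\<in>X. L \<noteq> p \<longrightarrow> M \<noteq> p \<longrightarrow> (\<exists>k::nat. \<sigma> (y [^] k) L = M)))"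

lemma p0: "p0 \<in> X" "\<sigma> y p0 = p0" "\<And>L. L \<in> X \<Longrightarrow> \<sigma> y L = L \<Longrightarrow> L = p0"
  "\<And>L M. L \<in> X \<Longrightarrow> M \<in> X \<Longrightarrow> L \<noteq> p0 \<Longrightarrow> M \<noteq> p0 \<Longrightarrow> \<exists>k::nat. \<sigma> (y [^] k) L = M"
proof -
  obtain p L where d: "distinct [p, L, \<sigma> y L, \<sigma> y (\<sigma> y L), \<sigma> y (\<sigma> y (\<sigma> y L)), \<sigma> y (\<sigma> y (\<sigma> y (\<sigma> y L)))]"
    and X: "X = {p, L, \<sigma> y L, \<sigma> y (\<sigma> y L), \<sigma> y (\<sigma> y (\<sigma> y L)), \<sigma> y (\<sigma> y (\<sigma> y (\<sigma> y L)))}"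
    and p: "\<sigma> y p = p" and five: "\<And>M. \<sigma> y (\<sigma> y (\<sigma> y (\<sigma> y (\<sigma> y M)))) = M"
    by (rule order_five_orbit[OF y_closed P_pow5[OF y(1)]]) (use P_J y in blast)+
  have orb: "\<exists>k\<le>4. M = (\<sigma> y ^^ k) L" if "M \<in> X" "M \<noteq> p" for M
  proof -
    have "M = (\<sigma> y ^^ 0) L \<or> M = (\<sigma> y ^^ 1) L \<or> M = (\<sigma> y ^^ 2) L \<or> M = (\<sigma> y ^^ 3) L \<or> M = (\<sigma> y ^^ 4) L"
      using that unfolding X by (auto simp: numeral_eq_Suc)
    then show ?thesis by (elim disjE) (auto intro: exI[of _ 0] exI[of _ 1] exI[of _ 2] exI[of _ 3] exI[of _ 4])
  qed
  have "p \<in> X \<and> \<sigma> y p = p \<and> (\<forall>L\<in>X. \<sigma> y L = L \<longrightarrow> L = p) \<and>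
    (\<forall>L\<in>X. \<forall>M\<in>X. L \<noteq> p \<longrightarrow> M \<noteq> p \<longrightarrow> (\<exists>k::nat. \<sigma> (y [^] k) L = M))"
  proof (intro conjI ballI impI)
    show "p \<in> X" unfolding X by simp
    show "\<sigma> y p = p" by (rule p)
    show "M = p" if "M \<in> X" "\<sigma> y M = M" for M
    proof (rule ccontr)
      assume "M \<noteq> p"
      then have "M \<in> {L, \<sigma> y L, \<sigma> y (\<sigma> y L), \<sigma> y (\<sigma> y (\<sigma> y L)), \<sigma> y (\<sigma> y (\<sigma> y (\<sigma> y L)))}" using that X by blast
      then show False using that(2) d five[of L] by (elim insertE emptyE) (auto; metis)+
    qed
    show "\<exists>k::nat. \<sigma> (y [^] k) M1 = M2" if MM: "M1 \<in> X" "M2 \<in> X" "M1 \<noteq> p" "M2 \<noteq> p" for M1 M2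
    proof -
      obtain i where i: "i \<le> 4" "M1 = (\<sigma> y ^^ i) L" using orb[OF MM(1,3)] by blast
      obtain j where j: "M2 = (\<sigma> y ^^ j) L" using orb[OF MM(2,4)] by blast
      have f5: "(\<sigma> y ^^ 5) M = M" for M using five by (simp add: numeral_eq_Suc)
      have "(\<sigma> y ^^ (j + (5 - i))) M1 = (\<sigma> y ^^ (j + (5 - i) + i)) L" unfolding i(2) by (simp only: funpow_add comp_apply)
      also have "j + (5 - i) + i = j + 5" using i by simp
      also have "(\<sigma> y ^^ (j + 5)) L = M2" unfolding j by (simp only: funpow_add comp_apply f5)
      finally show ?thesis using \<sigma>_pow[OF y_closed] by metis
    qed
  qed
  then have "\<exists>p. p \<in> X \<and> \<sigma> y p = p \<and> (\<forall>L\<in>X. \<sigma> y L = L \<longrightarrow> L = p) \<and>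
    (\<forall>L\<in>X. \<forall>M\<in>X. L \<noteq> p \<longrightarrow> M \<noteq> p \<longrightarrow> (\<exists>k::nat. \<sigma> (y [^] k) L = M))" by blast
  from someI_ex[OF this, folded p0_def]
  show "p0 \<in> X" "\<sigma> y p0 = p0" "\<And>L. L \<in> X \<Longrightarrow> \<sigma> y L = L \<Longrightarrow> L = p0"
    "\<And>L M. L \<in> X \<Longrightarrow> M \<in> X \<Longrightarrow> L \<noteq> p0 \<Longrightarrow> M \<noteq> p0 \<Longrightarrow> \<exists>k::nat. \<sigma> (y [^] k) L = M" by blast+
qed

text \<open>The generator of the group of order 2 in which \<open>H\<close> meets \<open>J\<close>.
  Having odd weight it avoids \<open>J0\<close>.\<close>

definition z0 :: 'g where "z0 = E (pt p0)"

lemma z0_J: "z0 \<in> J" unfolding z0_def by (rule E_J[OF lsupp_pt[OF p0(1)]])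

lemma z0_not_J0: "z0 \<notin> J0"
proof -
  have "(\<Sum>L\<in>X. pt p0 L) = 1" using p0(1) finite_X by (simp add: pt_def)
  then show ?thesis unfolding z0_def using odd_not_in_J0[OF lsupp_pt[OF p0(1)]] by simp
qed

lemma z0_H: "z0 \<in> H"
proof -
  have "inv y \<otimes> z0 \<otimes> y = z0" using E_pt_conj[OF p0(1) y_closed] p0(2) unfolding z0_def by simp
  then have "y \<otimes> (inv y \<otimes> z0 \<otimes> y) = y \<otimes> z0" by simp
  then have zy: "z0 \<otimes> y = y \<otimes> z0" using z0_J by (simp add: m_assoc[symmetric])
  have "z0 \<otimes> y \<otimes> inv z0 = y" unfolding zy using z0_J by (simp add: m_assoc)
  then show ?thesis using H_iff z0_J y by simp
qed

text \<open>The commutator of h and y lies in both \<open>P\<close> and \<open>J\<close>, so y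
  centralizes h. A function representing h is then invariant under y on the nose, not merely up to
  constants, because y fixes \<open>p0\<close>. It is therefore constant on the other five
  points.\<close>

lemma H_J: "h \<in> H \<Longrightarrow> h \<in> J \<Longrightarrow> h = \<one> \<or> h = z0"
proof -
  assume h: "h \<in> H" "h \<in> J"
  have "inv y \<otimes> (h \<otimes> y \<otimes> inv h) \<in> P"
    using h H_iff y subgroup.m_closed[OF P_subgroup] subgroup.m_inv_closed[OF P_subgroup] by blast
  moreover have "inv y \<otimes> (h \<otimes> y \<otimes> inv h) = (inv y \<otimes> h \<otimes> y) \<otimes> inv h" using h by (simp add: m_assoc)
  moreover have "(inv y \<otimes> h \<otimes> y) \<otimes> inv h \<in> J" using J_conj[OF h(2) y_closed] J_inv[OF h(2)] J_mult h(2) by simp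
  ultimately have "(inv y \<otimes> h \<otimes> y) \<otimes> inv h = \<one>" using P_J by simp
  then have hy: "inv y \<otimes> h \<otimes> y = h" using h by (metis inv_equality inv_inv J_closed H_closed inv_closed m_closed y_closed)
  obtain f where f: "lsupp X f" "E f = h" using E_surj h by blast
  have lf: "lsupp X (f \<circ> \<sigma> y)" by (rule lsupp_comp[OF f(1) y_closed])
  have "E (f \<circ> \<sigma> y) = E f" using E_act[OF f(1) y_closed] f(2) hy by simp
  moreover have "((f \<circ> \<sigma> y) + f) p0 = 0" using p0(2) by simp
  then have "(f \<circ> \<sigma> y) + f \<noteq> (\<lambda>L. if L \<in> X then 1 else 0)" using p0(1) by (metis zero_neq_one)
  ultimately have "f \<circ> \<sigma> y = f" using E_eq_iff[OF lf f(1)] by blast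
  then have fy: "f (\<sigma> y L) = f L" for L by (metis comp_apply)
  have fyk: "f (\<sigma> (y [^] k) L) = f L" for k :: nat and L
    unfolding \<sigma>_pow[OF y_closed] by (induction k) (simp_all add: fy)
  obtain L where L: "L \<in> X" "L \<noteq> p0" using ex_other_X[of p0 p0 p0 p0] by blast
  have all: "f M = f L" if "M \<in> X" "M \<noteq> p0" for M
    using p0(4)[OF L(1) that(1) L(2) that(2)] fyk by metis
  have out: "f M = 0" if "M \<notin> X" for M using f(1) that unfolding lsupp_def by blast
  have val: "f M = (if M = p0 then f p0 else if M \<in> X then f L else 0)" for M using all out by simp
  have lz: "lsupp X (pt p0)" by (rule lsupp_pt[OF p0(1)])
  have l0: "lsupp X 0" by (simp add: lsupp_def)
  have E0: "E 0 = \<one>" using E_eq_one[OF l0] by blast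
  consider "f p0 = f L" | "f p0 \<noteq> f L" by blast
  then show "h = \<one> \<or> h = z0"
  proof cases
    case 1
    then have v: "f M = (if M \<in> X then f L else 0)" for M using val[of M] p0(1) by simp
    have "f = 0 \<or> f = (\<lambda>L. if L \<in> X then 1 else 0)"
    proof (cases "f L = 0")
      case True
      have "f M = 0" for M using v[of M] True by simp
      then show ?thesis by (simp add: fun_eq_iff)
    next
      case False
      then have one: "f L = 1" by simp
      have "f M = (if M \<in> X then 1 else 0)" for M using v[of M] one by simp
      then show ?thesis by blast
    qed
    then show ?thesis using E_eq_one[OF f(1)] f(2) by blast
  next
    case 2
    have "f = pt p0 \<or> f + pt p0 = (\<lambda>L. if L \<in> X then 1 else 0)"
    proof (cases "f L = 0")
      case True
      then have one: "f p0 = 1" using 2 by simp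
      have "f M = pt p0 M" for M using val[of M] True one by (simp add: pt_def)
      then show ?thesis by blast
    next
      case False
      then have one: "f L = 1" "f p0 = 0" using 2 by simp_all
      have "(f + pt p0) M = (if M \<in> X then 1 else 0)" for M using val[of M] one p0(1) by (simp add: pt_def)
      then show ?thesis by blast
    qed
    then show ?thesis using E_eq_iff[OF f(1) lz] f(2) unfolding z0_def by blast
  qed
qed

lemma H_J0: "h \<in> H \<Longrightarrow> h \<in> J0 \<Longrightarrow> h = \<one>"
  using H_J z0_not_J0 J0_subset_J by blast

text \<open>Each of the 4 * 5 affine maps is lifted to \<open>H\<close> twice, the lifts differing
  by \<open>z0\<close>.\<close>

lemma card_H: assumes fin: "finite (carrier G)" shows "40 \<le> card H"
proof -
  define l where "l a b = (SOME h. h \<in> H \<and> (\<forall>j. t h (lab j) = lab (a * j + b)))" for a b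
  have l: "l a b \<in> H" "t (l a b) (lab j) = lab (a * j + b)" if "a \<noteq> 0" for a b j
    using someI_ex[of "\<lambda>h. h \<in> H \<and> (\<forall>j. t h (lab j) = lab (a * j + b))"] H_lift[OF that, of b] unfolding l_def by blast+
  define F where "F = (\<lambda>(a, b, e). l a b \<otimes> (if e then z0 else \<one>))"
  let ?A = "(UNIV - {0 :: 5}) \<times> (UNIV :: 5 set) \<times> (UNIV :: bool set)"
  have z1: "z0 \<noteq> \<one>" using z0_not_J0 subgroup.one_closed[OF J0_subgroup] by metis
  have inj: "inj_on F ?A"
  proof (rule inj_onI)
    fix u u' assume uu: "u \<in> ?A" "u' \<in> ?A" "F u = F u'"
    obtain a b e a' b' e' where u: "u = (a, b, e)" "u' = (a', b', e')" by (metis prod_cases3)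
    have a: "a \<noteq> 0" "a' \<noteq> 0" and eq: "F (a, b, e) = F (a', b', e')" using uu u by auto
    let ?z = "\<lambda>e. if e then z0 else \<one>"
    have zJ: "?z e \<in> J" for e using z0_J J_one by simp
    have "t (F (a, b, e)) = t (l a b)" if "a \<noteq> 0" for a b e
      unfolding F_def using t_mult[of "l a b" "?z e"] t_eq_id[of "?z e"] zJ[of e] l(1)[OF that, of b] by simp
    then have tt: "t (l a b) = t (l a' b')" using a eq by metis
    then have e: "a * j + b = a' * j + b'" for j
      using l(2)[OF a(1), of b j] l(2)[OF a(2), of b' j] lab_inj[OF lab] by metis
    have b: "b = b'" using e[of 0] by simp
    have a': "a = a'" using e[of 1] b by simp
    have "?z e = ?z e'" using eq l(1)[OF a(1), of b] zJ[of e] zJ[of e'] unfolding F_def a' b by (simp del: if_split)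
    then have "e = e'" using z1 by (auto split: if_splits)
    then show "u = u'" using a' b u by simp
  qed
  have "F ` ?A \<subseteq> H"
  proof (rule image_subsetI)
    fix u :: "5 \<times> 5 \<times> bool" assume uA: "u \<in> ?A"
    obtain a b e where u: "u = (a, b, e)" by (rule prod_cases3)
    have "l a b \<in> H" using uA u l(1) by auto
    moreover have "(if e then z0 else \<one>) \<in> H" using z0_H subgroup.one_closed[OF H_subgroup] by simp
    ultimately show "F u \<in> H" unfolding u F_def using subgroup.m_closed[OF H_subgroup] by simp
  qed
  moreover have "card ?A = 40" by (simp add: card_cartesian_product card_Diff_subset)
  moreover have "finite H" using fin finite_subset H_subgroup subgroup.subset by metis
  ultimately show ?thesis using card_image[OF inj] card_mono by metis
qed

section \<open>Conjugates of c acting on J\<close>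

lemma conj_c_fixed_free:
  assumes a: "a \<in> conjugacy_class G c" and L: "L \<in> X"
  shows "\<sigma> a L \<noteq> L" "a \<in> carrier G" "a \<otimes> a = \<one>"
proof -
  obtain g where g: "g \<in> carrier G" "a = inv g \<otimes> c \<otimes> g" using a by (auto simp: conjugacy_class_def)
  have sa: "\<sigma> a L = \<sigma> (inv g) (\<sigma> c (\<sigma> g L))" unfolding g(2) using g(1) c by (simp add: \<sigma>_mult)
  have gg: "\<sigma> g (\<sigma> (inv g) M) = M" for M
    using \<sigma>_mult[OF g(1) inv_closed[OF g(1)]] \<sigma>_J[OF J_one] g(1) by (simp add: fun_eq_iff)
  show "\<sigma> a L \<noteq> L"
  proof
    assume "\<sigma> a L = L"
    then have "\<sigma> c (\<sigma> g L) = \<sigma> g L" using sa gg by metis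
    then show False using transposition_fixed_free[OF c(1,3-6)] \<sigma>_in[OF g(1)] L by blast
  qed
  show "a \<in> carrier G" using g c by simp
  have "a \<otimes> a = inv g \<otimes> (c \<otimes> (g \<otimes> inv g) \<otimes> c) \<otimes> g" unfolding g(2) using g(1) c(1) by (simp only: m_assoc m_closed inv_closed)
  then show "a \<otimes> a = \<one>" using g(1) c(1,2) by simp
qed

text \<open>Conjugates of c move all six points. With q = \<open>p0\<close> this prevents products
  of such conjugates from giving \<open>z0\<close>.\<close>

lemma conj_c_not_centralizes_z0:
  assumes a: "a \<in> conjugacy_class G c" and q: "q \<in> X"
  shows "inv a \<otimes> E (pt q) \<otimes> a \<noteq> E (pt q)"
proof
  note ca = conj_c_fixed_free[OF a q]
  assume e: "inv a \<otimes> E (pt q) \<otimes> a = E (pt q)"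
  have "\<sigma> a (\<sigma> a q) = q" using \<sigma>_mult[OF ca(2) ca(2)] ca(3) \<sigma>_J[OF J_one] by (metis comp_apply id_apply)
  moreover have "\<sigma> a q \<in> X" using \<sigma>_in[OF ca(2)] q by simp
  ultimately have "inv a \<otimes> E (pt q) \<otimes> a = E (pt (\<sigma> a q))" using E_pt_conj[of "\<sigma> a q" a] ca(2) by simp
  then show False using e E_pt_eq_iff[OF q \<open>\<sigma> a q \<in> X\<close>] ca(1) by simp
qed

text \<open>A nontrivial v in \<open>J0\<close> is a sum of two points, and conjugation moves one of
  them to \<open>p0\<close>. So v' comes from {p0, q} and v' z0 from {q}. No conjugate of c
  centralizes the latter. One that centralizes v' must swap \<open>p0\<close> and q, and c and its
  conjugate by y cannot both do this, since y fixes \<open>p0\<close> but not q. Both v' and v' z0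
  are needed because \<open>H\<close> meets \<open>J\<close> in {1, z0}.\<close>

lemma J0_not_nearly_central:
  assumes v: "v \<in> J0" "v \<noteq> \<one>"
  shows "\<exists>g\<in>carrier G. \<exists>a\<in>conjugacy_class G c. let v' = inv g \<otimes> v \<otimes> g in
     inv a \<otimes> v' \<otimes> a \<noteq> v' \<and> inv a \<otimes> (v' \<otimes> z0) \<otimes> a \<noteq> v' \<otimes> z0"
proof -
  obtain f0 where f0: "lsupp X f0" "E f0 = v" "(\<Sum>L\<in>X. f0 L) = 0" using J0_even[OF v(1)] by blast
  have nz: "f0 \<noteq> 0" "f0 \<noteq> (\<lambda>L. if L \<in> X then 1 else 0)" using E_eq_one[OF f0(1)] f0(2) v(2) by auto
  define S where "S = {L \<in> X. f0 L = 1}"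
  have SX: "S \<subseteq> X" "finite S" using finite_X by (auto simp: S_def)
  have f0S: "f0 L = (if L \<in> S then 1 else 0)" for L
    using f0(1) unfolding S_def lsupp_def by (cases "f0 L") auto
  have "(\<Sum>L\<in>X. f0 L) = of_nat (card S)"
    unfolding f0S using SX finite_X by (simp add: sum.If_cases Int_absorb1)
  then have c0: "of_nat (card S) = (0 :: bit)" using f0(3) by simp
  have ev: "even (card S)"
  proof (rule ccontr)
    assume "odd (card S)"
    then obtain k where "card S = 2 * k + 1" by (rule oddE)
    then show False using c0 by simp
  qed
  have "S \<noteq> {}" using nz(1) f0S by (auto simp: fun_eq_iff)
  then have S0: "card S \<noteq> 0" using SX by simp
  have "S \<noteq> X" using nz(2) f0S by auto
  then have "card S < 6" using psubset_card_mono[OF finite_X] SX card_X by (metis psubsetI)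
  then have "card S = 2 \<or> card S = 4" using ev S0 by presburger
  then obtain q1 q2 where q: "q1 \<in> X" "q2 \<in> X" "q1 \<noteq> q2" "v = E (pt q1 + pt q2)"
  proof
    assume "card S = 2"
    then obtain a b where ab: "S = {a, b}" "a \<noteq> b" by (auto simp: card_2_iff)
    have "f0 = pt a + pt b" using ab by (auto simp: fun_eq_iff f0S pt_def)
    then show thesis using that[of a b] ab SX f0 by auto
  next
    \<comment> \<open>Adding the all-one function replaces the four-set by its complement of two
      points without changing the element of \<open>J\<close>.\<close>
    assume "card S = 4"
    then have "card (X - S) = 2" using card_Diff_subset[OF SX(2,1)] card_X by simp
    then obtain a b where ab: "X - S = {a, b}" "a \<noteq> b" by (auto simp: card_2_iff)
    have abX: "a \<in> X" "b \<in> X" using ab by blast+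
    have l2: "lsupp X (pt a + pt b)" by (intro lsupp_add lsupp_pt abX)
    have "(f0 + (pt a + pt b)) L = (if L \<in> X then 1 else 0)" for L
    proof -
      have "L \<in> X \<longleftrightarrow> L \<in> S \<or> L = a \<or> L = b" "L \<in> S \<Longrightarrow> L \<noteq> a \<and> L \<noteq> b" using ab SX by blast+
      then show ?thesis using ab(2) by (auto simp: f0S pt_def)
    qed
    then have "f0 + (pt a + pt b) = (\<lambda>L. if L \<in> X then 1 else 0)" by blast
    then have "E f0 = E (pt a + pt b)" using E_eq_iff[OF f0(1) l2] by blast
    then show thesis using that[of a b] abX ab f0 by auto
  qed
  have "\<exists>g\<in>carrier G. \<sigma> g p0 = q1"
  proof (cases "q1 = p0")
    case True
    then show ?thesis using \<sigma>_J[OF J_one] by (intro bexI[of _ \<one>]) simp_all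
  next
    case False
    have cp: "\<sigma> c p0 \<noteq> p0" "\<sigma> c p0 \<in> X"
      using transposition_fixed_free[OF c(1,3-6) p0(1)] \<sigma>_in[OF c(1)] p0(1) by auto
    then obtain k :: nat where "\<sigma> (y [^] k) (\<sigma> c p0) = q1" using p0(4) q(1) False by blast
    then have "\<sigma> (y [^] k \<otimes> c) p0 = q1" using c(1) by (simp add: \<sigma>_mult)
    then show ?thesis using c(1) by (intro bexI[of _ "y [^] k \<otimes> c"]) simp_all
  qed
  then obtain g where g: "g \<in> carrier G" "\<sigma> g p0 = q1" by blast
  obtain q where qq: "q2 = \<sigma> g q" using permutes_surj[OF \<sigma>_permutes[OF g(1)]] by (metis surjD)
  have qX: "q \<in> X" using qq q(2) \<sigma>_in[OF g(1)] by simp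
  have qp: "q \<noteq> p0" using qq g q(3) by blast
  define v' where "v' = inv g \<otimes> v \<otimes> g"
  have lpq: "lsupp X (pt p0 + pt q)" by (intro lsupp_add lsupp_pt p0(1) qX)
  have v': "v' = E (pt p0 + pt q)"
  proof -
    have "v' = E ((pt q1 + pt q2) \<circ> \<sigma> g)"
      unfolding v'_def q(4) by (rule E_act[symmetric]) (intro lsupp_add lsupp_pt q g)+
    also have "(pt q1 + pt q2) \<circ> \<sigma> g = pt p0 + pt q"
      using pt_comp[OF g(1), of p0] pt_comp[OF g(1), of q] unfolding g(2) qq by (simp add: add_comp)
    finally show ?thesis .
  qed
  have v'z: "v' \<otimes> z0 = E (pt q)"
  proof -
    have "v' \<otimes> z0 = E ((pt p0 + pt q) + pt p0)" unfolding v' z0_def by (rule E_add[symmetric, OF lpq lsupp_pt[OF p0(1)]])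
    also have "(pt p0 + pt q) + pt p0 = pt q" by (simp add: fun_eq_iff pt_def)
    finally show ?thesis .
  qed
  \<comment> \<open>Invariance modulo constants becomes true invariance: the sum of the function and
    its image vanishes at one of the six points, since it is supported on at most four.\<close>
  have moved: "\<sigma> a p0 = q" if a: "a \<in> conjugacy_class G c" and e: "inv a \<otimes> v' \<otimes> a = v'" for a
  proof -
    note ca = conj_c_fixed_free[OF a]
    have aG: "a \<in> carrier G" using ca p0(1) by blast
    have "E ((pt p0 + pt q) \<circ> \<sigma> a) = E (pt p0 + pt q)" using E_act[OF lpq aG] e unfolding v' by simp
    moreover have "((pt p0 + pt q) \<circ> \<sigma> a) + (pt p0 + pt q) \<noteq> (\<lambda>L. if L \<in> X then 1 else 0)"
    proof -
      obtain p' where p': "p0 = \<sigma> a p'" using permutes_surj[OF \<sigma>_permutes[OF aG]] by (metis surjD)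
      obtain q' where q': "q = \<sigma> a q'" using permutes_surj[OF \<sigma>_permutes[OF aG]] by (metis surjD)
      obtain L where L: "L \<in> X" "L \<notin> {p0, q, p', q'}" using ex_other_X by metis
      have "(((pt p0 + pt q) \<circ> \<sigma> a) + (pt p0 + pt q)) L = 0"
        using L p' q' \<sigma>_inj[OF aG] by (auto simp: pt_def)
      then show ?thesis using L(1) by (metis zero_neq_one)
    qed
    ultimately have "(pt p0 + pt q) \<circ> \<sigma> a = pt p0 + pt q"
      using E_eq_iff[OF lsupp_comp[OF lpq aG] lpq] by blast
    then have "((pt p0 + pt q) \<circ> \<sigma> a) p0 = (pt p0 + pt q) p0" by simp
    then show ?thesis using qp ca(1)[OF p0(1)] by (auto simp: pt_def split: if_splits)
  qed
  let ?a1 = c and ?a2 = "inv y \<otimes> c \<otimes> y"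
  have a1: "c \<in> conjugacy_class G c" using conjugacy_classI[of \<one> G c] c(1) by simp
  have a2: "?a2 \<in> conjugacy_class G c" by (rule conjugacy_classI[OF y_closed])
  have "\<exists>a\<in>conjugacy_class G c. inv a \<otimes> v' \<otimes> a \<noteq> v'"
  proof (rule ccontr)
    assume "\<not> ?thesis"
    then have "\<sigma> c p0 = q" "\<sigma> ?a2 p0 = q" using moved a1 a2 by blast+
    then have "\<sigma> (inv y) q = q" using c(1) p0(2) by (simp add: \<sigma>_mult)
    then have "\<sigma> y q = q"
      using \<sigma>_mult[OF y_closed inv_closed[OF y_closed]] \<sigma>_J[OF J_one] by (metis comp_apply id_apply r_inv y_closed)
    then show False using p0(3)[OF qX] qp by simp
  qed
  then obtain a where a: "a \<in> conjugacy_class G c" "inv a \<otimes> v' \<otimes> a \<noteq> v'" by blast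
  then have "inv a \<otimes> (v' \<otimes> z0) \<otimes> a \<noteq> v' \<otimes> z0" unfolding v'z using conj_c_not_centralizes_z0[OF a(1) qX] by simp
  then show ?thesis using a g(1) unfolding v'_def Let_def by blast
qed

end

subsection \<open>Powers of modules\<close>

lemma conjugacy_classE:
  assumes "x \<in> conjugacy_class G c"
  obtains g where "g \<in> carrier G" "x = inv\<^bsub>G\<^esub> g \<otimes>\<^bsub>G\<^esub> c \<otimes>\<^bsub>G\<^esub> g"
  using assms unfolding conjugacy_class_def by blast

lemma mod_power_add:
  assumes "\<And>x z. x \<in> M \<Longrightarrow> z \<in> M \<Longrightarrow> x + z \<in> M" "u \<in> mod_power k M" "v \<in> mod_power k M"
  shows "u + v \<in> mod_power k M"
  using assms by (auto simp: mod_power_def)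

lemma card_mod_power: "finite M \<Longrightarrow> finite (mod_power k M) \<and> card (mod_power k M) = card M ^ k"
proof -
  assume M: "finite M"
  have bb: "bij_betw (\<lambda>u. restrict u {..<k}) (mod_power k M) (PiE {..<k} (\<lambda>_. M))"
  proof (rule bij_betw_byWitness[where f' = "\<lambda>f i. if i < k then f i else 0"])
    show "\<forall>a\<in>mod_power k M. (\<lambda>i. if i < k then restrict a {..<k} i else 0) = a"
      by (auto simp: mod_power_def fun_eq_iff)
    show "\<forall>a'\<in>{..<k} \<rightarrow>\<^sub>E M. restrict (\<lambda>i. if i < k then a' i else 0) {..<k} = a'"
      by (auto simp: fun_eq_iff PiE_iff extensional_def)
    show "(\<lambda>u. restrict u {..<k}) ` mod_power k M \<subseteq> PiE {..<k} (\<lambda>_. M)"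
      by (rule image_subsetI) (simp add: mod_power_def)
    show "(\<lambda>f i. if i < k then f i else 0) ` PiE {..<k} (\<lambda>_. M) \<subseteq> mod_power k M"
      by (rule image_subsetI) (simp add: mod_power_def PiE_iff)
  qed
  have "finite (PiE {..<k} (\<lambda>_. M))" by (rule finite_PiE) (use M in simp_all)
  moreover have "card (PiE {..<k} (\<lambda>_. M)) = card M ^ k" by (simp add: card_PiE)
  ultimately show ?thesis using bij_betw_finite[OF bb] bij_betw_same_card[OF bb] by simp
qed

lemma copy_at_same [simp]: "copy_at s x s = x" and copy_at_other: "i \<noteq> s \<Longrightarrow> copy_at s x i = 0"
  by (simp_all add: copy_at_def)

lemma copy_at_add: "copy_at s x + copy_at s z = copy_at s (x + z)"
  by (simp add: copy_at_def fun_eq_iff)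

lemma copy_at_0: "copy_at s 0 = 0"
  by (simp add: copy_at_def fun_eq_iff)

lemma copy_at_inj: "copy_at s x = copy_at s z \<longleftrightarrow> x = z"
  by (metis copy_at_same)

lemma copy_at_eqI: "(\<And>i. i \<noteq> s \<Longrightarrow> w i = 0) \<Longrightarrow> w = copy_at s (w s)"
  by (auto simp: copy_at_def fun_eq_iff)

lemma power_act_copy_at: "power_act (copy_at s x) p = copy_at s (U_act x p)"
  by (auto simp: power_act_def copy_at_def fun_eq_iff)

lemma copy_at_mod_power: "s < k \<Longrightarrow> 0 \<in> M \<Longrightarrow> copy_at s x \<in> mod_power k M \<longleftrightarrow> x \<in> M"
  by (auto simp: mod_power_def copy_at_def)

lemma fun_U_add_self [simp]: "(u :: nat \<Rightarrow> U_elt) + u = 0"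
  by (rule ext) simp

lemma U_add_eq_0: "(x :: U_elt) + z = 0 \<longleftrightarrow> x = z"
  by (metis U_add_self add_right_cancel)

lemma fun_U_add_eq_0: "(u :: nat \<Rightarrow> U_elt) + v = 0 \<longleftrightarrow> u = v"
  by (metis fun_U_add_self add_right_cancel)

lemma S_set_cases:
  assumes "x \<in> S_set"
  obtains "x = 0" | a where "a \<in> {1..5}" "x = (covec a, covec a) \<or> x = (covec a, 0) \<or> x = (0, covec a)"
  using assms unfolding S_set_eq by auto

lemma S_set_0: "0 \<in> S_set"
  by (simp add: S_set_def)

lemma S_sub_U: "S_set \<subseteq> U_mod"
proof
  fix x assume "x \<in> S_set"
  then show "x \<in> U_mod"
    by (cases rule: S_set_cases) (use U_mod_0 covec_in_N in \<open>auto simp: U_mod_def\<close>)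
qed

lemma S_set_act:
  assumes x: "x \<in> S_set" and p: "p permutes {1..5}"
  shows "U_act x p \<in> S_set"
  using x
proof (cases rule: S_set_cases)
  case 1 then show ?thesis using S_set_0 by simp
next
  case (2 a)
  obtain b where b: "p b = a" using p by (metis permutes_def)
  then have b5: "b \<in> {1..5}" using permutes_in_image[OF p, of b] 2 by simp
  have "covec a \<circ> p = covec b" using covec_comp[OF p, of b] b by simp
  then have "U_act x p \<in> {(covec b, covec b), (covec b, 0), (0, covec b)}" using 2(2) by (auto simp: U_act_def)
  then show ?thesis unfolding S_set_eq using b5 by blast
qed

lemma covec_nonzero: "covec a \<noteq> 0"
proof
  assume z: "covec a = 0"
  have "covec a 1 = 0" "covec a 2 = 0" unfolding z by simp_all
  then show False by (auto simp: covec_def split: if_splits)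
qed

lemma card_S_set: "card S_set = 16" and finite_S_set: "finite S_set"
proof -
  let ?B = "\<lambda>a. {(covec a, covec a), (covec a, 0), (0, covec a)}"
  have "card (\<Union>a\<in>{1..5}. ?B a) = (\<Sum>a\<in>{1..5::nat}. card (?B a))"
  proof (rule card_UN_disjoint)
    show "\<forall>i\<in>{1..5}. \<forall>j\<in>{1..5}. i \<noteq> j \<longrightarrow> ?B i \<inter> ?B j = {}"
      using covec_inj covec_nonzero by (auto; metis)
  qed auto
  also have "\<dots> = (\<Sum>a\<in>{1..5::nat}. 3)"
  proof (rule sum.cong[OF refl])
    fix a :: nat show "card (?B a) = 3" using covec_nonzero[of a] by auto
  qed
  finally have 15: "card (\<Union>a\<in>{1..5}. ?B a) = 15" by simp
  have "0 \<notin> (\<Union>a\<in>{1..5}. ?B a)" using covec_nonzero by (auto simp: zero_prod_def)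
  then show "card S_set = 16" unfolding S_set_eq using 15 by simp
  show "finite S_set" unfolding S_set_eq by simp
qed

lemma W_tilde_cases:
  assumes "w \<in> W_tilde k s"
  obtains "w \<in> mod_power k W_mod" "w \<notin> copy_at s ` W_mod" | x where "x \<in> S_set" "w = copy_at s x"
  using assms unfolding W_tilde_def by blast

text \<open>S has as many elements as W, and the copy of S at s meets the rest of W^k in nothing, so
  the exchange does not alter the size.\<close>

lemma card_W_tilde:
  assumes "s < k" shows "card (W_tilde k s) = 16 ^ k" and "finite (W_tilde k s)"
proof -
  have inj: "inj (copy_at s)" by (rule injI) (simp add: copy_at_inj)
  have finW: "finite W_mod" using W_sub_U finite_U_mod finite_subset by blast
  note fin = card_mod_power[OF finW, of k]
  have sub: "copy_at s ` W_mod \<subseteq> mod_power k W_mod" using copy_at_mod_power[OF assms W_mod_0] by auto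
  have disj: "(mod_power k W_mod - copy_at s ` W_mod) \<inter> copy_at s ` S_set = {}"
    using copy_at_mod_power[OF assms W_mod_0] by auto
  have cW: "card (copy_at s ` W_mod) = 16" using card_image[OF inj_on_subset[OF inj]] card_W_mod by simp
  have cS: "card (copy_at s ` S_set) = 16" using card_image[OF inj_on_subset[OF inj]] card_S_set by simp
  have "card (mod_power k W_mod - copy_at s ` W_mod) = 16 ^ k - 16"
    using card_Diff_subset[OF finite_imageI[OF finW] sub] fin cW card_W_mod by simp
  moreover have "(16::nat) \<le> 16 ^ k" using assms by (intro self_le_power) auto
  ultimately show "card (W_tilde k s) = 16 ^ k"
    unfolding W_tilde_def using card_Un_disjoint[OF _ _ disj] fin cS finite_S_set by simp
  show "finite (W_tilde k s)" unfolding W_tilde_def using fin finite_S_set by simp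
qed

subsection \<open>The loop folder\<close>

text \<open>There are two labellings of the five points: \<open>lab\<close> follows the generator of
  \<open>P\<close>, and \<open>lb\<close> is adapted to \<open>T1\<close>. The group
  \<open>H\<close> acts by affine maps in both.\<close>

locale script_folder = labelled_folder G J X \<sigma> E t J0 P H y c lab c1 c2
  for G :: "('g, 'b) monoid_scheme" (structure) and J :: "'g set" and X :: "'x set" and \<sigma> E t J0 P H y c lab c1 c2 +
  fixes k s :: nat and T1 :: "U_elt set" and \<psi> :: "'g \<Rightarrow> nat \<Rightarrow> U_elt" and lb :: "5 \<Rightarrow> nat"
  assumes finite_G: "finite (carrier G)" and order_G: "order G = 3840" and card_J: "card J = 32"
    and s: "s < k"
    and omega: "omega_graph lb T1"
    and H_affine_lb: "\<And>h. h \<in> H \<Longrightarrow> affine_on lb (t h)"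
    and T1_0: "0 \<in> T1" and T1_add: "\<And>x z. x \<in> T1 \<Longrightarrow> z \<in> T1 \<Longrightarrow> x + z \<in> T1"
    and T1_act: "\<And>x h. x \<in> T1 \<Longrightarrow> h \<in> H \<Longrightarrow> U_act x (t h) \<in> T1"
    and \<psi>_bij: "bij_betw \<psi> J0 (copy_at s ` T1)"
    and \<psi>_mult: "\<And>v w. v \<in> J0 \<Longrightarrow> w \<in> J0 \<Longrightarrow> \<psi> (v \<otimes> w) = \<psi> v + \<psi> w"
    and \<psi>_act: "\<And>v h. v \<in> J0 \<Longrightarrow> h \<in> H \<Longrightarrow> \<psi> (inv h \<otimes> v \<otimes> h) = power_act (\<psi> v) (t h)"
begin

abbreviation UU where "UU \<equiv> mod_power k U_mod"
abbreviation act where "act u g \<equiv> power_act u (t g)"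
definition GG where "GG = semidirect G UU (\<lambda>u g. act u g)"
definition HH where "HH = (\<lambda>h. (h, 0)) ` H <#>\<^bsub>GG\<^esub> script_T J0 T1 \<psi> k s"
definition KK where "KK = conjugacy_class GG (c, 0) \<union> J0 \<times> W_tilde k s"

lemma lb: "bij_betw lb UNIV {1..5}" by (rule omega_graph_lab[OF omega])

lemma T1_sub: "T1 \<subseteq> U_mod"
  using omega_graphD(1,2)[OF omega] by (auto simp: U_mod_def)

lemma carrier_GG: "carrier GG = carrier G \<times> UU" by (simp add: GG_def semidirect_def)

lemma mult_GG: "(g, u) \<otimes>\<^bsub>GG\<^esub> (h, v) = (g \<otimes> h, act u h + v)" by (simp add: GG_def semidirect_def)

lemma one_GG: "\<one>\<^bsub>GG\<^esub> = (\<one>, 0)" by (simp add: GG_def semidirect_def)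

lemma act_add: "act (u + v) g = act u g + act v g" by (simp add: power_act_def U_act_add fun_eq_iff)

lemma act_0 [simp]: "act 0 g = 0" by (simp add: power_act_def fun_eq_iff)

lemma act_id: "t g = id \<Longrightarrow> act u g = u" by (simp add: power_act_def)

lemma act_J: "j \<in> J \<Longrightarrow> act u j = u" using t_eq_id[of j] act_id by simp

lemma act_act: "g \<in> carrier G \<Longrightarrow> h \<in> carrier G \<Longrightarrow> act (act u g) h = act u (g \<otimes> h)"
  by (simp only: power_act_def t_mult U_act_comp[OF t_permutes t_permutes])

lemma act_UU: "u \<in> UU \<Longrightarrow> g \<in> carrier G \<Longrightarrow> act u g \<in> UU"
  by (auto simp: mod_power_def power_act_def U_mod_act[OF _ t_permutes])

lemma UU_add: "u \<in> UU \<Longrightarrow> v \<in> UU \<Longrightarrow> u + v \<in> UU" by (rule mod_power_add[OF U_mod_add])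

lemma UU_0: "0 \<in> UU" by (simp add: mod_power_def U_mod_0)

lemma group_GG: "group GG"
proof (rule groupI)
  fix x z assume "x \<in> carrier GG" "z \<in> carrier GG"
  then show "x \<otimes>\<^bsub>GG\<^esub> z \<in> carrier GG" by (auto simp: carrier_GG mult_GG act_UU UU_add)
next
  show "\<one>\<^bsub>GG\<^esub> \<in> carrier GG" by (simp add: carrier_GG one_GG UU_0)
next
  fix x z w assume "x \<in> carrier GG" "z \<in> carrier GG" "w \<in> carrier GG"
  then show "x \<otimes>\<^bsub>GG\<^esub> z \<otimes>\<^bsub>GG\<^esub> w = x \<otimes>\<^bsub>GG\<^esub> (z \<otimes>\<^bsub>GG\<^esub> w)"
    by (auto simp: carrier_GG mult_GG m_assoc act_add act_act add.assoc)
next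
  fix x assume x: "x \<in> carrier GG"
  then show "\<one>\<^bsub>GG\<^esub> \<otimes>\<^bsub>GG\<^esub> x = x" by (auto simp: carrier_GG mult_GG one_GG)
  obtain g u where gu: "x = (g, u)" "g \<in> carrier G" "u \<in> UU" using x by (auto simp: carrier_GG)
  have "(inv g, act u (inv g)) \<otimes>\<^bsub>GG\<^esub> x = \<one>\<^bsub>GG\<^esub>"
    using gu by (simp add: mult_GG one_GG act_act act_J[OF J_one])
  then show "\<exists>z\<in>carrier GG. z \<otimes>\<^bsub>GG\<^esub> x = \<one>\<^bsub>GG\<^esub>"
    using gu by (intro bexI[of _ "(inv g, act u (inv g))"]) (auto simp: carrier_GG act_UU)
qed

sublocale GG: group GG by (rule group_GG)

lemma inv_GG: "g \<in> carrier G \<Longrightarrow> u \<in> UU \<Longrightarrow> inv\<^bsub>GG\<^esub> (g, u) = (inv g, act u (inv g))"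
  by (rule GG.inv_equality) (auto simp: mult_GG one_GG act_act act_J[OF J_one] carrier_GG act_UU)

lemma conj_GG:
  assumes "g \<in> carrier G" "u \<in> UU" "h \<in> carrier G" "v \<in> UU"
  shows "inv\<^bsub>GG\<^esub> (h, v) \<otimes>\<^bsub>GG\<^esub> (g, u) \<otimes>\<^bsub>GG\<^esub> (h, v) = (inv h \<otimes> g \<otimes> h, act v (inv h \<otimes> g \<otimes> h) + act u h + v)"
  using assms by (simp add: inv_GG mult_GG act_add act_act m_assoc)

lemma finite_GG: "finite (carrier GG)" and order_GG: "order GG = 3840 * 256 ^ k"
proof -
  note f = card_mod_power[OF finite_U_mod, of k]
  then show "finite (carrier GG)" by (simp add: carrier_GG finite_G)
  show "order GG = 3840 * 256 ^ k"
    using f order_G by (simp add: order_def carrier_GG card_cartesian_product card_U_mod)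
qed

section \<open>The conjugacy class of c in the semidirect product\<close>

abbreviation cG where "cG \<equiv> conjugacy_class G c"

lemma cG_closed [simp]: "a \<in> cG \<Longrightarrow> a \<in> carrier G"
  using c(1) by (auto elim!: conjugacy_classE)

lemma cG_square: "a \<in> cG \<Longrightarrow> a \<otimes> a = \<one>"
  using conj_c_fixed_free(3) p0(1) by blast

lemma cG_inv: "a \<in> cG \<Longrightarrow> inv a = a"
  using cG_square inv_equality by simp

lemma evenperm_t_inv: "g \<in> carrier G \<Longrightarrow> evenperm (t (inv g)) \<longleftrightarrow> evenperm (t g)"
  using evenperm_compose_1_5[OF t_permutes[of "inv g"] t_permutes[of g]] t_inv(1)[of g] by (simp add: evenperm_id)

lemma evenperm_t_mult: "g \<in> carrier G \<Longrightarrow> h \<in> carrier G \<Longrightarrow> evenperm (t (g \<otimes> h)) \<longleftrightarrow> evenperm (t g) = evenperm (t h)"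
  by (simp only: t_mult evenperm_compose_1_5[OF t_permutes t_permutes])

lemma cG_transposition:
  assumes a: "a \<in> cG"
  obtains p q where "p \<in> {1..5}" "q \<in> {1..5}" "p \<noteq> q" "t a = tr p q"
proof -
  obtain g where g: "g \<in> carrier G" "a = inv g \<otimes> c \<otimes> g" using a by (rule conjugacy_classE)
  have "\<not> evenperm (t c)" using c by (simp add: evenperm_swap)
  then have "\<not> evenperm (t a)" unfolding g(2) using g(1) c(1) by (simp add: evenperm_t_mult evenperm_t_inv)
  moreover have "t a \<circ> t a = id" using t_mult[of a a] a cG_square[OF a] t_one by simp
  ultimately show thesis using that odd_involution_1_5[OF t_permutes[of a]] a by auto
qed

lemma cG_odd: "a \<in> cG \<Longrightarrow> \<not> evenperm (t a)"
  by (rule cG_transposition) (auto simp: evenperm_swap)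

lemma cG_t_square: "a \<in> cG \<Longrightarrow> t a \<circ> t a = id"
  using t_mult[of a a] cG_square[of a] t_one by simp

text \<open>The fixed vectors of a in U^k. Being odd, \<open>t a\<close> swaps the two summands of
  U, which accounts for the shape of the equation.\<close>

definition CC where "CC a = {w \<in> UU. \<forall>i. snd (w i) = fst (w i) \<circ> t a}"

lemma U_act_odd: "\<not> evenperm p \<Longrightarrow> U_act x p = (snd x \<circ> p, fst x \<circ> p)"
  by (simp add: U_act_def)

text \<open>Because a swaps the two summands, the kernel and the image of 1 + a coincide. A preimage
  keeps the first components of w and has second components 0.\<close>

lemma CC_iff:
  assumes a: "a \<in> cG"
  shows "w \<in> CC a \<longleftrightarrow> (\<exists>v\<in>UU. w = act v a + v)"
proof
  assume w: "w \<in> CC a"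
  define v where "v i = (fst (w i), 0 :: nat \<Rightarrow> bit)" for i
  have "v \<in> UU" using w by (auto simp: CC_def mod_power_def U_mod_def v_def zero_prod_def)
  moreover have "w = act v a + v"
  proof
    fix i
    have "snd (w i) = fst (w i) \<circ> t a" using w by (auto simp: CC_def)
    then show "w i = (act v a + v) i" by (simp add: power_act_def U_act_odd[OF cG_odd[OF a]] v_def prod_eq_iff)
  qed
  ultimately show "\<exists>v\<in>UU. w = act v a + v" by blast
next
  assume "\<exists>v\<in>UU. w = act v a + v"
  then obtain v where v: "v \<in> UU" "w = act v a + v" by blast
  have "snd (w i) = fst (w i) \<circ> t a" for i
    using cG_t_square[OF a] unfolding v(2)
    by (simp add: power_act_def U_act_odd[OF cG_odd[OF a]] add_comp comp_assoc add.commute)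
  then show "w \<in> CC a" using v act_UU[OF v(1)] UU_add a by (simp add: CC_def)
qed

lemma CC_act:
  assumes a: "a \<in> cG" and w: "w \<in> CC a" and b: "t b = t a"
  shows "act w b = w"
proof
  fix i
  have "snd (w i) = fst (w i) \<circ> t a" using w by (auto simp: CC_def)
  then show "act w b i = w i"
    using cG_t_square[OF a] by (simp add: power_act_def b U_act_odd[OF cG_odd[OF a]] prod_eq_iff comp_assoc)
qed

text \<open>Conjugating (c, 0) by (h, v) gives (a, v^a + v) with a the conjugate of c by h. So the
  class lies over the class in G, with the image of 1 + a as fibre over a.\<close>

lemma class_eq: "conjugacy_class GG (c, 0) = (SIGMA a : cG. CC a)"
proof (intro equalityI subsetI)
  fix x assume "x \<in> conjugacy_class GG (c, 0)"
  then obtain z where z: "z \<in> carrier GG" "x = inv\<^bsub>GG\<^esub> z \<otimes>\<^bsub>GG\<^esub> (c, 0) \<otimes>\<^bsub>GG\<^esub> z"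
    by (rule conjugacy_classE)
  obtain h v where zhv: "z = (h, v)" by fastforce
  have hv: "h \<in> carrier G" "v \<in> UU" "x = inv\<^bsub>GG\<^esub> (h, v) \<otimes>\<^bsub>GG\<^esub> (c, 0) \<otimes>\<^bsub>GG\<^esub> (h, v)"
    using z zhv by (simp_all add: carrier_GG)
  have x: "x = (inv h \<otimes> c \<otimes> h, act v (inv h \<otimes> c \<otimes> h) + v)"
    using hv conj_GG[OF c(1) UU_0 hv(1,2)] by simp
  have a: "inv h \<otimes> c \<otimes> h \<in> cG" by (rule conjugacy_classI[OF hv(1)])
  show "x \<in> (SIGMA a : cG. CC a)" unfolding x using a CC_iff[OF a] hv(2) by blast
next
  fix x assume "x \<in> (SIGMA a : cG. CC a)"
  then obtain a w where x: "x = (a, w)" "a \<in> cG" "w \<in> CC a" by blast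
  obtain v where v: "v \<in> UU" "w = act v a + v" using CC_iff x by blast
  obtain h where h: "h \<in> carrier G" "a = inv h \<otimes> c \<otimes> h" using x(2) by (rule conjugacy_classE)
  have "inv\<^bsub>GG\<^esub> (h, v) \<otimes>\<^bsub>GG\<^esub> (c, 0) \<otimes>\<^bsub>GG\<^esub> (h, v) = x"
    using conj_GG[OF c(1) UU_0 h(1) v(1)] unfolding x(1) v(2) h(2) by simp
  moreover have "(h, v) \<in> carrier GG" using h v by (simp add: carrier_GG)
  ultimately show "x \<in> conjugacy_class GG (c, 0)" using conjugacy_classI by metis
qed

lemma KK_iff: "(a, w) \<in> KK \<longleftrightarrow> a \<in> cG \<and> w \<in> CC a \<or> a \<in> J0 \<and> w \<in> W_tilde k s"
  unfolding KK_def class_eq by auto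

lemma cG_not_J: "a \<in> cG \<Longrightarrow> a \<notin> J"
  using cG_odd t_eq_id evenperm_id by (metis cG_closed)

lemma W_tilde_UU: "W_tilde k s \<subseteq> UU"
proof
  fix w assume "w \<in> W_tilde k s"
  then show "w \<in> UU"
    by (cases rule: W_tilde_cases)
      (use s W_sub_U S_sub_U U_mod_0 in \<open>auto simp: mod_power_def copy_at_def\<close>)
qed

lemma W_tilde_0: "0 \<in> W_tilde k s"
  using S_set_0 copy_at_0 by (auto simp: W_tilde_def intro!: image_eqI[of 0 _ 0])

lemma W_tilde_act:
  assumes w: "w \<in> W_tilde k s" and g: "g \<in> carrier G"
  shows "act w g \<in> W_tilde k s"
  using w
proof (cases rule: W_tilde_cases)
  case 1
  have "act w g \<in> mod_power k W_mod"
    using 1(1) t_permutes[OF g] by (auto simp: mod_power_def power_act_def W_mod_act)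
  moreover have "act w g \<notin> copy_at s ` W_mod"
  proof
    assume "act w g \<in> copy_at s ` W_mod"
    then obtain x where x: "x \<in> W_mod" "act w g = copy_at s x" by blast
    have "w = act (act w g) (inv g)" using g by (simp add: act_act act_J[OF J_one])
    also have "\<dots> = copy_at s (U_act x (t (inv g)))" unfolding x(2) by (rule power_act_copy_at)
    finally show False using 1(2) W_mod_act[OF x(1) t_permutes[of "inv g"]] g by auto
  qed
  ultimately show ?thesis by (simp add: W_tilde_def)
next
  case (2 x)
  then show ?thesis using S_set_act[OF 2(1) t_permutes[OF g]] by (simp add: W_tilde_def power_act_copy_at)
qed

lemma KK_subset: "KK \<subseteq> carrier GG"
proof (rule subrelI)
  fix a w assume "(a, w) \<in> KK"
  then show "(a, w) \<in> carrier GG"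
    using W_tilde_UU J0_subset_J by (auto simp: KK_iff carrier_GG CC_def)
qed

lemma KK_conj:
  assumes x: "x \<in> KK" and g: "g \<in> carrier GG"
  shows "inv\<^bsub>GG\<^esub> g \<otimes>\<^bsub>GG\<^esub> x \<otimes>\<^bsub>GG\<^esub> g \<in> KK"
proof -
  obtain h v where hv: "g = (h, v)" "h \<in> carrier G" "v \<in> UU" using g by (auto simp: carrier_GG)
  show ?thesis
  proof (cases "x \<in> conjugacy_class GG (c, 0)")
    case True
    have c0: "(c, 0) \<in> carrier GG" using c(1) by (simp add: carrier_GG UU_0)
    obtain z where z: "z \<in> carrier GG" "x = inv\<^bsub>GG\<^esub> z \<otimes>\<^bsub>GG\<^esub> (c, 0) \<otimes>\<^bsub>GG\<^esub> z"
      using True by (rule conjugacy_classE)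
    have "inv\<^bsub>GG\<^esub> g \<otimes>\<^bsub>GG\<^esub> x \<otimes>\<^bsub>GG\<^esub> g = inv\<^bsub>GG\<^esub> (z \<otimes>\<^bsub>GG\<^esub> g) \<otimes>\<^bsub>GG\<^esub> (c, 0) \<otimes>\<^bsub>GG\<^esub> (z \<otimes>\<^bsub>GG\<^esub> g)"
      unfolding z(2) using z(1) g c0 by (simp add: GG.inv_mult_group GG.m_assoc)
    then have "inv\<^bsub>GG\<^esub> g \<otimes>\<^bsub>GG\<^esub> x \<otimes>\<^bsub>GG\<^esub> g \<in> conjugacy_class GG (c, 0)"
      using conjugacy_classI[OF GG.m_closed[OF z(1) g]] by metis
    then show ?thesis unfolding KK_def by blast
  next
    case False
    then obtain a w where a: "x = (a, w)" "a \<in> J0" "w \<in> W_tilde k s" using x unfolding KK_def by blast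
    have aG: "a \<in> carrier G" using a(2) J0_subset_J by auto
    have j: "inv h \<otimes> a \<otimes> h \<in> J0" by (rule J0_conj[OF a(2) hv(2)])
    have wU: "w \<in> UU" using a(3) W_tilde_UU by blast
    have "inv\<^bsub>GG\<^esub> g \<otimes>\<^bsub>GG\<^esub> x \<otimes>\<^bsub>GG\<^esub> g = (inv h \<otimes> a \<otimes> h, act v (inv h \<otimes> a \<otimes> h) + act w h + v)"
      unfolding a(1) hv(1) by (rule conj_GG[OF aG wU hv(2,3)])
    also have "act v (inv h \<otimes> a \<otimes> h) = v" by (rule act_J) (use j J0_subset_J in blast)
    also have "v + act w h + v = act w h" by (simp add: ac_simps)
    finally show ?thesis using j W_tilde_act[OF a(3) hv(2)] by (simp add: KK_iff)
  qed
qed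

lemma KK_square: "x \<in> KK \<Longrightarrow> x \<otimes>\<^bsub>GG\<^esub> x = \<one>\<^bsub>GG\<^esub>"
proof -
  assume x: "x \<in> KK"
  obtain a w where aw: "x = (a, w)" by fastforce
  from x consider "a \<in> cG" "w \<in> CC a" | "a \<in> J0" "w \<in> W_tilde k s" unfolding aw KK_iff by blast
  then show ?thesis
  proof cases
    case 1 then show ?thesis using cG_square[OF 1(1)] CC_act[OF 1 refl] by (simp add: aw mult_GG one_GG)
  next
    case 2
    then have "a \<in> J" using J0_subset_J by blast
    then show ?thesis by (simp add: aw mult_GG one_GG act_J J_sq)
  qed
qed

section \<open>The subgroup HH\<close>

lemma J0_mult: "v \<in> J0 \<Longrightarrow> w \<in> J0 \<Longrightarrow> v \<otimes> w \<in> J0"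
  using subgroup.m_closed[OF J0_subgroup] by blast

lemma J0_one: "\<one> \<in> J0" using subgroup.one_closed[OF J0_subgroup] by blast

lemma J0_J: "v \<in> J0 \<Longrightarrow> v \<in> J" using J0_subset_J by blast

lemma \<psi>_mem: "v \<in> J0 \<Longrightarrow> \<exists>x\<in>T1. \<psi> v = copy_at s x"
  using \<psi>_bij unfolding bij_betw_def by blast

lemma \<psi>_inj: "v \<in> J0 \<Longrightarrow> w \<in> J0 \<Longrightarrow> \<psi> v = \<psi> w \<longleftrightarrow> v = w"
  using \<psi>_bij unfolding bij_betw_def inj_on_def by blast

lemma \<psi>_one: "\<psi> \<one> = 0"
  using \<psi>_mult[OF J0_one J0_one] by simp

lemma \<psi>_s_eq_0: "v \<in> J0 \<Longrightarrow> \<psi> v s = 0 \<Longrightarrow> v = \<one>"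
  using \<psi>_mem[of v] \<psi>_inj[OF _ J0_one, of v] \<psi>_one copy_at_0 by fastforce

text \<open>The entry of w at s records the \<open>J0\<close> part v of the group component through
  \<psi>; the remaining entries range freely over \<open>T1\<close>.\<close>

lemma HH_iff: "(g, w) \<in> HH \<longleftrightarrow> (\<exists>h\<in>H. \<exists>v\<in>J0. g = h \<otimes> v \<and> w \<in> mod_power k T1 \<and> \<psi> v s = w s)"
proof
  assume "(g, w) \<in> HH"
  then obtain h v u where h: "h \<in> H" "v \<in> J0" "u \<in> mod_power k T1" "u s = 0" "(g, w) = (h, 0) \<otimes>\<^bsub>GG\<^esub> (v, \<psi> v + u)"
    unfolding HH_def set_mult_def script_T_def by blast
  have gw: "g = h \<otimes> v" "w = \<psi> v + u" using h(5) by (simp_all add: mult_GG)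
  have "\<psi> v \<in> mod_power k T1" using \<psi>_mem[OF h(2)] copy_at_mod_power[OF s T1_0] by auto
  then have "w \<in> mod_power k T1" unfolding gw by (intro mod_power_add T1_add h(3))
  then show "\<exists>h\<in>H. \<exists>v\<in>J0. g = h \<otimes> v \<and> w \<in> mod_power k T1 \<and> \<psi> v s = w s" using gw h by auto
next
  assume "\<exists>h\<in>H. \<exists>v\<in>J0. g = h \<otimes> v \<and> w \<in> mod_power k T1 \<and> \<psi> v s = w s"
  then obtain h v where h: "h \<in> H" "v \<in> J0" "g = h \<otimes> v" "w \<in> mod_power k T1" "\<psi> v s = w s" by blast
  define u where "u = \<psi> v + w"
  have "\<psi> v \<in> mod_power k T1" using \<psi>_mem[OF h(2)] copy_at_mod_power[OF s T1_0] by auto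
  then have "u \<in> mod_power k T1" unfolding u_def by (intro mod_power_add T1_add h(4))
  moreover have "u s = 0" using h(5) by (simp add: u_def)
  moreover have "w = \<psi> v + u" unfolding u_def by (simp add: add.assoc[symmetric])
  ultimately have "(v, w) \<in> script_T J0 T1 \<psi> k s" unfolding script_T_def using h(2) by blast
  moreover have "(g, w) = (h, 0) \<otimes>\<^bsub>GG\<^esub> (v, w)" using h(3) by (simp add: mult_GG)
  ultimately show "(g, w) \<in> HH" unfolding HH_def set_mult_def using h(1) by blast
qed

lemma HH_J0:
  assumes "(v, w) \<in> HH" "v \<in> J0" shows "w \<in> mod_power k T1" "w s = \<psi> v s"
proof -
  obtain h v' where h: "h \<in> H" "v' \<in> J0" "v = h \<otimes> v'" "w \<in> mod_power k T1" "\<psi> v' s = w s"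
    using assms(1) HH_iff by blast
  have "h = v \<otimes> inv v'" using h J0_J[OF h(2)] by (simp add: m_assoc)
  then have "h \<in> J0" using assms(2) h(2) J0_mult subgroup.m_inv_closed[OF J0_subgroup] by simp
  then have "h = \<one>" using H_J0 h(1) by blast
  then have "v = v'" using h J0_J[OF h(2)] by simp
  then show "w \<in> mod_power k T1" "w s = \<psi> v s" using h by simp_all
qed

lemma HH_s_0: assumes "(g, w) \<in> HH" "w s = 0" shows "g \<in> H"
proof -
  obtain h v where h: "h \<in> H" "v \<in> J0" "g = h \<otimes> v" "\<psi> v s = w s" using assms(1) HH_iff by blast
  then have "v = \<one>" using \<psi>_s_eq_0 assms(2) by simp
  then show ?thesis using h by simp
qed

lemma HH_affine: assumes "(g, w) \<in> HH" shows "affine_on lb (t g)"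
proof -
  obtain h v where h: "h \<in> H" "v \<in> J0" "g = h \<otimes> v" using assms HH_iff by blast
  have "t g = t h" using h J0_J[OF h(2)] t_eq_id[of v] by (simp add: t_mult)
  then show ?thesis using H_affine_lb[OF h(1)] by simp
qed

lemma T1_pow_act: "w \<in> mod_power k T1 \<Longrightarrow> h \<in> H \<Longrightarrow> act w h \<in> mod_power k T1"
  by (auto simp: mod_power_def power_act_def T1_act)

lemma T1_pow_UU: "mod_power k T1 \<subseteq> UU" using T1_sub by (auto simp: mod_power_def)

lemma HH_subgroup: "subgroup HH GG"
proof (rule GG.subgroupI)
  show sub: "HH \<subseteq> carrier GG"
  proof (rule subrelI)
    fix g w assume "(g, w) \<in> HH"
    then show "(g, w) \<in> carrier GG" using T1_pow_UU J0_J by (auto simp: HH_iff carrier_GG)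
  qed
  have "(\<one>, 0) \<in> HH" unfolding HH_iff
    using subgroup.one_closed[OF H_subgroup] J0_one \<psi>_one T1_0
    by (intro bexI[of _ \<one>] bexI[of _ \<one>]) (auto simp: mod_power_def)
  then show "HH \<noteq> {}" by blast
  fix x assume x: "x \<in> HH"
  obtain g w where gw: "x = (g, w)" by fastforce
  obtain h v where h: "h \<in> H" "v \<in> J0" "g = h \<otimes> v" "w \<in> mod_power k T1" "\<psi> v s = w s" using x gw HH_iff by blast
  have vJ: "v \<in> J" using J0_J h by simp
  have hi: "inv h \<in> H" using h(1) subgroup.m_inv_closed[OF H_subgroup] by blast
  have v': "inv (inv h) \<otimes> v \<otimes> inv h \<in> J0" using J0_conj[OF h(2), of "inv h"] h(1) by simp
  have wU: "w \<in> UU" using h(4) T1_pow_UU by blast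
  \<comment> \<open>The \<open>J0\<close> factor is moved to the right of inv h. The equivariance of
    \<psi> then matches the entry at s.\<close>
  have ig: "inv g = inv h \<otimes> (inv (inv h) \<otimes> v \<otimes> inv h)"
    unfolding h(3) using h(1) vJ by (simp add: inv_mult_group J_inv m_assoc[symmetric])
  have tg: "t (inv g) = t (inv h)" unfolding ig using h(1) v' J0_J t_eq_id[of "inv (inv h) \<otimes> v \<otimes> inv h"]
    by (simp add: t_mult vJ)
  have "(inv g, act w (inv g)) \<in> HH"
    unfolding HH_iff
  proof (intro bexI conjI)
    show "inv g = inv h \<otimes> (inv (inv h) \<otimes> v \<otimes> inv h)" by (rule ig)
    show "act w (inv g) \<in> mod_power k T1" unfolding tg by (rule T1_pow_act[OF h(4) hi])
    show "\<psi> (inv (inv h) \<otimes> v \<otimes> inv h) s = act w (inv g) s"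
      unfolding tg \<psi>_act[OF h(2) hi] by (simp add: power_act_def h(5))
  qed (fact hi v')+
  then show "inv\<^bsub>GG\<^esub> x \<in> HH" unfolding gw using inv_GG[OF _ wU, of g] h vJ by simp
  fix z assume z: "z \<in> HH"
  obtain g' w' where gw': "z = (g', w')" by fastforce
  obtain h' v' where h': "h' \<in> H" "v' \<in> J0" "g' = h' \<otimes> v'" "w' \<in> mod_power k T1" "\<psi> v' s = w' s"
    using z gw' HH_iff by blast
  have vJ': "v' \<in> J" using J0_J h' by simp
  have c1: "inv h' \<otimes> v \<otimes> h' \<in> J0" using J0_conj[OF h(2), of h'] h'(1) by simp
  have "g \<otimes> g' = (h \<otimes> h') \<otimes> ((inv h' \<otimes> v \<otimes> h') \<otimes> v')"
  proof -
    have "(h \<otimes> h') \<otimes> ((inv h' \<otimes> v \<otimes> h') \<otimes> v') = h \<otimes> (h' \<otimes> inv h') \<otimes> v \<otimes> h' \<otimes> v'"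
      using h(1) h'(1) vJ vJ' by (simp only: m_assoc m_closed inv_closed J_closed H_closed)
    then show ?thesis unfolding h(3) h'(3) using h(1) h'(1) vJ vJ' by (simp add: m_assoc)
  qed
  moreover have tg': "t g' = t h'" unfolding h'(3) using h'(1) vJ' t_eq_id[of v'] by (simp add: t_mult)
  moreover have "act w g' + w' \<in> mod_power k T1"
    unfolding tg' by (intro mod_power_add T1_add T1_pow_act h(4) h'(1,4))
  moreover have "\<psi> ((inv h' \<otimes> v \<otimes> h') \<otimes> v') s = (act w g' + w') s"
    unfolding \<psi>_mult[OF c1 h'(2)] \<psi>_act[OF h(2) h'(1)] tg' by (simp add: power_act_def h(5) h'(5))
  moreover have "(inv h' \<otimes> v \<otimes> h') \<otimes> v' \<in> J0" by (rule J0_mult[OF c1 h'(2)])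
  moreover have "h \<otimes> h' \<in> H" using h(1) h'(1) subgroup.m_closed[OF H_subgroup] by blast
  ultimately show "x \<otimes>\<^bsub>GG\<^esub> z \<in> HH" unfolding gw gw' mult_GG HH_iff by blast
qed

lemma card_J0: "card J0 = 16"
proof -
  have "card (copy_at s ` T1) = card T1" by (rule card_image) (simp add: inj_on_def copy_at_inj)
  then show ?thesis using bij_betw_same_card[OF \<psi>_bij] omega_graph_card[OF omega] by simp
qed

text \<open>The factor h and the vector w in T1^k can be chosen freely; v is recovered from the
  entry of w at s by inverting \<psi>.\<close>

lemma card_HH: "40 * 16 ^ k \<le> card HH"
proof -
  define r where "r w = the_inv_into J0 \<psi> (copy_at s (w s))" for w :: "nat \<Rightarrow> U_elt"
  have r: "r w \<in> J0" "\<psi> (r w) s = w s" if "w \<in> mod_power k T1" for w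
  proof -
    have "copy_at s (w s) \<in> \<psi> ` J0" using that s \<psi>_bij by (auto simp: bij_betw_def mod_power_def)
    then show "r w \<in> J0" "\<psi> (r w) s = w s"
      using the_inv_into_into[of \<psi> J0 _ J0] f_the_inv_into_f[of \<psi> J0] \<psi>_bij unfolding r_def bij_betw_def by auto
  qed
  let ?F = "\<lambda>(h, w). (h \<otimes> r w, w)"
  have inj: "inj_on ?F (H \<times> mod_power k T1)"
    by (rule inj_onI) (use r(1) J0_J in auto)
  have sub: "?F ` (H \<times> mod_power k T1) \<subseteq> HH"
  proof (rule image_subsetI)
    fix x assume "x \<in> H \<times> mod_power k T1"
    then obtain h w where "x = (h, w)" "h \<in> H" "w \<in> mod_power k T1" by blast
    then show "?F x \<in> HH" using r[of w] by (auto simp: HH_iff)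
  qed
  have finT: "finite T1" using T1_sub finite_U_mod finite_subset by blast
  have "card H * 16 ^ k = card (?F ` (H \<times> mod_power k T1))"
    using card_image[OF inj] card_mod_power[OF finT, of k] omega_graph_card[OF omega] by (simp add: card_cartesian_product)
  also have "\<dots> \<le> card HH"
    by (rule card_mono[OF finite_subset[OF subgroup.subset[OF HH_subgroup] finite_GG] sub])
  finally show ?thesis using card_H[OF finite_G] by (meson le_trans mult_le_mono1)
qed

section \<open>The sizes of the class of c and of K\<close>

lemma cG_over_transposition:
  assumes pq: "p \<in> {1..5}" "q \<in> {1..5}" "p \<noteq> q"
  shows "\<exists>a\<in>cG. t a = tr p q"
proof -
  obtain \<pi> where \<pi>: "\<pi> permutes {1..5}" "\<pi> p = c1" "\<pi> q = c2"
    using even_two_transitive[OF c(4-6) pq] by blast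
  obtain g where g: "g \<in> carrier G" "t g = \<pi>" using t_surj[OF \<pi>(1)] by blast
  let ?a = "inv g \<otimes> c \<otimes> g"
  have inj: "\<pi> x = \<pi> z \<longleftrightarrow> x = z" for x z using permutes_inj[OF \<pi>(1)] by (auto dest: injD)
  have "tr c1 c2 \<circ> \<pi> = \<pi> \<circ> tr p q"
    using \<pi>(2,3) inj by (auto simp: fun_eq_iff Transposition.transpose_def)
  then have "t (inv g) \<circ> (tr c1 c2 \<circ> \<pi>) = t (inv g) \<circ> (\<pi> \<circ> tr p q)" by simp
  then have "t ?a = tr p q" using t_inv(1)[OF g(1)] g c by (simp add: t_mult comp_assoc[symmetric])
  then show ?thesis using conjugacy_classI[OF g(1)] by blast
qed

lemma conjugacy_class_eq:
  assumes a: "a \<in> cG" shows "conjugacy_class G a \<subseteq> cG"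
proof
  fix x assume "x \<in> conjugacy_class G a"
  then obtain g where g: "g \<in> carrier G" "x = inv g \<otimes> a \<otimes> g" by (rule conjugacy_classE)
  obtain h where h: "h \<in> carrier G" "a = inv h \<otimes> c \<otimes> h" using a by (rule conjugacy_classE)
  have "x = inv (h \<otimes> g) \<otimes> c \<otimes> (h \<otimes> g)" unfolding g(2) h(2) using g(1) h(1) c(1) by (simp add: inv_mult_group m_assoc)
  then show "x \<in> cG" using conjugacy_classI[of "h \<otimes> g" G c] g h by simp
qed

lemma finite_cG: "finite cG"
  by (rule finite_subset[OF _ finite_G]) (use cG_closed in blast)

lemma card_cG: "80 \<le> card cG"
proof -
  \<comment> \<open>One ordered pair for each of the ten transpositions of five points.\<close>
  let ?I = "{(1,2),(1,3),(1,4),(1,5),(2,3),(2,4),(2,5),(3,4),(3,5),(4,5)} :: (nat \<times> nat) set"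
  let ?B = "\<lambda>(p, q). {b \<in> cG. t b = tr p q}"
  have I: "p \<in> {1..5} \<and> q \<in> {1..5} \<and> p < q" if "(p, q) \<in> ?I" for p q using that by auto
  have B8: "8 \<le> card (?B i)" if "i \<in> ?I" for i
  proof -
    obtain p q where i: "i = (p, q)" by fastforce
    then have pq: "i = (p, q)" "p \<in> {1..5}" "q \<in> {1..5}" "p \<noteq> q" using I[of p q] that by simp_all
    obtain a where a: "a \<in> cG" "t a = tr p q" using cG_over_transposition[OF pq(2-4)] by blast
    let ?S = "{m \<in> J. a \<otimes> m \<in> conjugacy_class G a}"
    have "8 \<le> card ?S" by (rule card_class_in_coset[OF _ cG_square[OF a(1)] a(2) pq(2-4)]) (use a in simp)
    also have "card ?S = card ((\<otimes>) a ` ?S)"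
    proof (rule card_image[symmetric], rule inj_onI)
      fix x z assume "x \<in> ?S" "z \<in> ?S" "a \<otimes> x = a \<otimes> z"
      then show "x = z" using a(1) by simp
    qed
    also have "\<dots> \<le> card (?B i)"
    proof (rule card_mono)
      show "finite (?B i)" unfolding pq(1) using finite_cG by simp
      show "(\<otimes>) a ` ?S \<subseteq> ?B i"
      proof (rule image_subsetI)
        fix m assume m: "m \<in> ?S"
        then have "a \<otimes> m \<in> cG" using conjugacy_class_eq[OF a(1)] by blast
        moreover have "t (a \<otimes> m) = tr p q" using m a t_mult[of a m] t_eq_id[of m] by simp
        ultimately show "a \<otimes> m \<in> ?B i" unfolding pq(1) by simp
      qed
    qed
    finally show ?thesis .
  qed
  have "80 = (\<Sum>i\<in>?I. 8)" by simp
  also have "\<dots> \<le> (\<Sum>i\<in>?I. card (?B i))" by (rule sum_mono) (rule B8)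
  also have "\<dots> = card (\<Union>i\<in>?I. ?B i)"
  proof (rule card_UN_disjoint[symmetric])
    show "finite ?I" by simp
    show "\<forall>i\<in>?I. finite (?B i)" using finite_cG by auto
    have inj: "p = p' \<and> q = q'" if "p < q" "p' < q'" "tr p q = tr p' q'" for p q p' q' :: nat
    proof -
      have 1: "tr p q p = tr p' q' p" "tr p q q = tr p' q' q" "tr p q p' = tr p' q' p'" using that(3) by simp_all
      then show ?thesis using that(1,2) by (auto simp: Transposition.transpose_def split: if_splits)
    qed
    show "\<forall>i\<in>?I. \<forall>j\<in>?I. i \<noteq> j \<longrightarrow> ?B i \<inter> ?B j = {}"
    proof (intro ballI impI)
      fix i j assume ij: "i \<in> ?I" "j \<in> ?I" "i \<noteq> j"
      obtain p q p' q' where e: "i = (p, q)" "j = (p', q')" by fastforce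
      then have "tr p q \<noteq> tr p' q'" using inj[of p q p' q'] ij I[of p q] I[of p' q'] by blast
      then show "?B i \<inter> ?B j = {}" unfolding e by auto
    qed
  qed
  also have "\<dots> \<le> card cG" by (rule card_mono[OF finite_cG]) auto
  finally show ?thesis .
qed

lemma card_CC: assumes a: "a \<in> cG" shows "card (CC a) = 16 ^ k"
proof -
  have "bij_betw (\<lambda>w. (\<lambda>i. (fst (w i), fst (w i)))) (CC a) (mod_power k W_mod)"
  proof (rule bij_betw_byWitness[where f' = "\<lambda>w i. (fst (w i), fst (w i) \<circ> t a)"])
    show "\<forall>w\<in>CC a. (\<lambda>i. (fst ((\<lambda>i. (fst (w i), fst (w i))) i), fst ((\<lambda>i. (fst (w i), fst (w i))) i) \<circ> t a)) = w"
      by (auto simp: CC_def fun_eq_iff prod_eq_iff)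
    show "\<forall>w\<in>mod_power k W_mod. (\<lambda>i. (fst ((\<lambda>i. (fst (w i), fst (w i) \<circ> t a)) i), fst ((\<lambda>i. (fst (w i), fst (w i) \<circ> t a)) i))) = w"
    proof
      fix w assume w: "w \<in> mod_power k W_mod"
      have "snd (w i) = fst (w i)" for i
        using w by (cases "i < k") (auto simp: mod_power_def W_mod_def)
      then show "(\<lambda>i. (fst ((\<lambda>i. (fst (w i), fst (w i) \<circ> t a)) i), fst ((\<lambda>i. (fst (w i), fst (w i) \<circ> t a)) i))) = w"
        by (simp add: fun_eq_iff prod_eq_iff)
    qed
    show "(\<lambda>w i. (fst (w i), fst (w i))) ` CC a \<subseteq> mod_power k W_mod"
      by (auto simp: CC_def mod_power_def W_mod_def U_mod_def zero_prod_def)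
    show "(\<lambda>w i. (fst (w i), fst (w i) \<circ> t a)) ` mod_power k W_mod \<subseteq> CC a"
      using N_mod_comp[OF _ t_permutes[of a]] a
      by (auto simp: CC_def mod_power_def W_mod_def U_mod_def zero_prod_def)
  qed
  moreover have "finite W_mod" using W_sub_U finite_U_mod finite_subset by blast
  ultimately show ?thesis using card_mod_power[of W_mod k] bij_betw_same_card card_W_mod by fastforce
qed

lemma card_class: "80 * 16 ^ k \<le> card (conjugacy_class GG (c, 0))"
proof -
  have "finite (CC a)" for a
    by (rule finite_subset[of _ UU]) (use card_mod_power[OF finite_U_mod, of k] in \<open>auto simp: CC_def\<close>)
  then have "card (conjugacy_class GG (c, 0)) = (\<Sum>a\<in>cG. card (CC a))"
    unfolding class_eq using finite_cG by (simp add: card_SigmaI)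
  also have "\<dots> = (\<Sum>a\<in>cG. 16 ^ k)" by (rule sum.cong[OF refl card_CC])
  finally show ?thesis using card_cG by simp
qed

lemma card_J0_W_tilde: "card (J0 \<times> W_tilde k s) = 16 * 16 ^ k" "finite (J0 \<times> W_tilde k s)"
proof -
  show "card (J0 \<times> W_tilde k s) = 16 * 16 ^ k" by (simp add: card_cartesian_product card_J0 card_W_tilde[OF s])
  have "finite J0" using card_J0 card.infinite by fastforce
  then show "finite (J0 \<times> W_tilde k s)" using card_W_tilde[OF s] by simp
qed

lemma card_KK: "96 * 16 ^ k \<le> card KK"
proof -
  have "conjugacy_class GG (c, 0) \<inter> J0 \<times> W_tilde k s = {}"
    unfolding class_eq using cG_not_J J0_subset_J by blast
  moreover have "finite (conjugacy_class GG (c, 0))"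
    using KK_subset finite_GG unfolding KK_def by (meson finite_subset le_sup_iff)
  ultimately have "card KK = card (conjugacy_class GG (c, 0)) + card (J0 \<times> W_tilde k s)"
    unfolding KK_def using card_J0_W_tilde(2) by (intro card_Un_disjoint)
  then show ?thesis using card_class card_J0_W_tilde(1) by simp
qed

section \<open>Distinct elements of K lie in distinct cosets of H\<close>

lemma W_T1: "x \<in> W_mod \<Longrightarrow> x \<in> T1 \<Longrightarrow> x = 0"
  using omega_graph_diag[OF omega] by (auto simp: W_mod_def zero_prod_def)

text \<open>Off s all entries lie in W, which meets \<open>T1\<close> trivially, so w and w' agree
  there. Elements of \<open>W_tilde\<close> vanishing off s are exactly those of the copy of S, so
  both lie in it or neither does. The entries at s then both belong to S or both to W, and no two
  elements of either set are congruent modulo \<open>T1\<close>.\<close>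

lemma W_tilde_separated:
  assumes w: "w \<in> W_tilde k s" and w': "w' \<in> W_tilde k s" and T: "w + w' \<in> mod_power k T1"
  shows "w = w'"
proof -
  have inW: "w i \<in> W_mod" if "w \<in> W_tilde k s" "i \<noteq> s" for w i
    using that(1) by (cases rule: W_tilde_cases; cases "i < k")
      (use that(2) W_mod_0 in \<open>auto simp: mod_power_def copy_at_other\<close>)
  have Ti: "(w + w') i \<in> T1" for i using T T1_0 by (cases "i < k") (auto simp: mod_power_def)
  have other: "w i = w' i" if "i \<noteq> s" for i
  proof -
    have "w i + w' i = 0"
      by (rule W_T1[OF W_mod_add[OF inW[OF w that] inW[OF w' that]]]) (use Ti[of i] in simp)
    then show ?thesis by (rule U_add_eq_0[THEN iffD1])
  qed
  have copies: "w' \<in> copy_at s ` S_set" if "w' \<in> W_tilde k s" "x \<in> S_set" "\<And>i. i \<noteq> s \<Longrightarrow> w' i = copy_at s x i" for w' x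
    using that(1)
  proof (cases rule: W_tilde_cases)
    case 1
    have "w' = copy_at s (w' s)" by (rule copy_at_eqI) (use that(3) copy_at_other in auto)
    moreover have "w' s \<in> W_mod" using 1 s by (simp add: mod_power_def)
    ultimately show ?thesis using 1(2) by blast
  qed blast
  have both: "w = w'" if xx: "w = copy_at s x" "w' = copy_at s x'" "x \<in> S_set" "x' \<in> S_set" for x x'
  proof -
    have "x + x' \<in> T1" using Ti[of s] xx by simp
    then show ?thesis using S_set_separated[OF omega xx(3,4)] xx by simp
  qed
  from w show ?thesis
  proof (cases rule: W_tilde_cases)
    case (2 x)
    have "w' \<in> copy_at s ` S_set" by (rule copies[OF w' 2(1)]) (use other 2(2) in metis)
    then show ?thesis using both 2 by blast
  next
    case W: 1
    from w' show ?thesis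
    proof (cases rule: W_tilde_cases)
      case (2 x)
      have "w \<in> copy_at s ` S_set" by (rule copies[OF w 2(1)]) (use other 2(2) in metis)
      then show ?thesis using both 2 by blast
    next
      case 1
      have "w s \<in> W_mod" "w' s \<in> W_mod" using W 1 s by (simp_all add: mod_power_def)
      then have "w s + w' s = 0" using W_T1[OF W_mod_add] Ti[of s] by simp
      then have "w s = w' s" by (rule U_add_eq_0[THEN iffD1])
      then show ?thesis using other by (metis ext)
    qed
  qed
qed

lemma CC_T1:
  assumes a: "a \<in> cG" and w: "w \<in> CC a" "w \<in> mod_power k T1" shows "w = 0"
proof
  fix i
  obtain p q where pq: "p \<in> {1..5}" "q \<in> {1..5}" "p \<noteq> q" "t a = tr p q" using cG_transposition[OF a] by blast
  have "w i \<in> T1" using w(2) T1_0 by (cases "i < k") (auto simp: mod_power_def)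
  moreover have wi: "snd (w i) = fst (w i) \<circ> tr p q" using w(1) pq by (auto simp: CC_def)
  ultimately have "(fst (w i), fst (w i) \<circ> tr p q) \<in> T1" by (metis prod.collapse)
  then have "fst (w i) = 0" using omega_graph_transposition[OF omega _ pq(1-3)] by blast
  then show "w i = 0 i" using wi by (simp add: prod_eq_iff)
qed

lemma CC_add: "w \<in> CC a \<Longrightarrow> w' \<in> CC a \<Longrightarrow> w + w' \<in> CC a"
  by (auto simp: CC_def UU_add add_comp)

text \<open>Over equal transpositions w + w' is fixed by a and lies in T1^k, hence is 0, and a b
  lies in both \<open>H\<close> and \<open>J\<close>. Over distinct ones write a b = h v with v in
  \<open>J0\<close>; the vector \<psi> v is invariant under h, so h and v commute and (a b)^2 = h^2
  lies in \<open>H\<close> and \<open>J\<close>. In both cases the value \<open>z0\<close> is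
  excluded and 1 remains. In the second case (a b)^2 = 1 contradicts
  \<open>square_not_in_J0\<close>.\<close>

lemma class_separated:
  assumes a: "a \<in> cG" "w \<in> CC a" and b: "b \<in> cG" "w' \<in> CC b" and HHab: "(a \<otimes> b, act w b + w') \<in> HH"
  shows "a = b \<and> w = w'"
proof -
  have aG: "a \<in> carrier G" and bG: "b \<in> carrier G" using a b by simp_all
  obtain p q where pq: "p \<in> {1..5}" "q \<in> {1..5}" "p \<noteq> q" "t a = tr p q" using cG_transposition[OF a(1)] by blast
  obtain r r' where rr: "r \<in> {1..5}" "r' \<in> {1..5}" "r \<noteq> r'" "t b = tr r r'" using cG_transposition[OF b(1)] by blast
  have tab: "t (a \<otimes> b) = tr p q \<circ> tr r r'" using t_mult[OF aG bG] pq rr by simp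
  have aff: "affine_on lb (tr p q \<circ> tr r r')" using HH_affine[OF HHab] tab by simp
  have a_not_z0: "inv a \<otimes> z0 \<otimes> a \<noteq> z0" using conj_c_not_centralizes_z0[OF a(1) p0(1)] by (simp add: z0_def)
  show ?thesis
  proof (cases "tr p q = tr r r'")
    case True
    then have tt: "t b = t a" using pq rr by simp
    have abJ: "a \<otimes> b \<in> J" using t_eq_id[of "a \<otimes> b"] aG bG tab True by simp
    have sum: "(a \<otimes> b, w + w') \<in> HH" using HHab CC_act[OF a tt] by simp
    have "w' \<in> CC a" using b(2) tt by (simp add: CC_def)
    then have "w + w' = 0" using CC_T1[OF a(1) CC_add[OF a(2)]] sum HH_iff by blast
    then have ww: "w = w'" using fun_U_add_eq_0 by blast
    have "a \<otimes> b \<in> H" using HH_s_0[OF sum] ww by simp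
    then have "a \<otimes> b = \<one> \<or> a \<otimes> b = z0" using H_J abJ by blast
    moreover have "a \<otimes> b \<noteq> z0"
    proof
      assume z: "a \<otimes> b = z0"
      \<comment> \<open>The involutions a and b have a product inverted by a, so if a b is
        \<open>z0\<close> then a centralizes \<open>z0\<close>.\<close>
      have "inv a \<otimes> z0 \<otimes> a = (inv a \<otimes> a) \<otimes> (b \<otimes> a)" unfolding z[symmetric] using aG bG by (simp only: m_assoc m_closed inv_closed)
      also have "\<dots> = inv (a \<otimes> b)" using aG bG cG_square[OF a(1)] cG_inv[OF a(1)] cG_inv[OF b(1)] by (simp add: inv_mult_group)
      also have "\<dots> = z0" using z J_inv[OF z0_J] by simp
      finally show False using a_not_z0 by simp
    qed
    ultimately have "a = inv b" using aG bG inv_equality[of a b] by simp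
    then show ?thesis using cG_inv[OF b(1)] ww by simp
  next
    case False
    have disj: "{p, q} \<inter> {r, r'} = {}" by (rule affine_product_disjoint[OF lb aff pq(1-3) rr(1-3) False])
    obtain h v where hv: "h \<in> H" "v \<in> J0" "a \<otimes> b = h \<otimes> v" "act w b + w' \<in> mod_power k T1" "\<psi> v s = (act w b + w') s"
      using HHab HH_iff by blast
    have hG: "h \<in> carrier G" and vJ: "v \<in> J" using hv J0_J by simp_all
    have th: "t h = tr p q \<circ> tr r r'" using tab hv(3) hG vJ t_eq_id[of v] by (simp add: t_mult)
    define n m where "n = fst (w s)" and "m = fst (w' s)"
    have wU: "w s \<in> U_mod" "w' s \<in> U_mod" using a(2) b(2) s by (auto simp: CC_def mod_power_def)
    have nm: "n \<in> N_mod" "m \<in> N_mod" using wU by (auto simp: n_def m_def U_mod_def)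
    have ws: "w s = (n, n \<circ> tr p q)" "w' s = (m, m \<circ> tr r r')"
      using a(2) b(2) pq(4) rr(4) by (auto simp: CC_def n_def m_def prod_eq_iff)
    have ps: "\<psi> v s = ((n \<circ> (tr p q \<circ> tr r r')) + m, (n + m) \<circ> tr r r')"
      unfolding hv(5) using ws U_act_odd[OF cG_odd[OF b(1)]] rr(4)
      by (simp add: power_act_def comp_assoc add_comp)
    have psT: "\<psi> v s \<in> T1" unfolding hv(5) using hv(4) s by (simp add: mod_power_def)
    note fixd = omega_graph_double_transposition[OF omega aff pq(1-3) rr(1-3) False nm psT[unfolded ps]]
    have ev: "evenperm (t h)" unfolding th
      using evenperm_compose_1_5[OF permutes_swap_id[OF pq(1,2)] permutes_swap_id[OF rr(1,2)]] pq(3) rr(3) by (simp add: evenperm_swap)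
    have "U_act (\<psi> v s) (t h) = \<psi> v s"
      unfolding U_act_def ps using ev fixd by (simp add: th)
    moreover obtain x where x: "\<psi> v = copy_at s x" using \<psi>_mem[OF hv(2)] by blast
    ultimately have "power_act (\<psi> v) (t h) = \<psi> v" by (simp add: power_act_copy_at)
    then have "\<psi> (inv h \<otimes> v \<otimes> h) = \<psi> v" using \<psi>_act[OF hv(2,1)] by simp
    then have vh: "inv h \<otimes> v \<otimes> h = v" using \<psi>_inj[OF J0_conj[OF hv(2) hG] hv(2)] by simp
    have sq: "a \<otimes> b \<otimes> (a \<otimes> b) = h \<otimes> h"
    proof -
      have "h \<otimes> v \<otimes> (h \<otimes> v) = h \<otimes> (h \<otimes> inv h) \<otimes> v \<otimes> h \<otimes> v" using hG vJ by (simp add: m_assoc)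
      also have "\<dots> = h \<otimes> h \<otimes> (inv h \<otimes> v \<otimes> h) \<otimes> v" using hG vJ by (simp only: m_assoc m_closed inv_closed J_closed)
      also have "\<dots> = h \<otimes> h \<otimes> (v \<otimes> v)" unfolding vh using hG vJ by (simp add: m_assoc)
      finally show ?thesis using hv(3) hG J_sq[OF vJ] by simp
    qed
    have "(tr p q \<circ> tr r r') \<circ> (tr p q \<circ> tr r r') = id"
      using disj by (auto simp: fun_eq_iff Transposition.transpose_def)
    then have abJ: "a \<otimes> b \<otimes> (a \<otimes> b) \<in> J" using t_eq_id[of "a \<otimes> b \<otimes> (a \<otimes> b)"] aG bG tab by (simp add: t_mult)
    have "h \<otimes> h \<in> H" using hv(1) subgroup.m_closed[OF H_subgroup] by blast
    then have "h \<otimes> h = \<one> \<or> h \<otimes> h = z0" using H_J abJ sq by simp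
    moreover have "h \<otimes> h \<noteq> z0"
    proof
      assume z: "h \<otimes> h = z0"
      have ab: "a \<otimes> b \<otimes> (a \<otimes> b) = z0" using sq z by simp
      have "inv a \<otimes> z0 \<otimes> a = (inv a \<otimes> a) \<otimes> (b \<otimes> a \<otimes> (b \<otimes> a))" unfolding ab[symmetric] using aG bG by (simp only: m_assoc m_closed inv_closed)
      also have "\<dots> = inv (a \<otimes> b \<otimes> (a \<otimes> b))" using aG bG cG_square[OF a(1)] cG_inv[OF a(1)] cG_inv[OF b(1)] by (simp add: inv_mult_group m_assoc)
      also have "\<dots> = z0" using ab J_inv[OF z0_J] by simp
      finally show False using a_not_z0 by simp
    qed
    ultimately have one: "a \<otimes> b \<otimes> (a \<otimes> b) \<in> J0" using sq J0_one by simp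
    obtain g1 where g1: "g1 \<in> carrier G" "a = inv g1 \<otimes> c \<otimes> g1" using a(1) by (rule conjugacy_classE)
    obtain g2 where g2: "g2 \<in> carrier G" "b = inv g2 \<otimes> c \<otimes> g2" using b(1) by (rule conjugacy_classE)
    have "inv (inv g1 \<otimes> g2) \<otimes> a \<otimes> (inv g1 \<otimes> g2) = inv g2 \<otimes> (g1 \<otimes> inv g1) \<otimes> c \<otimes> (g1 \<otimes> inv g1) \<otimes> g2"
      unfolding g1(2) using g1(1) g2(1) c(1) by (simp only: inv_mult_group inv_inv m_assoc m_closed inv_closed)
    then have bg: "b = inv (inv g1 \<otimes> g2) \<otimes> a \<otimes> (inv g1 \<otimes> g2)" unfolding g2(2) using g1(1) g2(1) c(1) by simp
    have "a \<otimes> b \<otimes> (a \<otimes> b) \<notin> J0"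
      by (rule square_not_in_J0[OF aG cG_square[OF a(1)] _ bg pq(4) rr(4) pq(1,2) rr(1) pq(3) rr(3) disj]) (use g1 g2 in simp)
    then show ?thesis using one by simp
  qed
qed

lemma KK_separated:
  assumes x: "x \<in> KK" and z: "z \<in> KK" and xz: "x \<otimes>\<^bsub>GG\<^esub> z \<in> HH"
  shows "x = z"
proof -
  obtain a w where x': "x = (a, w)" by fastforce
  obtain b w' where z': "z = (b, w')" by fastforce
  have H': "(a \<otimes> b, act w b + w') \<in> HH" using xz by (simp add: x' z' mult_GG)
  \<comment> \<open>A product of a conjugate of c and an element of \<open>J\<close> lies over a
    transposition, and these are not affine.\<close>
  have mixed: False if ab: "a \<in> cG" "b \<in> J" "(a \<otimes> b, u) \<in> HH \<or> (b \<otimes> a, u) \<in> HH" for a b u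
  proof -
    obtain p q where pq: "p \<in> {1..5}" "q \<in> {1..5}" "p \<noteq> q" "t a = tr p q" using cG_transposition[OF ab(1)] by blast
    have "t (a \<otimes> b) = tr p q" "t (b \<otimes> a) = tr p q" using ab pq t_eq_id[of b] by (simp_all add: t_mult)
    then have "affine_on lb (tr p q)" using HH_affine ab(3) by metis
    then show False using affine_not_transposition[OF lb pq(1-3)] by blast
  qed
  from x[unfolded x' KK_iff] z[unfolded z' KK_iff] show ?thesis
  proof (elim disjE conjE)
    assume "a \<in> cG" "w \<in> CC a" "b \<in> cG" "w' \<in> CC b"
    then show ?thesis using class_separated H' x' z' by blast
  next
    assume "a \<in> cG" "b \<in> J0"
    then show ?thesis using mixed[of a b] H' J0_J by blast
  next
    assume "a \<in> J0" "b \<in> cG"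
    then show ?thesis using mixed[of b a] H' J0_J by blast
  next
    assume ab: "a \<in> J0" "w \<in> W_tilde k s" "b \<in> J0" "w' \<in> W_tilde k s"
    have HHs: "(a \<otimes> b, w + w') \<in> HH" using H' act_J[OF J0_J[OF ab(3)]] by simp
    note T = HH_J0[OF HHs J0_mult[OF ab(1,3)]]
    have ww: "w = w'" by (rule W_tilde_separated[OF ab(2,4) T(1)])
    then have "a \<otimes> b = \<one>" using \<psi>_s_eq_0[OF J0_mult[OF ab(1,3)]] T(2) by simp
    then have "a = inv b" using inv_equality[of a b] J0_J ab by simp
    then show ?thesis using J_inv[OF J0_J[OF ab(3)]] ww x' z' by simp
  qed
qed

lemma KK_large: "order GG \<le> card HH * card KK"
proof -
  have "(40 * 16 ^ k) * (96 * 16 ^ k) \<le> card HH * card KK" by (rule mult_le_mono[OF card_HH card_KK])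
  moreover have "(40 * 16 ^ k) * (96 * 16 ^ k) = 3840 * (256 ^ k :: nat)"
    by (simp add: power_mult_distrib[symmetric])
  ultimately show ?thesis by (simp add: order_GG)
qed

lemma one_in_KK: "\<one>\<^bsub>GG\<^esub> \<in> KK"
  by (simp add: one_GG KK_iff J0_one W_tilde_0)

sublocale F: involution_folder GG HH KK
  by (intro involution_folder.intro involution_folder_axioms.intro group_GG)
    (fact finite_GG HH_subgroup KK_subset one_in_KK KK_conj KK_square KK_separated KK_large)+

end

subsection \<open>Simplicity\<close>

lemma (in group) conjugacy_class_conjugate:
  assumes "c \<in> carrier G" "x \<in> conjugacy_class G c" "z \<in> conjugacy_class G c"
  shows "\<exists>g\<in>carrier G. z = inv g \<otimes> x \<otimes> g"
proof -
  obtain g where g: "g \<in> carrier G" "x = inv g \<otimes> c \<otimes> g" using assms(2) by (rule conjugacy_classE)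
  obtain h where h: "h \<in> carrier G" "z = inv h \<otimes> c \<otimes> h" using assms(3) by (rule conjugacy_classE)
  have "inv (inv g \<otimes> h) \<otimes> x \<otimes> (inv g \<otimes> h) = inv h \<otimes> (g \<otimes> inv g) \<otimes> c \<otimes> (g \<otimes> inv g) \<otimes> h"
    unfolding g(2) using g(1) h(1) assms(1) by (simp only: inv_mult_group inv_inv m_assoc m_closed inv_closed)
  then have "z = inv (inv g \<otimes> h) \<otimes> x \<otimes> (inv g \<otimes> h)" unfolding h(2) using g(1) h(1) assms(1) by simp
  then show ?thesis using g(1) h(1) by blast
qed

text \<open>The Frobenius group of order 20 has trivial core in \<open>S\<^sub>5\<close>: a quotient of two conjugates of a
  nontrivial element by transpositions fixes two points.\<close>

lemma affine_core_trivial: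
  assumes lab: "bij_betw lab (UNIV :: 5 set) {1..5}"
    and perm: "\<And>q. q \<in> A \<Longrightarrow> q permutes {1..5}" and aff: "\<And>q. q \<in> A \<Longrightarrow> affine_on lab q"
    and quot: "\<And>q r. q \<in> A \<Longrightarrow> r \<in> A \<Longrightarrow> q \<circ> inv' r \<in> A"
    and conj: "\<And>q a b. q \<in> A \<Longrightarrow> a \<in> {1..5} \<Longrightarrow> b \<in> {1..5} \<Longrightarrow> tr a b \<circ> q \<circ> tr a b \<in> A"
    and q: "q \<in> A"
  shows "q = id"
proof (rule ccontr)
  assume "q \<noteq> id"
  then obtain x where x: "q x \<noteq> x" by (auto simp: fun_eq_iff)
  note qp = perm[OF q]
  define y where "y = q x"
  have x5: "x \<in> {1..5}" using x qp by (auto simp: permutes_def)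
  have y5: "y \<in> {1..5}" unfolding y_def using x5 permutes_in_image[OF qp] by simp
  have inj: "q u = q v \<longleftrightarrow> u = v" for u v using permutes_inj[OF qp] by (auto dest: injD)
  have qi: "q (inv' q e) = e" "inv' q (q e) = e" for e using permutes_inverses[OF qp] by simp_all
  have yx: "y \<noteq> x" using x by (simp add: y_def)
  have qy: "q y \<noteq> y" using inj[of y x] yx by (simp add: y_def)
  \<comment> \<open>The quotient r of q conjugated by (y z) and q itself moves only points among y,
    z, q y, q z. The point z is sought so that these are at most three points, leaving two fixed
    ones: either z = q y, or z is a fixed point of q.\<close>
  have "\<exists>z u. z \<in> {1..5} \<and> z \<notin> {x, y} \<and> {y, z, q y, q z} \<subseteq> {y, z, u}"
  proof (cases "q y = x")
    case False
    have "q y \<in> {1..5}" using y5 permutes_in_image[OF qp] by simp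
    then show ?thesis using False qy by (intro exI[of _ "q y"] exI[of _ "q (q y)"]) auto
  next
    case True
    \<comment> \<open>If q swaps x and y, then q^2 fixes both and is the identity. An involution on
      the remaining three points has a fixed point.\<close>
    have fixed: "\<exists>z. z \<in> {1..5} \<and> z \<notin> {x, y} \<and> q z = z"
    proof -
      obtain z1 where z1: "z1 \<in> {1..5}" "z1 \<notin> {x, y, y, y}" using ex_other_point by metis
      show ?thesis
      proof (cases "q z1 = z1")
        case True then show ?thesis using z1 by blast
      next
        case False
        have w: "q z1 \<in> {1..5}" "q z1 \<notin> {x, y}"
          using z1 permutes_in_image[OF qp] inj[of z1 y] inj[of z1 x] True by (auto simp: y_def[symmetric])
        show ?thesis
        proof (cases "q (q z1) = z1")
          case sq: True
          obtain e where e: "e \<in> {1..5}" "e \<notin> {x, y, z1, q z1}" using ex_other_point by metis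
          have "q e \<notin> {x, y, z1, q z1}"
            using e inj[of e y] inj[of e x] inj[of e "q z1"] inj[of e z1] True sq by (auto simp: y_def[symmetric])
          moreover have qe5: "q e \<in> {1..5}" using e permutes_in_image[OF qp] by simp
          moreover have "card {x, y, z1, q z1, e} = 5" using e z1 w False yx by auto
          then have "{x, y, z1, q z1, e} = {1..5}" using e(1) z1(1) w(1) x5 y5 by (intro card_subset_eq) auto
          ultimately have "q e = e" by blast
          then show ?thesis using e by blast
        next
          case nsq: False
          have q2p: "q \<circ> q \<in> A"
          proof -
            have "inv' q \<in> A" using quot[OF quot[OF q q] q] permutes_inv_o(1)[OF qp] by simp
            then have "q \<circ> inv' (inv' q) \<in> A" by (rule quot[OF q])
            then show ?thesis using permutes_inv_inv[OF qp] by simp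
          qed
          have "q \<circ> q = id"
            by (rule affine_on_two_fixed[OF lab aff[OF q2p] perm[OF q2p] x5 y5 yx[symmetric]])
              (use True in \<open>simp_all add: y_def[symmetric]\<close>)
          then have "q (q z1) = z1" by (metis comp_apply id_apply)
          then show ?thesis using nsq by simp
        qed
      qed
    qed
    then show ?thesis using True by (metis insert_commute insert_absorb2 order_refl)
  qed
  then obtain z u where z: "z \<in> {1..5}" "z \<notin> {x, y}" "{y, z, q y, q z} \<subseteq> {y, z, u}" by blast
  define r where "r = (tr y z \<circ> q \<circ> tr y z) \<circ> inv' q"
  have rA: "r \<in> A" unfolding r_def by (rule quot[OF conj[OF q y5 z(1)] q])
  have ry: "r y = z"
  proof -
    have "inv' q y = x" using qi(2)[of x] by (simp add: y_def)
    then show ?thesis using z yx unfolding r_def by (simp add: y_def[symmetric])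
  qed
  have rfix: "r e = e" if e: "e \<notin> {y, z, u}" for e
  proof -
    have "e \<noteq> q y" "e \<noteq> q z" using e z(3) by blast+
    then have "inv' q e \<noteq> y" "inv' q e \<noteq> z" using qi(1)[of e] by metis+
    then show ?thesis using e unfolding r_def by (simp add: qi)
  qed
  obtain e where e: "e \<in> {1..5}" "e \<notin> {y, z, u, u}" using ex_other_point by metis
  obtain f where f: "f \<in> {1..5}" "f \<notin> {y, z, u, e}" using ex_other_point by metis
  have "r = id"
    by (rule affine_on_two_fixed[OF lab aff[OF rA] perm[OF rA] e(1) f(1)]) (use e f rfix in auto)
  then show False using ry z by simp
qed

text \<open>For some transposition k = n + m \<circ> tr a b is nonzero, since otherwise m would be
  constant, hence 0. Then x plus its image is (k, k \<circ> tr a b). Adding to this its image under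
  a disjoint transposition gives a diagonal vector. If all of these vanish, k is invariant under tr
  a b and the vector was already diagonal. A diagonal vector r with r c \<noteq> r d yields
  \<open>pairv c d\<close>, and the pairs span N.\<close>

lemma U_submodule_contains_W:
  assumes M: "M \<subseteq> U_mod" "\<And>u v. u \<in> M \<Longrightarrow> v \<in> M \<Longrightarrow> u + v \<in> M"
    and act: "\<And>u p. u \<in> M \<Longrightarrow> p permutes {1..5} \<Longrightarrow> U_act u p \<in> M"
    and x: "x \<in> M" "x \<noteq> 0"
  shows "W_mod \<subseteq> M"
proof -
  have trp: "tr a b permutes {1..5}" if "a \<in> {1..5}" "b \<in> {1..5}" for a b using that by (rule permutes_swap_id)
  have odd: "U_act (n, m) (tr a b) = (m \<circ> tr a b, n \<circ> tr a b)" if "a \<noteq> b" for n m a b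
    using that by (simp add: U_act_def evenperm_swap)
  obtain n m where nm: "x = (n, m)" by fastforce
  have N: "n \<in> N_mod" "m \<in> N_mod" using x M nm by (auto simp: U_mod_def)
  have "\<exists>a\<in>{1..5}. \<exists>b\<in>{1..5}. a \<noteq> b \<and> n + (m \<circ> tr a b) \<noteq> 0"
  proof (rule ccontr)
    assume "\<not> ?thesis"
    then have e: "n = m \<circ> tr a b" if "a \<in> {1..5}" "b \<in> {1..5}" "a \<noteq> b" for a b
      using that bit_fun_add_eq_0 by blast
    have const: "m b = m d" if "b \<in> {1..5}" "d \<in> {1..5}" for b d
    proof -
      obtain a where a: "a \<in> {1..5}" "a \<notin> {b, d, d, d}" using ex_other_point by metis
      have "m \<circ> tr a b = m \<circ> tr a d" using e[of a b] e[of a d] a that by auto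
      then have "(m \<circ> tr a b) a = (m \<circ> tr a d) a" by simp
      then show ?thesis by simp
    qed
    have "m 1 + m 2 + m 3 + m 4 + m 5 = 0" using N(2) unfolding N_mod_iff by blast
    then have "m 1 = 0" using const[of 2 1] const[of 3 1] const[of 4 1] const[of 5 1]
      by (cases "m 1") simp_all
    then have "m i = 0" for i using const[of i 1] N(2) unfolding N_mod_def by (cases "i \<in> {1..5}") auto
    then have m0: "m = 0" by (simp add: fun_eq_iff)
    then have "n = 0" using e[of 1 2] by simp
    then show False using x(2) nm m0 by (simp add: zero_prod_def)
  qed
  then obtain a b where ab: "a \<in> {1..5}" "b \<in> {1..5}" "a \<noteq> b" "n + (m \<circ> tr a b) \<noteq> 0" by blast
  define kk where "kk = n + (m \<circ> tr a b)"
  have kN: "kk \<in> N_mod" unfolding kk_def using N N_mod_comp[OF N(2) trp[OF ab(1,2)]] by simp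
  have kk: "(kk, kk \<circ> tr a b) \<in> M"
  proof -
    have "x + U_act x (tr a b) \<in> M" by (rule M(2)[OF x(1) act[OF x(1) trp[OF ab(1,2)]]])
    moreover have "x + U_act x (tr a b) = (kk, kk \<circ> tr a b)"
      unfolding nm odd[OF ab(3)] kk_def by (simp add: add_comp comp_assoc add.commute)
    ultimately show ?thesis by simp
  qed
  have "\<exists>r. r \<in> N_mod \<and> r \<noteq> 0 \<and> (r, r) \<in> M"
  proof (cases "\<exists>c\<in>{1..5}. \<exists>d\<in>{1..5}. c \<noteq> d \<and> {a, b} \<inter> {c, d} = {} \<and> kk + (kk \<circ> tr a b \<circ> tr c d) \<noteq> 0")
    case True
    then obtain c d where cd: "c \<in> {1..5}" "d \<in> {1..5}" "c \<noteq> d" "{a, b} \<inter> {c, d} = {}"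
      "kk + (kk \<circ> tr a b \<circ> tr c d) \<noteq> 0" by blast
    let ?r = "kk + (kk \<circ> tr a b \<circ> tr c d)"
    have "(kk, kk \<circ> tr a b) + U_act (kk, kk \<circ> tr a b) (tr c d) \<in> M" by (rule M(2)[OF kk act[OF kk trp[OF cd(1,2)]]])
    moreover have "(kk, kk \<circ> tr a b) + U_act (kk, kk \<circ> tr a b) (tr c d) = (?r, (kk \<circ> tr a b) + (kk \<circ> tr c d))"
      unfolding odd[OF cd(3)] by simp
    moreover have "(kk \<circ> tr a b) + (kk \<circ> tr c d) = ?r"
    proof
      fix i
      show "((kk \<circ> tr a b) + (kk \<circ> tr c d)) i = ?r i"
        using cd(4) by (cases "i = a"; cases "i = b"; cases "i = c"; cases "i = d")
          (auto simp: Transposition.transpose_def add.commute)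
    qed
    moreover have "?r \<in> N_mod" by (intro N_mod_add kN N_mod_comp trp ab cd)
    ultimately show ?thesis using cd(5) by metis
  next
    case False
    have eq: "kk \<circ> tr a b \<circ> tr c d = kk" if "c \<in> {1..5}" "d \<in> {1..5}" "c \<noteq> d" "{a, b} \<inter> {c, d} = {}" for c d
      using False that bit_fun_add_eq_0 by metis
    obtain c where c: "c \<in> {1..5}" "c \<notin> {a, b, b, b}" using ex_other_point by metis
    obtain d where d: "d \<in> {1..5}" "d \<notin> {a, b, c, c}" using ex_other_point by metis
    have "kk \<circ> tr a b \<circ> tr c d = kk" using eq[of c d] c d by auto
    then have "(kk \<circ> tr a b \<circ> tr c d) a = kk a" by simp
    then have kab: "kk b = kk a" using c d ab by (auto simp: Transposition.transpose_def)
    have "kk \<circ> tr a b = kk"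
    proof
      fix i show "(kk \<circ> tr a b) i = kk i" using kab by (simp add: Transposition.transpose_def)
    qed
    then show ?thesis using kk kN ab(4) unfolding kk_def by auto
  qed
  then obtain r where r: "r \<in> N_mod" "r \<noteq> 0" "(r, r) \<in> M" by blast
  define A where "A = {v. (v, v) \<in> M}"
  have A_add: "u + v \<in> A" if "u \<in> A" "v \<in> A" for u v using M(2)[of "(u, u)" "(v, v)"] that by (simp add: A_def)
  have A_act: "u \<circ> p \<in> A" if "u \<in> A" "p permutes {1..5}" for u p
    using act[of "(u, u)" p] that by (auto simp: A_def U_act_def split: if_splits)
  have "\<exists>c\<in>{1..5}. \<exists>d\<in>{1..5}. r c \<noteq> r d"
  proof (rule ccontr)
    assume "\<not> ?thesis"
    then have const: "r d = r 1" if "d \<in> {1..5}" for d using that by (metis atLeastAtMost_iff le_numeral_extra(4) one_le_numeral)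
    have "r 1 + r 2 + r 3 + r 4 + r 5 = 0" using r(1) unfolding N_mod_iff by blast
    then have "r 1 = 0" using const[of 2] const[of 3] const[of 4] const[of 5] by (cases "r 1") simp_all
    then have "r i = 0" for i using const[of i] r(1) unfolding N_mod_def by (cases "i \<in> {1..5}") auto
    then show False using r(2) by (simp add: fun_eq_iff)
  qed
  then obtain c d where cd: "c \<in> {1..5}" "d \<in> {1..5}" "r c \<noteq> r d" by blast
  have cd1: "c \<noteq> d" using cd(3) by auto
  have "r \<in> A" using r(3) by (simp add: A_def)
  then have "r + (r \<circ> tr c d) \<in> A" using A_add A_act trp[OF cd(1,2)] by blast
  moreover have "r + (r \<circ> tr c d) = pairv c d"
  proof
    fix i show "(r + (r \<circ> tr c d)) i = pairv c d i"
      using cd(3) by (cases "r c"; cases "r d") (auto simp: pairv_def Transposition.transpose_def)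
  qed
  ultimately have cdA: "pairv c d \<in> A" by simp
  have "N_mod \<subseteq> A"
  proof (rule N_mod_span)
    have "r + r \<in> A" using A_add \<open>r \<in> A\<close> by blast
    then show "0 \<in> A" by simp
    show "pairv e f \<in> A" if ef: "e \<in> {1..5}" "f \<in> {1..5}" "e \<noteq> f" for e f
    proof -
      obtain p where p: "p permutes {1..5}" "p e = c" "p f = d"
        using even_two_transitive[OF cd(1,2) cd1 ef] by blast
      show ?thesis using A_act[OF cdA p(1)] pairv_comp[OF p(1), of e f] p(2,3) by simp
    qed
  qed (rule A_add)
  then show ?thesis by (auto simp: W_mod_def A_def)
qed

lemma U_norm_even:
  "p permutes {1..5} \<Longrightarrow> evenperm p \<Longrightarrow> (n, m) + U_act (n, m) p + U_act (n, m) (p \<circ> p) =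
    (n + (n \<circ> p) + (n \<circ> p \<circ> p), m + (m \<circ> p) + (m \<circ> p \<circ> p))"
  by (simp add: U_act_def evenperm_compose_1_5 comp_assoc)

lemma covec_cyc3:
  assumes "a \<notin> {b, c, d}" "b \<in> {1..5}" "c \<in> {1..5}" "d \<in> {1..5}" "b \<noteq> c" "c \<noteq> d" "b \<noteq> d"
  shows "covec a \<circ> cyc3 b c d = covec a"
  using covec_comp[OF cyc3_permutes[of b "{1..5}" c d], of a] cyc3_apply(4)[of b c d a] assms by simp

section \<open>Normal subloops of the folder loop\<close>

context script_folder
begin

text \<open>Products of two class members over the same a give the fixed vectors of a, which
  together span U^k. The class itself covers all transpositions, so the elements of G are reached
  once \<open>J\<close> is.\<close>

lemma generate_KK: "generate GG KK = carrier GG"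
proof
  show "generate GG KK \<subseteq> carrier GG" by (rule GG.generate_incl[OF KK_subset])
  let ?\<Gamma> = "generate GG KK"
  have mult: "x \<otimes>\<^bsub>GG\<^esub> z \<in> ?\<Gamma>" if "x \<in> ?\<Gamma>" "z \<in> ?\<Gamma>" for x z using that by (rule generate.eng)
  have incl: "x \<in> ?\<Gamma>" if "x \<in> KK" for x using that by (rule generate.incl)
  have CC0: "0 \<in> CC a" for a by (simp add: CC_def UU_0)
  have CC1: "(\<one>, w) \<in> ?\<Gamma>" if a: "a \<in> cG" "w \<in> CC a" for a w
  proof -
    have "(a, 0) \<otimes>\<^bsub>GG\<^esub> (a, w) \<in> ?\<Gamma>" by (intro mult incl) (use a CC0 in \<open>auto simp: KK_iff\<close>)
    then show ?thesis using cG_square[OF a(1)] by (simp add: mult_GG)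
  qed
  have add: "(\<one>, u + v) \<in> ?\<Gamma>" if "(\<one>, u) \<in> ?\<Gamma>" "(\<one>, v) \<in> ?\<Gamma>" for u v
    using mult[OF that] by (simp add: mult_GG act_J[OF J_one])
  have copy_all: "(\<one>, copy_at i x) \<in> ?\<Gamma>" if i: "i < k" and x: "x \<in> U_mod" for i x
  proof -
    define M where "M = {x. (\<one>, copy_at i x) \<in> ?\<Gamma>}"
    have M_add: "x + z \<in> M" if "x \<in> M" "z \<in> M" for x z
      using add[of "copy_at i x" "copy_at i z"] that by (simp add: M_def copy_at_add)
    have diag: "(n, n \<circ> tr p q) \<in> M" if n: "n \<in> N_mod" and pq: "p \<in> {1..5}" "q \<in> {1..5}" "p \<noteq> q" for n p q
    proof -
      obtain a where a: "a \<in> cG" "t a = tr p q" using cG_over_transposition[OF pq] by blast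
      have "(n, n \<circ> tr p q) \<in> U_mod" using n N_mod_comp[OF n permutes_swap_id[OF pq(1,2)]] by (simp add: U_mod_def)
      then have "copy_at i (n, n \<circ> tr p q) \<in> UU" using copy_at_mod_power[OF i U_mod_0] by simp
      then have "copy_at i (n, n \<circ> tr p q) \<in> CC a" by (auto simp: CC_def copy_at_def a(2))
      then show ?thesis unfolding M_def using CC1[OF a(1)] by simp
    qed
    have "N_mod \<subseteq> {n. (0, n) \<in> M}"
    proof (rule N_mod_span)
      have "copy_at i ((0 :: nat \<Rightarrow> bit), (0 :: nat \<Rightarrow> bit)) = 0" by (simp add: copy_at_def fun_eq_iff zero_prod_def)
      then have z: "(0, 0) \<in> M" unfolding M_def using generate.one[of GG KK] by (simp add: one_GG)
      then show "0 \<in> {n. (0, n) \<in> M}" by simp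
      show "u + v \<in> {n. (0, n) \<in> M}" if "u \<in> {n. (0, n) \<in> M}" "v \<in> {n. (0, n) \<in> M}" for u v
        using M_add[of "(0, u)" "(0, v)"] that by simp
      show "pairv b e \<in> {n. (0, n) \<in> M}" if be: "b \<in> {1..5}" "e \<in> {1..5}" "b \<noteq> e" for b e
      proof -
        \<comment> \<open>The fixed vectors of (a b) and of (a e) with the common first component
          \<open>pairv a d\<close> differ by (0, pairv b e).\<close>
        obtain a where a: "a \<in> {1..5}" "a \<notin> {b, e, e, e}" using ex_other_point by metis
        obtain d where d: "d \<in> {1..5}" "d \<notin> {a, b, e, e}" using ex_other_point by metis
        have n: "pairv a d \<in> N_mod" using pairv_in_N a d by auto
        have "pairv a d \<circ> tr a b = pairv b d" "pairv a d \<circ> tr a e = pairv e d"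
          using pairv_comp[OF permutes_swap_id[of a "{1..5}" b], of b d] pairv_comp[OF permutes_swap_id[of a "{1..5}" e], of e d] a d be
          by auto
        then have "(pairv a d, pairv b d) \<in> M" "(pairv a d, pairv e d) \<in> M"
          using diag[OF n, of a b] diag[OF n, of a e] a be by auto
        from M_add[OF this] have "(0, pairv b d + pairv e d) \<in> M" by simp
        moreover have "pairv b d + pairv e d = pairv b e" using be d by (auto simp: pairv_def fun_eq_iff)
        ultimately show ?thesis by simp
      qed
    qed
    then have second: "(0, n) \<in> M" if "n \<in> N_mod" for n using that by blast
    obtain n m where nm: "x = (n, m)" "n \<in> N_mod" "m \<in> N_mod" using x by (auto simp: U_mod_def)
    have t: "tr 1 2 permutes {1..5::nat}" by (rule permutes_swap_id) auto
    have d1: "(n, n \<circ> tr 1 2) \<in> M" by (rule diag[OF nm(2)]) auto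
    have d2: "(0, (n \<circ> tr 1 2) + m) \<in> M" by (rule second[OF N_mod_add[OF N_mod_comp[OF nm(2) t] nm(3)]])
    have "(n, m) = (n, n \<circ> tr 1 2) + (0, (n \<circ> tr 1 2) + m)" by (simp add: add.assoc[symmetric])
    then have "x \<in> M" using M_add[OF d1 d2] nm(1) by metis
    then show ?thesis by (simp add: M_def)
  qed
  have UU_in: "(\<one>, u) \<in> ?\<Gamma>" if u: "u \<in> UU" for u
  proof -
    have "(\<one>, \<lambda>i. if i < m then u i else 0) \<in> ?\<Gamma>" if "m \<le> k" for m
      using that
    proof (induction m)
      case 0
      show ?case using generate.one[of GG KK] by (simp add: one_GG zero_fun_def)
    next
      case (Suc m)
      have "(\<one>, copy_at m (u m)) \<in> ?\<Gamma>" by (rule copy_all) (use Suc u in \<open>auto simp: mod_power_def\<close>)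
      from add[OF _ this] have "(\<one>, (\<lambda>i. if i < m then u i else 0) + copy_at m (u m)) \<in> ?\<Gamma>" using Suc by simp
      moreover have "(\<lambda>i. if i < m then u i else 0) + copy_at m (u m) = (\<lambda>i. if i < Suc m then u i else 0)"
        by (auto simp: fun_eq_iff copy_at_def less_Suc_eq)
      ultimately show ?case by simp
    qed
    from this[of k] show ?thesis
    proof -
      have "(\<lambda>i. if i < k then u i else 0) = u" using u by (auto simp: fun_eq_iff mod_power_def)
      then show ?thesis using \<open>k \<le> k \<Longrightarrow> (\<one>, \<lambda>i. if i < k then u i else 0) \<in> ?\<Gamma>\<close> by simp
    qed
  qed
  have J0_in: "(v, 0) \<in> ?\<Gamma>" if "v \<in> J0" for v by (rule incl) (use that W_tilde_0 in \<open>simp add: KK_iff\<close>)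
  have mult0: "(g \<otimes> h, 0) \<in> ?\<Gamma>" if "(g, 0) \<in> ?\<Gamma>" "(h, 0) \<in> ?\<Gamma>" for g h
    using mult[OF that] by (simp add: mult_GG)
  have cG_in: "(a, 0) \<in> ?\<Gamma>" if "a \<in> cG" for a by (rule incl) (use that CC0 in \<open>simp add: KK_iff\<close>)
  \<comment> \<open>\<open>J0\<close> has index 2 in \<open>J\<close>, so a single element of
    \<open>J\<close> outside \<open>J0\<close> is enough. The square of a product of class members
    over disjoint transpositions is one.\<close>
  have J_in: "(j, 0) \<in> ?\<Gamma>" if j: "j \<in> J" for j
  proof -
    obtain a where a: "a \<in> cG" "t a = tr 1 2" using cG_over_transposition[of 1 2] by auto
    obtain b where b: "b \<in> cG" "t b = tr 3 4" using cG_over_transposition[of 3 4] by auto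
    obtain g where g: "g \<in> carrier G" "b = inv g \<otimes> a \<otimes> g"
      using conjugacy_class_conjugate[OF c(1) a(1) b(1)] by blast
    let ?m = "a \<otimes> b \<otimes> (a \<otimes> b)"
    have m0: "?m \<notin> J0"
      by (rule square_not_in_J0[OF cG_closed[OF a(1)] cG_square[OF a(1)] g a(2) b(2)]) auto
    have mG: "?m \<in> carrier G" using a(1) b(1) by simp
    have "t ?m = (tr 1 2 \<circ> tr 3 4) \<circ> (tr 1 2 \<circ> tr 3 4)" using a b by (simp add: t_mult)
    also have "\<dots> = id" by (auto simp: fun_eq_iff Transposition.transpose_def)
    finally have mJ: "?m \<in> J" using t_eq_id[OF mG] by simp
    have m_in: "(?m, 0) \<in> ?\<Gamma>" by (intro mult0 cG_in a b)
    have inj: "inj_on ((\<otimes>) ?m) J0"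
      by (rule inj_onI) (use mG J0_J in simp)
    have disj: "J0 \<inter> (\<otimes>) ?m ` J0 = {}"
    proof (rule ccontr)
      assume "J0 \<inter> (\<otimes>) ?m ` J0 \<noteq> {}"
      then obtain v w where vw: "v \<in> J0" "w \<in> J0" "v = ?m \<otimes> w" by blast
      have "v \<otimes> inv w = ?m" using vw mG J0_J[OF vw(2)] by (simp only: m_assoc J_closed inv_closed r_inv r_one)
      moreover have "v \<otimes> inv w \<in> J0" using vw J0_mult subgroup.m_inv_closed[OF J0_subgroup] by blast
      ultimately show False using m0 by simp
    qed
    have finJ: "finite J" using card_J card.infinite by fastforce
    have fin0: "finite J0" using finJ J0_subset_J finite_subset by blast
    have "card (J0 \<union> (\<otimes>) ?m ` J0) = 32"
      using card_Un_disjoint[OF fin0 finite_imageI[OF fin0] disj] card_image[OF inj] card_J0 by simp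
    moreover have "J0 \<union> (\<otimes>) ?m ` J0 \<subseteq> J" using J0_subset_J J_mult[OF mJ] by blast
    ultimately have "J0 \<union> (\<otimes>) ?m ` J0 = J" using finJ card_J by (intro card_subset_eq) auto
    then have "j \<in> J0 \<or> j \<in> (\<otimes>) ?m ` J0" using j by blast
    then show ?thesis using J0_in mult0[OF m_in J0_in] by blast
  qed
  have perm_in: "\<exists>g\<in>carrier G. t g = p \<and> (g, 0) \<in> ?\<Gamma>" if p: "p permutes {1..5}" for p
    using p finite_atLeastAtMost
  proof (induction rule: permutes_induct)
    case id
    show ?case using t_one J0_in[OF J0_one] by blast
  next
    case (swap a b p)
    then obtain g where g: "g \<in> carrier G" "t g = p" "(g, 0) \<in> ?\<Gamma>" by blast
    obtain a' where a': "a' \<in> cG" "t a' = tr a b" using cG_over_transposition[OF swap(1-3)] by blast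
    have "t (a' \<otimes> g) = tr a b \<circ> p" using g a' by (simp add: t_mult)
    moreover have "a' \<otimes> g \<in> carrier G" using g a' by simp
    ultimately show ?case using mult0[OF cG_in[OF a'(1)] g(3)] by blast
  qed
  show "carrier GG \<subseteq> ?\<Gamma>"
  proof
    fix x assume "x \<in> carrier GG"
    then obtain g u where gu: "x = (g, u)" "g \<in> carrier G" "u \<in> UU" by (auto simp: carrier_GG)
    obtain g' where g': "g' \<in> carrier G" "t g' = t g" "(g', 0) \<in> ?\<Gamma>" using perm_in[OF t_permutes[OF gu(2)]] by blast
    have j: "inv g' \<otimes> g \<in> J" using t_eq_iff[OF g'(1) gu(2)] g'(2) by simp
    have "(g' \<otimes> (inv g' \<otimes> g), 0) \<in> ?\<Gamma>" by (rule mult0[OF g'(3) J_in[OF j]])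
    then have "(g, 0) \<in> ?\<Gamma>" using g' gu by (simp add: m_assoc[symmetric])
    from mult[OF this UU_in[OF gu(3)]] show "x \<in> ?\<Gamma>" unfolding gu(1) using gu(2) by (simp add: mult_GG)
  qed
qed

lemma normal_subset_J0_W_tilde_trivial:
  assumes D: "D \<lhd> GG" and ND: "N = KK \<inter> D"
    and core: "\<And>d. d \<in> D \<Longrightarrow> \<exists>h\<in>HH. \<exists>n\<in>N. d = h \<otimes>\<^bsub>GG\<^esub> n"
    and fibre: "\<And>n z. n \<in> N \<Longrightarrow> z \<in> KK \<Longrightarrow> \<exists>d\<in>D. d \<otimes>\<^bsub>GG\<^esub> z \<in> KK \<and> d \<otimes>\<^bsub>GG\<^esub> inv\<^bsub>GG\<^esub> n \<in> HH"
    and sub: "N \<subseteq> J0 \<times> W_tilde k s"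
  shows "N = {\<one>\<^bsub>GG\<^esub>}"
proof -
  interpret D: normal D GG by (rule D)
  have D_carrier: "g \<in> carrier G" "u \<in> UU" if "(g, u) \<in> D" for g u
    using D.subset that by (auto simp: carrier_GG)
  have D_conj: "(inv h \<otimes> g \<otimes> h, act u h) \<in> D" if "(g, u) \<in> D" "h \<in> carrier G" for g u h
  proof -
    have "(h, 0) \<in> carrier GG" using that by (simp add: carrier_GG UU_0)
    from D.inv_op_closed1[OF this that(1)] show ?thesis
      using conj_GG[OF D_carrier[OF that(1)] that(2) UU_0] by simp
  qed
  have D_mult: "(g \<otimes> h, act u h + v) \<in> D" if "(g, u) \<in> D" "(h, v) \<in> D" for g u h v
    using D.m_closed[OF that] by (simp add: mult_GG)
  have D_J_mult: "(g \<otimes> j, u + v) \<in> D" if "(g, u) \<in> D" "(j, v) \<in> D" "j \<in> J" for g u j v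
    using D_mult[OF that(1,2)] act_J[OF that(3)] by simp
  \<comment> \<open>\<open>D\<close> lies in HH times \<open>N\<close>, and \<open>N\<close> lies
    over the identity, so the image of \<open>D\<close> in S5 is a normal subgroup consisting of
    affine maps.\<close>
  have D_image: "fst d \<in> J" if d: "d \<in> D" for d
  proof -
    let ?A = "{t (fst d) | d. d \<in> D}"
    have "t (fst d) = id"
    proof (rule affine_core_trivial[OF lb, of ?A])
      show "q permutes {1..5}" if "q \<in> ?A" for q using that D_carrier t_permutes by fastforce
      show "affine_on lb q" if qA: "q \<in> ?A" for q
      proof -
        obtain d where d: "d \<in> D" "q = t (fst d)" using qA by blast
        obtain h n where hn: "h \<in> HH" "n \<in> N" "d = h \<otimes>\<^bsub>GG\<^esub> n" using core[OF d(1)] by blast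
        obtain g w v w' where gv: "h = (g, w)" "n = (v, w')" by fastforce
        have v: "v \<in> J" using hn(2) sub gv J0_J by blast
        have gG: "g \<in> carrier G" using hn(1) gv subgroup.subset[OF HH_subgroup] by (auto simp: carrier_GG)
        have "t (fst d) = t g" using hn(3) gv v gG t_eq_id[of v] by (simp add: mult_GG t_mult)
        then show ?thesis using HH_affine[of g w] hn(1) gv d by simp
      qed
      show "q \<circ> inv' r \<in> ?A" if qA: "q \<in> ?A" and rA: "r \<in> ?A" for q r
      proof -
        obtain d where d: "d \<in> D" "q = t (fst d)" using qA by blast
        obtain e where e: "e \<in> D" "r = t (fst e)" using rA by blast
        obtain g u h v where gh: "d = (g, u)" "e = (h, v)" by fastforce
        have G: "g \<in> carrier G" "u \<in> UU" "h \<in> carrier G" "v \<in> UU" using d e gh D_carrier by blast+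
        have "inv' (t h) = t (inv h)" by (rule inv_unique_comp[OF t_inv(2,1)]) (use G in auto)
        then have "q \<circ> inv' r = t (fst (d \<otimes>\<^bsub>GG\<^esub> inv\<^bsub>GG\<^esub> e))"
          using d e gh G by (simp add: inv_GG mult_GG t_mult)
        moreover have "d \<otimes>\<^bsub>GG\<^esub> inv\<^bsub>GG\<^esub> e \<in> D" using d e by (intro D.m_closed D.m_inv_closed)
        ultimately show ?thesis by blast
      qed
      show "tr a b \<circ> q \<circ> tr a b \<in> ?A" if q: "q \<in> ?A" and ab: "a \<in> {1..5}" "b \<in> {1..5}" for q a b
      proof -
        obtain g u where g: "(g, u) \<in> D" "q = t g" using q by fastforce
        obtain h where h: "h \<in> carrier G" "t h = tr a b" using t_surj[OF permutes_swap_id[OF ab]] by blast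
        have "t (inv h) = tr a b"
          using t_inv(1)[OF h(1)] h(2) by (metis comp_assoc comp_id id_comp transpose_comp_involutory)
        then have "tr a b \<circ> q \<circ> tr a b = t (fst (inv h \<otimes> g \<otimes> h, act u h))"
          using h g D_carrier(1)[OF g(1)] by (simp add: t_mult)
        then show ?thesis using D_conj[OF g(1) h(1)] by blast
      qed
      show "t (fst d) \<in> ?A" using d by blast
    qed
    then show ?thesis using t_eq_id D_carrier(1)[of "fst d" "snd d"] d by simp
  qed
  have inv_N: "inv\<^bsub>GG\<^esub> n = n" if "n \<in> N" for n using that ND F.K_inv by blast
  \<comment> \<open>The fibre property for n = (v', 0) and z = (a, 0) yields d = (j, u). As d z is
    in the class, u is fixed by a and j commutes with a. As d n^-1 is in HH, u lies in T1^k, so u =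
    0 and j is v' or v' z0. The choice of v' and a excludes both.\<close>
  have noJ0: "v = \<one>" if v: "(v, 0) \<in> D" "v \<in> J0" for v
  proof (rule ccontr)
    assume "v \<noteq> \<one>"
    then obtain g a where ga: "g \<in> carrier G" "a \<in> cG"
      "inv a \<otimes> (inv g \<otimes> v \<otimes> g) \<otimes> a \<noteq> inv g \<otimes> v \<otimes> g"
      "inv a \<otimes> ((inv g \<otimes> v \<otimes> g) \<otimes> z0) \<otimes> a \<noteq> (inv g \<otimes> v \<otimes> g) \<otimes> z0"
      using J0_not_nearly_central[OF v(2)] unfolding Let_def by blast
    define v' where "v' = inv g \<otimes> v \<otimes> g"
    have v'0: "v' \<in> J0" unfolding v'_def by (rule J0_conj[OF v(2) ga(1)])
    have v'J: "v' \<in> J" using J0_J v'0 by blast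
    have "(v', 0) \<in> D" using D_conj[OF v(1) ga(1)] by (simp add: v'_def)
    then have v'N: "(v', 0) \<in> N" unfolding ND using v'0 W_tilde_0 by (simp add: KK_iff)
    have aK: "(a, 0) \<in> KK" using ga(2) UU_0 by (simp add: KK_iff CC_def)
    obtain d where d: "d \<in> D" "d \<otimes>\<^bsub>GG\<^esub> (a, 0) \<in> KK" "d \<otimes>\<^bsub>GG\<^esub> inv\<^bsub>GG\<^esub> (v', 0) \<in> HH"
      using fibre[OF v'N aK] by blast
    obtain j u where ju: "d = (j, u)" by fastforce
    have j: "j \<in> J" using D_image[OF d(1)] ju by simp
    have aG: "a \<in> carrier G" using ga(2) by simp
    have tja: "t (j \<otimes> a) = t a" using t_mult[of j a] j aG t_eq_id[of j] by simp
    have ja: "(j \<otimes> a, act u a) \<in> KK" using d(2) ju by (simp add: mult_GG)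
    have "j \<otimes> a \<notin> J0"
    proof
      assume "j \<otimes> a \<in> J0"
      then have "t (j \<otimes> a) = id" using t_eq_id J0_J by simp
      then show False using tja cG_not_J[OF ga(2)] t_eq_id aG by simp
    qed
    then have jac: "j \<otimes> a \<in> cG" "act u a \<in> CC (j \<otimes> a)" using ja KK_iff by blast+
    have "act u a \<in> CC a" using jac(2) tja by (simp add: CC_def)
    moreover have "act (act u a) a = u" using cG_square[OF ga(2)] aG by (simp add: act_act act_J[OF J_one])
    ultimately have uC: "u \<in> CC a" using CC_act[OF ga(2) _ refl] by metis
    have uH: "(j \<otimes> v', u) \<in> HH" using d(3) inv_N[OF v'N] ju by (simp add: mult_GG act_J[OF v'J])
    then have "u \<in> mod_power k T1" using HH_iff by blast
    then have u0: "u = 0" by (rule CC_T1[OF ga(2) uC])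
    then have "j \<otimes> v' \<in> H" using HH_s_0[OF uH] by simp
    then have jv: "j \<otimes> v' = \<one> \<or> j \<otimes> v' = z0" using H_J J_mult[OF j v'J] by blast
    have "j \<otimes> a \<otimes> (j \<otimes> a) = \<one>" by (rule cG_square[OF jac(1)])
    then have "j \<otimes> (a \<otimes> j \<otimes> a) = \<one>" using j aG by (simp add: m_assoc)
    then have "inv j = a \<otimes> j \<otimes> a" using j aG by (metis inv_solve_left J_closed inv_closed m_closed one_closed r_one)
    then have aj: "inv a \<otimes> j \<otimes> a = j" using J_inv[OF j] cG_inv[OF ga(2)] by simp
    have "j = v' \<or> j = v' \<otimes> z0"
    proof -
      have "j = (j \<otimes> v') \<otimes> v'" using j v'J by (simp add: m_assoc J_sq)
      then show ?thesis using jv J_comm[OF z0_J v'J] v'J by auto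
    qed
    then show False using aj ga(3,4) unfolding v'_def by auto
  qed
  \<comment> \<open>The operator 1 + x + x^2 for a three-cycle x annihilates the \<open>J0\<close>
    component, so an element of \<open>D\<close> over \<open>J0\<close> produces one in U^k.\<close>
  have norm: "(\<one>, \<lambda>i. u i + U_act (u i) (cyc3 a b e) + U_act (u i) (cyc3 a b e \<circ> cyc3 a b e)) \<in> D"
    if vu: "(v, u) \<in> D" "v \<in> J0" and abe: "a \<in> {1..5}" "b \<in> {1..5}" "e \<in> {1..5}" "a \<noteq> b" "b \<noteq> e" "a \<noteq> e" for v u a b e
  proof -
    obtain g where g: "g \<in> carrier G" "t g = cyc3 a b e" using t_surj[OF cyc3_permutes[OF abe(1-3)]] by blast
    have g3: "t g \<circ> t g \<circ> t g = id" unfolding g(2) by (rule cyc3_cube[OF abe(4-6)])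
    have gid: "t g \<noteq> id" using g(2) cyc3_apply(1)[OF abe(4-6)] abe(4) by (metis id_apply)
    let ?v1 = "inv g \<otimes> v \<otimes> g" and ?v2 = "inv (g \<otimes> g) \<otimes> v \<otimes> (g \<otimes> g)"
    have J: "?v1 \<in> J" "?v2 \<in> J" using J_conj[OF J0_J[OF vu(2)]] g(1) by simp_all
    have "(v \<otimes> ?v1 \<otimes> ?v2, u + act u g + act u (g \<otimes> g)) \<in> D"
      by (intro D_J_mult vu D_conj J) (use g in auto)
    then have "(\<one>, u + act u g + act u (g \<otimes> g)) \<in> D"
      unfolding three_cycle_kills_J0[OF g(1) g3 gid vu(2)] .
    moreover have "u + act u g + act u (g \<otimes> g) = (\<lambda>i. u i + U_act (u i) (cyc3 a b e) + U_act (u i) (cyc3 a b e \<circ> cyc3 a b e))"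
      by (rule ext) (simp only: plus_fun_apply power_act_def t_mult[OF g(1) g(1)] g(2))
    ultimately show ?thesis by simp
  qed
  have norm_even: "(n, m) + U_act (n, m) (cyc3 a b e) + U_act (n, m) (cyc3 a b e \<circ> cyc3 a b e) =
      (n + (n \<circ> cyc3 a b e) + (n \<circ> cyc3 a b e \<circ> cyc3 a b e), m + (m \<circ> cyc3 a b e) + (m \<circ> cyc3 a b e \<circ> cyc3 a b e))"
    if "a \<in> {1..5}" "b \<in> {1..5}" "e \<in> {1..5}" "a \<noteq> b" "b \<noteq> e" for n m a b e
    by (rule U_norm_even[OF cyc3_permutes[OF that(1-3)] evenperm_cyc3[OF that(4,5)]])
  define Ds where "Ds = {x \<in> U_mod. (\<one>, copy_at s x) \<in> D}"
  have norm_copy: "x + U_act x (cyc3 a b e) + U_act x (cyc3 a b e \<circ> cyc3 a b e) \<in> Ds"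
    if vx: "(v, copy_at s x) \<in> D" "v \<in> J0" and abe: "a \<in> {1..5}" "b \<in> {1..5}" "e \<in> {1..5}" "a \<noteq> b" "b \<noteq> e" "a \<noteq> e" for v x a b e
  proof -
    let ?y = "x + U_act x (cyc3 a b e) + U_act x (cyc3 a b e \<circ> cyc3 a b e)"
    have "(\<lambda>i. copy_at s x i + U_act (copy_at s x i) (cyc3 a b e) + U_act (copy_at s x i) (cyc3 a b e \<circ> cyc3 a b e)) = copy_at s ?y"
      by (auto simp: copy_at_def fun_eq_iff)
    then have d: "(\<one>, copy_at s ?y) \<in> D" using norm[OF vx abe] by simp
    then have "copy_at s ?y \<in> UU" using D_carrier(2) by blast
    then show ?thesis using d copy_at_mod_power[OF s U_mod_0] by (simp add: Ds_def)
  qed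
  \<comment> \<open>A three-cycle fixing the point f also fixes \<open>covec f\<close>, so on the
    corresponding vectors of S the operator is multiplication by 3 = 1.\<close>
  have S_norm: "\<exists>a b e. a \<in> {1..5} \<and> b \<in> {1..5} \<and> e \<in> {1..5} \<and> a \<noteq> b \<and> b \<noteq> e \<and> a \<noteq> e \<and>
      x + U_act x (cyc3 a b e) + U_act x (cyc3 a b e \<circ> cyc3 a b e) = x" if x: "x \<in> S_set" for x
  proof -
    have "\<exists>f. f \<in> {1..5} \<and> (x = 0 \<or> x = (covec f, covec f) \<or> x = (covec f, 0) \<or> x = (0, covec f))"
    proof (cases "x = 0")
      case True
      have "(1::nat) \<in> {1..5}" by simp
      then show ?thesis using True by blast
    next
      case False
      then show ?thesis using x unfolding S_set_eq by blast
    qed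
    then obtain f where f: "f \<in> {1..5}" "x = 0 \<or> x = (covec f, covec f) \<or> x = (covec f, 0) \<or> x = (0, covec f)" by blast
    obtain a where a: "a \<in> {1..5}" "a \<notin> {f, f, f, f}" using ex_other_point by metis
    obtain b where b: "b \<in> {1..5}" "b \<notin> {f, a, a, a}" using ex_other_point by metis
    obtain e where e: "e \<in> {1..5}" "e \<notin> {f, a, b, b}" using ex_other_point by metis
    have abe: "a \<noteq> b" "b \<noteq> e" "a \<noteq> e" using a b e by auto
    have cf: "covec f \<circ> cyc3 a b e = covec f" by (rule covec_cyc3) (use a b e in auto)
    have "x + U_act x (cyc3 a b e) + U_act x (cyc3 a b e \<circ> cyc3 a b e) = x"
      using f(2)
    proof (elim disjE)
      assume "x = 0" then show ?thesis by simp
    qed (simp_all only: norm_even[OF a(1) b(1) e(1) abe(1,2)] cf zero_comp bit_fun_add_self add_0)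
    then show ?thesis using a(1) b(1) e(1) abe by blast
  qed
  have S_copy: "x \<in> Ds" if "(v, copy_at s x) \<in> D" "v \<in> J0" "x \<in> S_set" for v x
    using S_norm[OF that(3)] norm_copy[OF that(1,2)] by metis
  have N_mem: "v \<in> J0" "w \<in> W_tilde k s" if "(v, w) \<in> N" for v w using sub that by blast+
  have Ds0: "x = 0" if x: "x \<in> Ds" for x
  proof (rule ccontr)
    assume "x \<noteq> 0"
    have "W_mod \<subseteq> Ds"
    proof (rule U_submodule_contains_W[OF _ _ _ x \<open>x \<noteq> 0\<close>])
      show "Ds \<subseteq> U_mod" by (auto simp: Ds_def)
      show "u + v \<in> Ds" if "u \<in> Ds" "v \<in> Ds" for u v
        using D_J_mult[of \<one> "copy_at s u" \<one> "copy_at s v"] that J_one U_mod_add by (simp add: Ds_def copy_at_add)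
      show "U_act u p \<in> Ds" if u: "u \<in> Ds" and p: "p permutes {1..5}" for u p
      proof -
        obtain g where g: "g \<in> carrier G" "t g = p" using t_surj[OF p] by blast
        have "(\<one>, copy_at s (U_act u p)) \<in> D"
          using D_conj[of \<one> "copy_at s u" g] u g by (simp add: Ds_def power_act_copy_at)
        then show ?thesis using u U_mod_act[OF _ p] by (simp add: Ds_def)
      qed
    qed
    \<comment> \<open>A vector of weight 2 gives an element of W outside S. Its representative
      modulo HH has its vector in the copy of S and a \<open>J0\<close> part v. Cancelling that
      vector inside \<open>D\<close> leaves (v, 0), so v = 1, and then y0 itself would lie in
      S.\<close>
    define y0 where "y0 = (pairv 1 2, pairv 1 2)"
    have y0W: "y0 \<in> W_mod" unfolding y0_def W_mod_def using pairv_in_N[of 1 2] by auto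
    have y0S: "y0 \<notin> S_set"
    proof
      assume "y0 \<in> S_set"
      moreover have "pairv 1 2 \<noteq> 0" by (auto simp: pairv_def fun_eq_iff)
      ultimately obtain f where f: "f \<in> {1..5}" "pairv 1 2 = covec f"
        by (cases rule: S_set_cases) (auto simp: y0_def zero_prod_def)
      have "card {i. pairv 1 2 i = 1} = 2" by (simp add: pairv_def Collect_disj_eq)
      then show False
        using fun_cong[OF f(2), of 3] fun_cong[OF f(2), of 4] by (auto simp: pairv_def covec_def split: if_splits)
    qed
    have y0D: "(\<one>, copy_at s y0) \<in> D" using \<open>W_mod \<subseteq> Ds\<close> y0W by (auto simp: Ds_def)
    obtain h n where hn: "h \<in> HH" "n \<in> N" "(\<one>, copy_at s y0) = h \<otimes>\<^bsub>GG\<^esub> n" using core[OF y0D] by blast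
    obtain v w where vw: "n = (v, w)" by fastforce
    note vw' = N_mem[OF hn(2)[unfolded vw]]
    have vJ: "v \<in> J" using vw' J0_J by blast
    have hG: "h \<in> carrier GG" using hn(1) subgroup.subset[OF HH_subgroup] by blast
    have nG: "n \<in> carrier GG" using hn(2) ND KK_subset by blast
    have "h = (\<one>, copy_at s y0) \<otimes>\<^bsub>GG\<^esub> inv\<^bsub>GG\<^esub> n" unfolding hn(3) using hG nG by (simp add: GG.m_assoc)
    then have h: "h = (v, copy_at s y0 + w)" unfolding inv_N[OF hn(2)] unfolding vw using vJ by (simp add: mult_GG act_J)
    note T = HH_J0[OF hn(1)[unfolded h] vw'(1)]
    have Ti: "(copy_at s y0 + w) i \<in> T1" for i using T(1) T1_0 by (cases "i < k") (auto simp: mod_power_def)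
    from vw'(2) show False
    proof (cases rule: W_tilde_cases)
      case 1
      have "w i = 0" if "i \<noteq> s" for i
      proof -
        have "w i \<in> W_mod" using 1(1) W_mod_0 by (cases "i < k") (auto simp: mod_power_def)
        moreover have "w i \<in> T1" using Ti[of i] that by (simp add: copy_at_other)
        ultimately show ?thesis by (rule W_T1)
      qed
      then have "w = copy_at s (w s)" by (rule copy_at_eqI)
      moreover have "w s \<in> W_mod" using 1(1) s by (simp add: mod_power_def)
      ultimately show False using 1(2) by blast
    next
      case (2 x')
      have "(v, copy_at s x') \<in> D" using hn(2) ND vw 2(2) by blast
      then have x'D: "x' \<in> Ds" using S_copy vw'(1) 2(1) by blast
      have "(v \<otimes> \<one>, copy_at s x' + copy_at s x') \<in> D"
        by (rule D_J_mult[OF \<open>(v, copy_at s x') \<in> D\<close> _ J_one]) (use x'D in \<open>simp add: Ds_def\<close>)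
      then have "(v, 0) \<in> D" using vJ by simp
      then have "v = \<one>" using noJ0 vw'(1) by blast
      then have "(copy_at s y0 + w) s = 0" using T(2) \<psi>_one by simp
      then have "y0 + x' = 0" using 2(2) by simp
      then have "y0 = x'" by (rule U_add_eq_0[THEN iffD1])
      then show False using y0S 2(1) by simp
    qed
  qed
  have W0: "w = 0" if w: "(\<one>, w) \<in> D" "w \<in> mod_power k W_mod" for w
  proof (rule ccontr)
    assume w0: "w \<noteq> 0"
    have not_copy: "w \<notin> copy_at s ` W_mod"
    proof
      assume "w \<in> copy_at s ` W_mod"
      then obtain x where x: "x \<in> W_mod" "w = copy_at s x" by blast
      then have "x \<in> Ds" using w(1) W_sub_U by (auto simp: Ds_def)
      then have "x = 0" using Ds0 by blast
      then show False using x(2) w0 copy_at_0 by simp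
    qed
    then have wN: "(\<one>, w) \<in> N" unfolding ND using w J0_one by (simp add: W_tilde_def KK_iff)
    \<comment> \<open>An element of S outside W. Translating it by w leads either back to the copy
      of S, which makes w a copy of a vector of W, or to a vector r in \<open>D\<close> over
      \<open>J0\<close> whose two components differ by \<open>covec 1\<close>. That difference is
      fixed by the cycle (2 3 4), so 1 + x + x^2 cannot annihilate both components of r.\<close>
    define y1 where "y1 = (covec 1, 0 :: nat \<Rightarrow> bit)"
    have y1S: "y1 \<in> S_set" unfolding S_set_eq y1_def by auto
    have yK: "(\<one>, copy_at s y1) \<in> KK" using y1S J0_one by (simp add: KK_iff W_tilde_def)
    obtain d where d: "d \<in> D" "d \<otimes>\<^bsub>GG\<^esub> (\<one>, copy_at s y1) \<in> KK" "d \<otimes>\<^bsub>GG\<^esub> inv\<^bsub>GG\<^esub> (\<one>, w) \<in> HH"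
      using fibre[OF wN yK] by blast
    obtain j u where ju: "d = (j, u)" by fastforce
    have jJ: "j \<in> J" using D_image[OF d(1)] ju by simp
    have juK: "(j, u + copy_at s y1) \<in> KK" using d(2) ju jJ by (simp add: mult_GG act_J[OF J_one])
    then have j: "j \<in> J0" "u + copy_at s y1 \<in> W_tilde k s" using KK_iff cG_not_J jJ by blast+
    have juH: "(j, u + w) \<in> HH" using d(3) inv_N[OF wN] ju jJ by (simp add: mult_GG act_J[OF J_one])
    have T: "(u + w) i \<in> T1" for i
    proof -
      have "u + w \<in> mod_power k T1" using juH HH_iff by blast
      then show ?thesis using T1_0 by (cases "i < k") (auto simp: mod_power_def)
    qed
    have wi: "w i \<in> W_mod" for i using w(2) W_mod_0 by (cases "i < k") (auto simp: mod_power_def)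
    from j(2) show False
    proof (cases rule: W_tilde_cases)
      case (2 x)
      have "u i = 0" if "i \<noteq> s" for i
        using fun_cong[OF 2(2), of i] that by (simp add: copy_at_other)
      then have "w i = 0" if "i \<noteq> s" for i using W_T1[OF wi] T[of i] that by simp
      then have "w = copy_at s (w s)" by (rule copy_at_eqI)
      then show False using not_copy wi[of s] by blast
    next
      case 1
      have ui: "(u + copy_at s y1) i \<in> W_mod" for i using 1(1) W_mod_0 by (cases "i < k") (auto simp: mod_power_def)
      have "(u + w) i = 0" if "i \<noteq> s" for i
      proof -
        have "u i \<in> W_mod" using ui[of i] that by (simp add: copy_at_other)
        then have "(u + w) i \<in> W_mod" using W_mod_add wi by simp
        then show ?thesis by (rule W_T1[OF _ T])
      qed
      then have c: "u + w = copy_at s ((u + w) s)" by (rule copy_at_eqI)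
      define r where "r = (u + w) s"
      have "r + y1 \<in> W_mod" using W_mod_add[OF ui[of s] wi[of s]] by (simp add: r_def ac_simps)
      then obtain l where l: "l \<in> N_mod" "r + y1 = (l, l)" by (auto simp: W_mod_def)
      have r: "r = (l + covec 1, l)"
      proof -
        have "r = (r + y1) + y1" by (simp add: add.assoc)
        then show ?thesis unfolding l(2) by (simp add: y1_def)
      qed
      have "(j \<otimes> \<one>, u + w) \<in> D" by (rule D_J_mult[OF _ w(1) J_one]) (use d(1) ju in simp)
      then have "(j, copy_at s r) \<in> D" using jJ c by (simp add: r_def)
      from norm_copy[OF this j(1), of 2 3 4]
      have "r + U_act r (cyc3 2 3 4) + U_act r (cyc3 2 3 4 \<circ> cyc3 2 3 4) \<in> Ds" by simp
      then have z: "r + U_act r (cyc3 2 3 4) + U_act r (cyc3 2 3 4 \<circ> cyc3 2 3 4) = 0" by (rule Ds0)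
      have cf: "covec 1 \<circ> cyc3 2 3 4 = covec 1" by (rule covec_cyc3) auto
      have ne: "r + U_act r (cyc3 2 3 4) + U_act r (cyc3 2 3 4 \<circ> cyc3 2 3 4) =
        ((l + covec 1) + ((l + covec 1) \<circ> cyc3 2 3 4) + ((l + covec 1) \<circ> cyc3 2 3 4 \<circ> cyc3 2 3 4),
          l + (l \<circ> cyc3 2 3 4) + (l \<circ> cyc3 2 3 4 \<circ> cyc3 2 3 4))"
        unfolding r by (rule norm_even) auto
      have l0: "l + (l \<circ> cyc3 2 3 4) + (l \<circ> cyc3 2 3 4 \<circ> cyc3 2 3 4) = 0"
        and lc: "(l + covec 1) + ((l + covec 1) \<circ> cyc3 2 3 4) + ((l + covec 1) \<circ> cyc3 2 3 4 \<circ> cyc3 2 3 4) = 0"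
        using z unfolding ne zero_prod_def by simp_all
      have "(l + covec 1) + ((l + covec 1) \<circ> cyc3 2 3 4) + ((l + covec 1) \<circ> cyc3 2 3 4 \<circ> cyc3 2 3 4) =
        (l + (l \<circ> cyc3 2 3 4) + (l \<circ> cyc3 2 3 4 \<circ> cyc3 2 3 4)) + (covec 1 + covec 1 + covec 1)"
        unfolding add_comp cf by (simp only: ac_simps)
      then have "covec 1 + covec 1 + covec 1 = 0" unfolding l0 lc by (simp only: add_0)
      then show False using covec_nonzero[of 1] by simp
    qed
  qed
  have "n = \<one>\<^bsub>GG\<^esub>" if n: "n \<in> N" for n
  proof -
    obtain v w where vw: "n = (v, w)" by fastforce
    have nD: "(v, w) \<in> D" using n ND vw by blast
    note vw' = N_mem[OF n[unfolded vw]]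
    have "w = 0"
      using vw'(2)
    proof (cases rule: W_tilde_cases)
      case 1
      have wi: "w i \<in> W_mod" for i using 1(1) W_mod_0 by (cases "i < k") (auto simp: mod_power_def)
      show ?thesis
      proof
        fix i
        obtain l where l: "l \<in> N_mod" "w i = (l, l)" using wi[of i] by (auto simp: W_mod_def)
        have "l = 0"
        \<comment> \<open>All norms of w stay in W^k and lie in \<open>D\<close>, so by
          \<open>W0\<close> they vanish. As the three-cycle is arbitrary, each entry of w
          vanishes.\<close>
        proof (rule N_mod_eq_0_if_killed[OF l(1)])
          fix a b e assume abe: "a \<in> {1..5}" "b \<in> {1..5}" "e \<in> {1..5}" "a \<noteq> b" "b \<noteq> e" "a \<noteq> (e::nat)"
          let ?w = "\<lambda>i. w i + U_act (w i) (cyc3 a b e) + U_act (w i) (cyc3 a b e \<circ> cyc3 a b e)"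
          have cp: "cyc3 a b e permutes {1..5}" by (rule cyc3_permutes[OF abe(1-3)])
          have "?w i \<in> W_mod" for i
            by (intro W_mod_add W_mod_act wi cp permutes_compose)
          moreover have "?w i = 0" if "i \<ge> k" for i using 1(1) that by (simp add: mod_power_def)
          ultimately have "?w \<in> mod_power k W_mod" by (simp add: mod_power_def)
          then have "?w = 0" by (rule W0[OF norm[OF nD vw'(1) abe]])
          from fun_cong[OF this, of i] show "l + (l \<circ> cyc3 a b e) + (l \<circ> cyc3 a b e \<circ> cyc3 a b e) = 0"
            unfolding l(2) norm_even[OF abe(1-5)] by (simp add: zero_prod_def)
        qed
        then show "w i = 0 i" using l(2) by (simp add: zero_prod_def)
      qed
    next
      case (2 x)
      have "x \<in> Ds" by (rule S_copy[OF nD[unfolded 2(2)] vw'(1) 2(1)])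
      then have "x = 0" by (rule Ds0)
      then show ?thesis unfolding 2(2) by (simp only: copy_at_0)
    qed
    then show ?thesis using noJ0 nD vw'(1) vw by (simp add: one_GG)
  qed
  moreover have "\<one>\<^bsub>GG\<^esub> \<in> N" unfolding ND using one_in_KK D.one_closed by blast
  ultimately show ?thesis by blast
qed

lemma simple_folder_loop: "simple_loop (folder_loop GG HH KK)"
  unfolding simple_loop_def
proof (intro conjI allI impI F.is_loop_L)
  fix N assume "normal_subloop N (folder_loop GG HH KK)"
  from F.normal_subloop_core[OF generate_KK this] obtain D where D: "D \<lhd> GG" "N = KK \<inter> D"
    and p4: "\<And>d. d \<in> D \<Longrightarrow> \<exists>h\<in>HH. \<exists>n\<in>N. d = h \<otimes>\<^bsub>GG\<^esub> n"
    and p5: "\<And>n y. n \<in> N \<Longrightarrow> y \<in> KK \<Longrightarrow> \<exists>d\<in>D. d \<otimes>\<^bsub>GG\<^esub> y \<in> KK \<and> d \<otimes>\<^bsub>GG\<^esub> inv\<^bsub>GG\<^esub> n \<in> HH"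
    and p6: "\<And>y. y \<in> KK \<Longrightarrow> y \<notin> N \<Longrightarrow> card N \<le> card (KK - N)"
    by metis
  interpret D: normal D GG by (rule D(1))
  show "N = {\<one>\<^bsub>folder_loop GG HH KK\<^esub>} \<or> N = carrier (folder_loop GG HH KK)"
  proof (cases "N \<subseteq> J0 \<times> W_tilde k s")
    case True
    have "N = {\<one>\<^bsub>GG\<^esub>}" by (rule normal_subset_J0_W_tilde_trivial[OF D p4 p5 True])
    then show ?thesis by simp
  next
    case False
    then obtain x where x: "x \<in> N" "x \<in> conjugacy_class GG (c, 0)" using D(2) unfolding KK_def by blast
    have c0: "(c, 0) \<in> carrier GG" using c(1) UU_0 by (simp add: carrier_GG)
    have cls: "conjugacy_class GG (c, 0) \<subseteq> N"
    proof
      fix z assume z: "z \<in> conjugacy_class GG (c, 0)"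
      obtain g where g: "g \<in> carrier GG" "z = inv\<^bsub>GG\<^esub> g \<otimes>\<^bsub>GG\<^esub> x \<otimes>\<^bsub>GG\<^esub> g"
        using GG.conjugacy_class_conjugate[OF c0 x(2) z] by blast
      have "z \<in> D" unfolding g(2) by (rule D.inv_op_closed1[OF g(1)]) (use x D(2) in blast)
      moreover have "z \<in> KK" using z unfolding KK_def by blast
      ultimately show "z \<in> N" using D(2) by blast
    qed
    have "N = KK"
    proof (rule ccontr)
      assume "N \<noteq> KK"
      then obtain y where "y \<in> KK" "y \<notin> N" using D(2) by blast
      then have "card N \<le> card (KK - N)" by (rule p6)
      also have "\<dots> \<le> card (J0 \<times> W_tilde k s)"
        by (rule card_mono[OF card_J0_W_tilde(2)]) (use cls in \<open>auto simp: KK_def\<close>)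
      also have "\<dots> = 16 * 16 ^ k" by (rule card_J0_W_tilde(1))
      finally have "card N \<le> 16 * 16 ^ k" .
      moreover have "80 * 16 ^ k \<le> card N"
      proof -
        have "finite N" using D(2) finite_subset[OF KK_subset finite_GG] by simp
        then show ?thesis using card_class card_mono[OF _ cls] by (meson le_trans)
      qed
      ultimately have "(80::nat) * 16 ^ k \<le> 16 * 16 ^ k" by linarith
      then show False by simp
    qed
    then show ?thesis by simp
  qed
qed

lemma KK_nontrivial: "KK \<noteq> {\<one>\<^bsub>GG\<^esub>}"
proof
  assume "KK = {\<one>\<^bsub>GG\<^esub>}"
  then have "96 * 16 ^ k \<le> (1::nat)" using card_KK by simp
  moreover have "(1::nat) \<le> 16 ^ k" by simp
  ultimately show False by linarith
qed

end

subsection \<open>Quotients of G\<close>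

lemma quotient_permutation_action:
  fixes G (structure)
  assumes J: "J \<lhd> G" and \<theta>: "\<theta> \<in> iso (G Mod J) (sym_group n)"
  shows "g \<in> carrier G \<Longrightarrow> \<theta> (J #> g) permutes {1..n}"
    and "g \<in> carrier G \<Longrightarrow> h \<in> carrier G \<Longrightarrow> \<theta> (J #> (g \<otimes> h)) = \<theta> (J #> g) \<circ> \<theta> (J #> h)"
    and "p permutes {1..n} \<Longrightarrow> \<exists>g\<in>carrier G. \<theta> (J #> g) = p"
    and "g \<in> carrier G \<Longrightarrow> \<theta> (J #> g) = id \<longleftrightarrow> g \<in> J"
    and "order G = fact n * card J"
proof -
  interpret J: normal J G by (rule J)
  have car: "carrier (G Mod J) = (\<lambda>g. J #> g) ` carrier G" by (auto simp: FactGroup_def RCOSETS_def)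
  have bij: "bij_betw \<theta> (carrier (G Mod J)) (carrier (sym_group n))" and hom: "\<theta> \<in> hom (G Mod J) (sym_group n)"
    using \<theta> by (auto simp: iso_def)
  have in_car: "J #> g \<in> carrier (G Mod J)" if "g \<in> carrier G" for g using that car by blast
  show perm: "\<theta> (J #> g) permutes {1..n}" if "g \<in> carrier G" for g
    using hom_in_carrier[OF hom in_car[OF that]] by (simp add: sym_group_carrier)
  show mult: "\<theta> (J #> (g \<otimes> h)) = \<theta> (J #> g) \<circ> \<theta> (J #> h)" if "g \<in> carrier G" "h \<in> carrier G" for g h
    using hom_mult[OF hom in_car[OF that(1)] in_car[OF that(2)]] J.rcos_sum[OF that]
    by (simp add: FactGroup_def sym_group_mult)
  show "\<exists>g\<in>carrier G. \<theta> (J #> g) = p" if "p permutes {1..n}" for p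
  proof -
    have "p \<in> \<theta> ` carrier (G Mod J)" using that bij by (simp add: bij_betw_def sym_group_carrier)
    then show ?thesis unfolding car by blast
  qed
  have one: "\<theta> (J #> \<one>) = id"
  proof -
    have "\<theta> (J #> \<one>) \<circ> \<theta> (J #> \<one>) = \<theta> (J #> \<one>)" using mult[of \<one> \<one>] by simp
    then have "\<theta> (J #> \<one>) (\<theta> (J #> \<one>) x) = \<theta> (J #> \<one>) x" for x by (metis comp_apply)
    then show ?thesis using permutes_inj[OF perm[of \<one>]] by (auto simp: fun_eq_iff dest: injD)
  qed
  show "\<theta> (J #> g) = id \<longleftrightarrow> g \<in> J" if g: "g \<in> carrier G" for g
  proof -
    have "\<theta> (J #> g) = id \<longleftrightarrow> J #> g = J #> \<one>"
      using inj_onD[OF bij_betw_imp_inj_on[OF bij] _ in_car[OF g] in_car[of \<one>]] one by auto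
    also have "\<dots> \<longleftrightarrow> J #> g = J" by (simp add: J.subset)
    also have "\<dots> \<longleftrightarrow> g \<in> J" using J.coset_join1[OF _ g J.subgroup_axioms] J.coset_join2[OF g J.subgroup_axioms] by blast
    finally show ?thesis .
  qed
  have "card (rcosets J) = fact n"
    using bij_betw_same_card[OF bij] by (simp add: sym_group_card_carrier FactGroup_def)
  then show "order G = fact n * card J" using J.lagrange[OF J.subgroup_axioms] by simp
qed

lemma (in group) commutator_subgroup_normal:
  assumes J: "J \<lhd> G" shows "commutator_subgroup G (carrier G) J \<lhd> G"
  unfolding commutator_subgroup_def
proof (rule normal_generateI)
  interpret J: normal J G by (rule J)
  let ?S = "{a \<otimes> b \<otimes> inv a \<otimes> inv b |a b. a \<in> carrier G \<and> b \<in> J}"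
  show "?S \<subseteq> carrier G" by (auto intro!: m_closed)
  show "g \<otimes> h \<otimes> inv g \<in> ?S" if h: "h \<in> ?S" and g: "g \<in> carrier G" for h g
  proof -
    obtain a b where ab: "h = a \<otimes> b \<otimes> inv a \<otimes> inv b" "a \<in> carrier G" "b \<in> J" using h by blast
    have b: "b \<in> carrier G" using ab(3) by simp
    have can: "inv g \<otimes> (g \<otimes> x) = x" if "x \<in> carrier G" for x using that g by (simp add: m_assoc[symmetric])
    have "g \<otimes> h \<otimes> inv g = (g \<otimes> a \<otimes> inv g) \<otimes> (g \<otimes> b \<otimes> inv g) \<otimes> inv (g \<otimes> a \<otimes> inv g) \<otimes> inv (g \<otimes> b \<otimes> inv g)"
      unfolding ab(1) using ab(2) b g by (simp add: inv_mult_group m_assoc can)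
    moreover have "g \<otimes> b \<otimes> inv g \<in> J" by (rule J.inv_op_closed2[OF g ab(3)])
    ultimately show ?thesis using ab(2) g by blast
  qed
qed

text \<open>The image of a in SL(2,5) has square 1, so it is scalar and commutes with the image of
  x.\<close>

lemma (in group) SL25_quotient_derived_involution:
  assumes J: "J \<lhd> G"
    and SL: "(G\<lparr>carrier := derived G (carrier G)\<rparr> Mod commutator_subgroup G (carrier G) J) \<cong> SL25"
    and a: "a \<in> derived G (carrier G)" "a \<otimes> a \<in> commutator_subgroup G (carrier G) J"
    and x: "x \<in> derived G (carrier G)"
  shows "a \<otimes> x \<otimes> inv a \<otimes> inv x \<in> commutator_subgroup G (carrier G) J"
proof -
  let ?D = "derived G (carrier G)"
  define J0 where "J0 = commutator_subgroup G (carrier G) J"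
  interpret J: normal J G by (rule J)
  have D: "subgroup ?D G" by (rule derived_is_subgroup) simp
  interpret D: subgroup ?D G by (rule D)
  have "J0 \<subseteq> ?D" unfolding J0_def commutator_subgroup_def derived_def
    by (rule mono_generate) (use J.subset in blast)
  then have nor: "J0 \<lhd> G\<lparr>carrier := ?D\<rparr>"
    using normal_restrict_supergroup[OF D commutator_subgroup_normal[OF J]] by (simp add: J0_def)
  interpret N: normal J0 "G\<lparr>carrier := ?D\<rparr>" by (rule nor)
  obtain f where "f \<in> iso (G\<lparr>carrier := ?D\<rparr> Mod J0) SL25" using SL by (auto simp: is_iso_def J0_def)
  then have hom: "f \<in> hom (G\<lparr>carrier := ?D\<rparr> Mod J0) SL25" and inj: "inj_on f (carrier (G\<lparr>carrier := ?D\<rparr> Mod J0))"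
    and surj: "f ` carrier (G\<lparr>carrier := ?D\<rparr> Mod J0) = carrier SL25"
    by (auto simp: iso_def bij_betw_def)
  have coset: "J0 #>\<^bsub>G\<lparr>carrier := ?D\<rparr>\<^esub> g = J0 #> g" for g by (simp add: r_coset_def)
  have car: "J0 #> g \<in> carrier (G\<lparr>carrier := ?D\<rparr> Mod J0)" if "g \<in> ?D" for g
    using that by (auto simp: FactGroup_def RCOSETS_def coset)
  have mult: "f (J0 #> (g \<otimes> h)) = f (J0 #> g) ** f (J0 #> h)" if "g \<in> ?D" "h \<in> ?D" for g h
    using hom_mult[OF hom car[OF that(1)] car[OF that(2)]] N.rcos_sum[of g h] that
    by (simp add: FactGroup_def SL25_def coset)
  have det: "det (f (J0 #> g)) = 1" if "g \<in> ?D" for g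
    using hom_in_carrier[OF hom car[OF that]] by (simp add: SL25_def)
  have "f (J0 #> \<one>) = mat 1"
  proof -
    have "mat 1 \<in> f ` carrier (G\<lparr>carrier := ?D\<rparr> Mod J0)" unfolding surj by (simp add: SL25_def)
    then obtain g where g: "g \<in> ?D" "f (J0 #> g) = mat 1"
      by (auto simp: FactGroup_def RCOSETS_def coset)
    have "f (J0 #> \<one>) = f (J0 #> \<one>) ** f (J0 #> g)" unfolding g(2) by (simp add: matrix_mul_rid)
    also have "\<dots> = f (J0 #> g)" using mult[of \<one> g] g(1) by simp
    finally show ?thesis using g(2) by simp
  qed
  moreover have "J0 #> (a \<otimes> a) = J0 #> \<one>"
    using N.coset_join2[of "a \<otimes> a" J0] N.coset_join2[of \<one> J0] N.subgroup_axioms subgroup.one_closed[OF N.subgroup_axioms] a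
    by (simp add: coset J0_def[symmetric])
  ultimately have "f (J0 #> a) ** f (J0 #> a) = mat 1" using mult[of a a] a(1) by simp
  then obtain b where b: "f (J0 #> a) = mat b" using SL25_involution_central[OF det[OF a(1)]] by blast
  have "f (J0 #> (a \<otimes> x)) = f (J0 #> (x \<otimes> a))"
    unfolding mult[OF a(1) x] mult[OF x a(1)] b by (rule mat_commute)
  then have "J0 #> (a \<otimes> x) = J0 #> (x \<otimes> a)"
    by (rule inj_onD[OF inj]) (use a x car in auto)
  moreover have "a \<otimes> x \<in> J0 #> (a \<otimes> x)"
    using N.rcos_self[of "a \<otimes> x"] N.subgroup_axioms a x by (simp add: coset)
  ultimately obtain v where v: "v \<in> J0" "a \<otimes> x = v \<otimes> (x \<otimes> a)" by (auto simp: r_coset_def)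
  have vG: "v \<in> carrier G" using v(1) N.subset D.subset by auto
  have "a \<otimes> x \<otimes> inv a \<otimes> inv x = v \<otimes> (x \<otimes> (a \<otimes> inv a) \<otimes> inv x)"
    unfolding v(2) using vG a(1) x by (simp only: m_assoc m_closed inv_closed D.mem_carrier)
  also have "\<dots> = v" using vG a(1) x by simp
  finally show ?thesis using v(1) by (simp add: J0_def)
qed

section \<open>Lifting even permutations to the derived subgroup\<close>

context base_action
begin

text \<open>A5 is perfect, so an even permutation is a product of commutators, and commutators lift
  to commutators.\<close>

lemma evenperm_lift:
  assumes "p permutes {1..5}" "evenperm p"
  shows "\<exists>d\<in>derived G (carrier G). t d = p"
proof -
  let ?A = "alt_group 5" and ?D = "derived G (carrier G)"
  have Dsub: "subgroup ?D G" by (rule derived_is_subgroup) simp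
  have lift_inv: "t (inv g) = inv' (t g)" if "g \<in> carrier G" for g
    by (rule inv_unique_comp[OF t_inv(2,1), symmetric]) (use that in auto)
  have A: "q permutes {1..5}" if "q \<in> carrier ?A" for q using that by (simp add: alt_group_carrier)
  have "p \<in> generate ?A (derived_set ?A (carrier ?A))"
    using derived_alt_group_const[of 5] assms unfolding derived_def by (simp add: alt_group_carrier)
  then show ?thesis
  proof (induction p rule: generate.induct)
    case one
    show ?case unfolding alt_group_one using subgroup.one_closed[OF Dsub] t_one by blast
  next
    case (incl q)
    then obtain a b where ab: "a \<in> carrier ?A" "b \<in> carrier ?A"
      "q = a \<otimes>\<^bsub>?A\<^esub> b \<otimes>\<^bsub>?A\<^esub> inv\<^bsub>?A\<^esub> a \<otimes>\<^bsub>?A\<^esub> inv\<^bsub>?A\<^esub> b" by blast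
    obtain g h where gh: "g \<in> carrier G" "t g = a" "h \<in> carrier G" "t h = b" using t_surj A ab by metis
    have "t (g \<otimes> h \<otimes> inv g \<otimes> inv h) = q"
      unfolding ab(3) using gh ab by (simp add: t_mult lift_inv alt_group_mult alt_group_inv_equality)
    moreover have "g \<otimes> h \<otimes> inv g \<otimes> inv h \<in> ?D" by (rule commutator_in_derived) (use gh in auto)
    ultimately show ?case by blast
  next
    case (inv q)
    then obtain a b where ab: "a \<in> carrier ?A" "b \<in> carrier ?A"
      "q = a \<otimes>\<^bsub>?A\<^esub> b \<otimes>\<^bsub>?A\<^esub> inv\<^bsub>?A\<^esub> a \<otimes>\<^bsub>?A\<^esub> inv\<^bsub>?A\<^esub> b" by blast
    interpret AG: group ?A by (rule alt_group_is_group)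
    have q: "inv\<^bsub>?A\<^esub> q = b \<otimes>\<^bsub>?A\<^esub> a \<otimes>\<^bsub>?A\<^esub> inv\<^bsub>?A\<^esub> b \<otimes>\<^bsub>?A\<^esub> inv\<^bsub>?A\<^esub> a"
      unfolding ab(3) using ab by (simp add: AG.inv_mult_group AG.m_assoc)
    obtain g h where gh: "g \<in> carrier G" "t g = b" "h \<in> carrier G" "t h = a" using t_surj A ab by metis
    have "t (g \<otimes> h \<otimes> inv g \<otimes> inv h) = inv\<^bsub>?A\<^esub> q"
      unfolding q using gh ab by (simp add: t_mult lift_inv alt_group_mult alt_group_inv_equality)
    moreover have "g \<otimes> h \<otimes> inv g \<otimes> inv h \<in> ?D" by (rule commutator_in_derived) (use gh in auto)
    ultimately show ?case by blast
  next
    case (eng q r)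
    then obtain d e where d: "d \<in> ?D" "t d = q" "e \<in> ?D" "t e = r" by blast
    have "t (d \<otimes> e) = q \<circ> r" using t_mult[of d e] subgroup.mem_carrier[OF Dsub] d by simp
    then show ?case unfolding alt_group_mult using subgroup.m_closed[OF Dsub d(1,3)] by blast
  qed
qed

text \<open>If \<open>t c\<close> were even, c would agree modulo \<open>J\<close> with an element
  of [G,G]. So \<open>t c\<close> is an odd involution of five points.\<close>

lemma outer_involution_transposition:
  assumes c: "c \<in> carrier G" "c \<notin> derived G (carrier G) <#> J" "c \<otimes> c = \<one>"
  obtains c1 c2 where "c1 \<in> {1..5}" "c2 \<in> {1..5}" "c1 \<noteq> c2" "t c = tr c1 c2"
proof -
  have "\<not> evenperm (t c)"
  proof
    assume "evenperm (t c)"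
    then obtain d where d: "d \<in> derived G (carrier G)" "t d = t c" using evenperm_lift t_permutes[OF c(1)] by blast
    have dG: "d \<in> carrier G" using d(1) derived_in_carrier[of "carrier G"] by auto
    have "inv d \<otimes> c \<in> J" using t_eq_iff[OF dG c(1)] d(2) by simp
    moreover have "c = d \<otimes> (inv d \<otimes> c)" using dG c(1) by (simp add: m_assoc[symmetric])
    ultimately show False using c(2) d(1) unfolding set_mult_def by blast
  qed
  moreover have "t c \<circ> t c = id" using t_mult[OF c(1,1)] c(3) t_one by simp
  ultimately show ?thesis using odd_involution_1_5[OF t_permutes[OF c(1)]] that by blast
qed

end

section \<open>The submodule T1 as an omega graph\<close>

context labelled_folder
begin

text \<open>From x^5 = 1 follows x = (x^3)^2, and squares are even.\<close>

lemma P_evenperm: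
  assumes "x \<in> P" shows "evenperm (t x)"
proof -
  have x: "x \<in> carrier G" using assms by simp
  have "x [^] (3::nat) \<otimes> x [^] (3::nat) = x [^] (5::nat) \<otimes> x" using x by (simp add: nat_pow_mult flip: nat_pow_Suc)
  then have "t x = t (x [^] (3::nat)) \<circ> t (x [^] (3::nat))" using P_pow5[OF assms] x t_mult[of "x [^] (3::nat)" "x [^] (3::nat)"] by simp
  then show ?thesis
    using evenperm_comp[of "t (x [^] (3::nat))" "t (x [^] (3::nat))"] t_permutes[of "x [^] (3::nat)"] x
    by (metis finite_atLeastAtMost nat_pow_closed permutation_permutes)
qed

lemma doubling_odd:
  assumes f: "f permutes {1..5}" "\<And>j. f (lab j) = lab (2 * j)"
  shows "\<not> evenperm f"
proof -
  have l: "lab i = lab j \<longleftrightarrow> i = j" for i j using lab by (auto simp: bij_betw_def dest: injD)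
  \<comment> \<open>Doubling of the labels is the four-cycle (1 2 4 3) and fixes 0.\<close>
  define F where "F = tr (lab 1) (lab 2) \<circ> tr (lab 2) (lab 4) \<circ> tr (lab 4) (lab 3)"
  have in5: "lab j \<in> {1..5}" for j using lab bij_betwE by blast
  have Fp: "F permutes {1..5}" unfolding F_def by (intro permutes_compose permutes_swap_id in5)
  have "f x = F x" for x
  proof (cases "x \<in> {1..5}")
    case False
    then show ?thesis using permutes_not_in[OF f(1)] permutes_not_in[OF Fp] by metis
  next
    case True
    then obtain j where j: "x = lab j" using lab unfolding bij_betw_def by blast
    have "f (lab j) = F (lab j)"
      unfolding f(2) F_def by (cases j rule: mod5_cases) (simp_all add: Transposition.transpose_def l)
    then show ?thesis by (simp only: j)
  qed
  then have "f = F" by blast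
  moreover have "\<not> evenperm F"
    unfolding F_def by (simp add: evenperm_comp evenperm_swap permutation_compose permutation_swap_id l)
  ultimately show ?thesis by simp
qed

text \<open>The even element y and an odd lift f of the doubling map provide the two invariances
  needed for the classification of submodules. The labels of the omega graph are a multiple of
  \<open>lab\<close>, so affine maps remain affine.\<close>

lemma ex_omega_graph:
  assumes T: "T \<subseteq> U_mod" "0 \<in> T" "\<And>u v. u \<in> T \<Longrightarrow> v \<in> T \<Longrightarrow> u + v \<in> T"
    and act: "\<And>u h. u \<in> T \<Longrightarrow> h \<in> H \<Longrightarrow> U_act u (t h) \<in> T"
    and nontriv: "T \<noteq> {0}" "T \<noteq> U_mod" "T \<noteq> W_mod"
  obtains lb where "omega_graph lb T" "\<And>h. h \<in> H \<Longrightarrow> affine_on lb (t h)"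
proof -
  obtain f where f: "f \<in> H" "\<And>j. t f (lab j) = lab (2 * j + 0)" using H_lift[of 2 0] by auto
  have fG: "f \<in> carrier G" using f(1) H_iff by blast
  have f2: "t f (lab j) = lab (2 * j)" for j using f(2)[of j] by simp
  have odd: "\<not> evenperm (t f)" by (rule doubling_odd[OF t_permutes[OF fG] f2])
  have "y \<otimes> y \<otimes> inv y = y" by (simp add: m_assoc)
  then have yH: "y \<in> H" using y(1) H_iff by simp
  have "\<exists>e. e \<noteq> 0 \<and> omega_graph (\<lambda>j. lab (e * j)) T"
  proof (rule submodule_is_omega_graph[OF lab t_permutes[OF y_closed] t_y t_permutes[OF fG] f2 T _ _ nontriv])
    show "(n \<circ> t y, m \<circ> t y) \<in> T" if nm: "(n, m) \<in> T" for n m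
      using act[OF nm yH] P_evenperm[OF y(1)] by (simp add: U_act_def)
    show "(m \<circ> t f, n \<circ> t f) \<in> T" if nm: "(n, m) \<in> T" for n m
      using act[OF nm f(1)] odd by (simp add: U_act_def)
  qed
  then obtain e where e: "e \<noteq> 0" "omega_graph (\<lambda>j. lab (e * j)) T" by blast
  obtain d where d: "e * d = 1" using mod5_unit[OF e(1)] by blast
  have "affine_on (\<lambda>j. lab (e * j)) (t h)" if h: "h \<in> H" for h
  proof -
    obtain a b where ab: "a \<noteq> 0" "\<And>j. t h (lab j) = lab (a * j + b)" using H_affine[OF h] unfolding affine_on_def by blast
    have "a * (e * j) + b = e * (a * j + d * b)" for j
    proof -
      have "e * (a * j + d * b) = a * (e * j) + (e * d) * b" by (simp only: algebra_simps)
      then show ?thesis by (simp add: d)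
    qed
    then show ?thesis unfolding affine_on_def using ab by metis
  qed
  then show ?thesis using that e(2) by blast
qed

end

theorem theorem5p2:
  fixes G :: "('g, 'b) monoid_scheme"
    and J J0 P H :: "'g set"
    and c :: 'g
    and \<theta> :: "'g set \<Rightarrow> nat \<Rightarrow> nat"
    and k s :: nat
    and T1 :: "U_elt set"
    and \<psi> :: "'g \<Rightarrow> nat \<Rightarrow> U_elt"
  assumes k: "k \<ge> 1"
    and s: "s < k"
    and G: "base_group G J"
    and \<theta>: "\<theta> \<in> iso (G Mod J) (sym_group 5)"
    and J0: "J0 = commutator_subgroup G (carrier G) J"
    and P: "sylow_subgroup G 5 P"
    and H: "H = normalizer G P"
    and c: "c \<in> carrier G" "c \<notin> derived G (carrier G) <#>\<^bsub>G\<^esub> J"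
      "c \<noteq> \<one>\<^bsub>G\<^esub>" "c \<otimes>\<^bsub>G\<^esub> c = \<one>\<^bsub>G\<^esub>"
    and T1: "U_submodule (F20_image G J \<theta> H) T1" "T1 \<noteq> {0}" "T1 \<noteq> U_mod" "T1 \<noteq> W_mod"
    and \<psi>: "F20_module_iso G J \<theta> H J0 (copy_at s ` T1) \<psi>"
  shows "bol_loop_folder (script_G G J \<theta> k)
           (script_H G J \<theta> H J0 T1 \<psi> k s) (script_K G J \<theta> J0 c k s)
       \<and> simple_loop (folder_loop (script_G G J \<theta> k)
           (script_H G J \<theta> H J0 T1 \<psi> k s) (script_K G J \<theta> J0 c k s))
       \<and> loop_exponent_two (folder_loop (script_G G J \<theta> k)
           (script_H G J \<theta> H J0 T1 \<psi> k s) (script_K G J \<theta> J0 c k s))"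
proof -
  define t where "t = (\<lambda>g. \<theta> (J #>\<^bsub>G\<^esub> g))"
  have J: "J \<lhd> G" and el: "elementary_abelian_2 G J" and card_J: "card J = 32"
    and SL: "(G\<lparr>carrier := derived G (carrier G)\<rparr> Mod commutator_subgroup G (carrier G) J) \<cong> SL25"
    using G by (simp_all add: base_group_def)
  interpret G: group G using G by (simp add: base_group_def)
  note t = quotient_permutation_action[OF J \<theta>, folded t_def]
  have t_at: "\<theta> (J #>\<^bsub>G\<^esub> g) = t g" for g by (simp add: t_def)
  note t = quotient_permutation_action[OF J \<theta>, unfolded t_at]
  obtain \<sigma> E where act: "\<And>g. g \<in> carrier G \<Longrightarrow> \<sigma> g permutes proj_line"
    "\<And>g h. g \<in> carrier G \<Longrightarrow> h \<in> carrier G \<Longrightarrow> \<sigma> (g \<otimes>\<^bsub>G\<^esub> h) = \<sigma> g \<circ> \<sigma> h"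
    "\<And>j. j \<in> J \<Longrightarrow> \<sigma> j = id"
    "\<And>g. g \<in> carrier G \<Longrightarrow> g \<notin> J \<Longrightarrow> card {L \<in> proj_line. \<sigma> g L = L} \<le> 2"
    "\<And>f. lsupp proj_line f \<Longrightarrow> E f \<in> J"
    "\<And>f f'. lsupp proj_line f \<Longrightarrow> lsupp proj_line f' \<Longrightarrow> E (f + f') = E f \<otimes>\<^bsub>G\<^esub> E f'"
    "\<And>j. j \<in> J \<Longrightarrow> \<exists>f. lsupp proj_line f \<and> E f = j"
    "\<And>f. lsupp proj_line f \<Longrightarrow> E f = \<one>\<^bsub>G\<^esub> \<longleftrightarrow> f = 0 \<or> f = all_one"
    "\<And>f g. lsupp proj_line f \<Longrightarrow> g \<in> carrier G \<Longrightarrow> E (f \<circ> \<sigma> g) = inv\<^bsub>G\<^esub> g \<otimes>\<^bsub>G\<^esub> E f \<otimes>\<^bsub>G\<^esub> g"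
    by (fact base_group_action[OF G])
  have J_comm: "\<And>x y. x \<in> J \<Longrightarrow> y \<in> J \<Longrightarrow> x \<otimes>\<^bsub>G\<^esub> y = y \<otimes>\<^bsub>G\<^esub> x"
    and J_sq: "\<And>x. x \<in> J \<Longrightarrow> x \<otimes>\<^bsub>G\<^esub> x = \<one>\<^bsub>G\<^esub>"
    using el unfolding elementary_abelian_2_def by blast+
  interpret B: base_action G J proj_line \<sigma> E t J0
  proof (intro base_action.intro base_action_axioms.intro)
    show "a \<otimes>\<^bsub>G\<^esub> x \<otimes>\<^bsub>G\<^esub> inv\<^bsub>G\<^esub> a \<otimes>\<^bsub>G\<^esub> inv\<^bsub>G\<^esub> x \<in> J0"
      if "a \<in> derived G (carrier G)" "a \<otimes>\<^bsub>G\<^esub> a \<in> J0" "x \<in> derived G (carrier G)" for a x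
      using G.SL25_quotient_derived_involution[OF J SL] that unfolding J0 by blast
  qed (fact G.group_axioms J J_comm J_sq J0 card_proj_line t act[unfolded all_one_def])+
  have order: "order G = 3840" using t(5) card_J by (simp add: fact_numeral)
  have "finite (carrier G)" using order by (simp add: order_def card_ge_0_finite)
  \<comment> \<open>3840 = 2^8 * 3 * 5, so a Sylow 5-subgroup has order 5.\<close>
  have "multiplicity 5 (3840::nat) = 1" by (rule multiplicity_eqI) simp_all
  then have P5: "subgroup P G" "card P = 5" using P order by (simp_all add: sylow_subgroup_def)
  obtain c1 c2 where c12: "c1 \<in> {1..5}" "c2 \<in> {1..5}" "c1 \<noteq> c2" "t c = tr c1 c2"
    using B.outer_involution_transposition[OF c(1,2,4)] by blast
  obtain y lab where lab: "y \<in> P" "y \<noteq> \<one>\<^bsub>G\<^esub>" "bij_betw lab (UNIV :: 5 set) {1..5}" "\<And>j. t y (lab j) = lab (j + 1)"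
    using B.ex_labelling[OF P5] by metis
  interpret L: labelled_folder G J proj_line \<sigma> E t J0 P H y c lab c1 c2
    by (intro labelled_folder.intro labelled_folder_axioms.intro) (fact B.base_action_axioms P5 H lab c(1,4) c12)+
  have T: "T1 \<subseteq> U_mod" "0 \<in> T1" "\<And>u v. u \<in> T1 \<Longrightarrow> v \<in> T1 \<Longrightarrow> u + v \<in> T1"
    "\<And>u h. u \<in> T1 \<Longrightarrow> h \<in> H \<Longrightarrow> U_act u (t h) \<in> T1"
    using T1(1) unfolding U_submodule_def F20_image_def t_def by blast+
  obtain lb where lb: "omega_graph lb T1" "\<And>h. h \<in> H \<Longrightarrow> affine_on lb (t h)"
    using L.ex_omega_graph[OF T T1(2-4)] by metis
  have \<psi>': "bij_betw \<psi> J0 (copy_at s ` T1)"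
    "\<And>v w. v \<in> J0 \<Longrightarrow> w \<in> J0 \<Longrightarrow> \<psi> (v \<otimes>\<^bsub>G\<^esub> w) = \<psi> v + \<psi> w"
    "\<And>v h. v \<in> J0 \<Longrightarrow> h \<in> H \<Longrightarrow> \<psi> (inv\<^bsub>G\<^esub> h \<otimes>\<^bsub>G\<^esub> v \<otimes>\<^bsub>G\<^esub> h) = power_act (\<psi> v) (t h)"
    using \<psi> unfolding F20_module_iso_def t_def by blast+
  interpret S: script_folder G J proj_line \<sigma> E t J0 P H y c lab c1 c2 k s T1 \<psi> lb
    by (intro script_folder.intro script_folder_axioms.intro) (fact L.labelled_folder_axioms \<open>finite (carrier G)\<close> order card_J s lb T \<psi>')+
  have GG: "script_G G J \<theta> k = S.GG" unfolding script_G_def S.GG_def unfolding t_def ..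
  have HH: "script_H G J \<theta> H J0 T1 \<psi> k s = S.HH" unfolding script_H_def S.HH_def GG ..
  have KK: "script_K G J \<theta> J0 c k s = S.KK" unfolding script_K_def S.KK_def GG ..
  show ?thesis unfolding GG HH KK
    using S.F.bol_loop_folder S.simple_folder_loop S.F.exponent_two_L[OF S.KK_nontrivial] by blast
qed

end
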